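(* Let $\gamma_*$ be a polar of $f$ with $1<d_{gr}(\gamma_* )\le\infty$. Then $$\mathscr{M}_f(\mathcal{GC}(\gamma_* ))=\begin{cases}2\pi\,[\mu_f(\mathcal{GC}(\gamma_* ))+m(\mathcal{GC}(\gamma_* ))], & 1<d_{gr}(\gamma_* )<\infty,\\ 0, & d_{gr}(\gamma_* )=\infty.\end{cases}$$
   Context: Standing assumptions. $f(z,w)\in\mathbb{C}\{z,w\}$, $f(0,0)=0$, $f=H_m+H_{m+1}+\cdots$ with $H_k$ a homogeneous $k$-form, $m=O(f)$ the order of $f$, $H_m(1,0)\neq0$ (mini-regular in $z$), and $f$ is not of the form $\text{unit}\cdot[z-\zeta(w)]^m$ with $\zeta$ an integral (ordinary) convergent power series. The singularity at $0$ need not be isolated. Series. $\mathbb{F}$ is the field of convergent fractional power series $\alpha(y)=a_0y^{n_0/N}+a_1y^{n_1/N}+\cdots$, $a_i\in\mathbb{C}\setminus\{0\}$, $n_0<n_1<\cdots$ integers, $\gcd(N,n_0,n_1,\dots)=1$; $N=m_{puiseux}(\alpha)$, $O(\alpha)=O_y(\alpha)=n_0/N$. $\mathbb{F}_1=\{\alpha: O(\alpha)\ge1\}$. $J^{(e)}(\alpha)$ is $\alpha$ with all terms $y^q$, $q>e$, deleted. Arcs. For $\alpha\in\mathbb{F}_1$, $\alpha_*$ is the image set germ at $0\in\mathbb{C}^2$ of $t\mapsto(\alpha(t^N),t^N)$, $N=m_{puiseux}(\alpha)$ (conjugate series, obtained by replacing $y^{1/N}$ by $\theta^k y^{1/N}$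 with $\theta=e^{2\pi\sqrt{-1}/N}$, give the same arc). For $1\le e<\infty$, $\rho\ge0$: $\mathcal{D}^{(e)}(\alpha_*;\rho)=\{\beta_*:\beta(y)=[J^{(e)}(\alpha)(y)+cy^e]+\text{(higher order terms)},\ |c|\le\rho\}$, $\mathcal{L}^{(e)}(\alpha_* )=\bigcup_{0<\rho<\infty}\mathcal{D}^{(e)}(\alpha_*;\rho)$, $\mathcal{L}^{(\infty)}(\alpha_* )=\{\alpha_*\}$. Polars. Factor $f_z(z,y)=\text{unit}\cdot\prod_{j=1}^{m-1}(z-\gamma_j(y))$, $\gamma_j\in\mathbb{F}_1$. Each $\gamma_j$ (and $\gamma_{j*}$) is called a polar. For a polar $\gamma$ with $f(\gamma(y),y)\not\equiv0$, $d_{gr}(\gamma)=d_{gr}(\gamma_* )$ is the smallest number $q$ ($\geq 1$) such that $O_y(\|\mathrm{Grad} f(\gamma(y),y)\|)=O_y(\|\mathrm{Grad} f(\gamma(y)+uy^q,y)\|)$ for generic $u\in\mathbb{C}$; if $f(\gamma(y),y)\equiv0$, $d_{gr}(\gamma)=\infty$. The gradient canyon is $\mathcal{GC}(\gamma_* )=\mathcal{L}^{(d)}(\gamma_* )$, $d=d_{gr}(\gamma)$. For $d_{gr}(\gamma_* )<\infty$: $\mu_f(\mathcal{GC}(\gamma_* ))=\sum_j[O_y(f(\gamma_j(y),y))-1]$, summed over all $j$, $1\le j\le m-1$, with $\gamma_{j*}\in\mathcal{GC}(\gamma_* )$; and $m(\mathcal{GC}(\gamma_* ))=\#\{j: 1\le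 j\le m-1,\ \gamma_{j*}\in\mathcal{GC}(\gamma_* )\}$. Curvature. $\mathcal{S}_c$ is the level surface $f=c$, $S$ its surface area, $K=\dfrac{2|\Delta_f|^2}{(|f_z|^2+|f_w|^2)^3}$ (the negative of the usual Gaussian curvature), $\Delta_f=\begin{vmatrix}f_{zz}&f_{zw}&f_z\\ f_{wz}&f_{ww}&f_w\\ f_z&f_w&0\end{vmatrix}$. For small $\eta>0$ let $D_{isc}(0;\eta)=\{(z,w):\sqrt{|z|^2+|w|^2}\le\eta\}$ and, for $1\le e<\infty$, $0<\rho<\infty$, $H_{orn}^{(e)}(\alpha_*;\rho;\eta)=\{(z,w)\in D_{isc}(0;\eta)\cap\beta_*:\beta(y)=J^{(e)}(\alpha)(y)+cy^e,\ |c|\le\rho\}$ (here $\beta$ has exactly this finite form and $\beta_*$ is regarded as globally defined). Define $$\mathscr{M}_f(\mathcal{D}^{(e)}(\alpha_*;\rho))=\lim_{\eta\to0}\Big\{\lim_{c\to0}\int_{\mathcal{S}_c\cap H_{orn}^{(e)}(\alpha_*;\rho;\eta)}K\,dS\Big\},\qquad \mathscr{M}_f(\mathcal{L}^{(e)}(\alpha_* ))=\lim_{\rho\to\infty}\mathscr{M}_f(\mathcal{D}^{(e)}(\alpha_*;\rho)),$$ and $\mathscr{M}_f(\mathcal{L}^{(\infty)}(\alpha_* ))=\mathscr{M}_f(\{\alpha_*\})=0$. *)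

theory Defs
  imports "HOL-Analysis.Analysis" "HOL-Computational_Algebra.Formal_Power_Series"
begin

section \<open>Convergent power series in two variables\<close>

text \<open>
  A series \<open>f(z,w)\<close> is an element of \<open>complex fps fps\<close>: the outer variable is \<open>z\<close>, the inner
  variable is \<open>w\<close>, and \<open>coeff2 f i j\<close> is the coefficient of \<open>z^i w^j\<close>. Thus \<open>fps_X\<close> denotes \<open>z\<close>
  and \<open>fps_const \<zeta>\<close> denotes the series \<open>\<zeta>(w)\<close> for \<open>\<zeta> :: complex fps\<close>.
\<close>

abbreviation coeff2 :: "complex fps fps \<Rightarrow> nat \<Rightarrow> nat \<Rightarrow> complex" where
  "coeff2 f i j \<equiv> fps_nth (fps_nth f i) j"

definition convergent2 :: "complex fps fps \<Rightarrow> bool" where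
  "convergent2 f \<longleftrightarrow>
     (\<exists>r>0. (\<lambda>(i, j). norm (coeff2 f i j) * r ^ (i + j)) summable_on (UNIV :: (nat \<times> nat) set))"

definition unit2 :: "complex fps fps \<Rightarrow> bool" where
  "unit2 u \<longleftrightarrow> convergent2 u \<and> coeff2 u 0 0 \<noteq> 0"

text \<open>
  The value is the sum of the series near the origin. Where the series does not converge it is \<open>0\<close>
  by the convention of \<open>infsum\<close>; all notions below depend on arbitrarily small neighbourhoods
  of the origin only.
\<close>

definition eval2 :: "complex fps fps \<Rightarrow> complex \<times> complex \<Rightarrow> complex" where
  "eval2 f p = (\<Sum>\<^sub>\<infinity>(i, j). coeff2 f i j * fst p ^ i * snd p ^ j)"

definition hform :: "complex fps fps \<Rightarrow> nat \<Rightarrow> complex \<Rightarrow> complex \<Rightarrow> complex" where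
  "hform f k z w = (\<Sum>i\<le>k. coeff2 f i (k - i) * z ^ i * w ^ (k - i))"

definition order2 :: "complex fps fps \<Rightarrow> nat" where
  "order2 f = (LEAST k. \<exists>z w. hform f k z w \<noteq> 0)"

definition mini_regular :: "complex fps fps \<Rightarrow> bool" where
  "mini_regular f \<longleftrightarrow> hform f (order2 f) 1 0 \<noteq> 0"

text \<open>\<open>f\<close> has the form \<open>unit \<cdot> (z - \<zeta>(w))^m\<close> with \<open>\<zeta>\<close> an ordinary convergent power series.\<close>

definition is_smooth_power :: "complex fps fps \<Rightarrow> bool" where
  "is_smooth_power f \<longleftrightarrow>
     (\<exists>u \<zeta>. unit2 u \<and> fps_conv_radius \<zeta> > 0 \<and> f = u * (fps_X - fps_const \<zeta>) ^ order2 f)"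

definition dz :: "complex fps fps \<Rightarrow> complex fps fps" where
  "dz f = fps_deriv f"

definition dw :: "complex fps fps \<Rightarrow> complex fps fps" where
  "dw f = Abs_fps (\<lambda>i. fps_deriv (fps_nth f i))"

section \<open>Fractional power series and their arcs\<close>

text \<open>
  A fractional power series is given by its coefficients: \<open>\<alpha> q\<close> is the coefficient of \<open>y^q\<close>.
  Whenever all exponents of \<open>\<alpha>\<close> are nonnegative and lie in \<open>(1/N)\<int>\<close>, \<open>param N \<alpha>\<close> is \<open>\<alpha>(t^N)\<close>.
\<close>

definition exponents_over :: "nat \<Rightarrow> (real \<Rightarrow> complex) \<Rightarrow> bool" where
  "exponents_over N \<alpha> \<longleftrightarrow> 0 < N \<and> (\<forall>q. \<alpha> q \<noteq> 0 \<longrightarrow> q * real N \<in> \<int>)"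

definition param :: "nat \<Rightarrow> (real \<Rightarrow> complex) \<Rightarrow> complex fps" where
  "param N \<alpha> = Abs_fps (\<lambda>n. \<alpha> (real n / real N))"

definition m_puiseux :: "(real \<Rightarrow> complex) \<Rightarrow> nat" where
  "m_puiseux \<alpha> = (THE N. exponents_over N \<alpha> \<and>
      Gcd (insert (int N) {n. \<alpha> (real_of_int n / real N) \<noteq> 0}) = 1)"

text \<open>The convergent fractional power series of order at least one, including \<open>0\<close> (of order \<open>\<infinity>\<close>).\<close>

definition puiseux1 :: "(real \<Rightarrow> complex) set" where
  "puiseux1 = {\<alpha>. (\<forall>q. \<alpha> q \<noteq> 0 \<longrightarrow> 1 \<le> q) \<and>
      (\<exists>N. exponents_over N \<alpha> \<and> fps_conv_radius (param N \<alpha>) > 0)}"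

definition jet :: "real \<Rightarrow> (real \<Rightarrow> complex) \<Rightarrow> real \<Rightarrow> complex" where
  "jet e \<alpha> = (\<lambda>q. if q \<le> e then \<alpha> q else 0)"

definition add_term :: "(real \<Rightarrow> complex) \<Rightarrow> complex \<Rightarrow> real \<Rightarrow> real \<Rightarrow> complex" where
  "add_term \<alpha> c e = \<alpha>(e := \<alpha> e + c)"

definition arc_map :: "(real \<Rightarrow> complex) \<Rightarrow> complex \<Rightarrow> complex \<times> complex" where
  "arc_map \<alpha> t = (eval_fps (param (m_puiseux \<alpha>) \<alpha>) t, t ^ m_puiseux \<alpha>)"

definition set_germ :: "(complex \<times> complex) set \<Rightarrow> (complex \<times> complex) set set" where
  "set_germ A = {B. \<forall>\<^sub>F p in nhds 0. p \<in> A \<longleftrightarrow> p \<in> B}"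

text \<open>
  Points of the image of \<open>arc_map \<alpha>\<close> close to the origin come from parameters \<open>t\<close> close to \<open>0\<close>,
  because the second coordinate is \<open>t^N\<close>. So the germ does not see values of \<open>t\<close> outside the disc
  of convergence.
\<close>

definition arc :: "(real \<Rightarrow> complex) \<Rightarrow> (complex \<times> complex) set set" where
  "arc \<alpha> = set_germ (range (arc_map \<alpha>))"

definition inf_disc ::
  "real \<Rightarrow> (real \<Rightarrow> complex) \<Rightarrow> real \<Rightarrow> (complex \<times> complex) set set set" where
  "inf_disc e \<alpha> \<rho> =
     {arc \<beta> |\<beta>. \<beta> \<in> puiseux1 \<and> (\<exists>c. norm c \<le> \<rho> \<and> jet e \<beta> = add_term (jet e \<alpha>) c e)}"

definition inf_line :: "ereal \<Rightarrow> (real \<Rightarrow> complex) \<Rightarrow> (complex \<times> complex) set set set" where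
  "inf_line e \<alpha> =
     (if e = \<infinity> then {arc \<alpha>} else (\<Union>\<rho>\<in>{0<..}. inf_disc (real_of_ereal e) \<alpha> \<rho>))"

section \<open>Polars and gradient canyons\<close>

definition subst_w_power :: "nat \<Rightarrow> complex fps fps \<Rightarrow> complex fps fps" where
  "subst_w_power N f = Abs_fps (\<lambda>i. fps_compose (fps_nth f i) (fps_X ^ N))"

text \<open>
  \<open>\<gamma> j\<close>, \<open>j < order2 f - 1\<close>, are the Newton--Puiseux roots of \<open>f_z\<close> (indexed from \<open>0\<close>). The
  factorization is stated after the substitution \<open>y = t^N\<close>, with \<open>N\<close> a common denominator of
  all exponents; it is an identity of formal power series in \<open>z\<close> and \<open>t\<close>.
\<close>

definition polar_factorization :: "complex fps fps \<Rightarrow> (nat \<Rightarrow> real \<Rightarrow> complex) \<Rightarrow> bool" where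
  "polar_factorization f \<gamma> \<longleftrightarrow>
     (\<forall>j < order2 f - 1. \<gamma> j \<in> puiseux1) \<and>
     (\<exists>u N. unit2 u \<and> 0 < N \<and> (\<forall>j < order2 f - 1. exponents_over N (\<gamma> j)) \<and>
        subst_w_power N (dz f) =
          subst_w_power N u * (\<Prod>j < order2 f - 1. fps_X - fps_const (param N (\<gamma> j))))"

text \<open>
  The series \<open>f(\<alpha>(t^N), t^N)\<close> in \<open>t\<close>, where \<open>N = m_puiseux \<alpha>\<close>. As \<open>\<alpha>(t^N)\<close> has no constant term
  for \<open>\<alpha> \<in> puiseux1\<close>, the powers of \<open>\<alpha>(t^N)\<close> with exponent above \<open>n\<close> do not contribute to the
  coefficient of \<open>t^n\<close>.
\<close>

definition along :: "complex fps fps \<Rightarrow> (real \<Rightarrow> complex) \<Rightarrow> complex fps" where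
  "along f \<alpha> = (let N = m_puiseux \<alpha> in
     Abs_fps (\<lambda>n. fps_nth (\<Sum>i\<le>n. fps_compose (fps_nth f i) (fps_X ^ N) * param N \<alpha> ^ i) n))"

text \<open>The order in \<open>y\<close> of \<open>f(\<alpha>(y), y)\<close>.\<close>

definition order_along :: "complex fps fps \<Rightarrow> (real \<Rightarrow> complex) \<Rightarrow> ereal" where
  "order_along f \<alpha> =
     (if along f \<alpha> = 0 then \<infinity> else ereal (real (subdegree (along f \<alpha>)) / real (m_puiseux \<alpha>)))"

definition grad_norm :: "complex fps fps \<Rightarrow> complex \<times> complex \<Rightarrow> real" where
  "grad_norm f p = norm (eval2 (dz f) p, eval2 (dw f) p)"

text \<open>
  The order in \<open>y\<close> of the real-valued function \<open>\<parallel>Grad f(\<alpha>(y), y)\<parallel>\<close>, i.e. the exponent \<open>e\<close> such that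
  this function is asymptotic to a positive multiple of \<open>|y|^e\<close>.
\<close>

definition grad_order :: "complex fps fps \<Rightarrow> (real \<Rightarrow> complex) \<Rightarrow> ereal" where
  "grad_order f \<alpha> =
     (if \<forall>\<^sub>F t in at 0. grad_norm f (arc_map \<alpha> t) = 0 then \<infinity>
      else ereal (THE e. \<exists>c>0.
        ((\<lambda>t. grad_norm f (arc_map \<alpha> t) / norm (snd (arc_map \<alpha> t)) powr e) \<longlongrightarrow> c) (at 0)))"

text \<open>
  \<open>\<gamma>(y) + u y^q\<close> is a fractional power series only for rational \<open>q\<close>. \<open>Generic\<close> means for all but
  finitely many \<open>u\<close>.
\<close>

definition d_gr :: "complex fps fps \<Rightarrow> (real \<Rightarrow> complex) \<Rightarrow> ereal" where
  "d_gr f \<gamma> =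
     (if along f \<gamma> = 0 then \<infinity>
      else ereal (LEAST q. q \<in> \<rat> \<and> 1 \<le> q \<and>
        (\<forall>\<^sub>F u in cofinite. grad_order f \<gamma> = grad_order f (add_term \<gamma> u q))))"

definition canyon :: "complex fps fps \<Rightarrow> (real \<Rightarrow> complex) \<Rightarrow> (complex \<times> complex) set set set" where
  "canyon f \<gamma> = inf_line (d_gr f \<gamma>) \<gamma>"

text \<open>
  In the next two definitions \<open>\<gamma>\<close> is the family of all polars of \<open>f\<close> and \<open>G\<close> is a gradient canyon.
\<close>

definition polars_in ::
  "complex fps fps \<Rightarrow> (nat \<Rightarrow> real \<Rightarrow> complex) \<Rightarrow> (complex \<times> complex) set set set \<Rightarrow> nat set" where
  "polars_in f \<gamma> G = {j. j < order2 f - 1 \<and> arc (\<gamma> j) \<in> G}"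

definition canyon_mu ::
  "complex fps fps \<Rightarrow> (nat \<Rightarrow> real \<Rightarrow> complex) \<Rightarrow> (complex \<times> complex) set set set \<Rightarrow> ereal" where
  "canyon_mu f \<gamma> G = (\<Sum>j\<in>polars_in f \<gamma> G. order_along f (\<gamma> j) - 1)"

definition canyon_mult ::
  "complex fps fps \<Rightarrow> (nat \<Rightarrow> real \<Rightarrow> complex) \<Rightarrow> (complex \<times> complex) set set set \<Rightarrow> nat" where
  "canyon_mult f \<gamma> G = card (polars_in f \<gamma> G)"

section \<open>Surface area\<close>

text \<open>
  The area element \<open>sqrt (EG - F^2)\<close> of a parametrized surface in real four-space \<open>\<complex> \<times> \<complex>\<close>.
\<close>

definition area_element :: "(real ^ 2 \<Rightarrow> complex \<times> complex) \<Rightarrow> real ^ 2 \<Rightarrow> real" where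
  "area_element \<phi> x =
     (let D = frechet_derivative \<phi> (at x); a = D (axis 1 1); b = D (axis 2 1)
      in sqrt ((a \<bullet> a) * (b \<bullet> b) - (a \<bullet> b)\<^sup>2))"

text \<open>Regular \<open>C^1\<close> parametrizations of relatively open pieces of \<open>S\<close>.\<close>

definition surface_chart ::
  "(complex \<times> complex) set \<Rightarrow> (real ^ 2) set \<Rightarrow> (real ^ 2 \<Rightarrow> complex \<times> complex) \<Rightarrow> bool" where
  "surface_chart S U \<phi> \<longleftrightarrow>
     open U \<and> openin (top_of_set S) (\<phi> ` U) \<and> (\<exists>\<psi>. homeomorphism U (\<phi> ` U) \<phi> \<psi>) \<and>
     (\<forall>x\<in>U. \<phi> differentiable (at x) \<and> area_element \<phi> x > 0) \<and>
     (\<forall>v. continuous_on U (\<lambda>x. frechet_derivative \<phi> (at x) v))"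

text \<open>
  The area measure of \<open>S\<close>: it is given by the area element on every chart and charges only the
  part of \<open>S\<close> covered by charts, i.e. singular points of \<open>S\<close> are null. (Countably many charts
  cover this part, so the measure is determined by these conditions.)
\<close>

definition is_area_measure :: "(complex \<times> complex) set \<Rightarrow> (complex \<times> complex) measure \<Rightarrow> bool" where
  "is_area_measure S M \<longleftrightarrow>
     sets M = sets borel \<and>
     emeasure M (- \<Union>{\<phi> ` U |U \<phi>. surface_chart S U \<phi>}) = 0 \<and>
     (\<forall>U \<phi> A. surface_chart S U \<phi> \<longrightarrow> A \<in> sets borel \<longrightarrow>
        emeasure M (A \<inter> \<phi> ` U) =
          (\<integral>\<^sup>+x\<in>{x \<in> U. \<phi> x \<in> A}. ennreal (area_element \<phi> x) \<partial>lborel))"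

definition area_measure :: "(complex \<times> complex) set \<Rightarrow> (complex \<times> complex) measure" where
  "area_measure S = (THE M. is_area_measure S M)"

section \<open>Curvature of the level surfaces\<close>

definition level_surface :: "complex fps fps \<Rightarrow> complex \<Rightarrow> (complex \<times> complex) set" where
  "level_surface f c = {p. eval2 f p = c}"

definition Delta :: "complex fps fps \<Rightarrow> complex \<times> complex \<Rightarrow> complex" where
  "Delta f p =
     det (vector
       [vector [eval2 (dz (dz f)) p, eval2 (dw (dz f)) p, eval2 (dz f) p],
        vector [eval2 (dz (dw f)) p, eval2 (dw (dw f)) p, eval2 (dw f) p],
        vector [eval2 (dz f) p,      eval2 (dw f) p,      0]] :: complex ^ 3 ^ 3)"

definition curvature :: "complex fps fps \<Rightarrow> complex \<times> complex \<Rightarrow> real" where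
  "curvature f p =
     2 * (norm (Delta f p))\<^sup>2 / ((norm (eval2 (dz f) p))\<^sup>2 + (norm (eval2 (dw f) p))\<^sup>2) ^ 3"

text \<open>
  The horn uses the finite series \<open>J^(e)(\<alpha>)(y) + c y^e\<close> exactly, so \<open>arc_map\<close> is polynomial and its
  range is the globally defined arc. The norm on \<open>\<complex> \<times> \<complex>\<close> is the Euclidean one.
\<close>

definition horn ::
  "real \<Rightarrow> (real \<Rightarrow> complex) \<Rightarrow> real \<Rightarrow> real \<Rightarrow> (complex \<times> complex) set" where
  "horn e \<alpha> \<rho> \<eta> = {p \<in> cball 0 \<eta>. \<exists>c. norm c \<le> \<rho> \<and> p \<in> range (arc_map (add_term (jet e \<alpha>) c e))}"

definition horn_curvature ::
  "complex fps fps \<Rightarrow> real \<Rightarrow> (real \<Rightarrow> complex) \<Rightarrow> real \<Rightarrow> real \<Rightarrow> complex \<Rightarrow> ereal" where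
  "horn_curvature f e \<alpha> \<rho> \<eta> c =
     enn2ereal (\<integral>\<^sup>+p\<in>level_surface f c \<inter> horn e \<alpha> \<rho> \<eta>.
       ennreal (curvature f p) \<partial>area_measure (level_surface f c))"

text \<open>
  The total curvatures are iterated limits; the following relations assert that the limits
  exist (for all sufficiently small \<open>\<eta>\<close>, resp. all sufficiently large \<open>\<rho>\<close>) and give their values.
\<close>

definition has_disc_curvature ::
  "complex fps fps \<Rightarrow> real \<Rightarrow> (real \<Rightarrow> complex) \<Rightarrow> real \<Rightarrow> ereal \<Rightarrow> bool" where
  "has_disc_curvature f e \<alpha> \<rho> M \<longleftrightarrow>
     (\<exists>I. (\<forall>\<^sub>F \<eta> in at_right 0. (horn_curvature f e \<alpha> \<rho> \<eta> \<longlongrightarrow> I \<eta>) (at 0)) \<and>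
          (I \<longlongrightarrow> M) (at_right 0))"

definition has_line_curvature ::
  "complex fps fps \<Rightarrow> ereal \<Rightarrow> (real \<Rightarrow> complex) \<Rightarrow> ereal \<Rightarrow> bool" where
  "has_line_curvature f e \<alpha> M \<longleftrightarrow>
     (if e = \<infinity> then M = 0
      else \<exists>D. (\<forall>\<^sub>F \<rho> in at_top. has_disc_curvature f (real_of_ereal e) \<alpha> \<rho> (D \<rho>)) \<and>
               (D \<longlongrightarrow> M) at_top)"

end

theory Submission
  imports Defs "HOL-Complex_Analysis.Complex_Analysis" "HOL-Computational_Algebra.Fundamental_Theorem_Algebra"
begin

text \<open>
  The curvature integrand, restricted to a level curve, is the area form of the projective line
  (of total area \<open>2 pi\<close>) pulled back by the Gauss map \<open>(f_z : f_w)\<close>. If \<open>A\<close> and \<open>C\<close> are proportional to \<open>f_z\<close> and \<open>f_w\<close> along a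
  holomorphic parametrization of the curve, then
  \<open>K dS = 2 |A C' - C A'|^2 / (|A|^2 + |C|^2)^2\<close>. The scalar factor between \<open>(A, C)\<close> and the gradient
  drops out, so the gradient may be rescaled before passing to the limit. The theorem follows by
  computing this Gauss map in the limit \<open>c \<rightarrow> 0\<close> and counting how often it covers the line.

  Let \<open>N\<close> be a common denominator of all polars and of the canyon degree \<open>d\<close>, put \<open>D = d N\<close>, and let
  \<open>trunc(t)\<close> be the part of \<open>\<gamma> k (t^N)\<close> below \<open>t^D\<close>. The horns of the canyon consist of the points
  \<open>pt t v = (trunc(t) + v t^D, t^N)\<close> with \<open>v\<close> in a disc. The factorization of \<open>f_z\<close> gives
  \<open>f_z(pt t v) ~ P(v) t^E\<close> with a polynomial \<open>P\<close> whose degree is the number of polars that agree with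
  \<open>\<gamma> k\<close> below \<open>t^D\<close> (\<open>dz_fan_limit\<close>, \<open>degree_lead_poly\<close>), while \<open>f(pt t v) ~ a t^H\<close> with \<open>a \<noteq> 0\<close>
  (\<open>f_limit\<close>). By the chain rule along the curves \<open>v = const\<close>, the condition that defines the degree
  of a canyon amounts to \<open>H = E + N\<close> (\<open>canyon_degree\<close>): this is the exponent at which \<open>f_z\<close> and
  \<open>f_w\<close> become comparable. Then \<open>f_w(pt t v) ~ (kappa - slope P(v)) t^E\<close> with a constant
  \<open>kappa \<noteq> 0\<close> (\<open>dw_limit\<close>), so the limit of the Gauss map is \<open>P\<close> followed by an affine embedding of the
  complex line into the projective line. A line has total curvature \<open>2 pi\<close>
  (\<open>nn_integral_plane_fubini_study\<close>), so the limit form has total mass \<open>2 pi deg P\<close>.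

  For fixed \<open>c \<noteq> 0\<close> the equation \<open>f(pt t v) = c\<close> has one solution \<open>t\<close> near every \<open>\<tau>\<close> with \<open>a \<tau>^H = c\<close>.
  So the level curve inside the horn is the union of \<open>H\<close> sheets \<open>v \<mapsto> pt t v\<close>. Distinct parameters
  give the same point precisely under the group of the \<open>q\<close> roots of unity \<open>\<theta>\<close> that leave \<open>trunc\<close>
  invariant (\<open>pt_fibre\<close>), whence every point lies on \<open>q\<close> sheets, and the curvature of the canyon is
  \<open>2 pi H deg P / q\<close> (\<open>has_line_curvature\<close>).

  On the other side, a polar lies in the canyon if and only if one of its conjugates agrees with
  \<open>\<gamma> k\<close> below \<open>t^D\<close>. The conjugations permute the polars, so counting pairs of a root of unity and a
  polar yields \<open>q m = N deg P\<close> for the number \<open>m\<close> of polars in the canyon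
  (\<open>card_polars_in_line\<close>). On each of them \<open>f\<close> has order \<open>H / N\<close> (\<open>order_along_canyon\<close>), hence
  \<open>\<mu> + m = m H / N = H deg P / q\<close>.
\<close>

unbundle no fps_syntax

section \<open>Area in charts\<close>

text \<open>
  A version for nonnegative integrands, where both sides may be infinite. It follows from the
  change of variables for absolutely integrable functions, because that result includes the
  equivalence of integrability.
\<close>

lemma nn_integral_change_of_variables:
  fixes g :: "real^2 \<Rightarrow> real^2" and f :: "real^2 \<Rightarrow> real"
  assumes S: "S \<in> sets borel"
    and der: "\<And>x. x \<in> S \<Longrightarrow> (g has_derivative g' x) (at x within S)"
    and inj: "inj_on g S"
    and gS: "g ` S \<in> sets borel"
    and f: "f \<in> borel_measurable borel" "\<And>y. f y \<ge> 0"
    and mg: "(\<lambda>x. indicator S x * (\<bar>det (matrix (g' x))\<bar> * f (g x))) \<in> borel_measurable borel"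
  shows "(\<integral>\<^sup>+y\<in>g ` S. ennreal (f y) \<partial>lborel) =
         (\<integral>\<^sup>+x\<in>S. ennreal (\<bar>det (matrix (g' x))\<bar> * f (g x)) \<partial>lborel)"
proof -
  define F where "F = (\<lambda>y. indicator (g ` S) y * f y)"
  define G where "G = (\<lambda>x. indicator S x * (\<bar>det (matrix (g' x))\<bar> * f (g x)))"
  have Fm: "F \<in> borel_measurable borel" unfolding F_def using gS f by measurable
  have Gm: "G \<in> borel_measurable borel" unfolding G_def by (rule mg)
  have F0: "F y \<ge> 0" for y by (simp add: F_def f)
  have G0: "G y \<ge> 0" for y by (simp add: G_def f)
  have e1: "(\<integral>\<^sup>+y\<in>g ` S. ennreal (f y) \<partial>lborel) = (\<integral>\<^sup>+y. ennreal (F y) \<partial>lborel)"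
    by (intro nn_integral_cong) (simp add: F_def indicator_def)
  have e2: "(\<integral>\<^sup>+x\<in>S. ennreal (\<bar>det (matrix (g' x))\<bar> * f (g x)) \<partial>lborel) = (\<integral>\<^sup>+x. ennreal (G x) \<partial>lborel)"
    by (intro nn_integral_cong) (simp add: G_def indicator_def)
  \<comment> \<open>The change of variables concerns vector-valued integrands, so a real function is viewed as one with values in \<open>real^1\<close>.\<close>
  have Sl: "S \<in> sets lebesgue" using S by simp
  have gl: "g ` S \<in> sets lebesgue" using gS by simp
  have cov: "((\<lambda>x. \<bar>det (matrix (g' x))\<bar> *\<^sub>R (vec (f (g x)) :: real^1)) absolutely_integrable_on S \<and>
      integral S (\<lambda>x. \<bar>det (matrix (g' x))\<bar> *\<^sub>R (vec (f (g x)) :: real^1)) = b)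
      \<longleftrightarrow> ((\<lambda>x. vec (f x) :: real^1) absolutely_integrable_on (g ` S) \<and> integral (g ` S) (\<lambda>x. vec (f x)) = b)" for b
    by (rule has_absolute_integral_change_of_variables[OF Sl der inj])
  have vecI: "(\<lambda>x. vec (h x) :: real^1) absolutely_integrable_on A \<longleftrightarrow> h absolutely_integrable_on A" for h :: "real^2 \<Rightarrow> real" and A
    by (subst absolutely_integrable_componentwise_iff) (auto simp: vec_def Basis_vec_def inner_axis)
  have vecJ: "integral A (\<lambda>x. vec (h x) :: real^1) = vec (integral A h)" if "h absolutely_integrable_on A" for h :: "real^2 \<Rightarrow> real" and A
    using that vecI[of A h]
    by (simp add: vec_eq_iff set_lebesgue_integral_eq_integral(1) integral_component_eq_cart[symmetric])
  have sm: "\<bar>det (matrix (g' x))\<bar> *\<^sub>R (vec (f (g x)) :: real^1) = vec (\<bar>det (matrix (g' x))\<bar> * f (g x))" for x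
    by (simp add: vec_eq_iff)
  have iff: "(\<lambda>x. \<bar>det (matrix (g' x))\<bar> * f (g x)) absolutely_integrable_on S \<longleftrightarrow> f absolutely_integrable_on (g ` S)"
    using cov unfolding sm vecI by blast
  have eq: "integral S (\<lambda>x. \<bar>det (matrix (g' x))\<bar> * f (g x)) = integral (g ` S) f"
    if "f absolutely_integrable_on (g ` S)"
  proof -
    have "integral S (\<lambda>x. vec (\<bar>det (matrix (g' x))\<bar> * f (g x)) :: real^1) = vec (integral (g ` S) f)"
      using cov[of "vec (integral (g ` S) f)"] that vecJ[OF that] unfolding sm vecI by simp
    moreover have "integral S (\<lambda>x. vec (\<bar>det (matrix (g' x))\<bar> * f (g x)) :: real^1)
        = vec (integral S (\<lambda>x. \<bar>det (matrix (g' x))\<bar> * f (g x)))"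
      by (rule vecJ) (use iff that in simp)
    ultimately show ?thesis by (simp add: vec_eq_iff)
  qed
  have Fi: "integrable lborel F \<longleftrightarrow> f absolutely_integrable_on (g ` S)"
    unfolding set_integrable_def F_def using Fm by (simp add: integrable_completion F_def)
  have Gi: "integrable lborel G \<longleftrightarrow> (\<lambda>x. \<bar>det (matrix (g' x))\<bar> * f (g x)) absolutely_integrable_on S"
    unfolding set_integrable_def G_def using Gm by (simp add: integrable_completion G_def)
  show ?thesis
  proof (cases "integrable lborel F")
    case True
    then have fi: "f absolutely_integrable_on (g ` S)" using Fi by simp
    then have gi: "(\<lambda>x. \<bar>det (matrix (g' x))\<bar> * f (g x)) absolutely_integrable_on S" using iff by simp
    then have TG: "integrable lborel G" using Gi by simp
    have "integral\<^sup>L lborel F = integral (g ` S) f"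
      using set_lebesgue_integral_eq_integral(2)[OF fi] Fm
      by (simp add: set_lebesgue_integral_def F_def integral_completion)
    moreover have "integral\<^sup>L lborel G = integral S (\<lambda>x. \<bar>det (matrix (g' x))\<bar> * f (g x))"
      using set_lebesgue_integral_eq_integral(2)[OF gi] Gm
      by (simp add: set_lebesgue_integral_def G_def integral_completion)
    ultimately have "integral\<^sup>L lborel F = integral\<^sup>L lborel G" using eq[OF fi] by simp
    then show ?thesis unfolding e1 e2
      using nn_integral_eq_integral[OF True] nn_integral_eq_integral[OF TG] F0 G0 by simp
  next
    case False
    then have "\<not> integrable lborel G" using Fi Gi iff by simp
    have infI: "(\<integral>\<^sup>+x. ennreal (h x) \<partial>lborel) = \<infinity>"
      if "\<not> integrable lborel h" "h \<in> borel_measurable borel" "\<And>x. h x \<ge> 0" for h :: "real^2 \<Rightarrow> real"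
    proof (rule ccontr)
      assume "(\<integral>\<^sup>+x. ennreal (h x) \<partial>lborel) \<noteq> \<infinity>"
      then have "integrable lborel h"
        using that by (intro integrableI_nonneg) (auto simp: less_top)
      then show False using that by simp
    qed
    have "\<not> integrable lborel G" using False Fi Gi iff by simp
    then have "(\<integral>\<^sup>+x. ennreal (G x) \<partial>lborel) = \<infinity>" "(\<integral>\<^sup>+x. ennreal (F x) \<partial>lborel) = \<infinity>"
      using False infI[of G] infI[of F] Gm Fm G0 F0 by blast+
    then show ?thesis unfolding e1 e2 by simp
  qed
qed

lemma area_element_nonneg: "area_element \<phi> x \<ge> 0"
  by (simp add: area_element_def Let_def Cauchy_Schwarz_ineq)

text \<open>
  The Gram determinant of two vectors scales with the square of the determinant of a base change.
  This is why the area element transforms with the Jacobian.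
\<close>

lemma gram_compose_linear:
  fixes B :: "real^2 \<Rightarrow> 'a::real_inner"
  assumes "linear B" "linear T"
  defines "p \<equiv> B (axis 1 1)" and "q \<equiv> B (axis 2 1)"
    and "a \<equiv> B (T (axis 1 1))" and "b \<equiv> B (T (axis 2 1))"
  shows "(a \<bullet> a) * (b \<bullet> b) - (a \<bullet> b)\<^sup>2 = (det (matrix T))\<^sup>2 * ((p \<bullet> p) * (q \<bullet> q) - (p \<bullet> q)\<^sup>2)"
proof -
  have dec: "x = (x$1) *\<^sub>R axis 1 1 + (x$2) *\<^sub>R axis 2 1" for x :: "real^2"
    by (simp add: vec_eq_iff forall_2 axis_def)
  have BT: "B x = (x$1) *\<^sub>R p + (x$2) *\<^sub>R q" for x
    by (subst dec) (simp only: linear_add[OF assms(1)] linear_scale[OF assms(1)] p_def q_def)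
  have ip: "(x *\<^sub>R p + y *\<^sub>R q) \<bullet> (z *\<^sub>R p + w *\<^sub>R q)
      = x * z * (p \<bullet> p) + (x * w + y * z) * (p \<bullet> q) + y * w * (q \<bullet> q)" for x y z w
    by (simp add: inner_simps inner_commute algebra_simps)
  show ?thesis
    unfolding a_def b_def BT ip det_2 matrix_def by simp algebra
qed

text \<open>
  Differentiability of a map \<open>\<tau>\<close> that is only known to be continuous and to satisfy
  \<open>\<psi> \<circ> \<tau> = \<phi>\<close> with \<open>\<psi>\<close> immersive. A left inverse of the derivative of \<open>\<psi>\<close> shows that \<open>\<tau>\<close> is Lipschitz
  at the point; then the error terms of \<open>\<phi>\<close> and \<open>\<psi>\<close> are both small relative to \<open>x - x0\<close>. It is used
  for transition maps between charts and for implicitly defined functions.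
\<close>

lemma left_factor_has_derivative:
  fixes \<phi> :: "'b::euclidean_space \<Rightarrow> 'c::euclidean_space" and \<psi> :: "'d::euclidean_space \<Rightarrow> 'c"
  assumes A: "(\<phi> has_derivative A) (at x0)" and B: "(\<psi> has_derivative B) (at (\<tau> x0))"
    and L: "linear L" "L \<circ> B = id"
    and cont: "isCont \<tau> x0"
    and fac: "\<forall>\<^sub>F x in nhds x0. \<psi> (\<tau> x) = \<phi> x"
  shows "(\<tau> has_derivative (L \<circ> A)) (at x0)"
  unfolding has_derivative_at_alt
proof (intro conjI allI impI)
  let ?y0 = "\<tau> x0"
  have blL: "bounded_linear L" using L(1) by (simp add: linear_conv_bounded_linear)
  have h: "((\<lambda>x. L (\<phi> x)) has_derivative (\<lambda>v. L (A v))) (at x0)"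
    by (rule bounded_linear.has_derivative[OF blL A])
  have k: "((\<lambda>y. L (\<psi> y)) has_derivative (\<lambda>v. v)) (at ?y0)"
    using bounded_linear.has_derivative[OF blL B] L(2) by (simp add: fun_eq_iff)
  show bl: "bounded_linear (L \<circ> A)"
    using has_derivative_bounded_linear[OF h] by (simp add: o_def)
  obtain C where C: "C > 0" "\<And>v. norm (L (A v)) \<le> norm v * C"
    using bounded_linear.pos_bounded[OF bl] by auto
  fix e :: real assume e: "e > 0"
  \<comment> \<open>The bound \<open>1/2\<close> makes \<open>\<tau>\<close> Lipschitz at \<open>x0\<close> with constant \<open>2 (C + 1)\<close>; the other one then makes the error \<open>e1 * norm (\<tau> x - \<tau> x0)\<close> at most \<open>e / 2 * norm (x - x0)\<close>.\<close>
  define e1 where "e1 = min (1/2) (e / (4 * (C + 1)))"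
  define e2 where "e2 = min 1 (e / 2)"
  have e1: "e1 > 0" "e1 \<le> 1/2" "e1 * (2 * (C + 1)) \<le> e / 2"
  proof -
    show "e1 > 0" using e C by (auto simp: e1_def)
    show "e1 \<le> 1/2" unfolding e1_def by (rule min.cobounded1)
    have "e1 \<le> e / (4 * (C + 1))" by (simp add: e1_def)
    then have "e1 * (2 * (C + 1)) \<le> e / (4 * (C + 1)) * (2 * (C + 1))"
      using C by (intro mult_right_mono) auto
    also have "\<dots> = e / 2" using C by (simp add: field_simps)
    finally show "e1 * (2 * (C + 1)) \<le> e / 2" .
  qed
  have e2: "e2 > 0" "e2 \<le> 1" "e2 \<le> e / 2" using e by (auto simp: e2_def)
  obtain d1 where d1: "d1 > 0" "\<And>y. norm (y - ?y0) < d1 \<Longrightarrow>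
      norm (L (\<psi> y) - L (\<psi> ?y0) - (y - ?y0)) \<le> e1 * norm (y - ?y0)"
    using k e1(1) unfolding has_derivative_at_alt by blast
  obtain d2 where d2: "d2 > 0" "\<And>x. norm (x - x0) < d2 \<Longrightarrow>
      norm (L (\<phi> x) - L (\<phi> x0) - L (A (x - x0))) \<le> e2 * norm (x - x0)"
    using h e2(1) unfolding has_derivative_at_alt by blast
  obtain d3 where d3: "d3 > 0" "\<And>x. norm (x - x0) < d3 \<Longrightarrow> norm (\<tau> x - ?y0) < d1"
    using cont d1(1) unfolding continuous_at_eps_delta dist_norm by blast
  obtain d4 where d4: "d4 > 0" "\<And>x. norm (x - x0) < d4 \<Longrightarrow> \<psi> (\<tau> x) = \<phi> x"
    using fac unfolding eventually_nhds_metric dist_norm by blast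
  show "\<exists>d>0. \<forall>x. norm (x - x0) < d \<longrightarrow> norm (\<tau> x - \<tau> x0 - (L \<circ> A) (x - x0)) \<le> e * norm (x - x0)"
  proof (intro exI[of _ "min d2 (min d3 d4)"] conjI allI impI)
    show "min d2 (min d3 d4) > 0" using d2 d3 d4 by simp
    fix x assume x: "norm (x - x0) < min d2 (min d3 d4)"
    let ?n = "norm (x - x0)" and ?m = "norm (\<tau> x - ?y0)"
    have "\<psi> ?y0 = \<phi> x0" using d4(2)[of x0] d4(1) by simp
    then have 1: "norm (L (\<phi> x) - L (\<phi> x0) - (\<tau> x - ?y0)) \<le> e1 * ?m"
      using d1(2)[of "\<tau> x"] d3(2)[of x] d4(2)[of x] x by simp
    have 2: "norm (L (\<phi> x) - L (\<phi> x0) - L (A (x - x0))) \<le> e2 * ?n" using d2 x by simp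
    have "norm (L (\<phi> x) - L (\<phi> x0)) \<le> e2 * ?n + norm (L (A (x - x0)))"
      using 2 norm_triangle_sub[of "L (\<phi> x) - L (\<phi> x0)" "L (A (x - x0))"] by linarith
    also have "\<dots> \<le> 1 * ?n + ?n * C"
      using e2(2) C(2)[of "x - x0"] by (intro add_mono mult_right_mono) auto
    finally have 3: "norm (L (\<phi> x) - L (\<phi> x0)) \<le> (C + 1) * ?n" by (simp add: algebra_simps)
    have "?m \<le> norm (L (\<phi> x) - L (\<phi> x0)) + e1 * ?m"
      using 1 norm_triangle_sub[of "\<tau> x - ?y0" "L (\<phi> x) - L (\<phi> x0)"] by (simp add: norm_minus_commute)
    also have "e1 * ?m \<le> 1/2 * ?m" using e1 by (intro mult_right_mono) auto
    finally have "?m \<le> 2 * norm (L (\<phi> x) - L (\<phi> x0))" by simp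
    also have "\<dots> \<le> 2 * ((C + 1) * ?n)" using 3 by simp
    finally have 4: "?m \<le> 2 * (C + 1) * ?n" by (simp only: mult.assoc)
    have "norm (\<tau> x - ?y0 - L (A (x - x0))) \<le> e1 * ?m + e2 * ?n"
      using 1 2 norm_triangle_le_diff[of "L (\<phi> x) - L (\<phi> x0) - L (A (x - x0))" "L (\<phi> x) - L (\<phi> x0) - (\<tau> x - ?y0)" "e1 * ?m + e2 * ?n"]
      by (simp add: algebra_simps)
    also have "e1 * ?m \<le> e1 * (2 * (C + 1) * ?n)" using 4 e1 by (intro mult_left_mono) auto
    also have "\<dots> = (e1 * (2 * (C + 1))) * ?n" by simp
    also have "\<dots> \<le> e / 2 * ?n" using e1(3) by (intro mult_right_mono) auto
    also have "e2 * ?n \<le> e / 2 * ?n" using e2(3) by (intro mult_right_mono) auto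
    finally show "norm (\<tau> x - \<tau> x0 - (L \<circ> A) (x - x0)) \<le> e * ?n" by (simp add: field_simps)
  qed
qed

lemma area_element_pos_left_inverse:
  assumes "\<phi> differentiable (at x)" "area_element \<phi> x > 0"
  obtains L where "linear L" "L \<circ> frechet_derivative \<phi> (at x) = id"
proof -
  let ?D = "frechet_derivative \<phi> (at x)"
  have lin: "linear ?D" using assms(1) by (rule linear_frechet_derivative)
  define p where "p = ?D (axis 1 1)"
  define q where "q = ?D (axis 2 1)"
  have g: "(p \<bullet> p) * (q \<bullet> q) - (p \<bullet> q)\<^sup>2 > 0"
    using assms(2) by (simp add: area_element_def Let_def p_def q_def)
  have BT: "?D v = (v$1) *\<^sub>R p + (v$2) *\<^sub>R q" for v
  proof -
    have "v = (v$1) *\<^sub>R axis 1 1 + (v$2) *\<^sub>R axis 2 1"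
      by (simp add: vec_eq_iff forall_2 axis_def)
    then show ?thesis
      by (metis linear_add[OF lin] linear_scale[OF lin] p_def q_def)
  qed
  have "v = 0" if "?D v = 0" for v
  proof -
    have "(?D v) \<bullet> p = 0" "(?D v) \<bullet> q = 0" using that by auto
    then have e: "(v$1) * (p \<bullet> p) + (v$2) * (p \<bullet> q) = 0" "(v$1) * (p \<bullet> q) + (v$2) * (q \<bullet> q) = 0"
      unfolding BT by (simp_all add: inner_simps inner_commute)
    have "(v$1) * ((p \<bullet> p) * (q \<bullet> q) - (p \<bullet> q)\<^sup>2) = 0" "(v$2) * ((p \<bullet> p) * (q \<bullet> q) - (p \<bullet> q)\<^sup>2) = 0"
      using e by algebra+
    then show ?thesis using g by (simp add: vec_eq_iff forall_2)
  qed
  then have "inj ?D" by (simp add: linear_injective_0[OF lin])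
  then show ?thesis using linear_injective_left_inverse[OF lin] that by blast
qed

lemma surface_chartD:
  assumes "surface_chart S U \<phi>"
  shows "open U" "openin (top_of_set S) (\<phi> ` U)" "continuous_on U \<phi>" "inj_on \<phi> U"
    "\<And>x. x \<in> U \<Longrightarrow> (\<phi> has_derivative frechet_derivative \<phi> (at x)) (at x)"
    "\<And>x. x \<in> U \<Longrightarrow> area_element \<phi> x > 0"
    "continuous_on U (area_element \<phi>)" "\<phi> ` U \<subseteq> S"
proof -
  from assms obtain \<psi> where h: "homeomorphism U (\<phi> ` U) \<phi> \<psi>" unfolding surface_chart_def by blast
  show "open U" "openin (top_of_set S) (\<phi> ` U)" using assms by (auto simp: surface_chart_def)
  show "continuous_on U \<phi>" "inj_on \<phi> U" using h
    by (auto simp: homeomorphism_def intro: inj_on_inverseI)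
  show "\<And>x. x \<in> U \<Longrightarrow> (\<phi> has_derivative frechet_derivative \<phi> (at x)) (at x)"
    "\<And>x. x \<in> U \<Longrightarrow> area_element \<phi> x > 0"
    using assms by (auto simp: surface_chart_def frechet_derivative_works)
  show "continuous_on U (area_element \<phi>)"
    unfolding area_element_def Let_def using assms
    by (intro continuous_intros) (auto simp: surface_chart_def)
  show "\<phi> ` U \<subseteq> S" using assms by (auto simp: surface_chart_def dest: openin_imp_subset)
qed

lemma borel_chart_image:
  assumes "surface_chart S U \<phi>"
  shows "\<phi> ` U \<in> sets borel"
proof -
  obtain C where C: "\<And>n::nat. compact (C n)" "\<And>n. C n \<subseteq> U" "(\<Union>n. C n) = U"
    using open_Union_compact_subsets[OF surface_chartD(1)[OF assms]] by metis
  have "\<phi> ` U = (\<Union>n. \<phi> ` C n)" using C(3) by blast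
  moreover have "compact (\<phi> ` C n)" for n
    using compact_continuous_image[OF continuous_on_subset[OF surface_chartD(3)[OF assms] C(2)] C(1)] .
  then have "\<phi> ` C n \<in> sets borel" for n by (simp add: borel_closed compact_imp_closed)
  ultimately show ?thesis by auto
qed

text \<open>
  Charts are meaningful on their domain only. Extension by zero turns them into Borel functions on
  the plane.
\<close>

definition extend0 :: "'a set \<Rightarrow> ('a \<Rightarrow> 'b::real_vector) \<Rightarrow> 'a \<Rightarrow> 'b" where
  "extend0 U \<phi> = (\<lambda>x. indicator U x *\<^sub>R \<phi> x)"

lemma extend0_simps [simp]: "x \<in> U \<Longrightarrow> extend0 U \<phi> x = \<phi> x" "x \<notin> U \<Longrightarrow> extend0 U \<phi> x = 0"
  by (auto simp: extend0_def)

lemma extend0_chart_measurable: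
  assumes "surface_chart S U \<phi>"
  shows "extend0 U \<phi> \<in> borel_measurable borel" "extend0 U (area_element \<phi>) \<in> borel_measurable borel"
    "U \<in> sets borel"
proof -
  show U: "U \<in> sets borel" using surface_chartD(1)[OF assms] by simp
  show "extend0 U \<phi> \<in> borel_measurable borel" "extend0 U (area_element \<phi>) \<in> borel_measurable borel"
    unfolding extend0_def
    using borel_measurable_continuous_on_indicator[OF U surface_chartD(3)[OF assms]]
      borel_measurable_continuous_on_indicator[OF U surface_chartD(7)[OF assms]] by auto
qed

lemma chart_preimage_borel:
  assumes "surface_chart S U \<phi>" "A \<in> sets borel"
  shows "{x \<in> U. \<phi> x \<in> A} \<in> sets borel"
proof -
  have "{x \<in> U. \<phi> x \<in> A} = U \<inter> (extend0 U \<phi> -` A \<inter> space borel)" by (auto simp: extend0_def)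
  then show ?thesis
    using extend0_chart_measurable[OF assms(1)] assms(2) by (metis measurable_sets sets.Int)
qed

text \<open>
  The transition map \<open>\<tau>\<close> between two charts is differentiable by \<open>left_factor_has_derivative\<close>, and the
  area elements differ by its Jacobian. So the area of a set does not depend on the chart.
\<close>

lemma chart_transition:
  assumes c1: "surface_chart S U \<phi>" and c2: "surface_chart S V \<psi>"
    and A: "A \<in> sets borel" "A \<subseteq> \<phi> ` U" "A \<subseteq> \<psi> ` V"
  shows "(\<integral>\<^sup>+x\<in>{x\<in>U. \<phi> x \<in> A}. ennreal (area_element \<phi> x) \<partial>lborel) =
         (\<integral>\<^sup>+y\<in>{y\<in>V. \<psi> y \<in> A}. ennreal (area_element \<psi> y) \<partial>lborel)"
proof -
  note D1 = surface_chartD[OF c1] and D2 = surface_chartD[OF c2]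
  obtain \<psi>i where hom: "homeomorphism V (\<psi> ` V) \<psi> \<psi>i" using c2 unfolding surface_chart_def by blast
  have inv: "\<And>y. y \<in> V \<Longrightarrow> \<psi>i (\<psi> y) = y" "\<And>p. p \<in> \<psi> ` V \<Longrightarrow> \<psi> (\<psi>i p) = p"
    "\<And>p. p \<in> \<psi> ` V \<Longrightarrow> \<psi>i p \<in> V" and ci: "continuous_on (\<psi> ` V) \<psi>i"
    using hom by (auto simp: homeomorphism_def)
  define U' where "U' = U \<inter> \<phi> -` (\<psi> ` V)"
  have U': "open U'"
  proof -
    have "openin (top_of_set U) U'" unfolding U'_def
      by (rule continuous_openin_preimage[OF D1(3) _ D2(2)]) (use D1(8) in auto)
    then show ?thesis using D1(1) openin_open_trans by blast
  qed
  define \<tau> where "\<tau> = \<psi>i \<circ> \<phi>"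
  have ct: "continuous_on U' \<tau>" unfolding \<tau>_def
    by (intro continuous_on_compose continuous_on_subset[OF D1(3)] continuous_on_subset[OF ci]) (auto simp: U'_def)
  have tV: "\<tau> x \<in> V" "\<psi> (\<tau> x) = \<phi> x" if "x \<in> U'" for x
    using that inv by (auto simp: \<tau>_def U'_def)
  define T where "T = (\<lambda>x. (SOME L. linear L \<and> L \<circ> frechet_derivative \<psi> (at (\<tau> x)) = id) \<circ> frechet_derivative \<phi> (at x))"
  have T: "(\<tau> has_derivative T x) (at x)" "area_element \<phi> x = \<bar>det (matrix (T x))\<bar> * area_element \<psi> (\<tau> x)"
    if x: "x \<in> U'" for x
  proof -
    let ?B = "frechet_derivative \<psi> (at (\<tau> x))" and ?A = "frechet_derivative \<phi> (at x)"
    define L where "L = (SOME L. linear L \<and> L \<circ> ?B = id)"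
    have psid: "(\<psi> has_derivative ?B) (at (\<tau> x))" using D2(5) tV[OF x] by blast
    have phid: "(\<phi> has_derivative ?A) (at x)" using D1(5) x by (auto simp: U'_def)
    have "\<exists>L. linear L \<and> L \<circ> ?B = id"
      using area_element_pos_left_inverse[of \<psi> "\<tau> x"] psid D2(6) tV[OF x]
      by (metis differentiableI)
    then have L: "linear L \<and> L \<circ> ?B = id" unfolding L_def by (rule someI_ex)
    have TL: "T x = L \<circ> ?A" by (simp add: T_def L_def)
    have ev: "\<forall>\<^sub>F x in nhds x. \<psi> (\<tau> x) = \<phi> x"
      using eventually_nhds_in_open[OF U' x] by eventually_elim (rule tV)
    show der: "(\<tau> has_derivative T x) (at x)" unfolding TL
      by (rule left_factor_has_derivative[where \<tau>=\<tau>, OF phid psid])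
        (use L ev ct U' x in \<open>auto simp: continuous_on_eq_continuous_at\<close>)
    have "((\<lambda>x. \<psi> (\<tau> x)) has_derivative (\<lambda>v. ?B (T x v))) (at x)"
      using has_derivative_compose[OF der psid] .
    then have "(\<phi> has_derivative (\<lambda>v. ?B (T x v))) (at x)"
      by (rule has_derivative_transform_eventually)
        (use ev tV(2)[OF x] in \<open>auto simp: eventually_at_filter elim: eventually_mono\<close>)
    then have eq: "?A = (\<lambda>v. ?B (T x v))" using phid has_derivative_unique by blast
    have lT: "linear (T x)" using der has_derivative_linear by blast
    have lB: "linear ?B" using psid has_derivative_linear by blast
    show "area_element \<phi> x = \<bar>det (matrix (T x))\<bar> * area_element \<psi> (\<tau> x)"
      unfolding area_element_def Let_def eq gram_compose_linear[OF lB lT]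
      by (simp add: real_sqrt_mult)
  qed
  define X where "X = {x\<in>U. \<phi> x \<in> A}"
  have XU: "X \<subseteq> U'" using A by (auto simp: X_def U'_def)
  have Xb: "X \<in> sets borel" unfolding X_def by (rule chart_preimage_borel[OF c1 A(1)])
  have tX: "\<tau> ` X = {y\<in>V. \<psi> y \<in> A}"
  proof (intro set_eqI iffI)
    fix y assume "y \<in> \<tau> ` X" then show "y \<in> {y\<in>V. \<psi> y \<in> A}" using XU tV by (auto simp: X_def)
  next
    fix y assume y: "y \<in> {y\<in>V. \<psi> y \<in> A}"
    then obtain x where "x \<in> U" "\<phi> x = \<psi> y" using A(2) by auto
    then show "y \<in> \<tau> ` X" using y inv by (intro image_eqI[of _ _ x]) (auto simp: X_def \<tau>_def)
  qed
  have injt: "inj_on \<tau> X"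
  proof (rule inj_onI)
    fix x y assume xy: "x \<in> X" "y \<in> X" "\<tau> x = \<tau> y"
    then have "\<phi> x = \<phi> y" using tV(2)[of x] tV(2)[of y] XU by (metis subsetD)
    then show "x = y" using D1(4) xy by (auto simp: X_def dest: inj_onD)
  qed
  let ?f = "extend0 V (area_element \<psi>)"
  have key: "\<bar>det (matrix (T x))\<bar> * ?f (\<tau> x) = area_element \<phi> x" if "x \<in> X" for x
    using that XU T(2)[of x] tV(1)[of x] by auto
  have "(\<integral>\<^sup>+y\<in>\<tau> ` X. ennreal (?f y) \<partial>lborel) = (\<integral>\<^sup>+x\<in>X. ennreal (\<bar>det (matrix (T x))\<bar> * ?f (\<tau> x)) \<partial>lborel)"
  proof (rule nn_integral_change_of_variables[OF Xb])
    show "\<And>x. x \<in> X \<Longrightarrow> (\<tau> has_derivative T x) (at x within X)"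
      using T(1) XU by (blast intro: has_derivative_at_withinI)
    show "\<tau> ` X \<in> sets borel" unfolding tX by (rule chart_preimage_borel[OF c2 A(1)])
    show "?f y \<ge> 0" for y by (simp add: extend0_def area_element_nonneg)
    have "(\<lambda>x. indicator X x * (\<bar>det (matrix (T x))\<bar> * ?f (\<tau> x))) = (\<lambda>x. indicator X x * extend0 U (area_element \<phi>) x)"
      using key by (auto simp: fun_eq_iff indicator_def X_def)
    then show "(\<lambda>x. indicator X x * (\<bar>det (matrix (T x))\<bar> * ?f (\<tau> x))) \<in> borel_measurable borel"
      using Xb extend0_chart_measurable[OF c1] by simp
  qed (use injt extend0_chart_measurable[OF c2] in auto)
  also have "(\<integral>\<^sup>+x\<in>X. ennreal (\<bar>det (matrix (T x))\<bar> * ?f (\<tau> x)) \<partial>lborel) = (\<integral>\<^sup>+x\<in>X. ennreal (area_element \<phi> x) \<partial>lborel)"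
    using key by (intro nn_integral_cong) (simp add: indicator_def)
  also have "(\<integral>\<^sup>+y\<in>\<tau> ` X. ennreal (?f y) \<partial>lborel) = (\<integral>\<^sup>+y\<in>\<tau> ` X. ennreal (area_element \<psi> y) \<partial>lborel)"
    using tX by (intro nn_integral_cong) (auto simp: indicator_def extend0_def)
  finally show ?thesis unfolding tX unfolding X_def by (rule sym)
qed

lemma nn_integral_chart_disjoint_union:
  assumes c: "surface_chart S U \<phi>" and B: "\<And>i::nat. B i \<in> sets borel" "disjoint_family B"
    and A: "A \<in> sets borel" "A \<inter> \<phi> ` U \<subseteq> (\<Union>i. B i)"
  shows "(\<Sum>i. \<integral>\<^sup>+x\<in>{x\<in>U. \<phi> x \<in> A \<inter> B i}. ennreal (area_element \<phi> x) \<partial>lborel) =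
     (\<integral>\<^sup>+x\<in>{x\<in>U. \<phi> x \<in> A}. ennreal (area_element \<phi> x) \<partial>lborel)"
proof -
  let ?a = "extend0 U (area_element \<phi>)"
  have am: "?a \<in> borel_measurable borel" by (rule extend0_chart_measurable[OF c])
  have X: "{x\<in>U. \<phi> x \<in> A \<inter> B i} \<in> sets borel" for i
    by (rule chart_preimage_borel[OF c]) (use A B in auto)
  define M where "M = density lborel (\<lambda>x. ennreal (?a x))"
  have em: "emeasure M {x\<in>U. \<phi> x \<in> Y} = (\<integral>\<^sup>+x\<in>{x\<in>U. \<phi> x \<in> Y}. ennreal (area_element \<phi> x) \<partial>lborel)"
    if "Y \<in> sets borel" for Y
    unfolding M_def using am chart_preimage_borel[OF c that]
    by (subst emeasure_density) (auto intro!: nn_integral_cong simp: indicator_def)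
  have "(\<Sum>i. emeasure M {x\<in>U. \<phi> x \<in> A \<inter> B i}) = emeasure M (\<Union>i. {x\<in>U. \<phi> x \<in> A \<inter> B i})"
    by (rule suminf_emeasure) (use X B(2) in \<open>auto simp: M_def disjoint_family_on_def\<close>)
  also have "(\<Union>i. {x\<in>U. \<phi> x \<in> A \<inter> B i}) = {x\<in>U. \<phi> x \<in> A}" using A(2) by auto
  finally show ?thesis using A(1) B(1) by (simp only: em sets.Int)
qed

text \<open>
  By the Lindeloef property countably many charts cover the regular part of \<open>S\<close>. Cutting their images
  into disjoint pieces \<open>B i\<close>, the area must be the sum of the areas of the pieces, which gives
  uniqueness. The measure defined by this sum agrees with the area on every other chart by
  \<open>chart_transition\<close>.
\<close>

lemma ex1_area_measure: "\<exists>!M. is_area_measure S M"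
proof -
  let ?F = "{\<phi> ` U |U \<phi>. surface_chart S U \<phi>}"
  have "\<And>T. T \<in> ?F \<Longrightarrow> openin (top_of_set S) T" using surface_chartD(2) by blast
  then obtain F' where F': "F' \<subseteq> ?F" "countable F'" "\<Union>F' = \<Union>?F"
    using Lindelof_openin[of ?F S] by blast
  have triv: "surface_chart S {} (\<lambda>_. 0)"
    by (auto simp: surface_chart_def homeomorphism_def)
  \<comment> \<open>The empty chart is added so that the family can be enumerated even if it is empty.\<close>
  define F where "F = insert {} F'"
  have "{} \<in> ?F" using triv by blast
  then have F: "F \<subseteq> ?F" "countable F" "F \<noteq> {}" "\<Union>F = \<Union>?F" using F' by (auto simp: F_def)
  define c where "c = from_nat_into F"
  have c: "range c = F" unfolding c_def by (rule range_from_nat_into[OF F(3,2)])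
  have "\<forall>i. \<exists>U \<phi>. surface_chart S U \<phi> \<and> c i = \<phi> ` U" using c F(1) by blast
  then obtain U \<phi> where ch: "\<And>i. surface_chart S (U i) (\<phi> i)" and ci: "\<And>i. c i = \<phi> i ` U i" by metis
  define B where "B = disjointed c"
  have cb: "c i \<in> sets borel" for i unfolding ci by (rule borel_chart_image[OF ch])
  have "range c \<subseteq> sets borel" using cb by auto
  then have "range (disjointed c) \<subseteq> sets borel" by (rule sets.range_disjointed_sets)
  then have B: "B i \<in> sets borel" "disjoint_family B" "B i \<subseteq> \<phi> i ` U i" for i
    using disjointed_subset[of c i] ci[of i] unfolding B_def
    by (auto simp: disjoint_family_disjointed)
  have BU: "(\<Union>i. B i) = \<Union>?F" unfolding B_def UN_disjointed_eq using c F(4) by simp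
  define T where "T = \<Union>?F"
  have T: "T \<in> sets borel" unfolding T_def BU[symmetric] using B(1) by auto
  define I where "I = (\<lambda>i A. \<integral>\<^sup>+x\<in>{x\<in>U i. \<phi> i x \<in> A \<inter> B i}. ennreal (area_element (\<phi> i) x) \<partial>lborel)"
  have uniq: "emeasure M A = (\<Sum>i. I i A)" if M: "is_area_measure S M" and A: "A \<in> sets borel" for M A
  proof -
    have sM: "sets M = sets borel" and null: "emeasure M (- T) = 0"
      and chM: "\<And>U \<phi> A. surface_chart S U \<phi> \<Longrightarrow> A \<in> sets borel \<Longrightarrow>
        emeasure M (A \<inter> \<phi> ` U) = (\<integral>\<^sup>+x\<in>{x \<in> U. \<phi> x \<in> A}. ennreal (area_element \<phi> x) \<partial>lborel)"
      using M unfolding is_area_measure_def T_def by blast+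
    have "- T \<in> null_sets M" using null T sM by auto
    then have "emeasure M (A - - T) = emeasure M A" using A sM by (intro emeasure_Diff_null_set) auto
    also have "A - - T = (\<Union>i. A \<inter> B i)" using BU by (auto simp: T_def)
    also have "emeasure M (\<Union>i. A \<inter> B i) = (\<Sum>i. emeasure M (A \<inter> B i))"
      by (rule suminf_emeasure[symmetric]) (use A B sM in \<open>auto simp: disjoint_family_on_def\<close>)
    also have "(\<lambda>i. emeasure M (A \<inter> B i)) = (\<lambda>i. I i A)"
    proof
      fix i
      have "A \<inter> B i = (A \<inter> B i) \<inter> \<phi> i ` U i" using B(3) by blast
      then show "emeasure M (A \<inter> B i) = I i A" using chM[OF ch, of "A \<inter> B i" i] A B(1) by (simp add: I_def)
    qed
    finally show ?thesis by simp
  qed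
  \<comment> \<open>The measure is the image of the area on the disjoint union of the chart domains.\<close>
  define g where "g = (\<lambda>(i, x). indicator (B i) (extend0 (U i) (\<phi> i) x) * (indicator (U i) x * ennreal (extend0 (U i) (area_element (\<phi> i)) x)))"
  define M where "M = distr (density (count_space (UNIV::nat set) \<Otimes>\<^sub>M lborel) g) borel
    (\<lambda>(i, x). extend0 (U i) (\<phi> i) x)"
  have m1: "(\<lambda>x. extend0 (U i) (\<phi> i) x) \<in> borel_measurable lborel"
    "(\<lambda>x. extend0 (U i) (area_element (\<phi> i)) x) \<in> borel_measurable lborel" for i
    using extend0_chart_measurable[OF ch[of i]] by simp_all
  have [measurable]: "(\<lambda>(i, x). extend0 (U i) (\<phi> i) x) \<in> borel_measurable (count_space (UNIV::nat set) \<Otimes>\<^sub>M lborel)"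
    by (rule measurable_pair_measure_countable1) (use m1 in auto)
  have [measurable]: "g \<in> borel_measurable (count_space (UNIV::nat set) \<Otimes>\<^sub>M lborel)"
  proof (rule measurable_pair_measure_countable1)
    fix i :: nat
    have [measurable]: "U i \<in> sets borel" "B i \<in> sets borel" using extend0_chart_measurable(3)[OF ch] B(1) by auto
    note m1[of i, measurable]
    show "(\<lambda>y. g (i, y)) \<in> borel_measurable lborel" unfolding g_def by simp
  qed simp
  have eM: "emeasure M A = (\<Sum>i. I i A)" if A: "A \<in> sets borel" for A
  proof -
    note A[measurable]
    let ?P = "count_space (UNIV::nat set) \<Otimes>\<^sub>M (lborel :: (real^2) measure)"
    let ?e = "\<lambda>(i, x). extend0 (U i) (\<phi> i) x"
    have pre: "?e -` A \<inter> space ?P \<in> sets ?P" by (rule measurable_sets[OF _ A]) simp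
    have "emeasure M A = emeasure (density ?P g) (?e -` A \<inter> space ?P)"
      unfolding M_def by (subst emeasure_distr) (use A in simp_all)
    also have "\<dots> = (\<integral>\<^sup>+z. g z * indicator (?e -` A \<inter> space ?P) z \<partial>?P)"
      by (rule emeasure_density[OF _ pre]) simp
    also have "\<dots> = (\<integral>\<^sup>+z. g z * indicator A (?e z) \<partial>?P)"
      by (intro nn_integral_cong) (auto simp: indicator_def space_pair_measure)
    also have "\<dots> = (\<integral>\<^sup>+i. \<integral>\<^sup>+x. g (i, x) * indicator A (extend0 (U i) (\<phi> i) x) \<partial>lborel \<partial>count_space UNIV)"
      by (subst lborel.nn_integral_fst[symmetric]) simp_all
    also have "\<dots> = (\<Sum>i. \<integral>\<^sup>+x. g (i, x) * indicator A (extend0 (U i) (\<phi> i) x) \<partial>lborel)"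
      by (rule nn_integral_count_space_nat)
    also have "(\<lambda>i. \<integral>\<^sup>+x. g (i, x) * indicator A (extend0 (U i) (\<phi> i) x) \<partial>lborel) = (\<lambda>i. I i A)"
      unfolding I_def g_def by (intro ext nn_integral_cong) (auto simp: indicator_def)
    finally show ?thesis .
  qed
  have "is_area_measure S M"
    unfolding is_area_measure_def
  proof (intro conjI allI impI)
    show "sets M = sets borel" by (simp add: M_def)
    have "I i (- T) = 0" for i
    proof -
      have "{x \<in> U i. \<phi> i x \<in> - T \<inter> B i} = {}" using BU by (auto simp: T_def)
      then show ?thesis unfolding I_def by (simp only: ) simp
    qed
    then show "emeasure M (- \<Union>?F) = 0" using eM[of "- T"] T by (simp add: T_def)
  next
    fix V \<psi> and A :: "(complex \<times> complex) set"
    assume V: "surface_chart S V \<psi>" and A: "A \<in> sets borel"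
    have bV: "\<psi> ` V \<in> sets borel" by (rule borel_chart_image[OF V])
    have sub: "\<psi> ` V \<subseteq> (\<Union>i. B i)" unfolding BU using V by blast
    have "I i (A \<inter> \<psi> ` V) = (\<integral>\<^sup>+y\<in>{y\<in>V. \<psi> y \<in> A \<inter> B i}. ennreal (area_element \<psi> y) \<partial>lborel)" for i
    proof -
      have "I i (A \<inter> \<psi> ` V) = (\<integral>\<^sup>+y\<in>{y\<in>V. \<psi> y \<in> A \<inter> \<psi> ` V \<inter> B i}. ennreal (area_element \<psi> y) \<partial>lborel)"
        unfolding I_def by (rule chart_transition[OF ch V]) (use A bV B in auto)
      also have "{y\<in>V. \<psi> y \<in> A \<inter> \<psi> ` V \<inter> B i} = {y\<in>V. \<psi> y \<in> A \<inter> B i}" by auto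
      finally show ?thesis .
    qed
    then have "emeasure M (A \<inter> \<psi> ` V) = (\<Sum>i. \<integral>\<^sup>+y\<in>{y\<in>V. \<psi> y \<in> A \<inter> B i}. ennreal (area_element \<psi> y) \<partial>lborel)"
      using eM[of "A \<inter> \<psi> ` V"] A bV by simp
    also have "\<dots> = (\<integral>\<^sup>+y\<in>{y\<in>V. \<psi> y \<in> A}. ennreal (area_element \<psi> y) \<partial>lborel)"
      by (rule nn_integral_chart_disjoint_union[OF V]) (use B A sub in auto)
    finally show "emeasure M (A \<inter> \<psi> ` V) = (\<integral>\<^sup>+y\<in>{y\<in>V. \<psi> y \<in> A}. ennreal (area_element \<psi> y) \<partial>lborel)" .
  qed
  moreover have "M1 = M2" if "is_area_measure S M1" "is_area_measure S M2" for M1 M2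
    using uniq[OF that(1)] uniq[OF that(2)] that
    by (intro measure_eqI) (auto simp: is_area_measure_def)
  ultimately show ?thesis by blast
qed

lemma is_area_measure_area_measure: "is_area_measure S (area_measure S)"
  unfolding area_measure_def by (rule theI'[OF ex1_area_measure])

text \<open>
  Measurability is required on \<open>X\<close> only, because the values of a power series are not controlled
  outside its domain of convergence.
\<close>

lemma nn_integral_area_measure_chart:
  assumes c: "surface_chart S U \<phi>" and X: "X \<in> sets borel" "X \<subseteq> \<phi> ` U"
    and h: "(\<lambda>p. h p * indicator X p) \<in> borel_measurable borel"
  shows "(\<integral>\<^sup>+p\<in>X. h p \<partial>area_measure S) =
    (\<integral>\<^sup>+x\<in>{x\<in>U. \<phi> x \<in> X}. h (\<phi> x) * ennreal (area_element \<phi> x) \<partial>lborel)"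
proof -
  let ?M = "area_measure S"
  have sM: "sets ?M = sets borel" and em: "emeasure ?M (A \<inter> \<phi> ` U) =
      (\<integral>\<^sup>+x\<in>{x \<in> U. \<phi> x \<in> A}. ennreal (area_element \<phi> x) \<partial>lborel)" if "A \<in> sets borel" for A
    using is_area_measure_area_measure[of S] c that unfolding is_area_measure_def by blast+
  have sM: "sets ?M = sets borel" using sM[of "{}"] by simp
  have [measurable_cong]: "sets ?M = sets borel" by (rule sM)
  have mb: "measurable ?M borel = borel_measurable borel" by (rule measurable_cong_sets[OF sM refl])
  have U: "U \<in> sets borel" and [measurable]: "extend0 U \<phi> \<in> borel_measurable borel"
    "extend0 U (area_element \<phi>) \<in> borel_measurable borel"
    using extend0_chart_measurable[OF c] by auto
  note U[measurable] X(1)[measurable]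
  have [measurable]: "\<phi> ` U \<in> sets borel" by (rule borel_chart_image[OF c])
  define g where "g = (\<lambda>x. indicator U x * ennreal (extend0 U (area_element \<phi>) x))"
  have [measurable]: "g \<in> borel_measurable borel" unfolding g_def by simp
  define M1 where "M1 = density ?M (indicator (\<phi> ` U))"
  define M2 where "M2 = distr (density lborel g) borel (extend0 U \<phi>)"
  have "M1 = M2"
  proof (rule measure_eqI)
    show "sets M1 = sets M2" by (simp add: M1_def M2_def sM)
    fix A assume "A \<in> sets M1"
    then have A[measurable]: "A \<in> sets borel" by (simp add: M1_def sM)
    have "emeasure M1 A = emeasure ?M (A \<inter> \<phi> ` U)"
      unfolding M1_def using sM by (subst emeasure_density) (auto simp: mb Int_commute simp flip: indicator_inter_arith)
    also have "\<dots> = (\<integral>\<^sup>+x. g x * indicator A (extend0 U \<phi> x) \<partial>lborel)"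
      unfolding em[OF A] g_def by (intro nn_integral_cong) (auto simp: indicator_def)
    also have "\<dots> = emeasure M2 A"
      unfolding M2_def
      by (subst emeasure_distr, simp, simp, subst emeasure_density)
        (auto intro!: nn_integral_cong measurable_sets_borel[OF _ A] simp: indicator_def)
    finally show "emeasure M1 A = emeasure M2 A" .
  qed
  let ?h = "\<lambda>p. h p * indicator X p"
  have "(\<integral>\<^sup>+p\<in>X. h p \<partial>?M) = (\<integral>\<^sup>+p. indicator (\<phi> ` U) p * ?h p \<partial>?M)"
    using X(2) by (intro nn_integral_cong) (auto simp: indicator_def)
  also have "\<dots> = (\<integral>\<^sup>+p. ?h p \<partial>M1)"
    unfolding M1_def by (rule nn_integral_density[symmetric]) (use h in \<open>auto simp: mb\<close>)
  also have "\<dots> = (\<integral>\<^sup>+x. ?h (extend0 U \<phi> x) \<partial>density lborel g)"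
    unfolding \<open>M1 = M2\<close> M2_def by (rule nn_integral_distr) (use h in simp_all)
  also have "\<dots> = (\<integral>\<^sup>+x. g x * ?h (extend0 U \<phi> x) \<partial>lborel)"
  proof (rule nn_integral_density)
    show "(\<lambda>x. ?h (extend0 U \<phi> x)) \<in> borel_measurable lborel"
      using measurable_compose[OF _ h, of "extend0 U \<phi>" lborel] by simp
  qed simp
  also have "\<dots> = (\<integral>\<^sup>+x\<in>{x\<in>U. \<phi> x \<in> X}. h (\<phi> x) * ennreal (area_element \<phi> x) \<partial>lborel)"
    by (intro nn_integral_cong) (auto simp: indicator_def g_def mult.commute)
  finally show ?thesis .
qed

section \<open>Holomorphic maps of the real plane\<close>

definition cplx :: "real^2 \<Rightarrow> complex" where "cplx x = Complex (x $ 1) (x $ 2)"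

definition uncplx :: "complex \<Rightarrow> real^2" where "uncplx z = vector [Re z, Im z]"

lemma cplx_uncplx [simp]: "cplx (uncplx z) = z" "uncplx (cplx x) = x"
  by (simp_all add: cplx_def uncplx_def vec_eq_iff forall_2)

lemma linear_cplx: "linear cplx" and linear_uncplx: "linear uncplx"
  by (auto simp: linear_iff cplx_def uncplx_def complex_eq_iff vec_eq_iff forall_2)

lemma norm_cplx [simp]: "norm (cplx x) = norm x"
  by (simp add: cplx_def norm_vec_def L2_set_def sum_2 cmod_def)

lemma norm_uncplx [simp]: "norm (uncplx z) = norm z"
  by (metis cplx_uncplx(1) norm_cplx)

lemma bounded_linear_cplx: "bounded_linear cplx" and bounded_linear_uncplx: "bounded_linear uncplx"
  using linear_cplx linear_uncplx by (simp_all add: linear_conv_bounded_linear)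

lemma continuous_cplx [continuous_intros]: "continuous_on A g \<Longrightarrow> continuous_on A (\<lambda>x. cplx (g x))"
  and continuous_uncplx [continuous_intros]: "continuous_on A h \<Longrightarrow> continuous_on A (\<lambda>x. uncplx (h x))"
  using bounded_linear.continuous_on[OF bounded_linear_cplx] bounded_linear.continuous_on[OF bounded_linear_uncplx]
  by blast+

lemma cplx_measurable [measurable]: "cplx \<in> borel_measurable borel"
  and uncplx_measurable [measurable]: "uncplx \<in> borel_measurable borel"
  by (auto intro!: borel_measurable_continuous_onI continuous_intros)

lemma cplx_axis: "cplx (axis 1 1) = 1" "cplx (axis 2 1) = \<i>"
  by (simp_all add: cplx_def axis_def complex_eq_iff)

text \<open>
  By the Cauchy--Riemann equations the Jacobian of a holomorphic map is the squared modulus of its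
  derivative.
\<close>

lemma holomorphic_as_plane_map:
  assumes "(F has_field_derivative c) (at (cplx x))"
  shows "((\<lambda>x. uncplx (F (cplx x))) has_derivative (\<lambda>v. uncplx (c * cplx v))) (at x)"
    and "det (matrix (\<lambda>v. uncplx (c * cplx v))) = (norm c)\<^sup>2"
proof -
  have "((\<lambda>x. F (cplx x)) has_derivative (\<lambda>v. c * cplx v)) (at x)"
    using has_derivative_compose[OF bounded_linear_imp_has_derivative[OF bounded_linear_cplx] assms[unfolded has_field_derivative_def]] .
  then show "((\<lambda>x. uncplx (F (cplx x))) has_derivative (\<lambda>v. uncplx (c * cplx v))) (at x)"
    by (rule bounded_linear.has_derivative[OF bounded_linear_uncplx])
  show "det (matrix (\<lambda>v. uncplx (c * cplx v))) = (norm c)\<^sup>2"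
    unfolding cmod_power2 by (simp add: det_2 matrix_def cplx_axis uncplx_def power2_eq_square)
qed

lemma emeasure_norm_sq_le:
  assumes "0 \<le> t"
  shows "emeasure lborel {y :: real^2. norm y ^ 2 \<le> t} = ennreal (pi * t)"
proof -
  have "{y :: real^2. norm y ^ 2 \<le> t} = cball 0 (sqrt t)"
    by (auto simp: dist_norm) (metis real_sqrt_le_iff real_sqrt_abs abs_norm_cancel)+
  then show ?thesis using assms emeasure_cball[of "sqrt t" "0 :: real^2"]
    by (simp add: unit_ball_vol_2)
qed

text \<open>
  The integrand at \<open>y\<close> is the integral of \<open>k\<close> over \<open>{norm y ^ 2 ..}\<close>. After exchanging the order of
  integration, the inner integral is the area of a disc.
\<close>

lemma nn_integral_plane_radial:
  assumes s: "s > 0" and b: "b > (0::real)"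
  shows "(\<integral>\<^sup>+y. ennreal (1 / (s * norm y ^ 2 + b)\<^sup>2) \<partial>(lborel :: (real^2) measure)) = ennreal (pi / (s * b))"
proof -
  define k where "k = (\<lambda>x::real. 2 * s / (s * x + b) ^ 3)"
  have pos: "s * x + b > 0" if "x \<ge> 0" for x using that s b by (simp add: add_nonneg_pos)
  have km[measurable]: "k \<in> borel_measurable borel" unfolding k_def by measurable
  have layer: "(\<integral>\<^sup>+x. ennreal (k x) * indicator {r..} x \<partial>lborel) = ennreal (1 / (s * r + b)\<^sup>2)" if r: "r \<ge> 0" for r
  proof -
    have "(\<integral>\<^sup>+x. ennreal (k x) * indicator {r..} x \<partial>lborel) = ennreal (0 - (- 1 / (s * r + b)\<^sup>2))"
    proof (rule nn_integral_FTC_atLeast[OF km])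
      fix x assume x: "r \<le> x"
      then have p: "s * x + b > 0" using pos r by auto
      show "((\<lambda>x. - 1 / (s * x + b)\<^sup>2) has_real_derivative k x) (at x)"
      proof -
        have "((\<lambda>x. - 1 / (s * x + b)\<^sup>2) has_real_derivative
            - ((-1) * (2 * (s * x + b) * s)) / ((s * x + b)\<^sup>2 * (s * x + b)\<^sup>2) * (-1) * (-1)) (at x)"
          using p by (auto intro!: derivative_eq_intros)
        also have "- ((-1) * (2 * (s * x + b) * s)) / ((s * x + b)\<^sup>2 * (s * x + b)\<^sup>2) * (-1) * (-1) = k x"
        proof -
          have "(s * x + b)\<^sup>2 * (s * x + b)\<^sup>2 = (s * x + b) * (s * x + b) ^ 3"
            by (simp add: power2_eq_square power3_eq_cube)
          moreover have "- ((-1) * (2 * (s * x + b) * s)) = (s * x + b) * (2 * s)" by simp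
          ultimately show ?thesis using p unfolding k_def by (simp only: ) simp
        qed
        finally show ?thesis .
      qed
      show "0 \<le> k x" unfolding k_def using p s by simp
    next
      show "((\<lambda>x. - 1 / (s * x + b)\<^sup>2) \<longlongrightarrow> 0) at_top"
        using s by real_asymp
    qed
    then show ?thesis by simp
  qed
  have "(\<integral>\<^sup>+y. ennreal (1 / (s * norm y ^ 2 + b)\<^sup>2) \<partial>(lborel :: (real^2) measure))
      = (\<integral>\<^sup>+y. \<integral>\<^sup>+x. ennreal (k x) * indicator {norm y ^ 2..} x \<partial>lborel \<partial>(lborel :: (real^2) measure))"
    by (simp add: layer)
  also have "\<dots> = (\<integral>\<^sup>+x. \<integral>\<^sup>+y. ennreal (k x) * indicator {norm y ^ 2..} x \<partial>(lborel :: (real^2) measure) \<partial>lborel)"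
  proof (rule lborel_pair.Fubini')
    have "(\<lambda>p::real \<times> (real^2). ennreal (k (fst p)) * indicator {p. norm (snd p) ^ 2 \<le> fst p} p) \<in> borel_measurable (lborel \<Otimes>\<^sub>M lborel)"
      by measurable
    then show "(\<lambda>(x, y). ennreal (k x) * indicator {norm (y::real^2) ^ 2..} x) \<in> borel_measurable (lborel \<Otimes>\<^sub>M lborel)"
      by (simp add: case_prod_beta' indicator_def)
  qed
  also have "\<dots> = (\<integral>\<^sup>+x. ennreal (2 * pi * s * x / (s * x + b) ^ 3) * indicator {0..} x \<partial>lborel)"
  proof (rule nn_integral_cong)
    fix x :: real
    have "(\<integral>\<^sup>+y. ennreal (k x) * indicator {norm y ^ 2..} x \<partial>(lborel :: (real^2) measure))
       = (\<integral>\<^sup>+y. ennreal (k x) * indicator {y. norm y ^ 2 \<le> x} y \<partial>(lborel :: (real^2) measure))"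
      by (simp add: indicator_def)
    also have "\<dots> = ennreal (k x) * emeasure lborel {y::real^2. norm y ^ 2 \<le> x}"
      by (rule nn_integral_cmult_indicator) measurable
    also have "\<dots> = ennreal (2 * pi * s * x / (s * x + b) ^ 3) * indicator {0..} x"
    proof (cases "x \<ge> 0")
      case True
      have "ennreal (k x) * ennreal (pi * x) = ennreal (k x * (pi * x))"
        using pos[OF True] s True by (intro ennreal_mult[symmetric]) (simp_all add: k_def)
      also have "k x * (pi * x) = 2 * pi * s * x / (s * x + b) ^ 3" by (simp add: k_def)
      finally have A: "ennreal (k x) * ennreal (pi * x) = ennreal (2 * pi * s * x / (s * x + b) ^ 3)" .
      have i: "indicator {0..} x = (1 :: ennreal)" using True by simp
      show ?thesis by (simp only: emeasure_norm_sq_le[OF True] A i mult_1_right)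
    next
      case False
      have "\<not> norm y ^ 2 \<le> x" for y :: "real^2" using False zero_le_power2[of "norm y"] by linarith
      then have "{y::real^2. norm y ^ 2 \<le> x} = {}" by blast
      moreover have "indicator {0..} x = (0 :: ennreal)" using False by simp
      ultimately show ?thesis by (simp only: emeasure_empty mult_zero_right)
    qed
    finally show "(\<integral>\<^sup>+y. ennreal (k x) * indicator {norm y ^ 2..} x \<partial>(lborel :: (real^2) measure))
       = ennreal (2 * pi * s * x / (s * x + b) ^ 3) * indicator {0..} x" .
  qed
  also have "\<dots> = ennreal (pi / (s * b) - pi * s / b * (0\<^sup>2 / (s * 0 + b)\<^sup>2))"
  proof (rule nn_integral_FTC_atLeast)
    fix x :: real assume x: "0 \<le> x"
    have p: "s * x + b > 0" using pos[OF x] .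
    show "((\<lambda>x. pi * s / b * (x\<^sup>2 / (s * x + b)\<^sup>2)) has_real_derivative 2 * pi * s * x / (s * x + b) ^ 3) (at x)"
    proof -
      have "((\<lambda>x. x\<^sup>2 / (s * x + b)\<^sup>2) has_real_derivative
          (2 * x * (s * x + b)\<^sup>2 - x\<^sup>2 * (2 * (s * x + b) * s)) / ((s * x + b)\<^sup>2 * (s * x + b)\<^sup>2)) (at x)"
        using p by (auto intro!: derivative_eq_intros)
      also have "(2 * x * (s * x + b)\<^sup>2 - x\<^sup>2 * (2 * (s * x + b) * s)) / ((s * x + b)\<^sup>2 * (s * x + b)\<^sup>2)
         = 2 * b * x / (s * x + b) ^ 3"
      proof -
        have "2 * x * (s * x + b)\<^sup>2 - x\<^sup>2 * (2 * (s * x + b) * s) = (s * x + b) * (2 * b * x)"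
          by (simp add: power2_eq_square algebra_simps)
        moreover have "(s * x + b)\<^sup>2 * (s * x + b)\<^sup>2 = (s * x + b) * (s * x + b) ^ 3"
          by (simp add: power2_eq_square power3_eq_cube)
        ultimately show ?thesis using p by simp
      qed
      finally have "((\<lambda>x. x\<^sup>2 / (s * x + b)\<^sup>2) has_real_derivative 2 * b * x / (s * x + b) ^ 3) (at x)" .
      from DERIV_cmult[OF this, of "pi * s / b"] show ?thesis using b by (simp add: mult_ac)
    qed
    show "0 \<le> 2 * pi * s * x / (s * x + b) ^ 3" using p x s by simp
  next
    have "((\<lambda>x. pi * s / b * (x\<^sup>2 / (s * x + b)\<^sup>2)) \<longlongrightarrow> pi * s / b * (1 / s\<^sup>2)) at_top"
    proof (rule tendsto_mult_left)
      show "((\<lambda>x. x\<^sup>2 / (s * x + b)\<^sup>2) \<longlongrightarrow> 1 / s\<^sup>2) at_top"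
        unfolding inverse_eq_divide[symmetric] using s by real_asymp
    qed
    moreover have "pi * s / b * (1 / s\<^sup>2) = pi / (s * b)" using s b by (simp add: power2_eq_square)
    ultimately show "((\<lambda>x. pi * s / b * (x\<^sup>2 / (s * x + b)\<^sup>2)) \<longlongrightarrow> pi / (s * b)) at_top" by simp
  qed measurable
  finally show ?thesis by simp
qed

text \<open>
  This is the total area of the projective line in the affine chart \<open>y \<mapsto> (y : \<kappa> - l y)\<close>, whose image
  omits a single point. Completing the square makes the integrand radial.
\<close>

lemma nn_integral_plane_fubini_study:
  fixes \<kappa> l :: complex
  assumes "\<kappa> \<noteq> 0"
  shows "(\<integral>\<^sup>+y. ennreal (2 * norm \<kappa> ^ 2 / (norm (cplx y) ^ 2 + norm (\<kappa> - l * cplx y) ^ 2)\<^sup>2) \<partial>lborel) = ennreal (2 * pi)"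
proof -
  define s where "s = 1 + norm l ^ 2"
  define b where "b = norm \<kappa> ^ 2 / s"
  \<comment> \<open>The quadratic function \<open>norm y ^ 2 + norm (\<kappa> - l * y) ^ 2\<close> has its minimum \<open>b\<close> at \<open>y0\<close>.\<close>
  define y0 where "y0 = \<kappa> * cnj l / of_real s"
  have s: "s > 0" by (simp add: s_def add_pos_nonneg)
  have b: "b > 0" using s assms by (simp add: b_def)
  have sq: "norm y ^ 2 + norm (\<kappa> - l * y) ^ 2 = s * norm (y - y0) ^ 2 + b" for y :: complex
  proof -
    have "of_real (norm y ^ 2 + norm (\<kappa> - l * y) ^ 2) = y * cnj y + (\<kappa> - l * y) * cnj (\<kappa> - l * y)"
      by (simp only: of_real_add complex_norm_square)
    moreover have "of_real (s * norm (y - y0) ^ 2 + b) = of_real s * ((y - y0) * cnj (y - y0)) + \<kappa> * cnj \<kappa> / of_real s"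
      by (simp only: of_real_add of_real_mult of_real_divide complex_norm_square b_def)
    moreover have "of_real s * (y - y0) * cnj (y - y0) + \<kappa> * cnj \<kappa> / of_real s = y * cnj y + (\<kappa> - l * y) * cnj (\<kappa> - l * y)"
    proof -
    have ss: "of_real s = 1 + l * cnj l" by (simp only: s_def of_real_add of_real_1 complex_norm_square)
    have sy: "of_real s * y0 = \<kappa> * cnj l" "of_real s * cnj y0 = cnj \<kappa> * l" using s by (simp_all add: y0_def)
    have "of_real s * (of_real s * ((y - y0) * cnj (y - y0)) + \<kappa> * cnj \<kappa> / of_real s)
       = (of_real s * y - of_real s * y0) * (of_real s * cnj y - of_real s * cnj y0) + \<kappa> * cnj \<kappa>"
      using s by (simp add: algebra_simps)
    also have "\<dots> = of_real s * (y * cnj y + (\<kappa> - l * y) * cnj (\<kappa> - l * y))"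
      unfolding sy unfolding ss by (simp add: algebra_simps)
    finally show ?thesis
      using s by (simp add: mult.assoc)
    qed
    ultimately show ?thesis by (metis (no_types, lifting) mult.assoc of_real_eq_iff)
  qed
  let ?g = "\<lambda>y. ennreal (2 * norm \<kappa> ^ 2 / (s * norm (cplx y - y0) ^ 2 + b)\<^sup>2)"
  have gm: "?g \<in> borel_measurable borel" by measurable
  have "(\<integral>\<^sup>+y. ennreal (2 * norm \<kappa> ^ 2 / (norm (cplx y) ^ 2 + norm (\<kappa> - l * cplx y) ^ 2)\<^sup>2) \<partial>lborel) = (\<integral>\<^sup>+y. ?g y \<partial>lborel)"
    unfolding sq ..
  also have "\<dots> = (\<integral>\<^sup>+y. ?g y \<partial>distr lborel borel ((+) (uncplx y0)))"
    by (simp add: lborel_distr_plus)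
  also have "\<dots> = (\<integral>\<^sup>+y. ?g (uncplx y0 + y) \<partial>lborel)"
    by (rule nn_integral_distr) (use gm in auto)
  also have "\<dots> = (\<integral>\<^sup>+y. ennreal (2 * norm \<kappa> ^ 2) * ennreal (1 / (s * norm y ^ 2 + b)\<^sup>2) \<partial>(lborel :: (real^2) measure))"
    using linear_add[OF linear_cplx] by (simp flip: ennreal_mult)
  also have "\<dots> = ennreal (2 * norm \<kappa> ^ 2) * ennreal (pi / (s * b))"
    by (subst nn_integral_cmult) (auto simp: nn_integral_plane_radial[OF s b])
  also have "\<dots> = ennreal (2 * pi)"
    using s b assms by (simp add: b_def flip: ennreal_mult)
  finally show ?thesis .
qed

text \<open>
  Over a regular value all roots of \<open>P - y\<close> are simple.
\<close>

lemma card_poly_fibre: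
  fixes P :: "complex poly"
  assumes deg: "degree P > 0" and reg: "\<And>z. poly P z = y \<Longrightarrow> poly (pderiv P) z \<noteq> 0"
  shows "finite {z. poly P z = y}" "card {z. poly P z = y} = degree P"
proof -
  define Q where "Q = P + [:- y:]"
  have dQ: "degree Q = degree P" unfolding Q_def using deg by (simp add: degree_add_eq_left)
  have Q0: "Q \<noteq> 0" using dQ deg by auto
  have set: "{z. poly P z = y} = {z. poly Q z = 0}" by (auto simp: Q_def)
  show fin: "finite {z. poly P z = y}" unfolding set by (rule poly_roots_finite[OF Q0])
  have "pderiv Q = pderiv P" by (simp add: Q_def pderiv_add)
  then have "rsquarefree Q" using reg by (auto simp: rsquarefree_roots Q_def)
  from complex_poly_decompose_rsquarefree[OF this]
  have "Q = smult (lead_coeff Q) (\<Prod>z|poly Q z = 0. [:- z, 1:])" by simp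
  then have "degree Q = degree (\<Prod>z|poly Q z = 0. [:- z, 1:])"
    using Q0 by (metis degree_smult_eq leading_coeff_0_iff)
  also have "\<dots> = card {z. poly Q z = 0}" by (subst degree_prod_sum_eq) auto
  finally show "card {z. poly P z = y} = degree P" using dQ set by simp
qed

lemma borel_image_Int_closed:
  fixes g :: "'a::euclidean_space \<Rightarrow> 'b::euclidean_space"
  assumes "open G" "closed C" "continuous_on (G \<inter> C) g"
  shows "g ` (G \<inter> C) \<in> sets borel"
proof -
  obtain K where K: "\<And>n::nat. compact (K n)" "\<And>n. K n \<subseteq> G" "(\<Union>n. K n) = G"
    using open_Union_compact_subsets[OF assms(1)] by metis
  have eq: "g ` (G \<inter> C) = (\<Union>n. g ` (K n \<inter> C))" using K(3) by blast
  have "compact (g ` (K n \<inter> C))" for n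
    by (rule compact_continuous_image[OF continuous_on_subset[OF assms(3)]])
      (use K assms(2) in \<open>auto intro: compact_Int_closed\<close>)
  then have "g ` (K n \<inter> C) \<in> sets borel" for n by (simp add: borel_closed compact_imp_closed)
  then show ?thesis unfolding eq by auto
qed

text \<open>
  Away from the finitely many critical points \<open>Z\<close>, the plane is a countable disjoint union of Borel
  sets \<open>B i\<close> on which \<open>P\<close> is injective. On each of them the change of variables applies, and a point
  outside the finite set of critical values is hit by exactly \<open>deg P\<close> of the pieces.
\<close>

lemma nn_integral_poly_pullback:
  fixes P :: "complex poly" and h :: "real^2 \<Rightarrow> real"
  assumes deg: "degree P > 0" and h[measurable]: "h \<in> borel_measurable borel" and h0: "\<And>y. h y \<ge> 0"
  shows "(\<integral>\<^sup>+x. ennreal ((norm (poly (pderiv P) (cplx x)))\<^sup>2 * h (uncplx (poly P (cplx x)))) \<partial>lborel)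
    = of_nat (degree P) * (\<integral>\<^sup>+y. ennreal (h y) \<partial>lborel)"
proof -
  define p where "p = (\<lambda>x. uncplx (poly P (cplx x)))"
  define J where "J = (\<lambda>x. (norm (poly (pderiv P) (cplx x)))\<^sup>2)"
  have cp: "continuous_on A p" "continuous_on A J" for A
    unfolding p_def J_def by (intro continuous_intros)+
  have pm[measurable]: "p \<in> borel_measurable borel" and Jm[measurable]: "J \<in> borel_measurable borel"
    using cp by (auto intro: borel_measurable_continuous_onI)
  define Z where "Z = {x. poly (pderiv P) (cplx x) = 0}"
  have "pderiv P \<noteq> 0" using deg by (simp add: pderiv_eq_0_iff)
  then have "finite (uncplx ` {z. poly (pderiv P) z = 0})" by (simp add: poly_roots_finite)
  moreover have "Z \<subseteq> uncplx ` {z. poly (pderiv P) z = 0}"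
    unfolding Z_def by (auto intro: image_eqI[of _ _ "cplx _"])
  ultimately have Z: "finite Z" using finite_subset by blast
  have loc: "\<exists>T. open T \<and> x \<in> T \<and> T \<inter> Z = {} \<and> inj_on p T" if "x \<notin> Z" for x
  proof -
    have "deriv (poly P) (cplx x) \<noteq> 0"
      using that by (simp add: Z_def DERIV_imp_deriv[OF poly_DERIV])
    moreover have "poly P holomorphic_on UNIV"
      by (rule holomorphic_onI) (metis poly_DERIV field_differentiable_at_within field_differentiable_def)
    ultimately obtain r where r: "r > 0" "inj_on (poly P) (ball (cplx x) r)"
      using has_complex_derivative_locally_injective[of "poly P" UNIV "cplx x"]
      by blast
    have "inj_on p (ball x r)"
    proof (rule inj_onI)
      fix a b assume ab: "a \<in> ball x r" "b \<in> ball x r" "p a = p b"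
      have "cplx a \<in> ball (cplx x) r" if "a \<in> ball x r" for a
        using that linear_diff[OF linear_cplx, symmetric] by (simp add: dist_norm)
      moreover have "poly P (cplx a) = poly P (cplx b)" using ab(3) unfolding p_def by (metis cplx_uncplx(1))
      ultimately have "cplx a = cplx b" using r(2) ab by (auto dest: inj_onD)
      then show "a = b" by (metis cplx_uncplx(2))
    qed
    then show ?thesis using that r(1) Z
      by (intro exI[of _ "ball x r - Z"]) (auto intro: open_Diff finite_imp_closed inj_on_subset)
  qed
  define F where "F = {T. open T \<and> T \<inter> Z = {} \<and> inj_on p T}"
  obtain F' where F': "F' \<subseteq> F" "countable F'" "\<Union>F' = \<Union>F"
    using Lindelof[of F] by (auto simp: F_def)
  have UF: "\<Union>F = - Z" using loc by (auto simp: F_def)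
  define c where "c = from_nat_into (insert {} F')"
  have rc: "range c = insert {} F'" unfolding c_def by (rule range_from_nat_into) (use F'(2) in auto)
  have c: "c i \<in> F" for i
  proof -
    have "c i \<in> insert {} F'" using rc by blast
    then show ?thesis using F'(1) by (auto simp: F_def)
  qed
  define B where "B = disjointed c"
  have UB: "(\<Union>i. B i) = - Z" unfolding B_def UN_disjointed_eq rc using F'(3) UF by simp
  have Bd: "disjoint_family B" unfolding B_def by (rule disjoint_family_disjointed)
  have Bsub: "B i \<subseteq> c i" for i unfolding B_def by (rule disjointed_subset)
  have Bform: "B i = c i \<inter> (- (\<Union>j\<in>{0..<i}. c j))" for i by (auto simp: B_def disjointed_def)
  have cl: "closed (- (\<Union>j\<in>{0..<i}. c j))" for i using c by (auto simp: F_def)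
  have op: "open (c i)" for i using c by (auto simp: F_def)
  have Bb[measurable]: "B i \<in> sets borel" for i
    unfolding Bform using op cl by (intro sets.Int borel_open borel_closed)
  have pB[measurable]: "p ` B i \<in> sets borel" for i
    unfolding Bform by (rule borel_image_Int_closed[OF op cl cp(1)])
  have inj: "inj_on p (B i)" for i using c[of i] Bsub by (auto simp: F_def intro: inj_on_subset)
  let ?H = "\<lambda>x. ennreal (J x * h (p x))"
  have piece: "(\<integral>\<^sup>+x\<in>B i. ?H x \<partial>lborel) = (\<integral>\<^sup>+y. ennreal (h y) * indicator (p ` B i) y \<partial>lborel)" for i
  proof -
    define g' where "g' = (\<lambda>x v. uncplx (poly (pderiv P) (cplx x) * cplx v))"
    have der: "(p has_derivative g' x) (at x)" "det (matrix (g' x)) = J x" for x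
      using holomorphic_as_plane_map[OF poly_DERIV[of P "cplx x"]] by (auto simp: p_def g'_def J_def)
    have J: "\<bar>J x\<bar> = J x" for x by (simp add: J_def)
    have "(\<integral>\<^sup>+y\<in>p ` B i. ennreal (h y) \<partial>lborel) =
         (\<integral>\<^sup>+x\<in>B i. ennreal (\<bar>det (matrix (g' x))\<bar> * h (p x)) \<partial>lborel)"
      by (rule nn_integral_change_of_variables)
        (use Bb inj pB h h0 der in \<open>auto intro: has_derivative_at_withinI\<close>)
    then show ?thesis by (simp add: der J)
  qed
  have fib: "(\<Sum>i. indicator (p ` B i) y) = (of_nat (degree P) :: ennreal)" if y: "y \<notin> p ` Z" for y
  proof -
    define R where "R = {x. p x = y}"
    have R: "R = uncplx ` {z. poly P z = cplx y}"
      unfolding R_def p_def by (auto simp: image_iff) (metis cplx_uncplx)+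
    have reg: "poly (pderiv P) z \<noteq> 0" if "poly P z = cplx y" for z
    proof
      assume "poly (pderiv P) z = 0"
      then have "uncplx z \<in> Z" by (simp add: Z_def)
      moreover have "p (uncplx z) = y" using that by (simp add: p_def)
      ultimately show False using y by blast
    qed
    have "inj_on uncplx X" for X by (metis cplx_uncplx(1) inj_on_inverseI)
    then have fR: "finite R" "card R = degree P"
      using card_poly_fibre[OF deg reg] unfolding R by (auto simp: card_image)
    have RZ: "x \<in> - Z" if "x \<in> R" for x using that y by (auto simp: R_def)
    have "indicator (p ` B i) y = (\<Sum>x\<in>R. indicator (B i) x :: ennreal)" for i
    proof (cases "y \<in> p ` B i")
      case True
      then obtain x where x: "x \<in> B i" "y = p x" by auto
      then have "x \<in> R" by (simp add: R_def)
      moreover have "indicator (B i) x' = (0::ennreal)" if "x' \<in> R - {x}" for x'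
        using that x inj[of i] by (auto simp: R_def indicator_def dest: inj_onD)
      ultimately have "(\<Sum>x\<in>R. indicator (B i) x :: ennreal) = indicator (B i) x"
        using fR(1) by (subst sum.remove[of _ x]) auto
      then show ?thesis using x by simp
    next
      case False
      then show ?thesis by (auto simp: R_def indicator_def intro!: sum.neutral)
    qed
    then have "(\<Sum>i. indicator (p ` B i) y) = (\<Sum>i. \<Sum>x\<in>R. indicator (B i) x :: ennreal)" by simp
    also have "\<dots> = (\<Sum>x\<in>R. \<Sum>i. indicator (B i) x)" by (rule suminf_sum) auto
    also have "\<dots> = (\<Sum>x\<in>R. 1)"
      using RZ by (intro sum.cong) (auto simp: suminf_indicator[OF Bd] UB)
    finally show ?thesis using fR by simp
  qed
  have Z0: "Z \<in> null_sets lborel" "p ` Z \<in> null_sets lborel"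
    using Z finite_imp_null_set_lborel by blast+
  have "(\<integral>\<^sup>+x. ?H x \<partial>lborel) = (\<integral>\<^sup>+x. (\<Sum>i. ?H x * indicator (B i) x) \<partial>lborel)"
  proof (rule nn_integral_cong_AE)
    have "AE x in lborel. x \<notin> Z" by (rule AE_not_in[OF Z0(1)])
    then show "AE x in lborel. ?H x = (\<Sum>i. ?H x * indicator (B i) x)"
    proof eventually_elim
      case (elim x)
      then have "x \<in> (\<Union>i. B i)" using UB by simp
      then show ?case using suminf_indicator[OF Bd, of x] by (simp add: ennreal_suminf_cmult)
    qed
  qed
  also have "\<dots> = (\<Sum>i. \<integral>\<^sup>+x. ?H x * indicator (B i) x \<partial>lborel)"
    by (rule nn_integral_suminf) measurable
  also have "\<dots> = (\<Sum>i. \<integral>\<^sup>+y. ennreal (h y) * indicator (p ` B i) y \<partial>lborel)" by (simp only: piece)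
  also have "\<dots> = (\<integral>\<^sup>+y. (\<Sum>i. ennreal (h y) * indicator (p ` B i) y) \<partial>lborel)"
    by (rule nn_integral_suminf[symmetric]) measurable
  also have "\<dots> = (\<integral>\<^sup>+y. of_nat (degree P) * ennreal (h y) \<partial>lborel)"
  proof (rule nn_integral_cong_AE)
    have "AE y in lborel. y \<notin> p ` Z" by (rule AE_not_in[OF Z0(2)])
    then show "AE y in lborel. (\<Sum>i. ennreal (h y) * indicator (p ` B i) y) = of_nat (degree P) * ennreal (h y)"
      by eventually_elim (simp add: ennreal_suminf_cmult fib mult.commute)
  qed
  also have "\<dots> = of_nat (degree P) * (\<integral>\<^sup>+y. ennreal (h y) \<partial>lborel)"
    by (rule nn_integral_cmult) simp
  finally show ?thesis unfolding J_def p_def .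
qed

section \<open>Convergent power series in two variables\<close>

text \<open>
  Cauchy estimates with the same radius in both variables. They are equivalent to convergence, and
  unlike a summability condition they pass to the partial derivatives by explicit constants.
\<close>

definition coeff_bound :: "complex fps fps \<Rightarrow> real \<Rightarrow> real \<Rightarrow> bool" where
  "coeff_bound f C r \<longleftrightarrow> 0 < r \<and> (\<forall>i j. norm (coeff2 f i j) * r ^ (i + j) \<le> C)"

definition polydisc :: "real \<Rightarrow> (complex \<times> complex) set" where
  "polydisc r = {p. norm (fst p) < r \<and> norm (snd p) < r}"

lemma polydisc_Times: "polydisc r = ball 0 r \<times> ball 0 r"
  by (auto simp: polydisc_def)

lemma open_polydisc: "open (polydisc r)"
  unfolding polydisc_Times by (intro open_Times) auto

lemma polydisc_mono: "r \<le> s \<Longrightarrow> polydisc r \<subseteq> polydisc s"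
  by (auto simp: polydisc_def)

lemma coeff_bound_nonneg: "coeff_bound f C r \<Longrightarrow> C \<ge> 0"
  unfolding coeff_bound_def by (metis norm_ge_zero order_trans mult_nonneg_nonneg zero_le_power less_imp_le)

lemma convergent2_imp_coeff_bound:
  assumes "convergent2 f" obtains C r where "coeff_bound f C r"
proof -
  obtain r where r: "r > 0" and s: "(\<lambda>(i, j). norm (coeff2 f i j) * r ^ (i + j)) summable_on (UNIV :: (nat \<times> nat) set)"
    using assms unfolding convergent2_def by blast
  have "norm (coeff2 f i j) * r ^ (i + j) \<le> (\<Sum>\<^sub>\<infinity>(i, j). norm (coeff2 f i j) * r ^ (i + j))" for i j
    using finite_sum_le_infsum[OF s, of "{(i, j)}"] r by auto
  then have "coeff_bound f (\<Sum>\<^sub>\<infinity>(i, j). norm (coeff2 f i j) * r ^ (i + j)) r"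
    using r by (simp add: coeff_bound_def)
  then show ?thesis by (rule that)
qed

lemma summable_on_geometric_product:
  fixes x y :: real assumes "0 \<le> x" "x < 1" "0 \<le> y" "y < 1"
  shows "(\<lambda>(i, j). x ^ i * y ^ j) summable_on (UNIV :: (nat \<times> nat) set)"
proof -
  have 1: "((\<lambda>j. x ^ i * y ^ j) has_sum x ^ i * (1 / (1 - y))) (UNIV :: nat set)" for i
    using assms by (intro has_sum_cmult_right norm_summable_imp_has_sum geometric_sums) (auto simp: summable_geometric norm_power)
  have 2: "(\<lambda>i. x ^ i * (1 / (1 - y))) summable_on (UNIV :: nat set)"
    using assms by (intro summable_on_cmult_left norm_summable_imp_summable_on) (auto simp: norm_power summable_geometric)
  show ?thesis
    using summable_on_SigmaI[where A=UNIV and B="\<lambda>_. UNIV" and f="\<lambda>(i, j). x ^ i * y ^ j", OF _ 2] 1 assms by simp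
qed

lemma coeff2_dz: "coeff2 (dz f) i j = of_nat (i + 1) * coeff2 f (i + 1) j"
  unfolding dz_def fps_deriv_nth by (metis fps_mult_of_nat_nth(1) of_nat_add of_nat_1)

lemma coeff2_dw: "coeff2 (dw f) i j = of_nat (j + 1) * coeff2 f i (j + 1)"
  by (simp add: dw_def)

text \<open>
  The factor \<open>i + j + 1\<close> produced by differentiation is absorbed by halving the radius.
\<close>

lemma coeff_bound_weight:
  assumes f: "coeff_bound f C r"
    and g: "\<And>i j. norm (coeff2 g i j) \<le> real (i + j + 1) * norm (coeff2 f (i + a) (j + b))" and ab: "a + b = 1"
  shows "coeff_bound g (C / r) (r / 2)"
  unfolding coeff_bound_def
proof (intro conjI allI)
  have r: "r > 0" using f by (simp add: coeff_bound_def)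
  then show "r / 2 > 0" by simp
  fix i j :: nat
  let ?n = "i + j"
  have "Suc ?n \<le> 2 ^ ?n" by (simp only: Suc_le_eq less_exp)
  then have "real (Suc ?n) \<le> real (2 ^ ?n)" by (rule of_nat_mono)
  then have "real (?n + 1) \<le> 2 ^ ?n" by simp
  have "norm (coeff2 g i j) * (r / 2) ^ ?n \<le> real (?n + 1) * norm (coeff2 f (i + a) (j + b)) * (r / 2) ^ ?n"
    using g[of i j] r by (intro mult_right_mono) auto
  also have "\<dots> = (real (?n + 1) / 2 ^ ?n) * (norm (coeff2 f (i + a) (j + b)) * r ^ ((i + a) + (j + b)) / r)"
  proof -
    have "(i + a) + (j + b) = Suc ?n" using ab by simp
    then show ?thesis using r by (simp only: power_divide power_Suc) (simp add: field_simps)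
  qed
  also have "\<dots> \<le> 1 * (C / r)"
  proof (rule mult_mono)
    show "real (?n + 1) / 2 ^ ?n \<le> 1" using \<open>real (?n + 1) \<le> 2 ^ ?n\<close> by simp
    show "norm (coeff2 f (i + a) (j + b)) * r ^ ((i + a) + (j + b)) / r \<le> C / r"
      using f r unfolding coeff_bound_def by (intro divide_right_mono) auto
  qed (use r in auto)
  finally show "norm (coeff2 g i j) * (r / 2) ^ ?n \<le> C / r" by simp
qed

lemma coeff_bound_dz: "coeff_bound f C r \<Longrightarrow> coeff_bound (dz f) (C / r) (r / 2)"
  by (rule coeff_bound_weight[where a=1 and b=0]) (auto simp only: coeff2_dz norm_mult norm_of_nat add_0_right intro!: mult_right_mono norm_ge_zero)

lemma coeff_bound_dw: "coeff_bound f C r \<Longrightarrow> coeff_bound (dw f) (C / r) (r / 2)"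
  by (rule coeff_bound_weight[where a=0 and b=1]) (auto simp only: coeff2_dw norm_mult norm_of_nat add_0_right intro!: mult_right_mono norm_ge_zero)

lemma summable_on_coeff_bound:
  assumes f: "coeff_bound f C r" and zw: "norm z < r" "norm w < r"
  shows "(\<lambda>(i, j). norm (coeff2 f i j * z ^ i * w ^ j)) summable_on (UNIV :: (nat \<times> nat) set)"
proof -
  have r: "r > 0" using f by (simp add: coeff_bound_def)
  have C: "C \<ge> 0" by (rule coeff_bound_nonneg[OF f])
  have le: "norm (coeff2 f i j * z ^ i * w ^ j) \<le> C * ((norm z / r) ^ i * (norm w / r) ^ j)" for i j
  proof -
    have "norm (coeff2 f i j * z ^ i * w ^ j) = norm (coeff2 f i j) * r ^ (i + j) * ((norm z / r) ^ i * (norm w / r) ^ j)"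
      using r by (simp add: norm_mult norm_power power_divide power_add)
    also have "\<dots> \<le> C * ((norm z / r) ^ i * (norm w / r) ^ j)"
      using f r by (intro mult_right_mono) (auto simp: coeff_bound_def)
    finally show ?thesis .
  qed
  have "(\<lambda>p. C * (case p of (i, j) \<Rightarrow> (norm z / r) ^ i * (norm w / r) ^ j)) summable_on (UNIV :: (nat \<times> nat) set)"
    using r zw by (intro summable_on_cmult_right summable_on_geometric_product) auto
  then show ?thesis
    by (rule summable_on_comparison_test) (use le in \<open>auto simp: case_prod_unfold\<close>)
qed

lemma coeff_bound_imp_convergent2:
  assumes "coeff_bound f C r" shows "convergent2 f"
proof -
  have r: "r > 0" using assms by (simp add: coeff_bound_def)
  have "(\<lambda>(i, j). norm (coeff2 f i j * of_real (r/2) ^ i * of_real (r/2) ^ j)) summable_on (UNIV :: (nat \<times> nat) set)"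
  proof (rule summable_on_coeff_bound[OF assms])
    show "norm (complex_of_real (r/2)) < r" "norm (complex_of_real (r/2)) < r"
      using r unfolding norm_of_real by simp_all
  qed
  then show ?thesis unfolding convergent2_def using r
    by (intro exI[of _ "r/2"]) (auto simp: norm_mult norm_power power_add mult.assoc)
qed

lemma convergent2_dz: "convergent2 f \<Longrightarrow> convergent2 (dz f)"
  and convergent2_dw: "convergent2 f \<Longrightarrow> convergent2 (dw f)"
  by (metis convergent2_imp_coeff_bound coeff_bound_imp_convergent2 coeff_bound_dz coeff_bound_dw)+

lemma coeff_bound_conv_radius:
  assumes "coeff_bound f C r" shows "fps_conv_radius (fps_nth f i) \<ge> r"
  unfolding fps_conv_radius_def
proof (rule conv_radius_geI_ex')
  fix s :: real assume s: "0 < s" "ereal s < ereal r"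
  have r: "r > 0" using s by auto
  have "summable (\<lambda>n. C / r ^ i * (s / r) ^ n)"
    using s r by (intro summable_mult summable_geometric) auto
  then show "summable (\<lambda>n. coeff2 f i n * of_real s ^ n)"
  proof (rule summable_comparison_test[OF _, rotated], intro exI allI impI)
    fix n
    have "norm (coeff2 f i n * of_real s ^ n) = norm (coeff2 f i n) * r ^ (i + n) / r ^ i * (s / r) ^ n"
      using r s by (simp add: norm_mult norm_power power_add power_divide)
    also have "\<dots> \<le> C / r ^ i * (s / r) ^ n"
      using assms r s unfolding coeff_bound_def by (intro mult_right_mono divide_right_mono) auto
    finally show "norm (coeff2 f i n * of_real s ^ n) \<le> C / r ^ i * (s / r) ^ n" .
  qed
qed

lemma norm_row_le:
  assumes f: "coeff_bound f C r" and w: "norm w \<le> s" "s < r"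
  shows "norm (eval_fps (fps_nth f i) w) \<le> C / (1 - s / r) / r ^ i"
proof -
  have r: "r > 0" using f by (simp add: coeff_bound_def)
  have s: "0 \<le> s" using w norm_ge_zero order_trans by blast
  have le: "norm (coeff2 f i n * w ^ n) \<le> C / r ^ i * (s / r) ^ n" for n
  proof -
    have "norm (coeff2 f i n * w ^ n) \<le> norm (coeff2 f i n) * s ^ n"
      using w by (simp add: norm_mult norm_power mult_left_mono power_mono)
    also have "\<dots> = norm (coeff2 f i n) * r ^ (i + n) / r ^ i * (s / r) ^ n"
      using r s by (simp add: power_add power_divide)
    also have "\<dots> \<le> C / r ^ i * (s / r) ^ n"
      using f r s unfolding coeff_bound_def by (intro mult_right_mono divide_right_mono) auto
    finally show ?thesis .
  qed
  have gs: "(\<lambda>n. C / r ^ i * (s / r) ^ n) sums (C / r ^ i * (1 / (1 - s / r)))"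
    using r s w by (intro sums_mult geometric_sums) auto
  have "norm (\<Sum>n. coeff2 f i n * w ^ n) \<le> (\<Sum>n. C / r ^ i * (s / r) ^ n)"
    by (rule norm_suminf_le[OF le sums_summable[OF gs]])
  then show ?thesis using sums_unique[OF gs] by (simp add: eval_fps_def mult_ac)
qed

text \<open>
  Summing over the powers of \<open>w\<close> first reduces questions about \<open>eval2\<close> to one-variable power series
  with holomorphic coefficients.
\<close>

lemma eval2_sums:
  assumes f: "coeff_bound f C r" and p: "p \<in> polydisc r"
  shows "(\<lambda>i. eval_fps (fps_nth f i) (snd p) * fst p ^ i) sums eval2 f p"
proof -
  obtain z w where pzw: "p = (z, w)" by (cases p)
  have zw: "norm z < r" "norm w < r" using p by (auto simp: pzw polydisc_def)
  let ?g = "\<lambda>(i, j). coeff2 f i j * z ^ i * w ^ j"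
  have "?g summable_on (UNIV :: (nat \<times> nat) set)"
  proof (rule abs_summable_summable)
    show "(\<lambda>p. norm (?g p)) summable_on UNIV"
      using summable_on_coeff_bound[OF f zw] unfolding case_prod_unfold .
  qed
  then have "(?g has_sum eval2 f p) (Sigma UNIV (\<lambda>_. UNIV))"
    unfolding eval2_def pzw by (simp add: has_sum_infsum)
  moreover have "((\<lambda>j. ?g (i, j)) has_sum (eval_fps (fps_nth f i) w * z ^ i)) UNIV" for i
  proof -
    have cr: "norm w < fps_conv_radius (fps_nth f i)"
      using coeff_bound_conv_radius[OF f, of i] zw by (metis ereal_less(2) less_ereal.simps(1) order_less_le_trans)
    have "((\<lambda>j. coeff2 f i j * w ^ j) has_sum eval_fps (fps_nth f i) w) UNIV"
      unfolding eval_fps_def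
    proof (rule norm_summable_imp_has_sum)
      show "summable (\<lambda>n. norm (coeff2 f i n * w ^ n))"
        using abs_summable_in_conv_radius[of w "fps_nth (fps_nth f i)"] cr by (simp add: fps_conv_radius_def)
      then show "(\<lambda>n. coeff2 f i n * w ^ n) sums (\<Sum>n. coeff2 f i n * w ^ n)"
        by (rule summable_sums[OF summable_norm_cancel])
    qed
    from has_sum_cmult_left[OF this, of "z ^ i"] show ?thesis by (simp add: mult_ac)
  qed
  ultimately have "((\<lambda>i. eval_fps (fps_nth f i) w * z ^ i) has_sum eval2 f p) UNIV"
    by (rule has_sum_SigmaD)
  then show ?thesis using has_sum_imp_sums by (simp add: pzw)
qed

lemma eval2_uniform_limit:
  assumes f: "coeff_bound f C r" and s: "s < r"
  shows "uniform_limit (polydisc s) (\<lambda>n p. \<Sum>i<n. eval_fps (fps_nth f i) (snd p) * fst p ^ i) (eval2 f) sequentially"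
proof (cases "s > 0")
  case False
  then have "polydisc s = {}" by (auto simp: polydisc_def) (meson norm_ge_zero not_less order_trans)
  then show ?thesis by simp
next
  case s0: True
  have r: "r > 0" using f by (simp add: coeff_bound_def)
  let ?t = "\<lambda>i p. eval_fps (fps_nth f i) (snd p) * fst p ^ i"
  have "uniform_limit (polydisc s) (\<lambda>n p. \<Sum>i<n. ?t i p) (\<lambda>p. suminf (\<lambda>i. ?t i p)) sequentially"
  proof (rule Weierstrass_m_test)
    show "summable (\<lambda>n. C / (1 - s / r) * (s / r) ^ n)"
      using r s s0 by (intro summable_mult summable_geometric) auto
    fix n and p :: "complex \<times> complex" assume p: "p \<in> polydisc s"
    have "norm (?t n p) \<le> C / (1 - s / r) / r ^ n * s ^ n"
      unfolding norm_mult norm_power using p s r s0 coeff_bound_nonneg[OF f]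
      by (intro mult_mono norm_row_le[OF f] power_mono) (auto simp: polydisc_def)
    then show "norm (?t n p) \<le> C / (1 - s / r) * (s / r) ^ n" by (simp add: power_divide)
  qed
  then show ?thesis
  proof (rule uniform_limit_cong'[THEN iffD1, rotated 2])
    fix p assume "p \<in> polydisc s"
    then have "p \<in> polydisc r" using polydisc_mono[of s r] s by auto
    then show "suminf (\<lambda>i. ?t i p) = eval2 f p" using sums_unique[OF eval2_sums[OF f]] by simp
  qed simp
qed

text \<open>
  The partial sums over the powers of \<open>z\<close> and their derivatives converge uniformly on a smaller
  polydisc, so the series may be differentiated termwise.
\<close>

theorem eval2_has_derivative:
  assumes f: "coeff_bound f C r" and p: "p \<in> polydisc (r / 2)"
  shows "(eval2 f has_derivative (\<lambda>h. eval2 (dz f) p * fst h + eval2 (dw f) p * snd h)) (at p)"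
proof -
  have r: "r > 0" using f by (simp add: coeff_bound_def)
  define s where "s = (max (norm (fst p)) (norm (snd p)) + r / 2) / 2"
  have s: "s < r / 2" "s > 0" "p \<in> polydisc s"
    using p r unfolding s_def polydisc_def by (auto simp: max_def field_simps)
       (smt (verit) norm_ge_zero)+
  define S where "S = polydisc s"
  define t where "t = (\<lambda>n (p::complex\<times>complex). eval_fps (fps_nth f n) (snd p) * fst p ^ n)"
  define A where "A = (\<lambda>n (p::complex\<times>complex). eval_fps (fps_nth f n) (snd p) * (of_nat n * fst p ^ (n - 1)))"
  define B where "B = (\<lambda>n (p::complex\<times>complex). eval_fps (fps_deriv (fps_nth f n)) (snd p) * fst p ^ n)"
  have cr: "norm w < fps_conv_radius (fps_nth f i)" if "norm w < r" for w i
    using coeff_bound_conv_radius[OF f, of i] that by (metis less_ereal.simps(1) order_less_le_trans)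
  have tder: "(t n has_derivative (\<lambda>h. A n x * fst h + B n x * snd h)) (at x within S)" if x: "x \<in> S" for n x
  proof -
    have "norm (snd x) < r" using x s r by (auto simp: S_def polydisc_def)
    then have "((\<lambda>x. eval_fps (fps_nth f n) (snd x)) has_derivative (\<lambda>h. eval_fps (fps_deriv (fps_nth f n)) (snd x) * snd h)) (at x within S)"
      using has_derivative_compose[where f=snd and f'=snd and g="eval_fps (fps_nth f n)" and x=x and s=S,
          OF _ has_field_derivative_imp_has_derivative[OF has_field_derivative_eval_fps[OF cr]]]
      by (simp add: bounded_linear_snd bounded_linear_imp_has_derivative)
    then show ?thesis unfolding t_def A_def B_def
      by (auto intro!: derivative_eq_intros simp: algebra_simps)
  qed
  have ulA: "uniform_limit S (\<lambda>n p. \<Sum>i<Suc n. A i p) (eval2 (dz f)) sequentially"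
  proof -
    have "(\<Sum>i<Suc n. A i p) = (\<Sum>i<n. eval_fps (fps_nth (dz f) i) (snd p) * fst p ^ i)" if p: "p \<in> S" for n p
    proof -
      have w: "norm (snd p) < r" using p s r by (auto simp: S_def polydisc_def)
      have "eval_fps (fps_nth (dz f) i) (snd p) = of_nat (Suc i) * eval_fps (fps_nth f (Suc i)) (snd p)" for i
      proof -
        have "fps_nth (dz f) i = fps_const (of_nat (Suc i)) * fps_nth f (Suc i)"
          by (simp only: dz_def fps_deriv_nth fps_of_nat Suc_eq_plus1)
        then show ?thesis using cr[OF w] by (simp add: eval_fps_mult)
      qed
      then show ?thesis unfolding sum.lessThan_Suc_shift A_def by (simp add: mult_ac)
    qed
    then show ?thesis
      using eval2_uniform_limit[OF coeff_bound_dz[OF f] s(1)]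
      by (subst uniform_limit_cong'[where g="\<lambda>n p. \<Sum>i<n. eval_fps (fps_nth (dz f) i) (snd p) * fst p ^ i"])
         (auto simp: S_def)
  qed
  have ulB: "uniform_limit S (\<lambda>n p. \<Sum>i<n. B i p) (eval2 (dw f)) sequentially"
    using eval2_uniform_limit[OF coeff_bound_dw[OF f] s(1)] by (simp add: S_def B_def dw_def)
  have "\<exists>g. \<forall>x\<in>S. (\<lambda>n. t n x) sums (g x) \<and>
      (g has_derivative (\<lambda>h. eval2 (dz f) x * fst h + eval2 (dw f) x * snd h)) (at x within S)"
  proof (rule has_derivative_series[OF _ tder])
    show "convex S" unfolding S_def polydisc_Times by (intro convex_Times) auto
    show "p \<in> S" using s by (simp add: S_def)
    show "(\<lambda>n. t n p) sums eval2 f p"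
      unfolding t_def by (rule eval2_sums[OF f]) (use p polydisc_mono[of "r/2" r] r in auto)
    fix e :: real assume e: "e > 0"
    have "\<forall>\<^sub>F n in sequentially. \<forall>x\<in>S. dist (\<Sum>i<Suc n. A i x) (eval2 (dz f) x) < e / 2"
      using uniform_limitD[OF ulA, of "e/2"] e by simp
    then have 1: "\<forall>\<^sub>F n in sequentially. \<forall>x\<in>S. dist (\<Sum>i<n. A i x) (eval2 (dz f) x) < e / 2"
      by (subst (asm) eventually_sequentially_Suc)
    have 2: "\<forall>\<^sub>F n in sequentially. \<forall>x\<in>S. dist (\<Sum>i<n. B i x) (eval2 (dw f) x) < e / 2"
      using uniform_limitD[OF ulB, of "e/2"] e by simp
    show "\<forall>\<^sub>F n in sequentially. \<forall>x\<in>S. \<forall>h. norm ((\<Sum>i<n. A i x * fst h + B i x * snd h) -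
        (eval2 (dz f) x * fst h + eval2 (dw f) x * snd h)) \<le> e * norm h"
      using 1 2
    proof eventually_elim
      case (elim n)
      show ?case
      proof (intro ballI allI)
        fix x and h :: "complex \<times> complex" assume x: "x \<in> S"
        have h: "norm (fst h) \<le> norm h" "norm (snd h) \<le> norm h"
          using norm_fst_le[of "fst h" "snd h"] norm_snd_le[of "snd h" "fst h"] by simp_all
        have "(\<Sum>i<n. A i x * fst h + B i x * snd h) - (eval2 (dz f) x * fst h + eval2 (dw f) x * snd h)
          = ((\<Sum>i<n. A i x) - eval2 (dz f) x) * fst h + ((\<Sum>i<n. B i x) - eval2 (dw f) x) * snd h"
          by (simp add: sum.distrib left_diff_distrib flip: sum_distrib_right)
        also have "norm \<dots> \<le> norm ((\<Sum>i<n. A i x) - eval2 (dz f) x) * norm (fst h) + norm ((\<Sum>i<n. B i x) - eval2 (dw f) x) * norm (snd h)"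
          by (metis norm_mult norm_triangle_ineq)
        also have "\<dots> \<le> e / 2 * norm h + e / 2 * norm h"
          using elim x h e by (intro add_mono mult_mono) (auto simp: dist_norm intro: less_imp_le)
        finally show "norm ((\<Sum>i<n. A i x * fst h + B i x * snd h) -
          (eval2 (dz f) x * fst h + eval2 (dw f) x * snd h)) \<le> e * norm h" by simp
      qed
    qed
  qed
  then obtain g where g: "\<And>x. x \<in> S \<Longrightarrow> (\<lambda>n. t n x) sums (g x)"
    "\<And>x. x \<in> S \<Longrightarrow> (g has_derivative (\<lambda>h. eval2 (dz f) x * fst h + eval2 (dw f) x * snd h)) (at x within S)"
    by blast
  have geq: "g x = eval2 f x" if x: "x \<in> S" for x
  proof -
    have "x \<in> polydisc r" using x s r polydisc_mono[of s r] by (auto simp: S_def)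
    then show ?thesis using sums_unique2[OF g(1)[OF x]] eval2_sums[OF f, of x] by (simp add: t_def)
  qed
  have S: "open S" "p \<in> S" using s by (auto simp: S_def open_polydisc)
  have "(g has_derivative (\<lambda>h. eval2 (dz f) p * fst h + eval2 (dw f) p * snd h)) (at p)"
    using g(2)[OF S(2)] unfolding at_within_open[OF S(2,1)] .
  then show ?thesis
    by (rule has_derivative_transform_within_open[OF _ S geq])
qed

section \<open>Evaluating a Newton--Puiseux factorization\<close>

lemma sums_fps_compose_X_power:
  fixes f :: "complex fps"
  assumes k: "k > 0"
  shows "(\<lambda>n. fps_nth (f oo fps_X ^ k) n * t ^ n) sums s \<longleftrightarrow> (\<lambda>n. fps_nth f n * (t ^ k) ^ n) sums s"
proof -
  have "(\<lambda>n. (\<lambda>m. fps_nth (f oo fps_X ^ k) m * t ^ m) (k * n)) sums s \<longleftrightarrow> (\<lambda>m. fps_nth (f oo fps_X ^ k) m * t ^ m) sums s"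
    using k by (intro sums_mono_reindex) (auto simp: strict_mono_def fps_nth_compose_X_power)
  then show ?thesis using k by (simp add: fps_nth_compose_X_power power_mult)
qed

lemma eval_fps_compose_X_power:
  fixes f :: "complex fps"
  assumes "k > 0" shows "eval_fps (f oo fps_X ^ k) t = eval_fps f (t ^ k)"
  unfolding eval_fps_def suminf_def sums_fps_compose_X_power[OF assms] ..

lemma conv_radius_compose_X_power_ge:
  fixes f :: "complex fps"
  assumes k: "k > 0" and r: "ereal r \<le> fps_conv_radius f" "r \<le> 1"
  shows "ereal r \<le> fps_conv_radius (f oo fps_X ^ k)"
  unfolding fps_conv_radius_def
proof (rule conv_radius_geI_ex')
  fix s :: real assume s: "0 < s" "ereal s < ereal r"
  have "s ^ k \<le> s ^ 1" using k s r by (intro power_decreasing) auto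
  then have "norm (complex_of_real s ^ k) < r" using s by (simp add: norm_power)
  then have "summable (\<lambda>n. fps_nth f n * (complex_of_real s ^ k) ^ n)"
    using r by (intro summable_fps) (metis less_ereal.simps(1) order_less_le_trans)
  then show "summable (\<lambda>n. fps_nth (f oo fps_X ^ k) n * complex_of_real s ^ n)"
    unfolding summable_def sums_fps_compose_X_power[OF k] .
qed

lemma conv_radius_pos_of_compose_X_power:
  fixes f :: "complex fps"
  assumes k: "k > 0" and r: "0 < fps_conv_radius (f oo fps_X ^ k)"
  shows "0 < fps_conv_radius f"
proof -
  obtain s where s: "0 < s" "ereal s < fps_conv_radius (f oo fps_X ^ k)"
    using ereal_dense2[OF r] by auto
  then have "summable (\<lambda>n. fps_nth (f oo fps_X ^ k) n * complex_of_real s ^ n)"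
    by (intro summable_fps) simp
  then have "summable (\<lambda>n. fps_nth f n * (complex_of_real s ^ k) ^ n)"
    unfolding summable_def sums_fps_compose_X_power[OF k] .
  then have "norm (complex_of_real s ^ k) \<le> fps_conv_radius f"
    unfolding fps_conv_radius_def by (rule conv_radius_geI)
  moreover have "0 < norm (complex_of_real s ^ k)" using s by simp
  ultimately show ?thesis by (metis ereal_less(2) order_less_le_trans)
qed

definition inner_eval :: "complex fps fps \<Rightarrow> complex \<Rightarrow> complex fps" where
  "inner_eval h t = Abs_fps (\<lambda>i. eval_fps (fps_nth h i) t)"

text \<open>
  The second clause states convergence in \<open>z\<close> for every admissible value of \<open>t\<close>. It is included
  because the formal factorization is evaluated first in \<open>t\<close> and then in \<open>z\<close>.
\<close>

definition evaluable :: "complex fps fps \<Rightarrow> real \<Rightarrow> bool" where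
  "evaluable h r \<longleftrightarrow> (\<forall>i. ereal r \<le> fps_conv_radius (fps_nth h i)) \<and>
     (\<forall>t. norm t < r \<longrightarrow> ereal r \<le> fps_conv_radius (inner_eval h t))"

lemma evaluable_mult_linear:
  assumes h: "evaluable h r" and a: "ereal r \<le> fps_conv_radius a"
  shows "evaluable (h * (fps_X - fps_const a)) r"
    and "norm t < r \<Longrightarrow> norm z < r \<Longrightarrow>
      eval_fps (inner_eval (h * (fps_X - fps_const a)) t) z = eval_fps (inner_eval h t) z * (z - eval_fps a t)"
proof -
  let ?H = "h * (fps_X - fps_const a)"
  have nth: "fps_nth ?H i = (if i = 0 then 0 else fps_nth h (i - 1)) - fps_nth h i * a" for i
    by (simp add: right_diff_distrib fps_mult_fps_X_commute[symmetric])
  have cr: "ereal r \<le> fps_conv_radius (fps_nth h i * a)" for i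
    using h a unfolding evaluable_def by (intro fps_conv_radius_mult_ge) auto
  have cr1: "ereal r \<le> fps_conv_radius (if i = 0 then 0 else fps_nth h (i - 1))" for i
    using h unfolding evaluable_def by auto
  have cr': "ereal r \<le> fps_conv_radius (fps_nth ?H i)" for i
    unfolding nth by (rule fps_conv_radius_diff_ge[OF cr1 cr])
  have ie: "inner_eval ?H t = inner_eval h t * (fps_X - fps_const (eval_fps a t))" if t: "norm t < r" for t
  proof (rule fps_ext)
    fix i
    have lt: "norm t < fps_conv_radius b" if "ereal r \<le> fps_conv_radius b" for b :: "complex fps"
      using t that by (metis less_ereal.simps(1) order_less_le_trans)
    have "eval_fps (fps_nth ?H i) t = eval_fps (if i = 0 then 0 else fps_nth h (i - 1)) t - eval_fps (fps_nth h i * a) t"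
      unfolding nth by (rule eval_fps_diff[OF lt[OF cr1] lt[OF cr]])
    also have "eval_fps (fps_nth h i * a) t = eval_fps (fps_nth h i) t * eval_fps a t"
      using h a unfolding evaluable_def by (intro eval_fps_mult lt) auto
    finally show "fps_nth (inner_eval ?H t) i = fps_nth (inner_eval h t * (fps_X - fps_const (eval_fps a t))) i"
      by (simp add: inner_eval_def right_diff_distrib fps_mult_fps_X_commute[symmetric])
  qed
  have crl: "fps_conv_radius (fps_X - fps_const (c::complex)) = \<infinity>" for c
    using fps_conv_radius_diff[of fps_X "fps_const c"] by simp
  show "evaluable ?H r" unfolding evaluable_def
  proof (intro conjI allI impI cr')
    fix t :: complex assume t: "norm t < r"
    then have "ereal r \<le> fps_conv_radius (inner_eval h t)" using h by (simp add: evaluable_def)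
    then show "ereal r \<le> fps_conv_radius (inner_eval ?H t)"
      unfolding ie[OF t]
      using fps_conv_radius_mult[of "inner_eval h t" "fps_X - fps_const (eval_fps a t)"] by (simp add: crl)
  qed
  assume t: "norm t < r" and z: "norm z < r"
  have "norm z < fps_conv_radius (inner_eval h t)"
    using h t z unfolding evaluable_def by (metis less_ereal.simps(1) order_less_le_trans)
  then show "eval_fps (inner_eval ?H t) z = eval_fps (inner_eval h t) z * (z - eval_fps a t)"
    unfolding ie[OF t] by (simp add: eval_fps_mult crl eval_fps_diff)
qed

lemma evaluable_mult_prod_linear:
  fixes n :: nat
  assumes "evaluable h r" and "\<And>j. j < n \<Longrightarrow> ereal r \<le> fps_conv_radius (a j)"
  shows "evaluable (h * (\<Prod>j<n. fps_X - fps_const (a j))) r \<and>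
      (\<forall>t z. norm t < r \<longrightarrow> norm z < r \<longrightarrow>
      eval_fps (inner_eval (h * (\<Prod>j<n. fps_X - fps_const (a j))) t) z
        = eval_fps (inner_eval h t) z * (\<Prod>j<n. z - eval_fps (a j) t))"
  using assms(2)
proof (induction n)
  case 0
  then show ?case using assms(1) by simp
next
  case (Suc n)
  then have IH: "evaluable (h * (\<Prod>j<n. fps_X - fps_const (a j))) r"
    "\<And>t z. norm t < r \<Longrightarrow> norm z < r \<Longrightarrow>
      eval_fps (inner_eval (h * (\<Prod>j<n. fps_X - fps_const (a j))) t) z
        = eval_fps (inner_eval h t) z * (\<Prod>j<n. z - eval_fps (a j) t)" and a: "ereal r \<le> fps_conv_radius (a n)"
    by auto
  show ?case
    using evaluable_mult_linear[OF IH(1) a] IH(2) by (simp add: mult.assoc)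
qed

lemma evaluable_subst_w_power:
  assumes f: "coeff_bound f C r" and N: "N > 0" and s: "s \<le> r" "s \<le> 1"
  shows "evaluable (subst_w_power N f) s"
    and "norm t < s \<Longrightarrow> norm z < s \<Longrightarrow> eval_fps (inner_eval (subst_w_power N f) t) z = eval2 f (z, t ^ N)"
proof -
  have nth: "fps_nth (subst_w_power N f) i = fps_nth f i oo fps_X ^ N" for i by (simp add: subst_w_power_def)
  have tN: "norm (t ^ N) < s" if "norm t < s" for t :: complex
  proof -
    have "norm t ^ N \<le> norm t ^ 1" using N that s by (intro power_decreasing) auto
    then show ?thesis using that by (simp add: norm_power)
  qed
  have ie: "fps_nth (inner_eval (subst_w_power N f) t) i = eval_fps (fps_nth f i) (t ^ N)" for t i
    by (simp add: inner_eval_def nth eval_fps_compose_X_power[OF N])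
  have sm: "(\<lambda>i. fps_nth (inner_eval (subst_w_power N f) t) i * z ^ i) sums eval2 f (z, t ^ N)"
    if "norm t < s" "norm z < s" for t z
    unfolding ie using eval2_sums[OF f, of "(z, t ^ N)"] tN[OF that(1)] that s by (simp add: polydisc_def)
  show "evaluable (subst_w_power N f) s"
    unfolding evaluable_def
  proof (intro conjI allI impI)
    fix i
    have "ereal s \<le> fps_conv_radius (fps_nth f i)"
      using coeff_bound_conv_radius[OF f, of i] s by (meson ereal_less_eq(3) order_trans)
    then show "ereal s \<le> fps_conv_radius (fps_nth (subst_w_power N f) i)"
      unfolding nth using conv_radius_compose_X_power_ge[OF N] s by blast
  next
    fix t :: complex assume t: "norm t < s"
    show "ereal s \<le> fps_conv_radius (inner_eval (subst_w_power N f) t)"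
      unfolding fps_conv_radius_def
      by (rule conv_radius_geI_ex', rule sums_summable[OF sm[OF t]]) simp
  qed
  assume "norm t < s" "norm z < s"
  then show "eval_fps (inner_eval (subst_w_power N f) t) z = eval2 f (z, t ^ N)"
    using sums_unique[OF sm] by (simp add: eval_fps_def)
qed

text \<open>
  The factorization of \<open>g\<close> into linear factors over the power series in \<open>t\<close> is a formal identity.
  Near the origin it holds for values, because each linear factor preserves evaluability.
\<close>

theorem eval2_factorization:
  fixes n :: nat
  assumes g: "convergent2 g" and u: "convergent2 u" and N: "N > 0"
    and a: "\<And>j. j < n \<Longrightarrow> 0 < fps_conv_radius (a j)"
    and fac: "subst_w_power N g = subst_w_power N u * (\<Prod>j<n. fps_X - fps_const (a j))"
  obtains r where "r > 0" "\<And>z t. norm z < r \<Longrightarrow> norm t < r \<Longrightarrow>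
    eval2 g (z, t ^ N) = eval2 u (z, t ^ N) * (\<Prod>j<n. z - eval_fps (a j) t)"
proof -
  obtain C1 r1 where 1: "coeff_bound g C1 r1" using convergent2_imp_coeff_bound[OF g] .
  obtain C2 r2 where 2: "coeff_bound u C2 r2" using convergent2_imp_coeff_bound[OF u] .
  have "\<exists>s>0. ereal s \<le> fps_conv_radius (a j)" if "j < n" for j
    using ereal_dense2[OF a[OF that]] by (auto intro: less_imp_le)
  then obtain s where s: "\<And>j. j < n \<Longrightarrow> s j > 0" "\<And>j. j < n \<Longrightarrow> ereal (s j) \<le> fps_conv_radius (a j)" by metis
  define X where "X = {1, r1, r2} \<union> s ` {..<n}"
  define r where "r = Min X"
  have X: "finite X" "X \<noteq> {}" "\<And>x. x \<in> X \<Longrightarrow> x > 0"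
    using 1 2 s unfolding coeff_bound_def X_def by auto
  have "r \<in> X" unfolding r_def by (rule Min_in[OF X(1,2)])
  moreover have "r \<le> x" if "x \<in> X" for x unfolding r_def by (rule Min_le[OF X(1) that])
  ultimately have r: "r > 0" "r \<le> 1" "r \<le> r1" "r \<le> r2" "\<And>j. j < n \<Longrightarrow> r \<le> s j"
    using X(3) by (auto simp: X_def)
  have ra: "ereal r \<le> fps_conv_radius (a j)" if "j < n" for j
    using r(5)[OF that] s(2)[OF that] by (meson ereal_less_eq(3) order_trans)
  show ?thesis
  proof (rule that[OF r(1)])
    fix z t :: complex assume zt: "norm z < r" "norm t < r"
    have "eval2 g (z, t ^ N) = eval_fps (inner_eval (subst_w_power N g) t) z"
      using evaluable_subst_w_power(2)[OF 1 N r(3,2)] zt by simp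
    also have "\<dots> = eval_fps (inner_eval (subst_w_power N u) t) z * (\<Prod>j<n. z - eval_fps (a j) t)"
      unfolding fac
      by (rule evaluable_mult_prod_linear[where a=a, THEN conjunct2, rule_format,
            OF evaluable_subst_w_power(1)[OF 2 N r(4,2)] ra zt(2,1)])
    also have "eval_fps (inner_eval (subst_w_power N u) t) z = eval2 u (z, t ^ N)"
      using evaluable_subst_w_power(2)[OF 2 N r(4,2)] zt by simp
    finally show "eval2 g (z, t ^ N) = eval2 u (z, t ^ N) * (\<Prod>j<n. z - eval_fps (a j) t)" .
  qed
qed

text \<open>
  Substituting a series without constant term for the inner variable is a ring homomorphism. The two
  cases of interest are \<open>w = t^N\<close> and the rotation \<open>t \<mapsto> \<theta> t\<close>.
\<close>

definition inner_compose :: "complex fps \<Rightarrow> complex fps fps \<Rightarrow> complex fps fps" where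
  "inner_compose c h = Abs_fps (\<lambda>i. fps_nth h i oo c)"

lemma inner_compose_X_power: "inner_compose (fps_X ^ N) = subst_w_power N"
  by (simp add: fun_eq_iff inner_compose_def subst_w_power_def)

lemma inner_compose_mult:
  assumes "fps_nth c 0 = 0"
  shows "inner_compose c (f * g) = inner_compose c f * inner_compose c g"
  by (intro fps_ext) (simp add: inner_compose_def fps_mult_nth fps_compose_sum_distrib fps_compose_mult_distrib[OF assms])

lemma inner_compose_linear: "inner_compose c (fps_X - fps_const a) = fps_X - fps_const (a oo c)"
  by (rule fps_ext) (auto simp: inner_compose_def fps_compose_sub_distrib fps_X_def)

lemma inner_compose_prod_linear:
  assumes "fps_nth c 0 = 0"
  shows "inner_compose c (h * (\<Prod>j<n. fps_X - fps_const (a j)))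
    = inner_compose c h * (\<Prod>j<(n::nat). fps_X - fps_const (a j oo c))"
  by (induction n) (simp_all add: inner_compose_mult[OF assms] inner_compose_linear mult.assoc[symmetric])

lemma subst_w_power_prod_linear:
  assumes "M > 0"
  shows "subst_w_power M (h * (\<Prod>j<n. fps_X - fps_const (a j)))
    = subst_w_power M h * (\<Prod>j<(n::nat). fps_X - fps_const (a j oo fps_X ^ M))"
  unfolding inner_compose_X_power[symmetric] by (rule inner_compose_prod_linear) (use assms in simp)

lemma subst_w_power_subst_w_power:
  assumes "M > 0" "N > 0"
  shows "subst_w_power M (subst_w_power N f) = subst_w_power (N * M) f"
proof -
  have "(a oo fps_X ^ N) oo fps_X ^ M = a oo fps_X ^ (N * M)" for a :: "complex fps"
    using assms by (intro fps_ext) (auto simp: fps_nth_compose_X_power div_mult2_eq mult.commute[of N M] dvd_mult_imp_div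
        dest: dvd_mult_left dvd_mult_right elim!: dvdE)
  then show ?thesis by (intro fps_ext) (simp add: subst_w_power_def)
qed

section \<open>Denominators of fractional power series\<close>

lemma exponents_overD: "exponents_over N \<alpha> \<Longrightarrow> \<alpha> q \<noteq> 0 \<Longrightarrow> q * real N \<in> \<int>"
  by (simp add: exponents_over_def)

lemma exponents_over_gcd:
  assumes "exponents_over N \<alpha>" "exponents_over M \<alpha>"
  shows "exponents_over (gcd N M) \<alpha>"
  unfolding exponents_over_def
proof (intro conjI allI impI)
  show "0 < gcd N M" using assms by (simp add: exponents_over_def)
  fix q assume q: "\<alpha> q \<noteq> 0"
  obtain x y :: int where xy: "x * int N + y * int M = gcd (int N) (int M)" using bezout_int by blast
  have "real (gcd N M) = of_int x * real N + of_int y * real M"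
    by (metis gcd_int_int_eq of_int_add of_int_mult of_int_of_nat_eq xy)
  then have "q * real (gcd N M) = of_int x * (q * real N) + of_int y * (q * real M)"
    by (simp add: algebra_simps)
  moreover have "q * real N \<in> \<int>" "q * real M \<in> \<int>" using assms q by (auto simp: exponents_over_def)
  ultimately show "q * real (gcd N M) \<in> \<int>" by simp
qed

lemma exponents_over_mult: "exponents_over N \<alpha> \<Longrightarrow> 0 < k \<Longrightarrow> exponents_over (N * k) \<alpha>"
  unfolding exponents_over_def by (auto simp flip: mult.assoc)

definition primitive_over :: "nat \<Rightarrow> (real \<Rightarrow> complex) \<Rightarrow> bool" where
  "primitive_over N \<alpha> \<longleftrightarrow> exponents_over N \<alpha> \<and>
      Gcd (insert (int N) {n. \<alpha> (real_of_int n / real N) \<noteq> 0}) = 1"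

text \<open>
  The exponents also lie in \<open>(1/gcd N M)\<int>\<close>. Hence \<open>N / gcd N M\<close> divides \<open>N\<close> and all numerators, so
  it is \<open>1\<close> by primitivity.
\<close>

lemma primitive_over_dvd:
  assumes N: "primitive_over N \<alpha>" and M: "exponents_over M \<alpha>"
  shows "N dvd M"
proof -
  have eN: "exponents_over N \<alpha>" and G1: "Gcd (insert (int N) {n. \<alpha> (real_of_int n / real N) \<noteq> 0}) = 1"
    using N by (auto simp: primitive_over_def)
  have N0: "N > 0" using eN by (simp add: exponents_over_def)
  obtain k where k: "N = gcd N M * k" by (metis gcd_dvd1 dvdE)
  have k0: "k > 0" using k N0 by (metis gr0I mult_0_right)
  have "int k dvd x" if "x \<in> insert (int N) {n. \<alpha> (real_of_int n / real N) \<noteq> 0}" for x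
  proof (cases "x = int N")
    case True then show ?thesis using k by (metis dvd_triv_right int_dvd_int_iff)
  next
    case False
    then have "\<alpha> (real_of_int x / real N) \<noteq> 0" using that by simp
    then have "real_of_int x / real N * real (gcd N M) \<in> \<int>"
      by (rule exponents_overD[OF exponents_over_gcd[OF eN M]])
    moreover have "real_of_int x / real N * real (gcd N M) = real_of_int x / real k"
    proof -
      have "real N = real (gcd N M) * real k" using k by (metis of_nat_mult)
      then show ?thesis using N0 k0 by (simp add: field_simps)
    qed
    ultimately obtain y where "real_of_int x / real k = of_int y" by (auto elim: Ints_cases)
    then have "real_of_int x = of_int (y * int k)" using k0 by (simp add: field_simps)
    then have "x = y * int k" by (simp only: of_int_eq_iff)
    then show ?thesis by simp
  qed
  then have "int k dvd 1" using G1 by (metis Gcd_greatest)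
  then have "k = 1" by simp
  then show ?thesis using k by (metis gcd_dvd2 mult.right_neutral)
qed

text \<open>
  Cancelling the common divisor of the denominator and all numerators.
\<close>

lemma ex_primitive_over:
  assumes "exponents_over N \<alpha>" shows "\<exists>m. primitive_over m \<alpha>"
proof -
  have N0: "N > 0" using assms by (simp add: exponents_over_def)
  let ?S = "\<lambda>N. insert (int N) {n. \<alpha> (real_of_int n / real N) \<noteq> 0}"
  define g where "g = nat (Gcd (?S N))"
  have gg: "int g = Gcd (?S N)" by (simp add: g_def)
  have g0: "g > 0" using N0 gg by (metis Gcd_0_iff gr0I insert_subset of_nat_0 of_nat_eq_0_iff singletonD not_gr0)
  have "int g dvd int N" unfolding gg by (rule Gcd_dvd) simp
  then obtain m where m: "N = m * g" by (metis dvdE int_dvd_int_iff mult.commute)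
  have m0: "m > 0" using m N0 by (metis gr0I mult_0)
  have em: "exponents_over m \<alpha>" unfolding exponents_over_def
  proof (intro conjI allI impI m0)
    fix q assume q: "\<alpha> q \<noteq> 0"
    then obtain n where n: "q * real N = of_int n" using assms unfolding exponents_over_def by (auto elim: Ints_cases)
    then have "q = of_int n / real N" using N0 by (simp add: field_simps)
    then have "n \<in> ?S N" using q by simp
    then have "int g dvd n" unfolding gg by (rule Gcd_dvd)
    then obtain l where "n = int g * l" by (rule dvdE)
    then have "q * real m = of_int l" using n m g0 by simp
    then show "q * real m \<in> \<int>" by simp
  qed
  have sub: "(*) (int g) ` ?S m \<supseteq> ?S N"
  proof
    fix x assume x: "x \<in> ?S N"
    then have "int g dvd x" unfolding gg by (rule Gcd_dvd)
    then obtain l where l: "x = int g * l" by (rule dvdE)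
    have "l \<in> ?S m"
    proof (cases "x = int N")
      case True then show ?thesis using l m g0 by auto
    next
      case False
      then have "\<alpha> (real_of_int x / real N) \<noteq> 0" using x by simp
      moreover have "real_of_int x / real N = real_of_int l / real m" using l m g0 by simp
      ultimately show ?thesis by simp
    qed
    then show "x \<in> (*) (int g) ` ?S m" using l by blast
  qed
  have "int g * Gcd (?S m) dvd int g"
  proof -
    have "int g * Gcd (?S m) dvd x" if "x \<in> ?S N" for x
    proof -
      have "x \<in> (*) (int g) ` ?S m" using sub that by (rule subsetD)
      then obtain l where l: "x = int g * l" "l \<in> ?S m" by (rule imageE)
      have "Gcd (?S m) dvd l" by (rule Gcd_dvd[OF l(2)])
      then show ?thesis unfolding l(1) by (rule mult_dvd_mono[OF dvd_refl])
    qed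
    then have "int g * Gcd (?S m) dvd Gcd (?S N)" by (rule Gcd_greatest)
    then show ?thesis unfolding gg[symmetric] .
  qed
  then have "Gcd (?S m) dvd 1" using g0 by (metis dvd_mult_cancel_left mult.right_neutral of_nat_0_less_iff less_irrefl)
  then have "Gcd (?S m) = 1" by (metis Gcd_int_greater_eq_0 zdvd1_eq abs_of_nonneg)
  then show ?thesis using em unfolding primitive_over_def by blast
qed

text \<open>
  The Puiseux multiplicity is the least common denominator of the exponents. In particular it is
  well-defined as soon as some common denominator exists.
\<close>

lemma m_puiseux:
  assumes "exponents_over N \<alpha>"
  shows "exponents_over (m_puiseux \<alpha>) \<alpha>" "m_puiseux \<alpha> dvd N" "m_puiseux \<alpha> > 0"
proof -
  obtain m where m: "primitive_over m \<alpha>" using ex_primitive_over[OF assms] by blast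
  have "m_puiseux \<alpha> = m"
    unfolding m_puiseux_def primitive_over_def[symmetric]
  proof (rule the_equality[where P="\<lambda>N. primitive_over N \<alpha>", OF m])
    fix n assume "primitive_over n \<alpha>"
    then show "n = m" using m primitive_over_dvd by (metis dvd_antisym primitive_over_def)
  qed
  then show "exponents_over (m_puiseux \<alpha>) \<alpha>" "m_puiseux \<alpha> dvd N" "m_puiseux \<alpha> > 0"
    using m primitive_over_dvd[OF m assms] by (auto simp: primitive_over_def exponents_over_def)
qed

lemma param_mult:
  assumes "exponents_over m \<alpha>" "k > 0"
  shows "param (m * k) \<alpha> = param m \<alpha> oo fps_X ^ k"
proof (rule fps_ext)
  fix n
  have m: "m > 0" using assms by (simp add: exponents_over_def)
  show "fps_nth (param (m * k) \<alpha>) n = fps_nth (param m \<alpha> oo fps_X ^ k) n"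
  proof (cases "k dvd n")
    case True
    then obtain l where "n = k * l" ..
    then show ?thesis using assms(2) m by (simp add: param_def fps_nth_compose_X_power)
  next
    case False
    have "\<alpha> (real n / real (m * k)) = 0"
    proof (rule ccontr)
      assume "\<alpha> (real n / real (m * k)) \<noteq> 0"
      then have "real n / real (m * k) * real m \<in> \<int>" by (rule exponents_overD[OF assms(1)])
      then obtain y where "real n / real (m * k) * real m = of_int y" by (auto elim: Ints_cases)
      then have "of_int (int n) = real_of_int (y * int k)" using m assms(2) by (simp add: field_simps)
      then have "int n = y * int k" by (simp only: of_int_eq_iff)
      then have "int k dvd int n" by simp
      then show False using False by simp
    qed
    then show ?thesis using False by (simp add: param_def fps_nth_compose_X_power)
  qed
qed

lemma param_puiseux:
  assumes "exponents_over N \<alpha>"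
  shows "param N \<alpha> = param (m_puiseux \<alpha>) \<alpha> oo fps_X ^ (N div m_puiseux \<alpha>)"
    and "N div m_puiseux \<alpha> > 0"
proof -
  have N: "N > 0" using assms by (simp add: exponents_over_def)
  show k: "N div m_puiseux \<alpha> > 0" using m_puiseux[OF assms] N by (simp add: dvd_imp_le div_greater_zero_iff)
  show "param N \<alpha> = param (m_puiseux \<alpha>) \<alpha> oo fps_X ^ (N div m_puiseux \<alpha>)"
    using param_mult[OF m_puiseux(1)[OF assms] k] m_puiseux(2)[OF assms] by simp
qed

lemma conv_radius_param_pos:
  assumes "\<alpha> \<in> puiseux1" "exponents_over N \<alpha>"
  shows "0 < fps_conv_radius (param N \<alpha>)"
proof -
  obtain M where M: "exponents_over M \<alpha>" "0 < fps_conv_radius (param M \<alpha>)"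
    using assms(1) unfolding puiseux1_def by auto
  have "0 < fps_conv_radius (param (m_puiseux \<alpha>) \<alpha>)"
    using conv_radius_pos_of_compose_X_power[OF param_puiseux(2)[OF M(1)]] M(2) param_puiseux(1)[OF M(1)] by simp
  then obtain s where s: "0 < s" "ereal s < fps_conv_radius (param (m_puiseux \<alpha>) \<alpha>)"
    using ereal_dense2[OF \<open>0 < fps_conv_radius (param (m_puiseux \<alpha>) \<alpha>)\<close>] by auto
  have "ereal (min s 1) \<le> ereal s" by simp
  then have "ereal (min s 1) \<le> fps_conv_radius (param (m_puiseux \<alpha>) \<alpha>)" using s(2) by (meson less_imp_le order_trans)
  then have "ereal (min s 1) \<le> fps_conv_radius (param N \<alpha>)"
    unfolding param_puiseux(1)[OF assms(2)]
    by (rule conv_radius_compose_X_power_ge[OF param_puiseux(2)[OF assms(2)]]) simp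
  moreover have "0 < ereal (min s 1)" using s by simp
  ultimately show ?thesis by (rule order_less_le_trans[rotated])
qed

lemma param_nth_eq_0:
  assumes "\<alpha> \<in> puiseux1" "n < N"
  shows "fps_nth (param N \<alpha>) n = 0"
proof (rule ccontr)
  assume "fps_nth (param N \<alpha>) n \<noteq> 0"
  then have "1 \<le> real n / real N" using assms by (simp add: puiseux1_def param_def)
  then show False using assms(2) by (simp add: field_simps)
qed

text \<open>
  The arc of a series written over a common denominator \<open>N\<close> that need not be the least one. Several
  series with different Puiseux multiplicities can be compared only after such a change of parameter.
\<close>

definition level_arc :: "nat \<Rightarrow> complex fps \<Rightarrow> complex \<Rightarrow> complex \<times> complex" where
  "level_arc N a t = (eval_fps a t, t ^ N)"

lemma arc_map_power:
  assumes "exponents_over N \<alpha>"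
  shows "arc_map \<alpha> (t ^ (N div m_puiseux \<alpha>)) = level_arc N (param N \<alpha>) t"
  using m_puiseux(2)[OF assms]
  by (simp add: arc_map_def level_arc_def param_puiseux(1)[OF assms]
      eval_fps_compose_X_power[OF param_puiseux(2)[OF assms]] flip: power_mult)

lemma ex_complex_root: assumes "k > 0" shows "\<exists>t::complex. t ^ k = s"
proof (cases "s = 0")
  case True then show ?thesis using assms by (intro exI[of _ 0]) simp
next
  case False
  then show ?thesis using assms by (intro exI[of _ "exp (Ln s / of_nat k)"]) (simp flip: exp_of_nat_mult)
qed

text \<open>
  Taking roots is surjective on the complex numbers, so the passage to a larger denominator covers
  the same set.
\<close>

lemma range_arc_map:
  assumes "exponents_over N \<alpha>"
  shows "range (arc_map \<alpha>) = range (level_arc N (param N \<alpha>))"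
proof -
  have "range (arc_map \<alpha>) = range (\<lambda>t. arc_map \<alpha> (t ^ (N div m_puiseux \<alpha>)))"
    using ex_complex_root[OF param_puiseux(2)[OF assms]] by (metis (mono_tags, lifting) image_iff rangeI subsetI subset_antisym)
  then show ?thesis by (simp add: arc_map_power[OF assms])
qed

lemma tendsto_at_0_power:
  fixes h :: "complex \<Rightarrow> 'b::metric_space"
  assumes k: "k > 0" and l: "((\<lambda>t. h (t ^ k)) \<longlongrightarrow> c) (at 0)"
  shows "(h \<longlongrightarrow> c) (at 0)"
proof (rule tendstoI)
  fix e :: real assume "e > 0"
  then obtain d where d: "d > 0" "\<And>t. t \<noteq> 0 \<Longrightarrow> norm t < d \<Longrightarrow> dist (h (t ^ k)) c < e"
    using tendstoD[OF l \<open>e > 0\<close>] unfolding eventually_at dist_norm by auto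
  show "\<forall>\<^sub>F s in at 0. dist (h s) c < e"
    unfolding eventually_at
  proof (intro exI[of _ "d ^ k"] conjI ballI impI)
    show "0 < d ^ k" using d by simp
    fix s :: complex assume s: "s \<noteq> 0 \<and> dist s 0 < d ^ k"
    obtain t where t: "t ^ k = s" using ex_complex_root[OF k] by blast
    have "norm t ^ k < d ^ k" using s t by (simp flip: norm_power)
    then have "norm t < d" using d(1) by (metis less_imp_le power_mono not_less norm_ge_zero)
    moreover have "t \<noteq> 0" using s t k by auto
    ultimately show "dist (h s) c < e" using d(2) t by metis
  qed
qed

section \<open>Orders of holomorphic functions of one variable\<close>

lemma fps_expansion_factor:
  fixes G :: "complex \<Rightarrow> complex"
  assumes G: "G has_fps_expansion g" and k: "\<And>i. i < k \<Longrightarrow> fps_nth g i = 0"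
  shows "\<forall>\<^sub>F t in nhds 0. G t = t ^ k * eval_fps (fps_shift k g) t"
proof -
  have g: "g = fps_X ^ k * fps_shift k g"
    using k by (intro fps_ext) (simp add: fps_X_power_mult_nth)
  have cr: "fps_conv_radius g > 0" using G by (simp add: has_fps_expansion_def)
  obtain s where s: "0 < s" "ereal s < fps_conv_radius g" using ereal_dense2[OF cr] by auto
  have "\<forall>\<^sub>F t::complex in nhds 0. norm t < s"
    using s(1) by (auto simp: eventually_nhds_metric)
  then have "\<forall>\<^sub>F t::complex in nhds 0. ereal (norm t) < fps_conv_radius g"
    by eventually_elim (use s(2) in \<open>metis less_ereal.simps(1) less_trans\<close>)
  moreover have "\<forall>\<^sub>F t in nhds 0. eval_fps g t = G t" using G by (simp add: has_fps_expansion_def)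
  ultimately show ?thesis
  proof eventually_elim
    case (elim t)
    then show ?case by (subst elim(2)[symmetric], subst g) (simp add: eval_fps_mult)
  qed
qed

lemma fps_expansion_leading:
  fixes G :: "complex \<Rightarrow> complex"
  assumes G: "G has_fps_expansion g" and k: "\<And>i. i < k \<Longrightarrow> fps_nth g i = 0"
  shows "((\<lambda>t. G t / t ^ k) \<longlongrightarrow> fps_nth g k) (at 0)"
proof -
  have cr: "fps_conv_radius (fps_shift k g) > 0" using G by (simp add: has_fps_expansion_def)
  have "isCont (eval_fps (fps_shift k g)) 0"
    using has_field_derivative_eval_fps[of 0 "fps_shift k g" UNIV] cr by (auto simp: zero_ereal_def intro: DERIV_isCont)
  then have "(eval_fps (fps_shift k g) \<longlongrightarrow> fps_nth g k) (at 0)"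
    by (simp add: isCont_def eval_fps_at_0)
  moreover have "\<forall>\<^sub>F t in at 0. eval_fps (fps_shift k g) t = G t / t ^ k"
  proof -
    have "\<forall>\<^sub>F t in nhds 0. G t = t ^ k * eval_fps (fps_shift k g) t"
      by (rule fps_expansion_factor[OF G k])
    then show ?thesis by (auto simp: eventually_at_filter elim: eventually_mono)
  qed
  ultimately show ?thesis by (rule Lim_transform_eventually)
qed

text \<open>
  A bound on the growth at the origin forces the low coefficients to vanish, one after the other.
\<close>

lemma fps_expansion_order_ge:
  fixes G :: "complex \<Rightarrow> complex"
  assumes G: "G has_fps_expansion g" and K: "\<forall>\<^sub>F t in at 0. norm (G t) \<le> K * norm t ^ k" and i: "i < k"
  shows "fps_nth g i = 0"
  using i
proof (induction i rule: less_induct)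
  case (less i)
  have "((\<lambda>t. G t / t ^ i) \<longlongrightarrow> fps_nth g i) (at 0)"
    by (rule fps_expansion_leading[OF G]) (use less in auto)
  moreover have "((\<lambda>t. G t / t ^ i) \<longlongrightarrow> 0) (at 0)"
  proof (rule Lim_null_comparison)
    show "\<forall>\<^sub>F t in at 0. norm (G t / t ^ i) \<le> K * norm t ^ (k - i)"
      using K eventually_neq_at_within[of 0 0 UNIV]
    proof eventually_elim
      case (elim t)
      have "norm t ^ k = norm t ^ (k - i) * norm t ^ i" using less.prems by (simp flip: power_add)
      then show ?case using elim by (simp add: norm_divide norm_power field_simps)
    qed
    have "((\<lambda>t::complex. K * norm t ^ (k - i)) \<longlongrightarrow> K * norm (0::complex) ^ (k - i)) (at 0)"
      by (intro tendsto_intros)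
    moreover have "K * norm (0::complex) ^ (k - i) = 0" using less.prems by simp
    ultimately show "((\<lambda>t::complex. K * norm t ^ (k - i)) \<longlongrightarrow> 0) (at 0)" by (simp only: )
  qed
  ultimately show ?case using tendsto_unique[of "at (0::complex)"] by auto
qed

section \<open>Functions along an arc\<close>

definition diff_radius :: "complex fps fps \<Rightarrow> real \<Rightarrow> bool" where
  "diff_radius f R \<longleftrightarrow> R > 0 \<and> (\<forall>p\<in>polydisc R. (eval2 f has_derivative
     (\<lambda>h. eval2 (dz f) p * fst h + eval2 (dw f) p * snd h)) (at p))"

lemma ex_diff_radius: assumes "convergent2 f" obtains R where "diff_radius f R"
proof -
  obtain C r where r: "coeff_bound f C r" using convergent2_imp_coeff_bound[OF assms] .
  then have "diff_radius f (r / 2)" unfolding diff_radius_def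
    using eval2_has_derivative[OF r] by (auto simp: coeff_bound_def)
  then show ?thesis by (rule that)
qed

lemma diff_radius_mono: "diff_radius f R \<Longrightarrow> 0 < S \<Longrightarrow> S \<le> R \<Longrightarrow> diff_radius f S"
  unfolding diff_radius_def using polydisc_mono by blast

lemma eval2_curve_derivative:
  assumes R: "diff_radius f R" and x: "(x has_field_derivative x') (at t)"
    and y: "(y has_field_derivative y') (at t)" and p: "(x t, y t) \<in> polydisc R"
  shows "((\<lambda>t. eval2 f (x t, y t)) has_field_derivative
     (eval2 (dz f) (x t, y t) * x' + eval2 (dw f) (x t, y t) * y')) (at t)"
proof -
  have 1: "((\<lambda>t. (x t, y t)) has_derivative (\<lambda>h. (x' * h, y' * h))) (at t)"
    using x y unfolding has_field_derivative_def by (rule has_derivative_Pair)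
  have 2: "(eval2 f has_derivative (\<lambda>h. eval2 (dz f) (x t, y t) * fst h + eval2 (dw f) (x t, y t) * snd h)) (at (x t, y t))"
    using R p by (simp add: diff_radius_def)
  have "((\<lambda>t. eval2 f (x t, y t)) has_derivative
     (\<lambda>h. eval2 (dz f) (x t, y t) * fst (x' * h, y' * h) + eval2 (dw f) (x t, y t) * snd (x' * h, y' * h))) (at t)"
    using has_derivative_compose[OF 1 2] .
  then show ?thesis unfolding has_field_derivative_def
    by (rule has_derivative_eq_rhs) (simp add: fun_eq_iff algebra_simps)
qed

lemma continuous_on_eval2:
  assumes "diff_radius f R" shows "continuous_on (polydisc R) (eval2 f)"
  using assms unfolding diff_radius_def
  by (meson continuous_at_imp_continuous_on has_derivative_continuous)

lemma level_arc_near_0: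
  assumes a: "fps_nth a 0 = 0" "fps_conv_radius a > 0" and N: "N > 0" and R: "R > 0"
  obtains d c where "d > 0" "d \<le> 1" "c > 0" "\<And>t::complex. norm t < d \<Longrightarrow> ereal (norm t) < fps_conv_radius a"
    "\<And>t. norm t < d \<Longrightarrow> norm (eval_fps a t) \<le> c * norm t" "\<And>t. norm t < d \<Longrightarrow> level_arc N a t \<in> polydisc R"
proof -
  obtain s where s: "0 < s" "ereal s < fps_conv_radius a" using ereal_dense2[OF a(2)] by auto
  have cr: "ereal (norm t) < fps_conv_radius a" if "norm t \<le> s" for t :: complex
    using that s(2) by (metis ereal_less_eq(3) order_le_less_trans)
  have "continuous_on (cball 0 s) (eval_fps (fps_shift 1 a))"
    by (intro holomorphic_on_imp_continuous_on holomorphic_on_eval_fps) (use cr in \<open>auto simp: eball_def\<close>)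
  then have "compact (eval_fps (fps_shift 1 a) ` cball 0 s)" by (rule compact_continuous_image) auto
  then have "bounded (eval_fps (fps_shift 1 a) ` cball 0 s)" by (rule compact_imp_bounded)
  then obtain c where c: "c > 0" "\<And>t. norm t \<le> s \<Longrightarrow> norm (eval_fps (fps_shift 1 a) t) \<le> c"
    unfolding bounded_pos by (auto simp: dist_norm)
  have fac: "eval_fps a t = t * eval_fps (fps_shift 1 a) t" if "norm t \<le> s" for t
  proof -
    have "a = fps_X * fps_shift 1 a" using a(1) by (intro fps_ext) (simp add: fps_X_mult_nth split: nat.split)
    then show ?thesis using cr[OF that] by (metis eval_fps_X eval_fps_mult fps_conv_radius_fps_X fps_conv_radius_shift ereal_infty_less(1) less_ereal.simps(2))
  qed
  have le: "norm (eval_fps a t) \<le> c * norm t" if "norm t \<le> s" for t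
    unfolding fac[OF that] norm_mult mult.commute[of c] using c(2)[OF that] by (rule mult_left_mono) simp
  define d where "d = min (min s 1) (min R (R / c))"
  have d: "d > 0" "d \<le> s" "d \<le> 1" "d \<le> R" "d \<le> R / c" using s R c by (auto simp: d_def)
  show ?thesis
  proof (rule that[OF d(1,3) c(1)])
    fix t :: complex assume t: "norm t < d"
    then have ts: "norm t \<le> s" using d by simp
    show "ereal (norm t) < fps_conv_radius a" by (rule cr[OF ts])
    show l: "norm (eval_fps a t) \<le> c * norm t" by (rule le[OF ts])
    have "norm t < R / c" using t d(5) by simp
    then have "c * norm t < R" using c(1) by (simp add: pos_less_divide_eq mult.commute)
    moreover have "norm t ^ N \<le> norm t ^ 1" using N t d by (intro power_decreasing) auto
    ultimately show "level_arc N a t \<in> polydisc R"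
      using l t d by (auto simp: level_arc_def polydisc_def norm_power)
  qed
qed

text \<open>
  Along an arc \<open>f\<close> is a holomorphic function of the parameter, hence has a power series.
\<close>

lemma ex_level_expansion:
  assumes f: "convergent2 f" and a: "fps_nth a 0 = 0" "fps_conv_radius a > 0" and N: "N > 0"
  shows "\<exists>S. (\<lambda>t. eval2 f (level_arc N a t)) has_fps_expansion S"
proof -
  obtain R where R: "diff_radius f R" using ex_diff_radius[OF f] .
  then have R0: "R > 0" by (simp add: diff_radius_def)
  obtain d c where d: "d > 0" "\<And>t::complex. norm t < d \<Longrightarrow> ereal (norm t) < fps_conv_radius a"
    "\<And>t. norm t < d \<Longrightarrow> level_arc N a t \<in> polydisc R" using level_arc_near_0[OF a N R0] by metis
  have "(\<lambda>t. eval2 f (level_arc N a t)) holomorphic_on ball 0 d"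
    unfolding holomorphic_on_open[OF open_ball]
  proof (intro ballI)
    fix t :: complex assume "t \<in> ball 0 d"
    then have t: "norm t < d" by simp
    have "((\<lambda>t. eval2 f (eval_fps a t, t ^ N)) has_field_derivative
       (eval2 (dz f) (eval_fps a t, t ^ N) * eval_fps (fps_deriv a) t + eval2 (dw f) (eval_fps a t, t ^ N) * (of_nat N * t ^ (N - 1)))) (at t)"
      by (rule eval2_curve_derivative[OF R has_field_derivative_eval_fps[OF d(2)[OF t]]])
        (use d(3)[OF t] in \<open>auto intro!: derivative_eq_intros simp: level_arc_def\<close>)
    then show "\<exists>f'. ((\<lambda>t. eval2 f (level_arc N a t)) has_field_derivative f') (at t)"
      unfolding level_arc_def by blast
  qed
  then have "(\<lambda>t. eval2 f (level_arc N a t)) analytic_on {0}"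
    unfolding analytic_at using d(1) by (intro exI[of _ "ball 0 d"]) auto
  then show ?thesis using analytic_at_imp_has_fps_expansion_0 by blast
qed

text \<open>
  The chain rule along an arc, as an identity of formal power series. It gives access to \<open>f_w\<close>, for
  which no factorization is available, from the series of \<open>f\<close> and \<open>f_z\<close>.
\<close>

lemma level_chain_rule:
  assumes f: "convergent2 f" and a: "fps_nth a 0 = 0" "fps_conv_radius a > 0" and N: "N > 0"
    and \<Phi>: "(\<lambda>t. eval2 f (level_arc N a t)) has_fps_expansion \<Phi>"
    and FZ: "(\<lambda>t. eval2 (dz f) (level_arc N a t)) has_fps_expansion FZ"
    and FW: "(\<lambda>t. eval2 (dw f) (level_arc N a t)) has_fps_expansion FW"
  shows "fps_deriv \<Phi> = FZ * fps_deriv a + FW * (of_nat N * fps_X ^ (N - 1))"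
proof -
  obtain R where R: "diff_radius f R" using ex_diff_radius[OF f] .
  then have R0: "R > 0" by (simp add: diff_radius_def)
  obtain d c where d: "d > 0" "\<And>t::complex. norm t < d \<Longrightarrow> ereal (norm t) < fps_conv_radius a"
    "\<And>t. norm t < d \<Longrightarrow> level_arc N a t \<in> polydisc R" using level_arc_near_0[OF a N R0] by metis
  let ?L = "level_arc N a"
  have der: "deriv (\<lambda>t. eval2 f (?L t)) t = eval2 (dz f) (?L t) * eval_fps (fps_deriv a) t + eval2 (dw f) (?L t) * (of_nat N * t ^ (N - 1))"
    if t: "norm t < d" for t
  proof (rule DERIV_imp_deriv)
    show "((\<lambda>t. eval2 f (?L t)) has_field_derivative
       (eval2 (dz f) (?L t) * eval_fps (fps_deriv a) t + eval2 (dw f) (?L t) * (of_nat N * t ^ (N - 1)))) (at t)"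
      unfolding level_arc_def
      by (rule eval2_curve_derivative[OF R has_field_derivative_eval_fps[OF d(2)[OF t]]])
        (use d(3)[OF t] in \<open>auto intro!: derivative_eq_intros simp: level_arc_def\<close>)
  qed
  have "deriv (\<lambda>t. eval2 f (?L t)) has_fps_expansion fps_deriv \<Phi>" by (rule has_fps_expansion_deriv[OF \<Phi>])
  moreover have "\<forall>\<^sub>F t in nhds 0. deriv (\<lambda>t. eval2 f (?L t)) t =
      eval2 (dz f) (?L t) * eval_fps (fps_deriv a) t + eval2 (dw f) (?L t) * (of_nat N * t ^ (N - 1))"
    using d(1) der by (auto simp: eventually_nhds_metric)
  ultimately have 1: "(\<lambda>t. eval2 (dz f) (?L t) * eval_fps (fps_deriv a) t + eval2 (dw f) (?L t) * (of_nat N * t ^ (N - 1))) has_fps_expansion fps_deriv \<Phi>"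
    by (subst (asm) has_fps_expansion_cong) auto
  have cr': "fps_conv_radius (fps_deriv a) > 0" using fps_conv_radius_deriv[of a] a(2) by simp
  have a': "eval_fps (fps_deriv a) has_fps_expansion fps_deriv a"
    using cr' by (simp add: has_fps_expansion_def)
  have 2: "(\<lambda>t. eval2 (dz f) (?L t) * eval_fps (fps_deriv a) t + eval2 (dw f) (?L t) * (of_nat N * t ^ (N - 1))) has_fps_expansion
      (FZ * fps_deriv a + FW * (fps_const (of_nat N) * fps_X ^ (N - 1)))"
    by (intro has_fps_expansion_add has_fps_expansion_mult FZ FW a' has_fps_expansion_cmult_left has_fps_expansion_fps_X_power)
  show ?thesis using fps_expansion_unique_complex[OF 1 2] by (simp add: fps_of_nat)
qed

text \<open>
  The definition of \<open>along\<close> truncates the substitution differently for each coefficient. The tail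
  \<open>i > n\<close> of the series is \<open>O(t^(n+1))\<close>, so it does not affect the coefficient of \<open>t^n\<close>.
\<close>

lemma along_expansion:
  assumes f: "convergent2 f" and \<alpha>: "\<alpha> \<in> puiseux1"
  shows "(\<lambda>t. eval2 f (arc_map \<alpha> t)) has_fps_expansion along f \<alpha>"
proof -
  define N where "N = m_puiseux \<alpha>"
  define a where "a = param N \<alpha>"
  obtain M where M: "exponents_over M \<alpha>" using \<alpha> by (auto simp: puiseux1_def)
  have N: "N > 0" "exponents_over N \<alpha>" using m_puiseux[OF M] by (auto simp: N_def)
  have a: "fps_nth a 0 = 0" "fps_conv_radius a > 0"
    using param_nth_eq_0[OF \<alpha>, of 0 N] conv_radius_param_pos[OF \<alpha> N(2)] N by (auto simp: a_def)
  have am: "arc_map \<alpha> t = level_arc N a t" for t by (simp add: arc_map_def level_arc_def N_def a_def)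
  obtain S where S: "(\<lambda>t. eval2 f (level_arc N a t)) has_fps_expansion S"
    using ex_level_expansion[OF f a N(1)] by blast
  obtain C r where r: "coeff_bound f C r" using convergent2_imp_coeff_bound[OF f] .
  then have r0: "r > 0" by (simp add: coeff_bound_def)
  define r' where "r' = min (r / 2) 1"
  have r': "r' > 0" "r' < r" "r' \<le> 1" using r0 by (auto simp: r'_def)
  obtain d c where d: "d > 0" "d \<le> 1" "c > 0" "\<And>t::complex. norm t < d \<Longrightarrow> ereal (norm t) < fps_conv_radius a"
    "\<And>t. norm t < d \<Longrightarrow> norm (eval_fps a t) \<le> c * norm t" "\<And>t. norm t < d \<Longrightarrow> level_arc N a t \<in> polydisc r'"
    using level_arc_near_0[OF a N(1) r'(1)] by metis
  have "S = along f \<alpha>"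
  proof (rule fps_ext)
    fix n
    define T where "T = (\<Sum>i\<le>n. (fps_nth f i oo fps_X ^ N) * a ^ i)"
    \<comment> \<open>For these \<open>t\<close> the tail is dominated by a geometric series of ratio \<open>x \<le> 1/2\<close>.\<close>
    define e where "e = min d (r / (2 * c))"
    have e: "e > 0" "e \<le> d" "e \<le> r / (2 * c)" using d r0 by (auto simp: e_def)
    have crf: "ereal r' \<le> fps_conv_radius (fps_nth f i oo fps_X ^ N)" for i
    proof (rule conv_radius_compose_X_power_ge[OF N(1) _ r'(3)])
      show "ereal r' \<le> fps_conv_radius (fps_nth f i)"
        using coeff_bound_conv_radius[OF r, of i] r'(2) by (meson ereal_less_eq(3) less_imp_le order_trans)
    qed
    have crf0: "0 < fps_conv_radius (fps_nth f i oo fps_X ^ N)" for i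
      using crf[of i] r'(1) by (metis ereal_less(2) order_less_le_trans)
    have exT: "(\<lambda>t. \<Sum>i\<le>n. eval_fps (fps_nth f i) (t ^ N) * eval_fps a t ^ i) has_fps_expansion T"
      unfolding T_def
    proof (intro has_fps_expansion_sum has_fps_expansion_mult has_fps_expansion_power)
      fix i
      have "eval_fps (fps_nth f i oo fps_X ^ N) has_fps_expansion (fps_nth f i oo fps_X ^ N)"
        using crf0[of i] by (simp add: has_fps_expansion_def)
      then show "(\<lambda>t. eval_fps (fps_nth f i) (t ^ N)) has_fps_expansion (fps_nth f i oo fps_X ^ N)"
        by (simp add: eval_fps_compose_X_power[OF N(1), abs_def])
      show "eval_fps a has_fps_expansion a" using a(2) by (simp add: has_fps_expansion_def)
    qed
    define D where "D = (\<lambda>t. eval2 f (level_arc N a t) - (\<Sum>i\<le>n. eval_fps (fps_nth f i) (t ^ N) * eval_fps a t ^ i))"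
    have exD: "D has_fps_expansion (S - T)" unfolding D_def by (rule has_fps_expansion_diff[OF S exT])
    define K where "K = C / (1 - r' / r)"
    have K: "K \<ge> 0" using r' r0 coeff_bound_nonneg[OF r] by (simp add: K_def)
    have bound: "norm (D t) \<le> (2 * K * (c / r) ^ Suc n) * norm t ^ Suc n" if t: "norm t < e" for t
    proof -
      define x where "x = c * norm t / r"
      have td: "norm t < d" using t e by simp
      have "c * norm t \<le> c * (r / (2 * c))" using t e(3) d(3) by (intro mult_left_mono) auto
      then have x: "0 \<le> x" "x \<le> 1/2" using d(3) r0 by (auto simp: x_def field_simps)
      have pr: "level_arc N a t \<in> polydisc r" using d(6)[OF td] polydisc_mono[of r' r] r' by auto
      have w: "norm (t ^ N) \<le> r'" using d(6)[OF td] by (simp add: level_arc_def polydisc_def)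
      let ?u = "\<lambda>i. eval_fps (fps_nth f i) (t ^ N) * eval_fps a t ^ i"
      have u: "?u sums eval2 f (level_arc N a t)" using eval2_sums[OF r pr] by (simp add: level_arc_def)
      have un: "norm (?u i) \<le> K * x ^ i" for i
      proof -
        have "norm (?u i) \<le> (K / r ^ i) * (c * norm t) ^ i"
          unfolding norm_mult norm_power
          using norm_row_le[OF r w r'(2), of i, folded K_def] d(5)[OF td] K r0
          by (intro mult_mono power_mono) auto
        then show ?thesis by (simp add: x_def power_divide)
      qed
      have "(\<lambda>i. ?u (i + Suc n)) sums (eval2 f (level_arc N a t) - (\<Sum>i<Suc n. ?u i))"
        by (rule sums_split_initial_segment[OF u])
      then have "D t = (\<Sum>i. ?u (i + Suc n))" by (simp add: D_def sums_iff lessThan_Suc_atMost)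
      moreover have gs: "(\<lambda>i. K * x ^ Suc n * x ^ i) sums (K * x ^ Suc n * (1 / (1 - x)))"
        using x by (intro sums_mult geometric_sums) auto
      have "norm (\<Sum>i. ?u (i + Suc n)) \<le> (\<Sum>i. K * x ^ Suc n * x ^ i)"
      proof (rule norm_suminf_le[OF _ sums_summable[OF gs]])
        show "norm (?u (i + Suc n)) \<le> K * x ^ Suc n * x ^ i" for i
          using un[of "i + Suc n"] by (simp add: power_add mult_ac)
      qed
      moreover have "K * x ^ Suc n * (1 / (1 - x)) \<le> K * x ^ Suc n * 2"
        using x K by (intro mult_left_mono) (auto simp: field_simps)
      moreover have "K * x ^ Suc n * 2 = (2 * K * (c / r) ^ Suc n) * norm t ^ Suc n"
        by (simp add: x_def power_divide power_mult_distrib)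
      ultimately show ?thesis using sums_unique[OF gs] by simp
    qed
    have "fps_nth (S - T) n = 0"
    proof (rule fps_expansion_order_ge[OF exD])
      show "\<forall>\<^sub>F t in at 0. norm (D t) \<le> (2 * K * (c / r) ^ Suc n) * norm t ^ Suc n"
        unfolding eventually_at using e(1) bound by (intro exI[of _ e]) auto
    qed simp
    then show "fps_nth S n = fps_nth (along f \<alpha>) n"
      by (simp add: along_def Let_def T_def a_def N_def)
  qed
  then show ?thesis using S by (simp add: am)
qed

lemma norm_Pair_divide:
  fixes x y t :: complex shows "norm (x / t, y / t) = norm (x, y) / norm t"
  by (cases "t = 0") (simp_all add: norm_Pair norm_divide power_divide real_sqrt_divide flip: add_divide_distrib)

text \<open>
  The order of the gradient is the least order of its two components along the arc. Uniqueness of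
  the exponent holds because two exponents would differ by a positive power of \<open>|y|\<close>, which tends
  to \<open>0\<close>.
\<close>

lemma grad_order_eq:
  assumes N: "exponents_over N \<alpha>"
    and FZ: "(\<lambda>t. eval2 (dz f) (level_arc N (param N \<alpha>) t)) has_fps_expansion FZ"
    and FW: "(\<lambda>t. eval2 (dw f) (level_arc N (param N \<alpha>) t)) has_fps_expansion FW"
    and low: "\<And>i. i < p \<Longrightarrow> fps_nth FZ i = 0 \<and> fps_nth FW i = 0"
    and top: "fps_nth FZ p \<noteq> 0 \<or> fps_nth FW p \<noteq> 0"
  shows "grad_order f \<alpha> = ereal (real p / real N)"
proof -
  define m where "m = m_puiseux \<alpha>"
  define k where "k = N div m"
  have N0: "N > 0" using N by (simp add: exponents_over_def)
  have k: "k > 0" "m > 0" "m * k = N" using param_puiseux(2)[OF N] m_puiseux[OF N] by (auto simp: k_def m_def)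
  define e where "e = real p / real N"
  define c where "c = norm (fps_nth FZ p, fps_nth FW p)"
  have c: "c > 0" using top by (auto simp: c_def norm_Pair intro: add_pos_nonneg add_nonneg_pos)
  define h where "h = (\<lambda>e t. grad_norm f (arc_map \<alpha> t) / norm (snd (arc_map \<alpha> t)) powr e)"
  have snd: "snd (arc_map \<alpha> t) = t ^ m" for t by (simp add: arc_map_def m_def)
  have "((\<lambda>t. (eval2 (dz f) (level_arc N (param N \<alpha>) t) / t ^ p, eval2 (dw f) (level_arc N (param N \<alpha>) t) / t ^ p))
      \<longlongrightarrow> (fps_nth FZ p, fps_nth FW p)) (at 0)"
    by (intro tendsto_Pair fps_expansion_leading[OF FZ] fps_expansion_leading[OF FW]) (use low in auto)
  then have l: "((\<lambda>t. norm (eval2 (dz f) (level_arc N (param N \<alpha>) t) / t ^ p, eval2 (dw f) (level_arc N (param N \<alpha>) t) / t ^ p))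
      \<longlongrightarrow> c) (at 0)" unfolding c_def by (rule tendsto_norm)
  have "((\<lambda>t. h e (t ^ k)) \<longlongrightarrow> c) (at 0)"
  proof (rule Lim_transform_eventually[OF l])
    show "\<forall>\<^sub>F t in at 0. norm (eval2 (dz f) (level_arc N (param N \<alpha>) t) / t ^ p, eval2 (dw f) (level_arc N (param N \<alpha>) t) / t ^ p) = h e (t ^ k)"
      using eventually_neq_at_within[of 0 0 UNIV]
    proof eventually_elim
      case (elim t)
      have "norm ((t ^ k) ^ m) powr e = norm t ^ p"
      proof -
        have "norm ((t ^ k) ^ m) = norm t ^ N" using k(3) by (simp add: norm_power mult.commute flip: power_mult)
        also have "\<dots> = norm t powr real N" using elim by (simp add: powr_realpow)
        finally have "norm ((t ^ k) ^ m) powr e = norm t powr (real N * e)" by (simp add: powr_powr)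
        also have "real N * e = real p" using N0 by (simp add: e_def)
        finally show ?thesis using elim by (simp add: powr_realpow)
      qed
      moreover have "arc_map \<alpha> (t ^ k) = level_arc N (param N \<alpha>) t"
        using arc_map_power[OF N] by (simp add: k_def m_def)
      ultimately show ?case by (simp add: h_def snd norm_Pair_divide grad_norm_def norm_power)
    qed
  qed
  then have he: "(h e \<longlongrightarrow> c) (at 0)" by (rule tendsto_at_0_power[OF k(1)])
  have tozero: "((\<lambda>t. norm (snd (arc_map \<alpha> t)) powr x) \<longlongrightarrow> 0) (at 0)" if "x > 0" for x
  proof -
    have "((\<lambda>t::complex. norm (t ^ m) powr x) \<longlongrightarrow> norm ((0::complex) ^ m) powr x) (at 0)"
      using that by (intro tendsto_powr2 tendsto_intros) auto
    then show ?thesis using k(2) by (simp add: snd power_0_left)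
  qed
  have neg: False if "(h e1 \<longlongrightarrow> c1) (at 0)" "(h e2 \<longlongrightarrow> c2) (at 0)" "c1 > 0" "e1 < e2" for e1 e2 c1 c2
  proof -
    have "((\<lambda>t. h e2 t * norm (snd (arc_map \<alpha> t)) powr (e2 - e1)) \<longlongrightarrow> c2 * 0) (at 0)"
      by (intro tendsto_mult that tozero) (use that in simp)
    moreover have "\<forall>\<^sub>F t in at 0. h e2 t * norm (snd (arc_map \<alpha> t)) powr (e2 - e1) = h e1 t"
      using eventually_neq_at_within[of 0 0 UNIV]
    proof eventually_elim
      case (elim t)
      then have "norm (snd (arc_map \<alpha> t)) > 0" by (simp add: snd)
      then show ?case by (simp add: h_def powr_diff)
    qed
    ultimately have "(h e1 \<longlongrightarrow> c2 * 0) (at 0)" by (rule Lim_transform_eventually)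
    then have "c1 = c2 * 0" using that(1) by (intro tendsto_unique[of "at (0::complex)"]) auto
    then show False using that by simp
  qed
  have the: "(THE e. \<exists>c>0. (h e \<longlongrightarrow> c) (at 0)) = e"
  proof (rule the_equality)
    show "\<exists>c>0. (h e \<longlongrightarrow> c) (at 0)" using he c by blast
    show "e' = e" if "\<exists>c>0. (h e' \<longlongrightarrow> c) (at 0)" for e'
      using that he c neg by (metis linorder_neqE_linordered_idom)
  qed
  have "\<not> (\<forall>\<^sub>F t in at 0. grad_norm f (arc_map \<alpha> t) = 0)"
  proof
    assume "\<forall>\<^sub>F t in at 0. grad_norm f (arc_map \<alpha> t) = 0"
    then have "\<forall>\<^sub>F t in at 0. h e t = 0" by eventually_elim (simp add: h_def)
    then have "(h e \<longlongrightarrow> 0) (at 0)" by (simp add: tendsto_eventually)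
    then show False using he c tendsto_unique[of "at (0::complex)"] by fastforce
  qed
  then show ?thesis unfolding grad_order_def using the by (simp add: h_def e_def)
qed

text \<open>
  An asymptotic of \<open>f\<close> over an arbitrary common denominator determines the order in \<open>y\<close>.
\<close>

lemma order_along_eq:
  assumes f: "convergent2 f" and \<alpha>: "\<alpha> \<in> puiseux1" and N: "exponents_over N \<alpha>"
    and lim: "((\<lambda>t. eval2 f (level_arc N (param N \<alpha>) t) / t ^ H) \<longlongrightarrow> c) (at 0)" and c: "c \<noteq> 0"
  shows "along f \<alpha> \<noteq> 0" "order_along f \<alpha> = ereal (real H / real N)"
proof -
  define m where "m = m_puiseux \<alpha>"
  define k where "k = N div m"
  have N0: "N > 0" using N by (simp add: exponents_over_def)
  have k: "k > 0" "m > 0" "m * k = N" using param_puiseux(2)[OF N] m_puiseux[OF N] by (auto simp: k_def m_def)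
  have am: "arc_map \<alpha> (t ^ k) = level_arc N (param N \<alpha>) t" for t
    using arc_map_power[OF N] by (simp add: k_def m_def)
  let ?A = "along f \<alpha>"
  have "(\<lambda>t::complex. t ^ k) has_fps_expansion fps_X ^ k" by (rule has_fps_expansion_fps_X_power)
  then have "((\<lambda>t. eval2 f (arc_map \<alpha> t)) \<circ> (\<lambda>t. t ^ k)) has_fps_expansion (?A oo fps_X ^ k)"
    by (intro has_fps_expansion_compose along_expansion[OF f \<alpha>]) (use k in auto)
  then have ex: "(\<lambda>t. eval2 f (level_arc N (param N \<alpha>) t)) has_fps_expansion (?A oo fps_X ^ k)"
    by (simp add: o_def am)
  have low: "fps_nth (?A oo fps_X ^ k) i = 0" if "i < H" for i
  proof -
    have "\<forall>\<^sub>F t in at 0. norm (eval2 f (level_arc N (param N \<alpha>) t) / t ^ H) < norm c + 1"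
      using tendsto_norm[OF lim] by (rule order_tendstoD) simp
    then have "\<forall>\<^sub>F t in at 0. norm (eval2 f (level_arc N (param N \<alpha>) t)) \<le> (norm c + 1) * norm t ^ H"
      using eventually_neq_at_within[of 0 0 UNIV]
      by eventually_elim (simp add: norm_divide norm_power field_simps)
    then show ?thesis by (rule fps_expansion_order_ge[OF ex _ that])
  qed
  have "((\<lambda>t. eval2 f (level_arc N (param N \<alpha>) t) / t ^ H) \<longlongrightarrow> fps_nth (?A oo fps_X ^ k) H) (at 0)"
    by (rule fps_expansion_leading[OF ex low])
  then have top: "fps_nth (?A oo fps_X ^ k) H = c" using lim by (intro tendsto_unique[of "at (0::complex)"]) auto
  show nz: "?A \<noteq> 0" using top c by auto
  have "k dvd H" and AH: "fps_nth ?A (H div k) \<noteq> 0"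
    using top c k by (auto simp: fps_nth_compose_X_power split: if_splits)
  have "fps_nth ?A i = 0" if "i < H div k" for i
  proof -
    have "k * i < H" using that k \<open>k dvd H\<close> by (metis dvd_mult_div_cancel mult_less_cancel1)
    then show ?thesis using low[of "k * i"] k by (simp add: fps_nth_compose_X_power)
  qed
  then have "subdegree ?A = H div k" using AH by (intro subdegreeI) auto
  then have "order_along f \<alpha> = ereal (real (H div k) / real m)" using nz by (simp add: order_along_def m_def)
  also have "real (H div k) / real m = real H / real N"
    using k \<open>k dvd H\<close> by (auto elim!: dvdE simp flip: k(3))
  finally show "order_along f \<alpha> = ereal (real H / real N)" .
qed

section \<open>Uniform limits\<close>

lemma uniform_limit_of_tendsto:
  assumes "(h \<longlongrightarrow> h0) F" shows "uniform_limit S (\<lambda>t v. h t) (\<lambda>v. h0) F"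
  using assms by (auto simp: uniform_limit_iff tendsto_iff elim: eventually_mono)

lemma uniform_limit_scaled:
  fixes h :: "'a \<Rightarrow> complex"
  assumes "(h \<longlongrightarrow> h0) F" shows "uniform_limit (ball 0 R) (\<lambda>t v. v * h t) (\<lambda>v. v * h0) F"
proof (rule uniform_limitI)
  fix e :: real assume e: "e > 0"
  have "\<forall>\<^sub>F t in F. dist (h t) h0 < e / (\<bar>R\<bar> + 1)" using assms e by (auto simp: tendsto_iff)
  then show "\<forall>\<^sub>F t in F. \<forall>v\<in>ball 0 R. dist (v * h t) (v * h0) < e"
  proof eventually_elim
    case (elim t)
    show ?case
    proof
      fix v :: complex assume v: "v \<in> ball 0 R"
      have "dist (v * h t) (v * h0) = norm v * dist (h t) h0"
        by (simp add: dist_norm norm_mult flip: right_diff_distrib)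
      also have "\<dots> \<le> (\<bar>R\<bar> + 1) * dist (h t) h0" using v by (intro mult_right_mono) auto
      also have "\<dots> < e" using elim by (simp add: field_simps)
      finally show "dist (v * h t) (v * h0) < e" .
    qed
  qed
qed

lemma uniform_limit_isCont_0:
  fixes G :: "'b::real_normed_vector \<Rightarrow> 'c::metric_space"
  assumes "isCont G 0" "\<And>e. e > 0 \<Longrightarrow> \<forall>\<^sub>F t in F. \<forall>v\<in>S. norm (q t v) < e"
  shows "uniform_limit S (\<lambda>t v. G (q t v)) (\<lambda>v. G 0) F"
proof (rule uniform_limitI)
  fix e :: real assume "e > 0"
  then obtain d where d: "d > 0" "\<And>x. norm x < d \<Longrightarrow> dist (G x) (G 0) < e"
    using assms(1) unfolding continuous_at_eps_delta by (metis diff_zero dist_norm)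
  show "\<forall>\<^sub>F t in F. \<forall>v\<in>S. dist (G (q t v)) (G 0) < e"
    using assms(2)[OF d(1)] by eventually_elim (use d(2) in auto)
qed

text \<open>
  The limit functions must be bounded for the product of uniform limits to be uniform, so
  boundedness is carried along in the induction.
\<close>

lemma uniform_limit_prod_complex:
  fixes h :: "'j \<Rightarrow> 'a \<Rightarrow> 'b \<Rightarrow> complex"
  assumes "finite J" "\<And>j. j \<in> J \<Longrightarrow> uniform_limit S (h j) (l j) F" "\<And>j. j \<in> J \<Longrightarrow> bounded (l j ` S)"
  shows "uniform_limit S (\<lambda>t v. \<Prod>j\<in>J. h j t v) (\<lambda>v. \<Prod>j\<in>J. l j v) F \<and> bounded ((\<lambda>v. \<Prod>j\<in>J. l j v) ` S)"
  using assms
proof (induction J rule: finite_induct)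
  case empty
  then show ?case by (auto intro: uniform_limit_const simp: bounded_iff)
next
  case (insert x J)
  then have IH: "uniform_limit S (\<lambda>t v. \<Prod>j\<in>J. h j t v) (\<lambda>v. \<Prod>j\<in>J. l j v) F" "bounded ((\<lambda>v. \<Prod>j\<in>J. l j v) ` S)" by auto
  have x: "uniform_limit S (h x) (l x) F" "bounded (l x ` S)" using insert.prems by auto
  have "uniform_limit S (\<lambda>t v. h x t v * (\<Prod>j\<in>J. h j t v)) (\<lambda>v. l x v * (\<Prod>j\<in>J. l j v)) F"
    by (rule bounded_bilinear.bounded_uniform_limit[OF bounded_bilinear_mult x(1) IH(1) IH(2) x(2)])
  moreover have "bounded ((\<lambda>v. l x v * (\<Prod>j\<in>J. l j v)) ` S)"
  proof -
    obtain A B where "\<And>v. v \<in> S \<Longrightarrow> norm (l x v) \<le> A" "\<And>v. v \<in> S \<Longrightarrow> norm (\<Prod>j\<in>J. l j v) \<le> B"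
      using x(2) IH(2) unfolding bounded_iff by auto
    then have "norm (l x v * (\<Prod>j\<in>J. l j v)) \<le> A * B" if "v \<in> S" for v
      using that unfolding norm_mult by (intro mult_mono) (auto intro: order_trans[OF norm_ge_zero])
    then show ?thesis unfolding bounded_iff by auto
  qed
  ultimately show ?case using insert.hyps by simp
qed

section \<open>The derivative along a family of arcs\<close>

text \<open>
  For fixed \<open>v\<close> this is the arc of \<open>a + v y^(D/N)\<close>, and for fixed \<open>t\<close> it is a disc in the line
  \<open>y = t^N\<close>. The letter \<open>v\<close> denotes the transversal coordinate throughout.
\<close>

definition fan :: "nat \<Rightarrow> nat \<Rightarrow> complex fps \<Rightarrow> complex \<Rightarrow> complex \<Rightarrow> complex \<times> complex" where
  "fan N D a t v = (eval_fps a t + v * t ^ D, t ^ N)"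

lemma fan_near_0:
  assumes a: "fps_nth a 0 = 0" "fps_conv_radius a > 0" and N: "N > 0" and D: "D > 0" and e: "e > 0"
  obtains d where "d > 0" "\<And>t v. norm t < d \<Longrightarrow> v \<in> ball 0 R \<Longrightarrow> fan N D a t v \<in> polydisc e"
    "\<And>t::complex. norm t < d \<Longrightarrow> ereal (norm t) < fps_conv_radius a"
proof -
  obtain d c where d: "d > 0" "d \<le> 1" "c > 0" "\<And>t::complex. norm t < d \<Longrightarrow> ereal (norm t) < fps_conv_radius a"
    "\<And>t. norm t < d \<Longrightarrow> norm (eval_fps a t) \<le> c * norm t" using level_arc_near_0[OF a N e] by metis
  define d' where "d' = min d (e / (c + \<bar>R\<bar> + 1))"
  have d': "d' > 0" "d' \<le> d" "d' \<le> e / (c + \<bar>R\<bar> + 1)" using d e by (auto simp: d'_def)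
  show ?thesis
  proof (rule that[OF d'(1)])
    fix t v :: complex assume t: "norm t < d'" and v: "v \<in> ball 0 R"
    have t1: "norm t \<le> 1" and td: "norm t < d" using t d' d by auto
    have pw: "norm t ^ n \<le> norm t" if "n > 0" for n
      using power_decreasing[of 1 n "norm t"] that t1 by simp
    have "norm (v * t ^ D) \<le> \<bar>R\<bar> * norm t"
      unfolding norm_mult norm_power using v pw[OF D] by (intro mult_mono) auto
    then have "norm (eval_fps a t + v * t ^ D) \<le> (c + \<bar>R\<bar>) * norm t"
      using d(5)[OF td] norm_triangle_ineq[of "eval_fps a t" "v * t ^ D"] by (simp add: algebra_simps)
    also have "\<dots> \<le> (c + \<bar>R\<bar> + 1) * norm t" by (intro mult_right_mono) auto
    also have le: "\<dots> < e" 
    proof -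
      have "norm t < e / (c + \<bar>R\<bar> + 1)" using t d'(3) by simp
      moreover have "c + \<bar>R\<bar> + 1 > 0" using d(3) by simp
      ultimately show ?thesis by (simp add: pos_less_divide_eq mult.commute)
    qed
    finally have 1: "norm (eval_fps a t + v * t ^ D) < e" .
    have "1 * norm t \<le> (c + \<bar>R\<bar> + 1) * norm t" using d(3) by (intro mult_right_mono) auto
    then have "norm t < e" using le by simp
    then show "fan N D a t v \<in> polydisc e" using 1 pw[OF N] by (simp add: fan_def polydisc_def norm_power)
  next
    fix t :: complex assume "norm t < d'" then show "ereal (norm t) < fps_conv_radius a" using d(4) d'(2) by simp
  qed
qed

text \<open>
  This is the order in \<open>t\<close> of \<open>a + v t^D - g\<close> for generic \<open>v\<close>. Truncation at \<open>D\<close> also takes care of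
  \<open>a = g\<close>, where the difference has no order.
\<close>

definition contact :: "nat \<Rightarrow> complex fps \<Rightarrow> complex fps \<Rightarrow> nat" where
  "contact D a g = (if a = g then D else min D (subdegree (a - g)))"

lemma contact_le: "contact D a g \<le> D"
  by (simp add: contact_def)

lemma contact_nth: "i < contact D a g \<Longrightarrow> fps_nth a i = fps_nth g i"
  using nth_less_subdegree_zero[of i "a - g"] by (auto simp: contact_def split: if_splits)

lemma contact_less: "contact D a g < D \<Longrightarrow> fps_nth (a - g) (contact D a g) \<noteq> 0"
  using nth_subdegree_nonzero[of "a - g"] by (auto simp: contact_def min_def simp del: fps_sub_nth split: if_splits)

lemma contact_eq_iff: "contact D a g = D \<longleftrightarrow> (\<forall>i<D. fps_nth a i = fps_nth g i)"
  using contact_nth[of _ D a g] contact_less[of D a g] contact_le[of D a g]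
  by (metis fps_sub_nth linorder_not_less order_le_less right_minus_eq)

lemma contact_cong:
  assumes "\<And>i. i < D \<Longrightarrow> fps_nth a i = fps_nth b i"
  shows "contact D a g = contact D b g"
proof (rule antisym)
  show "contact D a g \<le> contact D b g"
  proof (rule ccontr)
    assume "\<not> ?thesis"
    then have l: "contact D b g < contact D a g" by simp
    then have "contact D b g < D" using contact_le[of D a g] by simp
    then show False using contact_less[of D b g] contact_nth[OF l] assms by simp
  qed
  show "contact D b g \<le> contact D a g"
  proof (rule ccontr)
    assume "\<not> ?thesis"
    then have l: "contact D a g < contact D b g" by simp
    then have "contact D a g < D" using contact_le[of D b g] by simp
    then show False using contact_less[of D a g] contact_nth[OF l] assms by simp
  qed
qed

text \<open>
  After division by the contact power of \<open>t\<close> the factor has a limit that is constant in \<open>v\<close> if the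
  contact is less than \<open>D\<close>, and affine in \<open>v\<close> if it equals \<open>D\<close>.
\<close>

lemma fan_factor:
  assumes g: "fps_conv_radius g > 0" and a: "fps_conv_radius a > 0"
  shows "\<forall>\<^sub>F t in nhds 0. \<forall>v. eval_fps a t + v * t ^ D - eval_fps g t
     = t ^ contact D a g * (eval_fps (fps_shift (contact D a g) (a - g)) t + v * t ^ (D - contact D a g))"
proof -
  have "(\<lambda>t. eval_fps a t - eval_fps g t) has_fps_expansion (a - g)"
    using a g by (intro has_fps_expansion_diff) (auto simp: has_fps_expansion_def)
  then have "\<forall>\<^sub>F t in nhds 0. eval_fps a t - eval_fps g t = t ^ contact D a g * eval_fps (fps_shift (contact D a g) (a - g)) t"
    by (rule fps_expansion_factor) (simp add: contact_nth)
  then show ?thesis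
  proof eventually_elim
    case (elim t)
    have "t ^ D = t ^ contact D a g * t ^ (D - contact D a g)"
      using contact_le[of D a g] by (simp flip: power_add)
    then show ?case using elim by (simp add: algebra_simps)
  qed
qed

text \<open>
  The data of a Newton--Puiseux factorization of \<open>f_z\<close>, with \<open>N0\<close> one common denominator of the \<open>n\<close>
  polars.
\<close>

locale polar_family =
  fixes f :: "complex fps fps" and \<gamma> :: "nat \<Rightarrow> real \<Rightarrow> complex" and n N0 :: nat and u :: "complex fps fps"
  assumes conv: "convergent2 f" and f00: "coeff2 f 0 0 = 0"
    and unit: "unit2 u" and N0: "N0 > 0"
    and polar: "\<And>j. j < n \<Longrightarrow> \<gamma> j \<in> puiseux1" "\<And>j. j < n \<Longrightarrow> exponents_over N0 (\<gamma> j)"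
    and fac: "subst_w_power N0 (dz f) = subst_w_power N0 u * (\<Prod>j<n. fps_X - fps_const (param N0 (\<gamma> j)))"
begin

text \<open>
  The denominators for which the factorization is available. They are cofinal, so any rational
  exponent becomes an integer at some level.
\<close>

definition level :: "nat \<Rightarrow> bool" where "level N \<longleftrightarrow> (\<exists>M>0. N = N0 * M)"

lemma levelD:
  assumes "level N" shows "N > 0" "\<And>j. j < n \<Longrightarrow> exponents_over N (\<gamma> j)"
  using assms N0 polar exponents_over_mult by (auto simp: level_def)

lemma level_param:
  assumes "level N" "j < n"
  shows "fps_conv_radius (param N (\<gamma> j)) > 0" "\<And>i. i < N \<Longrightarrow> fps_nth (param N (\<gamma> j)) i = 0"
    "fps_nth (param N (\<gamma> j)) 0 = 0"
  using conv_radius_param_pos[OF polar(1)] param_nth_eq_0[OF polar(1)] levelD[OF assms(1)] assms(2) by auto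

lemma level_factorization:
  assumes "level N"
  shows "subst_w_power N (dz f) = subst_w_power N u * (\<Prod>j<n. fps_X - fps_const (param N (\<gamma> j)))"
proof -
  obtain M where M: "M > 0" "N = N0 * M" using assms by (auto simp: level_def)
  have "subst_w_power M (subst_w_power N0 (dz f)) = subst_w_power M (subst_w_power N0 u) * (\<Prod>j<n. fps_X - fps_const (param N0 (\<gamma> j) oo fps_X ^ M))"
    unfolding fac by (rule subst_w_power_prod_linear[OF M(1)])
  also have "(\<Prod>j<n. fps_X - fps_const (param N0 (\<gamma> j) oo fps_X ^ M)) = (\<Prod>j<n. fps_X - fps_const (param N (\<gamma> j)))"
    using polar(2) M by (intro prod.cong) (auto simp: param_mult)
  finally show ?thesis using subst_w_power_subst_w_power[OF M(1) N0] M(2) by simp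
qed

text \<open>
  The order in \<open>t\<close> of \<open>f_z\<close> on the generic arc of the fan: each polar contributes its contact.
\<close>

definition order_E :: "nat \<Rightarrow> nat \<Rightarrow> complex fps \<Rightarrow> nat" where
  "order_E N D a = (\<Sum>j<n. contact D a (param N (\<gamma> j)))"

text \<open>
  The coefficient of the leading power of \<open>t\<close> in \<open>f_z\<close> on the fan. A polar whose contact is maximal
  contributes a factor that is affine in \<open>v\<close>; every other polar contributes a constant.
\<close>

definition lead_P :: "nat \<Rightarrow> nat \<Rightarrow> complex fps \<Rightarrow> complex \<Rightarrow> complex" where
  "lead_P N D a v = coeff2 u 0 0 * (\<Prod>j<n. let m = contact D a (param N (\<gamma> j)) in
      fps_nth (a - param N (\<gamma> j)) m + v * (if m = D then 1 else 0))"

text \<open>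
  The factorization of \<open>f_z\<close> evaluated on the fan: each factor is handled by \<open>fan_factor\<close>, and the
  unit by continuity at the origin. Uniformity in \<open>v\<close> is what later allows differentiation with
  respect to \<open>v\<close> in the limit.
\<close>

theorem dz_fan_limit:
  assumes N: "level N" and D: "D > 0" and a: "fps_nth a 0 = 0" "fps_conv_radius a > 0"
  shows "uniform_limit (ball 0 R) (\<lambda>t v. eval2 (dz f) (fan N D a t v) / t ^ order_E N D a) (lead_P N D a) (at 0)"
    and "bounded (lead_P N D a ` ball 0 R)"
proof -
  let ?g = "\<lambda>j. param N (\<gamma> j)"
  let ?m = "\<lambda>j. contact D a (?g j)"
  have cu: "convergent2 u" and u00: "coeff2 u 0 0 \<noteq> 0" using unit by (auto simp: unit2_def)
  obtain r where r: "r > 0" "\<And>z t. norm z < r \<Longrightarrow> norm t < r \<Longrightarrow>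
    eval2 (dz f) (z, t ^ N) = eval2 u (z, t ^ N) * (\<Prod>j<n. z - eval_fps (?g j) t)"
    using eval2_factorization[OF convergent2_dz[OF conv] cu levelD(1)[OF N] level_param(1)[OF N] level_factorization[OF N]]
    by metis
  define h where "h = (\<lambda>j t v. eval_fps (fps_shift (?m j) (a - ?g j)) t + v * t ^ (D - ?m j))"
  define l where "l = (\<lambda>j v. fps_nth (a - ?g j) (?m j) + v * (if ?m j = D then 1 else (0::complex)))"
  have hl: "uniform_limit (ball 0 R) (h j) (l j) (at 0)" if j: "j < n" for j
    unfolding h_def l_def
  proof (rule uniform_limit_add[OF uniform_limit_of_tendsto uniform_limit_scaled])
    have "fps_conv_radius (a - ?g j) > 0"
      using fps_conv_radius_diff[of a "?g j"] a(2) level_param(1)[OF N j] by (metis min_less_iff_conj order_less_le_trans)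
    then have "isCont (eval_fps (fps_shift (?m j) (a - ?g j))) 0"
      using has_field_derivative_eval_fps[of 0 "fps_shift (?m j) (a - ?g j)" UNIV] by (auto simp: zero_ereal_def intro: DERIV_isCont)
    then show "(eval_fps (fps_shift (?m j) (a - ?g j)) \<longlongrightarrow> fps_nth (a - ?g j) (?m j)) (at 0)"
      by (simp add: isCont_def eval_fps_at_0)
    have "((\<lambda>t::complex. t ^ (D - ?m j)) \<longlongrightarrow> 0 ^ (D - ?m j)) (at 0)" by (intro tendsto_intros)
    moreover have "(0::complex) ^ (D - ?m j) = (if ?m j = D then 1 else 0)" using contact_le[of D a "?g j"] by (auto simp: power_0_left)
    ultimately show "((\<lambda>t::complex. t ^ (D - ?m j)) \<longlongrightarrow> (if ?m j = D then 1 else 0)) (at 0)" by simp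
  qed
  have bl: "bounded (l j ` ball 0 R)" for j
  proof -
    have "norm (l j v) \<le> norm (fps_nth (a - ?g j) (?m j)) + R" if "v \<in> ball 0 R" for v
    proof -
      have vR: "norm v < R" using that by simp
      moreover have "0 \<le> R" using vR norm_ge_zero[of v] by linarith
      ultimately show ?thesis
        using norm_triangle_ineq[of "fps_nth (a - ?g j) (?m j)" v] unfolding l_def by (auto simp del: fps_sub_nth)
    qed
    then show ?thesis unfolding bounded_iff by (metis imageE)
  qed
  have pr: "uniform_limit (ball 0 R) (\<lambda>t v. \<Prod>j<n. h j t v) (\<lambda>v. \<Prod>j<n. l j v) (at 0) \<and> bounded ((\<lambda>v. \<Prod>j<n. l j v) ` ball 0 R)"
    by (rule uniform_limit_prod_complex) (use hl bl in auto)
  obtain Ru where Ru: "diff_radius u Ru" using ex_diff_radius[OF cu] .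
  have ul: "uniform_limit (ball 0 R) (\<lambda>t v. eval2 u (fan N D a t v)) (\<lambda>v. eval2 u 0) (at 0)"
  proof (rule uniform_limit_isCont_0)
    show "isCont (eval2 u) 0"
    proof -
      have "0 \<in> polydisc Ru" using Ru by (simp add: diff_radius_def polydisc_def)
      then show ?thesis using Ru unfolding diff_radius_def by (blast intro: has_derivative_continuous)
    qed
    fix e :: real assume e: "e > 0"
    obtain d where d: "d > 0" "\<And>t v. norm t < d \<Longrightarrow> v \<in> ball 0 R \<Longrightarrow> fan N D a t v \<in> polydisc (e / 2)"
      using fan_near_0[OF a levelD(1)[OF N] D, of "e/2" R] e by (metis half_gt_zero)
    have pe: "norm p < e" if "p \<in> polydisc (e / 2)" for p :: "complex \<times> complex"
      using that norm_Pair_le[of "fst p" "snd p"] by (auto simp: polydisc_def)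
    show "\<forall>\<^sub>F t in at 0. \<forall>v\<in>ball 0 R. norm (fan N D a t v) < e"
      unfolding eventually_at using d pe by (intro exI[of _ d]) auto
  qed
  have u0: "eval2 u 0 = coeff2 u 0 0"
  proof -
    obtain C s where s: "coeff_bound u C s" using convergent2_imp_coeff_bound[OF cu] .
    then have "(\<lambda>i. eval_fps (fps_nth u i) 0 * 0 ^ i) sums eval2 u (0, 0)"
      using eval2_sums[OF s, of "(0, 0)"] by (auto simp: polydisc_def coeff_bound_def)
    moreover have "(\<lambda>i. eval_fps (fps_nth u i) 0 * 0 ^ i) sums (coeff2 u 0 0)"
      using sums_single[of 0 "\<lambda>i. eval_fps (fps_nth u i) 0"] by (simp add: eval_fps_at_0 power_0_left if_distrib cong: if_cong)
    ultimately show ?thesis using sums_unique2 by (simp add: zero_prod_def) 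
  qed
  have tot: "uniform_limit (ball 0 R) (\<lambda>t v. eval2 u (fan N D a t v) * (\<Prod>j<n. h j t v)) (\<lambda>v. eval2 u 0 * (\<Prod>j<n. l j v)) (at 0)"
    by (rule bounded_bilinear.bounded_uniform_limit[OF bounded_bilinear_mult ul conjunct1[OF pr] conjunct2[OF pr]]) (auto simp: bounded_iff)
  have lim: "(\<lambda>v. eval2 u 0 * (\<Prod>j<n. l j v)) = lead_P N D a"
    by (simp add: fun_eq_iff lead_P_def l_def u0 Let_def)
  obtain d where d: "d > 0" "\<And>t v. norm t < d \<Longrightarrow> v \<in> ball 0 R \<Longrightarrow> fan N D a t v \<in> polydisc r"
    using fan_near_0[OF a levelD(1)[OF N] D r(1)] by metis
  have evd: "\<forall>\<^sub>F t in nhds 0. norm (t::complex) < min d r" using d(1) r(1) by (auto simp: eventually_nhds_metric intro!: exI[of _ "min d r"])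
  have evf: "\<forall>\<^sub>F t in nhds 0. \<forall>j\<in>{..<n}. \<forall>v. eval_fps a t + v * t ^ D - eval_fps (?g j) t = t ^ ?m j * h j t v"
    unfolding h_def by (rule eventually_ball_finite) (use fan_factor level_param(1)[OF N] a(2) in auto)
  have "\<forall>\<^sub>F t in nhds 0. t \<noteq> 0 \<longrightarrow> (\<forall>v\<in>ball 0 R. eval2 u (fan N D a t v) * (\<Prod>j<n. h j t v) = eval2 (dz f) (fan N D a t v) / t ^ order_E N D a)"
    using evd evf
  proof eventually_elim
    case (elim t)
    show ?case
    proof (intro impI ballI)
      fix v :: complex assume t0: "t \<noteq> 0" and v: "v \<in> ball 0 R"
      have "norm (eval_fps a t + v * t ^ D) < r" using d(2)[of t v] elim v by (simp add: fan_def polydisc_def)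
      then have "eval2 (dz f) (fan N D a t v) = eval2 u (fan N D a t v) * (\<Prod>j<n. eval_fps a t + v * t ^ D - eval_fps (?g j) t)"
        using r(2) elim(1) by (simp add: fan_def)
      also have "(\<Prod>j<n. eval_fps a t + v * t ^ D - eval_fps (?g j) t) = (\<Prod>j<n. t ^ ?m j * h j t v)"
        using elim(2) by (intro prod.cong) auto
      also have "\<dots> = t ^ order_E N D a * (\<Prod>j<n. h j t v)"
        by (simp add: prod.distrib order_E_def power_sum)
      finally show "eval2 u (fan N D a t v) * (\<Prod>j<n. h j t v) = eval2 (dz f) (fan N D a t v) / t ^ order_E N D a"
        using t0 by simp
    qed
  qed
  then have "\<forall>\<^sub>F t in at 0. \<forall>v\<in>ball 0 R. eval2 u (fan N D a t v) * (\<Prod>j<n. h j t v) = eval2 (dz f) (fan N D a t v) / t ^ order_E N D a"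
    by (simp add: eventually_at_filter)
  from uniform_limit_cong[OF this] tot
  show "uniform_limit (ball 0 R) (\<lambda>t v. eval2 (dz f) (fan N D a t v) / t ^ order_E N D a) (lead_P N D a) (at 0)"
    unfolding lim by blast
  have "bounded ((\<lambda>v. eval2 u 0 * (\<Prod>j<n. l j v)) ` ball 0 R)"
    using bounded_linear_image[OF conjunct2[OF pr] bounded_linear_mult_right[of "eval2 u 0"]] by (simp add: image_image)
  then show "bounded (lead_P N D a ` ball 0 R)" unfolding lim .
qed

lemma finite_zeros_lead_P: "finite {v. lead_P N D a v = 0}"
proof (rule finite_subset)
  show "{v. lead_P N D a v = 0} \<subseteq> (\<lambda>j. - fps_nth (a - param N (\<gamma> j)) D) ` {..<n}"
  proof
    fix v assume "v \<in> {v. lead_P N D a v = 0}"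
    then obtain j where j: "j < n" "fps_nth (a - param N (\<gamma> j)) (contact D a (param N (\<gamma> j)))
        + v * (if contact D a (param N (\<gamma> j)) = D then 1 else 0) = 0"
      using unit unfolding lead_P_def unit2_def Let_def by (auto simp del: fps_sub_nth)
    have "contact D a (param N (\<gamma> j)) = D"
    proof (rule ccontr)
      assume "contact D a (param N (\<gamma> j)) \<noteq> D"
      then show False using j(2) contact_less[of D a "param N (\<gamma> j)"] contact_le[of D a "param N (\<gamma> j)"] by simp
    qed
    then have "v = - fps_nth (a - param N (\<gamma> j)) D" using j(2) by (simp add: eq_neg_iff_add_eq_0 add.commute del: fps_sub_nth)
    then show "v \<in> (\<lambda>j. - fps_nth (a - param N (\<gamma> j)) D) ` {..<n}" using j(1) by blast
  qed
qed simp

text \<open>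
  The derivative of \<open>f\<close> in the direction of \<open>v\<close> is \<open>f_z t^D\<close>, and \<open>f_z\<close> is of order \<open>E\<close> uniformly on
  the fan.
\<close>

lemma fan_variation:
  assumes N: "level N" and D: "D > 0" and a: "fps_nth a 0 = 0" "fps_conv_radius a > 0"
  shows "\<exists>K. \<forall>\<^sub>F t in at 0. \<forall>v\<in>ball 0 R. \<forall>w\<in>ball 0 R.
    norm (eval2 f (fan N D a t v) - eval2 f (fan N D a t w)) \<le> K * norm t ^ (D + order_E N D a)"
proof -
  let ?E = "order_E N D a"
  obtain Rf where Rf: "diff_radius f Rf" using ex_diff_radius[OF conv] .
  then have Rf0: "Rf > 0" by (simp add: diff_radius_def)
  obtain d where d: "d > 0" "\<And>t v. norm t < d \<Longrightarrow> v \<in> ball 0 R \<Longrightarrow> fan N D a t v \<in> polydisc Rf"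
    using fan_near_0[OF a levelD(1)[OF N] D Rf0] by metis
  obtain B where B: "\<And>v. v \<in> ball 0 R \<Longrightarrow> norm (lead_P N D a v) \<le> B"
    using dz_fan_limit(2)[OF N D a, of R] unfolding bounded_iff by (metis imageI)
  have ev1: "\<forall>\<^sub>F t in at 0. \<forall>v\<in>ball 0 R. dist (eval2 (dz f) (fan N D a t v) / t ^ ?E) (lead_P N D a v) < 1"
    using uniform_limitD[OF dz_fan_limit(1)[OF N D a]] by simp
  have ev2: "\<forall>\<^sub>F t in at 0. t \<noteq> 0 \<and> norm (t::complex) < d" using d(1) by (auto simp: eventually_at intro!: exI[of _ d])
  have "\<forall>\<^sub>F t in at 0. \<forall>v\<in>ball 0 R. \<forall>w\<in>ball 0 R.
    norm (eval2 f (fan N D a t v) - eval2 f (fan N D a t w)) \<le> ((B + 1) * (2 * \<bar>R\<bar>)) * norm t ^ (D + ?E)"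
    using ev1 ev2
  proof eventually_elim
    case (elim t)
    show ?case
    proof (intro ballI)
      fix v w :: complex assume v: "v \<in> ball 0 R" and w: "w \<in> ball 0 R"
      have der: "((\<lambda>v. eval2 f (fan N D a t v)) has_field_derivative eval2 (dz f) (fan N D a t x) * t ^ D) (at x within ball 0 R)"
        if x: "x \<in> ball 0 R" for x
      proof -
        have "((\<lambda>v. eval2 f (eval_fps a t + v * t ^ D, t ^ N)) has_field_derivative
          eval2 (dz f) (eval_fps a t + x * t ^ D, t ^ N) * t ^ D + eval2 (dw f) (eval_fps a t + x * t ^ D, t ^ N) * 0) (at x)"
          by (rule eval2_curve_derivative[OF Rf])
            (use d(2)[of t x] elim x in \<open>auto intro!: derivative_eq_intros simp: fan_def\<close>)
        then show ?thesis by (simp add: fan_def has_field_derivative_at_within)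
      qed
      have bd: "norm (eval2 (dz f) (fan N D a t x) * t ^ D) \<le> (B + 1) * norm t ^ (D + ?E)" if x: "x \<in> ball 0 R" for x
      proof -
        have "norm (eval2 (dz f) (fan N D a t x) / t ^ ?E) \<le> B + 1"
          using elim(1) x B[OF x] norm_triangle_sub[of "eval2 (dz f) (fan N D a t x) / t ^ ?E" "lead_P N D a x"]
          by (force simp: dist_norm)
        then have "norm (eval2 (dz f) (fan N D a t x)) \<le> (B + 1) * norm t ^ ?E"
          using elim(2) by (simp add: norm_divide norm_power field_simps)
        then have "norm (eval2 (dz f) (fan N D a t x)) * norm t ^ D \<le> ((B + 1) * norm t ^ ?E) * norm t ^ D"
          by (rule mult_right_mono) simp
        then show ?thesis by (simp add: norm_mult norm_power power_add mult_ac)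
      qed
      have "norm (eval2 f (fan N D a t v) - eval2 f (fan N D a t w)) \<le> ((B + 1) * norm t ^ (D + ?E)) * norm (v - w)"
        by (rule field_differentiable_bound[OF convex_ball der bd v w])
      also have "\<dots> \<le> ((B + 1) * norm t ^ (D + ?E)) * (2 * \<bar>R\<bar>)"
      proof (rule mult_left_mono)
        show "norm (v - w) \<le> 2 * \<bar>R\<bar>" using v w norm_triangle_ineq4[of v w] by simp
        show "0 \<le> (B + 1) * norm t ^ (D + ?E)" 
        proof -
          have "0 \<le> B + 1" using B[OF v] norm_ge_zero[of "lead_P N D a v"] by linarith
          then show ?thesis by simp
        qed
      qed
      also have "\<dots> = ((B + 1) * (2 * \<bar>R\<bar>)) * norm t ^ (D + ?E)" by (simp only: mult_ac)
      finally show "norm (eval2 f (fan N D a t v) - eval2 f (fan N D a t w)) \<le> ((B + 1) * (2 * \<bar>R\<bar>)) * norm t ^ (D + ?E)" .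
    qed
  qed
  then show ?thesis by blast
qed

end

section \<open>The canyon degree\<close>

lemma eval2_0: assumes "convergent2 f" shows "eval2 f 0 = coeff2 f 0 0"
proof -
  obtain C s where s: "coeff_bound f C s" using convergent2_imp_coeff_bound[OF assms] .
  then have "(\<lambda>i. eval_fps (fps_nth f i) 0 * 0 ^ i) sums eval2 f (0, 0)"
    using eval2_sums[OF s, of "(0, 0)"] by (auto simp: polydisc_def coeff_bound_def)
  moreover have "(\<lambda>i. eval_fps (fps_nth f i) 0 * 0 ^ i) sums (coeff2 f 0 0)"
    using sums_single[of 0 "\<lambda>i. eval_fps (fps_nth f i) 0"] by (simp add: eval_fps_at_0 power_0_left if_distrib cong: if_cong)
  ultimately show ?thesis using sums_unique2 by (simp add: zero_prod_def)
qed

text \<open>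
  An asymptotic of the function gives the low coefficients of its power series.
\<close>

lemma order_ge_of_limit:
  fixes G :: "complex \<Rightarrow> complex"
  assumes "G has_fps_expansion S" "((\<lambda>t. G t / t ^ p) \<longlongrightarrow> c) (at 0)"
  shows "\<And>i. i < p \<Longrightarrow> fps_nth S i = 0" "fps_nth S p = c"
proof -
  show low: "fps_nth S i = 0" if "i < p" for i
  proof -
    have "\<forall>\<^sub>F t in at 0. norm (G t / t ^ p) < norm c + 1"
      using tendsto_norm[OF assms(2)] by (rule order_tendstoD) simp
    then have "\<forall>\<^sub>F t in at 0. norm (G t) \<le> (norm c + 1) * norm t ^ p"
      using eventually_neq_at_within[of 0 0 UNIV]
      by eventually_elim (simp add: norm_divide norm_power field_simps)
    then show ?thesis by (rule fps_expansion_order_ge[OF assms(1) _ that])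
  qed
  have "((\<lambda>t. G t / t ^ p) \<longlongrightarrow> fps_nth S p) (at 0)" by (rule fps_expansion_leading[OF assms(1) low])
  then show "fps_nth S p = c" using assms(2) by (intro tendsto_unique[of "at (0::complex)"]) auto
qed

lemma subdegree_compose_X_power:
  assumes "M > 0" "b \<noteq> (0 :: complex fps)"
  shows "subdegree (b oo fps_X ^ M) = M * subdegree b" "b oo fps_X ^ M \<noteq> 0"
proof -
  have "fps_nth (b oo fps_X ^ M) (M * subdegree b) \<noteq> 0" using assms by (simp add: fps_nth_compose_X_power)
  moreover have "fps_nth (b oo fps_X ^ M) i = 0" if "i < M * subdegree b" for i
    using that assms by (auto simp: fps_nth_compose_X_power elim!: dvdE)
  ultimately show "subdegree (b oo fps_X ^ M) = M * subdegree b" by (rule subdegreeI)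
  show "b oo fps_X ^ M \<noteq> 0" using \<open>fps_nth (b oo fps_X ^ M) (M * subdegree b) \<noteq> 0\<close> by auto
qed

text \<open>
  Let \<open>\<Phi>\<close>, \<open>FZ\<close>, \<open>FW\<close> be the series of \<open>f\<close>, \<open>f_z\<close>, \<open>f_w\<close> along an arc whose first coordinate has order at
  least \<open>N\<close>. If \<open>f_z\<close> has order at least \<open>H - N\<close>, then comparing coefficients in the chain rule shows
  that the gradient has order at least \<open>H - N\<close>. It has exactly this order if \<open>f\<close> has order \<open>H\<close>.
\<close>

lemma chain_rule_orders:
  fixes \<Phi> FZ FW b :: "complex fps"
  assumes eq: "fps_deriv \<Phi> = FZ * fps_deriv b + FW * (of_nat N * fps_X ^ (N - 1))"
    and N: "N > 0" and b: "\<And>i. i < N \<Longrightarrow> fps_nth b i = 0" and \<Phi>: "\<And>i. i < H \<Longrightarrow> fps_nth \<Phi> i = 0"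
    and FZ: "\<And>i. i < E \<Longrightarrow> fps_nth FZ i = 0" and HE: "H \<le> E + N"
  shows "\<And>i. i + N < H \<Longrightarrow> fps_nth FZ i = 0 \<and> fps_nth FW i = 0"
    and "fps_nth \<Phi> H \<noteq> 0 \<Longrightarrow> H > 0 \<Longrightarrow> N \<le> H \<and> (fps_nth FZ (H - N) \<noteq> 0 \<or> fps_nth FW (H - N) \<noteq> 0)"
proof -
  have db: "fps_nth (fps_deriv b) i = 0" if "i < N - 1" for i using b that by simp
  have w: "fps_nth (FW * (of_nat N * fps_X ^ (N - 1))) j = (if j < N - 1 then 0 else of_nat N * fps_nth FW (j - (N - 1)))" for j
  proof -
    have "FW * (of_nat N * fps_X ^ (N - 1)) = fps_const (of_nat N) * (FW * fps_X ^ (N - 1))" by (simp only: fps_of_nat mult_ac)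
    then show ?thesis by (simp only: fps_mult_left_const_nth fps_X_power_mult_right_nth) simp
  qed
  have coeff: "of_nat (j + 1) * fps_nth \<Phi> (j + 1) = fps_nth (FZ * fps_deriv b) j + (if j < N - 1 then 0 else of_nat N * fps_nth FW (j - (N - 1)))" for j
    using arg_cong[OF eq, of "\<lambda>x. fps_nth x j"] w[of j] by simp
  show "fps_nth FZ i = 0 \<and> fps_nth FW i = 0" if i: "i + N < H" for i
  proof
    show "fps_nth FZ i = 0" using FZ i HE by simp
    have "fps_nth (FZ * fps_deriv b) (i + N - 1) = 0" unfolding fps_mult_nth
    proof (rule sum.neutral, rule ballI)
      fix l assume "l \<in> {0..i + N - 1}"
      then show "fps_nth FZ l * fps_nth (fps_deriv b) (i + N - 1 - l) = 0"
        using FZ[of l] db[of "i + N - 1 - l"] i HE by (cases "l < E") auto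
    qed
    moreover have idx: "i + N - 1 - (N - 1) = i" "\<not> i + N - 1 < N - 1" "i + N - 1 + 1 = i + N" using N by auto
    ultimately have "of_nat (i + N) * fps_nth \<Phi> (i + N) = of_nat N * fps_nth FW i"
      using coeff[of "i + N - 1"] by (simp only: idx if_False add_0_left)
    then show "fps_nth FW i = 0" using \<Phi>[of "i + N"] i N by simp
  qed
  assume top: "fps_nth \<Phi> H \<noteq> 0" and H: "H > 0"
  show "N \<le> H \<and> (fps_nth FZ (H - N) \<noteq> 0 \<or> fps_nth FW (H - N) \<noteq> 0)"
  proof (rule ccontr)
    assume neg: "\<not> ?thesis"
    have "fps_nth (FZ * fps_deriv b) (H - 1) = 0" unfolding fps_mult_nth
    proof (rule sum.neutral, rule ballI)
      fix l assume l: "l \<in> {0..H - 1}"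
      show "fps_nth FZ l * fps_nth (fps_deriv b) (H - 1 - l) = 0"
      proof (cases "H - 1 - l < N - 1")
        case True then show ?thesis using db by simp
      next
        case False
        then have "l \<le> H - N" "N \<le> H" using H l N by auto
        then show ?thesis using FZ[of l] neg HE by (cases "l = H - N") auto
      qed
    qed
    then have "of_nat H * fps_nth \<Phi> H = (if H - 1 < N - 1 then 0 else of_nat N * fps_nth FW (H - 1 - (N - 1)))"
      using coeff[of "H - 1"] H by simp
    also have "\<dots> = 0"
    proof (cases "N \<le> H")
      case True
      then have "H - 1 - (N - 1) = H - N" using N by simp
      then show ?thesis using neg True by auto
    next
      case False
      then have "H - 1 < N - 1" using H by simp
      then show ?thesis by simp
    qed
    finally show False using top H by simp
  qed
qed

lemma add_term_level:
  assumes N: "exponents_over N \<alpha>"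
  shows "param N (add_term \<alpha> v (real D / real N)) = param N \<alpha> + fps_const v * fps_X ^ D"
    and "exponents_over N (add_term \<alpha> v (real D / real N))"
proof -
  have N0: "N > 0" using N by (simp add: exponents_over_def)
  show "param N (add_term \<alpha> v (real D / real N)) = param N \<alpha> + fps_const v * fps_X ^ D"
    using N0 by (intro fps_ext) (auto simp: param_def add_term_def)
  show "exponents_over N (add_term \<alpha> v (real D / real N))"
    using N N0 by (auto simp: exponents_over_def add_term_def)
qed

text \<open>
  A polar on which \<open>f\<close> does not vanish identically, that is, a polar with a finite canyon degree.
\<close>

locale polar_at = polar_family +
  fixes k :: nat
  assumes k: "k < n" and along_nz: "along f (\<gamma> k) \<noteq> 0"
begin

text \<open>
  The order of \<open>f\<close> along the \<open>k\<close>-th polar, in terms of the parameter \<open>t\<close> with \<open>y = t^N\<close>.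
\<close>

definition ord_H :: "nat \<Rightarrow> nat" where
  "ord_H N = (N div m_puiseux (\<gamma> k)) * subdegree (along f (\<gamma> k))"

definition lead_a :: complex where
  "lead_a = fps_nth (along f (\<gamma> k)) (subdegree (along f (\<gamma> k)))"

lemma lead_a_nz: "lead_a \<noteq> 0"
  using along_nz by (simp add: lead_a_def)

lemma ord_H_pos: assumes "level N" shows "ord_H N > 0"
proof -
  have e: "exponents_over N (\<gamma> k)" using levelD(2)[OF assms] k by blast
  have "eval2 f (arc_map (\<gamma> k) 0) = fps_nth (along f (\<gamma> k)) 0"
    using along_expansion[OF conv polar(1)[OF k]] by (rule has_fps_expansion_imp_0_eq_fps_nth_0)
  moreover have "arc_map (\<gamma> k) 0 = 0"
    using param_nth_eq_0[OF polar(1)[OF k], of 0 "m_puiseux (\<gamma> k)"] m_puiseux(3)[OF e]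
    by (simp add: arc_map_def eval_fps_at_0 zero_prod_def)
  ultimately have "fps_nth (along f (\<gamma> k)) 0 = 0" using eval2_0[OF conv] f00 by simp
  then have "subdegree (along f (\<gamma> k)) > 0" using along_nz by (metis gr0I subdegree_eq_0_iff)
  then show ?thesis using param_puiseux(2)[OF e] by (simp add: ord_H_def)
qed

lemma level_limit:
  assumes "level N"
  shows "((\<lambda>t. eval2 f (level_arc N (param N (\<gamma> k)) t) / t ^ ord_H N) \<longlongrightarrow> lead_a) (at 0)"
proof -
  have e: "exponents_over N (\<gamma> k)" using levelD(2)[OF assms] k by blast
  let ?K = "N div m_puiseux (\<gamma> k)" and ?s = "subdegree (along f (\<gamma> k))"
  have K: "?K > 0" by (rule param_puiseux(2)[OF e])
  have 1: "((\<lambda>s. eval2 f (arc_map (\<gamma> k) s) / s ^ ?s) \<longlongrightarrow> lead_a) (at 0)"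
    unfolding lead_a_def
    by (rule fps_expansion_leading[OF along_expansion[OF conv polar(1)[OF k]]]) (rule nth_less_subdegree_zero)
  have "((\<lambda>t::complex. t ^ ?K) \<longlongrightarrow> 0 ^ ?K) (at 0)" by (intro tendsto_intros)
  moreover have "(0::complex) ^ ?K = 0" by (rule power_eq_0_iff[THEN iffD2]) (use K in simp)
  ultimately have "((\<lambda>t::complex. t ^ ?K) \<longlongrightarrow> 0) (at 0)" by (simp only: )
  then have "filterlim (\<lambda>t::complex. t ^ ?K) (at 0) (at 0)"
    using K eventually_neq_at_within[of 0 0 UNIV] unfolding filterlim_at by (auto elim: eventually_mono)
  from filterlim_compose[OF 1 this] show ?thesis
    by (simp add: arc_map_power[OF e] ord_H_def flip: power_mult)
qed

context
  fixes N D :: nat and v :: complex and b \<Phi> FZ FW :: "complex fps"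
  assumes N: "level N" and D: "N \<le> D"
  defines "b \<equiv> param N (\<gamma> k) + fps_const v * fps_X ^ D"
  assumes \<Phi>: "(\<lambda>t. eval2 f (level_arc N b t)) has_fps_expansion \<Phi>"
    and FZ: "(\<lambda>t. eval2 (dz f) (level_arc N b t)) has_fps_expansion FZ"
    and FW: "(\<lambda>t. eval2 (dw f) (level_arc N b t)) has_fps_expansion FW"
begin

lemma fan_level_arc: "\<forall>\<^sub>F t in at 0. fan N D (param N (\<gamma> k)) t v = level_arc N b t"
proof -
  have "(\<lambda>t. eval_fps (param N (\<gamma> k)) t + v * t ^ D) has_fps_expansion b"
    unfolding b_def
    by (intro has_fps_expansion_add has_fps_expansion_cmult_left has_fps_expansion_fps_X_power)
      (use level_param(1)[OF N k] in \<open>simp add: has_fps_expansion_def\<close>)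
  then have "\<forall>\<^sub>F t in nhds 0. eval_fps b t = eval_fps (param N (\<gamma> k)) t + v * t ^ D"
    by (simp add: has_fps_expansion_def)
  then show ?thesis by (auto simp: eventually_at_filter fan_def level_arc_def elim: eventually_mono)
qed

lemma D0: "D > 0" using D levelD(1)[OF N] by simp

lemma b_low: "i < N \<Longrightarrow> fps_nth b i = 0"
  using level_param(2)[OF N k] D by (simp add: b_def)

lemma b_conv: "fps_conv_radius b > 0" "fps_nth b 0 = 0"
proof -
  have "(\<lambda>t. eval_fps (param N (\<gamma> k)) t + v * t ^ D) has_fps_expansion b"
    unfolding b_def
    by (intro has_fps_expansion_add has_fps_expansion_cmult_left has_fps_expansion_fps_X_power)
      (use level_param(1)[OF N k] in \<open>simp add: has_fps_expansion_def\<close>)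
  then show "fps_conv_radius b > 0" by (simp add: has_fps_expansion_def)
  show "fps_nth b 0 = 0" using b_low levelD(1)[OF N] by simp
qed

lemma FZ_limit: "((\<lambda>t. eval2 (dz f) (level_arc N b t) / t ^ order_E N D (param N (\<gamma> k))) \<longlongrightarrow> lead_P N D (param N (\<gamma> k)) v) (at 0)"
proof -
  have "v \<in> ball 0 (norm v + 1)" by simp
  from tendsto_uniform_limitI[OF dz_fan_limit(1)[OF N D0 level_param(3,1)[OF N k]] this]
  show ?thesis
    by (rule Lim_transform_eventually) (use fan_level_arc in \<open>eventually_elim, simp\<close>)
qed

lemma FZ_coeffs:
  "\<And>i. i < order_E N D (param N (\<gamma> k)) \<Longrightarrow> fps_nth FZ i = 0"
  "fps_nth FZ (order_E N D (param N (\<gamma> k))) = lead_P N D (param N (\<gamma> k)) v"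
  using order_ge_of_limit[OF FZ FZ_limit] by auto

text \<open>
  Adding \<open>v y^(D/N)\<close> to the polar changes \<open>f\<close> by \<open>O(t^(D + E))\<close>, which does not affect the leading
  coefficient as long as \<open>H < D + E\<close>.
\<close>

lemma \<Phi>_coeffs:
  assumes HE: "ord_H N \<le> order_E N D (param N (\<gamma> k)) + N"
  shows "\<And>i. i < ord_H N \<Longrightarrow> fps_nth \<Phi> i = 0"
    and "ord_H N < D + order_E N D (param N (\<gamma> k)) \<Longrightarrow> fps_nth \<Phi> (ord_H N) = lead_a"
proof -
  let ?a = "param N (\<gamma> k)"
  let ?E = "order_E N D ?a"
  obtain \<Phi>0 where \<Phi>0: "(\<lambda>t. eval2 f (level_arc N ?a t)) has_fps_expansion \<Phi>0"
    using ex_level_expansion[OF conv level_param(3,1)[OF N k] levelD(1)[OF N]] by blast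
  note c0 = order_ge_of_limit[OF \<Phi>0 level_limit[OF N]]
  obtain K where K: "\<forall>\<^sub>F t in at 0. \<forall>x\<in>ball 0 (norm v + 1). \<forall>w\<in>ball 0 (norm v + 1).
    norm (eval2 f (fan N D ?a t x) - eval2 f (fan N D ?a t w)) \<le> K * norm t ^ (D + ?E)"
    using fan_variation[OF N D0 level_param(3,1)[OF N k]] by blast
  have f0: "fan N D ?a t 0 = level_arc N ?a t" for t by (simp add: fan_def level_arc_def)
  have ev: "\<forall>\<^sub>F t in at 0. norm (eval2 f (level_arc N b t) - eval2 f (level_arc N ?a t)) \<le> K * norm t ^ (D + ?E)"
    using K fan_level_arc
  proof eventually_elim
    case (elim t)
    have "norm (eval2 f (fan N D ?a t v) - eval2 f (fan N D ?a t 0)) \<le> K * norm t ^ (D + ?E)"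
      by (rule elim(1)[rule_format]) (auto simp: add_nonneg_pos)
    then show ?case unfolding f0 elim(2) .
  qed
  have diff: "fps_nth \<Phi> i = fps_nth \<Phi>0 i" if "i < D + ?E" for i
    using fps_expansion_order_ge[OF has_fps_expansion_diff[OF \<Phi> \<Phi>0] ev that] by simp
  show "fps_nth \<Phi> i = 0" if "i < ord_H N" for i using that diff c0(1) HE D by simp
  show "fps_nth \<Phi> (ord_H N) = lead_a" if "ord_H N < D + ?E" using that diff c0(2) by simp
qed

lemmas chain_rule_b = level_chain_rule[OF conv b_conv(2,1) levelD(1)[OF N] \<Phi> FZ FW]

text \<open>
  If \<open>f_z\<close> vanishes to sufficiently high order, \<open>H \<le> E + N\<close>, then the gradient along the deformed arc
  still has the order \<open>H - N\<close> that it has along the polar. In the boundary case \<open>H = D + E\<close>, where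
  \<open>f\<close> itself may change its leading term, \<open>f_z\<close> provides the term of order \<open>H - N = E\<close>.
\<close>

lemma grad_order_fan:
  assumes HE: "ord_H N \<le> order_E N D (param N (\<gamma> k)) + N"
    and top: "ord_H N < D + order_E N D (param N (\<gamma> k)) \<or> lead_P N D (param N (\<gamma> k)) v \<noteq> 0"
  shows "N \<le> ord_H N" "grad_order f (add_term (\<gamma> k) v (real D / real N)) = ereal (real (ord_H N - N) / real N)"
proof -
  let ?E = "order_E N D (param N (\<gamma> k))"
  note low = chain_rule_orders(1)[OF chain_rule_b levelD(1)[OF N] b_low \<Phi>_coeffs(1)[OF HE] FZ_coeffs(1) HE]
  have t: "N \<le> ord_H N \<and> (fps_nth FZ (ord_H N - N) \<noteq> 0 \<or> fps_nth FW (ord_H N - N) \<noteq> 0)"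
  proof (cases "ord_H N < D + ?E")
    case True
    then have "fps_nth \<Phi> (ord_H N) \<noteq> 0" using \<Phi>_coeffs(2)[OF HE] lead_a_nz by simp
    then show ?thesis
      using chain_rule_orders(2)[OF chain_rule_b levelD(1)[OF N] b_low \<Phi>_coeffs(1)[OF HE] FZ_coeffs(1) HE] ord_H_pos[OF N]
      by blast
  next
    case False
    then have "ord_H N = ?E + N" using HE D by simp
    then show ?thesis using top False FZ_coeffs(2) by simp
  qed
  then show "N \<le> ord_H N" by simp
  have e: "exponents_over N (\<gamma> k)" using levelD(2)[OF N] k by blast
  show "grad_order f (add_term (\<gamma> k) v (real D / real N)) = ereal (real (ord_H N - N) / real N)"
  proof (rule grad_order_eq[OF add_term_level(2)[OF e]])
    show "(\<lambda>t. eval2 (dz f) (level_arc N (param N (add_term (\<gamma> k) v (real D / real N))) t)) has_fps_expansion FZ"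
      "(\<lambda>t. eval2 (dw f) (level_arc N (param N (add_term (\<gamma> k) v (real D / real N))) t)) has_fps_expansion FW"
      using FZ FW unfolding add_term_level(1)[OF e] b_def by auto
    show "fps_nth FZ i = 0 \<and> fps_nth FW i = 0" if "i < ord_H N - N" for i using low[of i] that by simp
    show "fps_nth FZ (ord_H N - N) \<noteq> 0 \<or> fps_nth FW (ord_H N - N) \<noteq> 0" using t by simp
  qed
qed

text \<open>
  If \<open>E + N < H\<close>, then \<open>f_z\<close> dominates and lowers the order of the gradient for generic \<open>v\<close>.
\<close>

lemma grad_order_fan_less:
  assumes E: "order_E N D (param N (\<gamma> k)) + N < ord_H N" and P: "lead_P N D (param N (\<gamma> k)) v \<noteq> 0"
  shows "grad_order f (add_term (\<gamma> k) v (real D / real N)) \<noteq> ereal (real (ord_H N - N) / real N)"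
proof -
  let ?E = "order_E N D (param N (\<gamma> k))"
  let ?p = "LEAST i. fps_nth FZ i \<noteq> 0 \<or> fps_nth FW i \<noteq> 0"
  have ex: "fps_nth FZ ?E \<noteq> 0 \<or> fps_nth FW ?E \<noteq> 0" using FZ_coeffs(2) P by simp
  have e: "exponents_over N (\<gamma> k)" using levelD(2)[OF N] k by blast
  have "grad_order f (add_term (\<gamma> k) v (real D / real N)) = ereal (real ?p / real N)"
  proof (rule grad_order_eq[OF add_term_level(2)[OF e]])
    show "(\<lambda>t. eval2 (dz f) (level_arc N (param N (add_term (\<gamma> k) v (real D / real N))) t)) has_fps_expansion FZ"
      "(\<lambda>t. eval2 (dw f) (level_arc N (param N (add_term (\<gamma> k) v (real D / real N))) t)) has_fps_expansion FW"
      using FZ FW unfolding add_term_level(1)[OF e] b_def by auto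
    show "fps_nth FZ i = 0 \<and> fps_nth FW i = 0" if "i < ?p" for i using not_less_Least[OF that] by simp
    show "fps_nth FZ ?p \<noteq> 0 \<or> fps_nth FW ?p \<noteq> 0" by (rule LeastI) (rule ex)
  qed
  moreover have "?p \<le> ?E" by (rule Least_le) (rule ex)
  ultimately show ?thesis using E levelD(1)[OF N] by auto
qed

end

lemma ex_expansions:
  assumes N: "level N" and D: "N \<le> D"
  obtains \<Phi> FZ FW where
    "(\<lambda>t. eval2 f (level_arc N (param N (\<gamma> k) + fps_const v * fps_X ^ D) t)) has_fps_expansion \<Phi>"
    "(\<lambda>t. eval2 (dz f) (level_arc N (param N (\<gamma> k) + fps_const v * fps_X ^ D) t)) has_fps_expansion FZ"
    "(\<lambda>t. eval2 (dw f) (level_arc N (param N (\<gamma> k) + fps_const v * fps_X ^ D) t)) has_fps_expansion FW"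
proof -
  let ?b = "param N (\<gamma> k) + fps_const v * fps_X ^ D"
  have "(\<lambda>t. eval_fps (param N (\<gamma> k)) t + v * t ^ D) has_fps_expansion ?b"
    by (intro has_fps_expansion_add has_fps_expansion_cmult_left has_fps_expansion_fps_X_power)
      (use level_param(1)[OF N k] in \<open>simp add: has_fps_expansion_def\<close>)
  then have 1: "fps_conv_radius ?b > 0" by (simp add: has_fps_expansion_def)
  have 2: "fps_nth ?b 0 = 0" using level_param(3)[OF N k] levelD(1)[OF N] D by simp
  note ex = ex_level_expansion[OF _ 2 1 levelD(1)[OF N]]
  show ?thesis
    using that ex[OF conv] ex[OF convergent2_dz[OF conv]] ex[OF convergent2_dw[OF conv]] by blast
qed

text \<open>
  The polar itself is the deformation with \<open>v = 0\<close>. For large \<open>D\<close> the order \<open>E\<close> is large, since the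
  contact of the polar with itself is \<open>D\<close>.
\<close>

lemma grad_order_polar:
  assumes N: "level N"
  shows "N \<le> ord_H N" "grad_order f (\<gamma> k) = ereal (real (ord_H N - N) / real N)"
proof -
  \<comment> \<open>Large enough for \<open>H \<le> E + N\<close> and \<open>H < D + E\<close>.\<close>
  let ?D = "ord_H N + N + 1" and ?a = "param N (\<gamma> k)"
  have ND: "N \<le> ?D" by simp
  have "contact ?D ?a ?a \<le> order_E N ?D ?a"
    unfolding order_E_def by (rule member_le_sum[of k]) (use k in auto)
  then have E: "?D \<le> order_E N ?D ?a" by (simp add: contact_def)
  obtain \<Phi> FZ FW where ex:
    "(\<lambda>t. eval2 f (level_arc N (?a + fps_const 0 * fps_X ^ ?D) t)) has_fps_expansion \<Phi>"
    "(\<lambda>t. eval2 (dz f) (level_arc N (?a + fps_const 0 * fps_X ^ ?D) t)) has_fps_expansion FZ"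
    "(\<lambda>t. eval2 (dw f) (level_arc N (?a + fps_const 0 * fps_X ^ ?D) t)) has_fps_expansion FW"
    using ex_expansions[OF N ND, of 0] by metis
  have add0: "add_term (\<gamma> k) 0 q = \<gamma> k" for q by (simp add: add_term_def)
  show "N \<le> ord_H N" "grad_order f (\<gamma> k) = ereal (real (ord_H N - N) / real N)"
    using grad_order_fan[OF N ND ex] E unfolding add0 by auto
qed

text \<open>
  For the exponent \<open>D / N\<close>, the condition in the definition of the canyon degree compares two integers.
\<close>

lemma generic_grad_order:
  assumes N: "level N" and D: "N \<le> D"
  shows "(\<forall>\<^sub>F v in cofinite. grad_order f (\<gamma> k) = grad_order f (add_term (\<gamma> k) v (real D / real N)))
    \<longleftrightarrow> ord_H N \<le> order_E N D (param N (\<gamma> k)) + N"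
proof -
  let ?a = "param N (\<gamma> k)"
  have gen: "\<forall>\<^sub>F v in cofinite. lead_P N D ?a v \<noteq> 0"
    using finite_zeros_lead_P by (simp add: eventually_cofinite)
  show ?thesis
  proof
    assume HE: "ord_H N \<le> order_E N D ?a + N"
    show "\<forall>\<^sub>F v in cofinite. grad_order f (\<gamma> k) = grad_order f (add_term (\<gamma> k) v (real D / real N))"
      using gen
    proof eventually_elim
      case (elim v)
      obtain \<Phi> FZ FW where ex:
        "(\<lambda>t. eval2 f (level_arc N (?a + fps_const v * fps_X ^ D) t)) has_fps_expansion \<Phi>"
        "(\<lambda>t. eval2 (dz f) (level_arc N (?a + fps_const v * fps_X ^ D) t)) has_fps_expansion FZ"
        "(\<lambda>t. eval2 (dw f) (level_arc N (?a + fps_const v * fps_X ^ D) t)) has_fps_expansion FW"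
        using ex_expansions[OF N D, of v] by metis
      show ?case using grad_order_fan(2)[OF N D ex HE] grad_order_polar(2)[OF N] elim by simp
    qed
  next
    assume ev: "\<forall>\<^sub>F v in cofinite. grad_order f (\<gamma> k) = grad_order f (add_term (\<gamma> k) v (real D / real N))"
    show "ord_H N \<le> order_E N D ?a + N"
    proof (rule ccontr)
      assume neg: "\<not> ?thesis"
      have "\<forall>\<^sub>F v::complex in cofinite. False"
        using ev gen
      proof eventually_elim
        case (elim v)
        obtain \<Phi> FZ FW where ex:
          "(\<lambda>t. eval2 f (level_arc N (?a + fps_const v * fps_X ^ D) t)) has_fps_expansion \<Phi>"
          "(\<lambda>t. eval2 (dz f) (level_arc N (?a + fps_const v * fps_X ^ D) t)) has_fps_expansion FZ"
          "(\<lambda>t. eval2 (dw f) (level_arc N (?a + fps_const v * fps_X ^ D) t)) has_fps_expansion FW"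
          using ex_expansions[OF N D, of v] by metis
        show ?case using grad_order_fan_less[OF N D ex] grad_order_polar(2)[OF N] elim neg by simp
      qed
      then show False by (simp add: eventually_cofinite infinite_UNIV_char_0)
    qed
  qed
qed

text \<open>
  The value is meaningful only for \<open>\<gamma> j \<noteq> \<gamma> k\<close>; for equal series the subdegree of \<open>0\<close> yields \<open>0\<close>.
\<close>

definition contact_exp :: "nat \<Rightarrow> real" where
  "contact_exp j = real (subdegree (param N0 (\<gamma> k) - param N0 (\<gamma> j))) / real N0"

text \<open>
  The order in \<open>y\<close> of \<open>f_z\<close> along \<open>\<gamma> k\<close> plus a generic multiple of \<open>y^q\<close>. It is a piecewise linear
  function of a real number \<open>q\<close>, independent of a denominator.
\<close>

definition fz_order :: "real \<Rightarrow> real" where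
  "fz_order q = (\<Sum>j<n. if param N0 (\<gamma> k) = param N0 (\<gamma> j) then q else min q (contact_exp j))"

definition f_order :: real where
  "f_order = real (subdegree (along f (\<gamma> k))) / real (m_puiseux (\<gamma> k))"

lemma ord_H_f_order: assumes "level N" shows "real (ord_H N) = real N * f_order"
proof -
  have e: "exponents_over N (\<gamma> k)" using levelD(2)[OF assms] k by blast
  then show ?thesis using m_puiseux[OF e] by (auto simp: ord_H_def f_order_def elim!: dvdE)
qed

lemma order_E_fz_order:
  assumes N: "level N" and D: "real D = q * real N"
  shows "real (order_E N D (param N (\<gamma> k))) = real N * fz_order q"
proof -
  obtain M where M: "M > 0" "N = N0 * M" using N by (auto simp: level_def)
  have "real (contact D (param N (\<gamma> k)) (param N (\<gamma> j)))
      = real N * (if param N0 (\<gamma> k) = param N0 (\<gamma> j) then q else min q (contact_exp j))" if j: "j < n" for j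
  proof -
    let ?d = "param N0 (\<gamma> k) - param N0 (\<gamma> j)"
    have pk: "param N (\<gamma> j) = param N0 (\<gamma> j) oo fps_X ^ M" if "j < n" for j
      using param_mult[OF polar(2)[OF that] M(1)] M(2) by simp
    have d: "param N (\<gamma> k) - param N (\<gamma> j) = ?d oo fps_X ^ M"
      using pk[OF k] pk[OF j] by (simp add: fps_compose_sub_distrib)
    show ?thesis
    proof (cases "param N0 (\<gamma> k) = param N0 (\<gamma> j)")
      case True
      then show ?thesis using pk[OF k] pk[OF j] D by (simp add: contact_def)
    next
      case False
      then have nz: "?d \<noteq> 0" by simp
      have "param N (\<gamma> k) \<noteq> param N (\<gamma> j)" using subdegree_compose_X_power(2)[OF M(1) nz] d by auto
      then have "real (contact D (param N (\<gamma> k)) (param N (\<gamma> j))) = min (q * real N) (real M * real (subdegree ?d))"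
        unfolding contact_def d using subdegree_compose_X_power(1)[OF M(1) nz] D by (simp add: of_nat_min)
      also have "\<dots> = real N * min q (contact_exp j)"
        using M N0 by (auto simp: contact_exp_def min_def field_simps)
      finally show ?thesis using False by simp
    qed
  qed
  then show ?thesis by (simp add: order_E_def fz_order_def sum_distrib_left)
qed

lemma ex_level_of_rational:
  assumes "q \<in> \<rat>" "q \<ge> 1"
  obtains N D where "level N" "N \<le> D" "real D = q * real N"
proof -
  obtain a b where ab: "b \<noteq> 0" "q = real a / real b"
    using Rats_abs_nat_div_natE[OF assms(1)] assms(2) by (metis abs_of_nonneg order_trans zero_le_one)
  have b: "b > 0" using ab by simp
  have "real b \<le> real a" using assms(2) ab b by (simp add: field_simps)
  then have "N0 * b \<le> N0 * a" by simp
  then show ?thesis using that[of "N0 * b" "N0 * a"] ab b by (auto simp: level_def)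
qed

theorem generic_iff_fz_order:
  assumes "q \<in> \<rat>" "q \<ge> 1"
  shows "(\<forall>\<^sub>F v in cofinite. grad_order f (\<gamma> k) = grad_order f (add_term (\<gamma> k) v q)) \<longleftrightarrow> f_order \<le> fz_order q + 1"
proof -
  obtain N D where ND: "level N" "N \<le> D" "real D = q * real N" using ex_level_of_rational[OF assms] .
  have N0: "real N > 0" using levelD(1)[OF ND(1)] by simp
  then have "q = real D / real N" using ND by simp
  then have "(\<forall>\<^sub>F v in cofinite. grad_order f (\<gamma> k) = grad_order f (add_term (\<gamma> k) v q)) \<longleftrightarrow> ord_H N \<le> order_E N D (param N (\<gamma> k)) + N"
    using generic_grad_order[OF ND(1,2)] by simp
  also have "\<dots> \<longleftrightarrow> real (ord_H N) \<le> real (order_E N D (param N (\<gamma> k))) + real N" by (metis of_nat_add of_nat_le_iff)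
  also have "\<dots> \<longleftrightarrow> real N * f_order \<le> real N * (fz_order q + 1)"
    using ord_H_f_order[OF ND(1)] order_E_fz_order[OF ND(1,3)] by (simp add: algebra_simps)
  also have "\<dots> \<longleftrightarrow> f_order \<le> fz_order q + 1" using N0 by simp
  finally show ?thesis .
qed

text \<open>
  The summand \<open>j = k\<close> is \<open>q\<close> itself, and the others are nondecreasing.
\<close>

lemma fz_order_strict_mono: assumes "p < q" shows "fz_order p < fz_order q"
  unfolding fz_order_def
proof (rule sum_strict_mono_ex1)
  show "\<exists>j\<in>{..<n}. (if param N0 (\<gamma> k) = param N0 (\<gamma> j) then p else min p (contact_exp j))
      < (if param N0 (\<gamma> k) = param N0 (\<gamma> j) then q else min q (contact_exp j))"
    using k assms by (intro bexI[of _ k]) auto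
qed (use assms in auto)

lemma continuous_fz_order: "continuous_on A fz_order"
proof -
  have "continuous_on A (\<lambda>q. if param N0 (\<gamma> k) = param N0 (\<gamma> j) then q else min q (contact_exp j))" for j
    by (cases "param N0 (\<gamma> k) = param N0 (\<gamma> j)") (auto intro: continuous_intros)
  then show ?thesis unfolding fz_order_def[abs_def] by (intro continuous_on_sum)
qed

lemma fz_order_ge: assumes "q \<ge> 0" shows "q \<le> fz_order q"
proof -
  have "(if param N0 (\<gamma> k) = param N0 (\<gamma> k) then q else min q (contact_exp k)) \<le> fz_order q"
    unfolding fz_order_def by (rule member_le_sum[of k]) (use k assms in \<open>auto simp: contact_exp_def\<close>)
  then show ?thesis by simp
qed

text \<open>
  On each of its linear pieces the function has integer slope, which is positive, and rational
  constant term. This shows that the real solution found by the intermediate value theorem is a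
  rational exponent.
\<close>

lemma fz_order_rational:
  assumes "fz_order d \<in> \<rat>" shows "d \<in> \<rat>"
proof -
  \<comment> \<open>The polars in \<open>?I\<close> contribute slope \<open>1\<close> to the left of \<open>d\<close>, those in \<open>?J\<close> contribute constants.\<close>
  let ?I = "{j. j < n \<and> (param N0 (\<gamma> k) = param N0 (\<gamma> j) \<or> d \<le> contact_exp j)}"
  let ?J = "{j. j < n \<and> \<not> (param N0 (\<gamma> k) = param N0 (\<gamma> j) \<or> d \<le> contact_exp j)}"
  have fin: "finite ?I" "finite ?J" by auto
  have "fz_order d = (\<Sum>j\<in>?I \<union> ?J. if param N0 (\<gamma> k) = param N0 (\<gamma> j) then d else min d (contact_exp j))"
    unfolding fz_order_def by (intro sum.cong) auto
  also have "\<dots> = (\<Sum>j\<in>?I. if param N0 (\<gamma> k) = param N0 (\<gamma> j) then d else min d (contact_exp j))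
      + (\<Sum>j\<in>?J. if param N0 (\<gamma> k) = param N0 (\<gamma> j) then d else min d (contact_exp j))"
    by (rule sum.union_disjoint) (use fin in auto)
  also have "(\<Sum>j\<in>?I. if param N0 (\<gamma> k) = param N0 (\<gamma> j) then d else min d (contact_exp j)) = (\<Sum>j\<in>?I. d)"
    by (intro sum.cong) auto
  also have "(\<Sum>j\<in>?J. if param N0 (\<gamma> k) = param N0 (\<gamma> j) then d else min d (contact_exp j)) = (\<Sum>j\<in>?J. contact_exp j)"
    by (intro sum.cong) auto
  finally have eq: "fz_order d = real (card ?I) * d + (\<Sum>j\<in>?J. contact_exp j)" by simp
  have "contact_exp j \<in> \<rat>" for j unfolding contact_exp_def by (intro Rats_divide Rats_of_nat)
  then have r: "(\<Sum>j\<in>?J. contact_exp j) \<in> \<rat>" by (intro Rats_sum)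
  have "k \<in> ?I" using k by simp
  then have c: "card ?I \<noteq> 0" using fin by (metis card_0_eq empty_iff)
  have "d = (fz_order d - (\<Sum>j\<in>?J. contact_exp j)) / real (card ?I)" using eq c by (simp add: field_simps)
  also have "\<dots> \<in> \<rat>" using assms r by (intro Rats_divide Rats_diff Rats_of_nat)
  finally show ?thesis .
qed

text \<open>
  The set of admissible exponents \<open>q\<close> is given by \<open>f_order \<le> fz_order q + 1\<close>. Since \<open>fz_order\<close> is
  continuous and strictly increasing, equality holds at the least element, provided that this element
  is not the lower end \<open>q = 1\<close>.
\<close>

theorem canyon_degree:
  assumes "1 < d_gr f (\<gamma> k)"
  obtains d where "d_gr f (\<gamma> k) = ereal d" "d \<in> \<rat>" "d > 1" "fz_order d + 1 = f_order"
proof -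
  let ?Q = "\<lambda>q. q \<in> \<rat> \<and> 1 \<le> q \<and> (\<forall>\<^sub>F v in cofinite. grad_order f (\<gamma> k) = grad_order f (add_term (\<gamma> k) v q))"
  have Q: "?Q q \<longleftrightarrow> q \<in> \<rat> \<and> 1 \<le> q \<and> f_order \<le> fz_order q + 1" for q using generic_iff_fz_order by blast
  have dgr: "d_gr f (\<gamma> k) = ereal (LEAST q. ?Q q)" using along_nz by (simp add: d_gr_def)
  have h1: "\<not> f_order \<le> fz_order 1 + 1"
  proof
    assume "f_order \<le> fz_order 1 + 1"
    then have "?Q 1" unfolding Q by simp
    then have "(LEAST q. ?Q q) = 1" by (rule Least_equality) simp
    then show False using assms dgr by simp
  qed
  have "1 \<le> fz_order 1" by (rule fz_order_ge) simp
  then have hp: "f_order > 1" using h1 by simp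
  have "\<exists>d. 1 \<le> d \<and> d \<le> f_order \<and> fz_order d = f_order - 1"
  proof (rule IVT')
    show "fz_order 1 \<le> f_order - 1" using h1 by simp
    show "f_order - 1 \<le> fz_order f_order" using fz_order_ge[of f_order] hp by simp
  qed (use hp continuous_fz_order in auto)
  then obtain d where d: "1 \<le> d" "fz_order d = f_order - 1" by blast
  have "f_order \<in> \<rat>" unfolding f_order_def by (intro Rats_divide Rats_of_nat)
  then have dr: "d \<in> \<rat>" using fz_order_rational[of d] d(2) by (simp add: Rats_diff)
  have "d \<noteq> 1" using d(2) h1 by auto
  then have d1: "d > 1" using d by simp
  have "(LEAST q. ?Q q) = d"
  proof (rule Least_equality)
    show "?Q d" unfolding Q using d dr by simp
    fix y assume "?Q y"
    then have "f_order \<le> fz_order y + 1" unfolding Q by simp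
    then show "d \<le> y" using fz_order_strict_mono[of y d] d(2) by (cases "y < d") auto
  qed
  then show ?thesis using that[of d] dgr dr d1 d(2) by simp
qed

end

section \<open>Conjugate polars\<close>

text \<open>
  Replacing \<open>y^(1/N)\<close> by \<open>\<theta> y^(1/N)\<close>, that is, passing to a conjugate series.
\<close>

definition rotate_fps :: "complex \<Rightarrow> complex fps \<Rightarrow> complex fps" where
  "rotate_fps \<theta> b = b oo (fps_const \<theta> * fps_X)"

lemma rotate_fps_nth [simp]: "fps_nth (rotate_fps \<theta> b) i = fps_nth b i * \<theta> ^ i"
  unfolding rotate_fps_def fps_compose_linear by simp

lemma eval_rotate_fps: "eval_fps (rotate_fps \<theta> b) t = eval_fps b (\<theta> * t)"
  by (simp add: eval_fps_def power_mult_distrib mult.assoc)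

lemma rotate_fps_has_expansion:
  assumes "fps_conv_radius b > 0"
  shows "(\<lambda>t. eval_fps b (\<theta> * t)) has_fps_expansion rotate_fps \<theta> b"
proof -
  have "(\<lambda>t. \<theta> * t) has_fps_expansion (fps_const \<theta> * fps_X)"
    by (intro has_fps_expansion_cmult_left has_fps_expansion_fps_X)
  then have "(eval_fps b \<circ> (\<lambda>t. \<theta> * t)) has_fps_expansion (b oo (fps_const \<theta> * fps_X))"
    by (intro has_fps_expansion_compose) (use assms in \<open>auto simp: has_fps_expansion_def\<close>)
  then show ?thesis by (simp add: o_def rotate_fps_def)
qed

lemma level_arc_mult:
  assumes "\<theta> ^ N = 1"
  shows "level_arc N (rotate_fps \<theta> b) t = level_arc N b (\<theta> * t)"
  using assms by (simp add: level_arc_def eval_rotate_fps power_mult_distrib)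

text \<open>
  If the arcs coincide as germs, then for every small \<open>t\<close> the value \<open>\<alpha>(t^N)\<close> is \<open>\<beta>\<close> at some rotation
  of \<open>t\<close>. As there are finitely many rotations, one of them occurs for \<open>t\<close> accumulating at \<open>0\<close>, and the
  identity theorem applies to it.
\<close>

lemma arc_eq_iff:
  assumes \<alpha>: "\<alpha> \<in> puiseux1" "exponents_over N \<alpha>" and \<beta>: "\<beta> \<in> puiseux1" "exponents_over N \<beta>"
  shows "arc \<alpha> = arc \<beta> \<longleftrightarrow> (\<exists>\<theta>. \<theta> ^ N = 1 \<and> param N \<alpha> = rotate_fps \<theta> (param N \<beta>))"
proof
  have N: "N > 0" using \<alpha> by (simp add: exponents_over_def)
  assume "\<exists>\<theta>. \<theta> ^ N = 1 \<and> param N \<alpha> = rotate_fps \<theta> (param N \<beta>)"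
  then obtain \<theta> where \<theta>: "\<theta> ^ N = 1" "param N \<alpha> = rotate_fps \<theta> (param N \<beta>)" by blast
  have nz: "\<theta> \<noteq> 0" using \<theta>(1) N by (auto simp: power_0_left)
  have "range (level_arc N (param N \<alpha>)) = range (level_arc N (param N \<beta>))"
  proof
    show "range (level_arc N (param N \<alpha>)) \<subseteq> range (level_arc N (param N \<beta>))"
      unfolding \<theta>(2) using level_arc_mult[OF \<theta>(1)] by auto
    show "range (level_arc N (param N \<beta>)) \<subseteq> range (level_arc N (param N \<alpha>))"
    proof
      fix p assume "p \<in> range (level_arc N (param N \<beta>))"
      then obtain t where "p = level_arc N (param N \<beta>) t" by auto
      then have "p = level_arc N (param N \<alpha>) (t / \<theta>)"
        unfolding \<theta>(2) level_arc_mult[OF \<theta>(1)] using nz by simp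
      then show "p \<in> range (level_arc N (param N \<alpha>))" by simp
    qed
  qed
  then show "arc \<alpha> = arc \<beta>" unfolding arc_def range_arc_map[OF \<alpha>(2)] range_arc_map[OF \<beta>(2)] by simp
next
  have N: "N > 0" using \<alpha> by (simp add: exponents_over_def)
  let ?a = "param N \<alpha>" and ?b = "param N \<beta>"
  have a: "fps_nth ?a 0 = 0" "fps_conv_radius ?a > 0" and b: "fps_conv_radius ?b > 0"
    using param_nth_eq_0[OF \<alpha>(1), of 0 N] N conv_radius_param_pos[OF \<alpha>] conv_radius_param_pos[OF \<beta>] by auto
  assume eq: "arc \<alpha> = arc \<beta>"
  let ?A = "range (level_arc N ?a)" and ?B = "range (level_arc N ?b)"
  have "set_germ ?A = set_germ ?B"
    using eq unfolding arc_def range_arc_map[OF \<alpha>(2)] range_arc_map[OF \<beta>(2)] .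
  moreover have "?A \<in> set_germ ?A" by (simp add: set_germ_def)
  ultimately have "\<forall>\<^sub>F p in nhds 0. p \<in> ?B \<longleftrightarrow> p \<in> ?A" by (simp add: set_germ_def)
  then obtain e where e: "e > 0" "\<And>p. norm p < e \<Longrightarrow> p \<in> ?B \<longleftrightarrow> p \<in> ?A"
    unfolding eventually_nhds_metric by (auto simp: dist_norm)
  obtain d c where d: "d > 0" "\<And>t. norm t < d \<Longrightarrow> level_arc N ?a t \<in> polydisc (e / 2)"
    using level_arc_near_0[OF a N, of "e/2"] e(1) by (metis half_gt_zero)
  have ex: "\<exists>\<theta>\<in>{\<theta>. \<theta> ^ N = 1}. eval_fps ?a t = eval_fps ?b (\<theta> * t)" if t: "t \<noteq> 0" "norm t < d" for t
  proof -
    have "norm (level_arc N ?a t) < e"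
      using d(2)[OF t(2)] norm_Pair_le[of "fst (level_arc N ?a t)" "snd (level_arc N ?a t)"] by (auto simp: polydisc_def)
    then have "level_arc N ?a t \<in> ?B" using e(2) by blast
    then obtain s where s: "eval_fps ?a t = eval_fps ?b s" "t ^ N = s ^ N" by (auto simp: level_arc_def)
    have "(s / t) ^ N = 1" unfolding power_divide s(2)[symmetric] using t(1) by simp
    then show ?thesis using t(1) s(1) by (intro bexI[of _ "s / t"]) auto
  qed
  have "\<forall>\<^sub>F t in at 0. \<exists>\<theta>\<in>{\<theta>. \<theta> ^ N = 1}. eval_fps ?a t = eval_fps ?b (\<theta> * t)"
    unfolding eventually_at using d(1) ex by (intro exI[of _ d]) auto
  then have fr0: "\<exists>\<^sub>F t in at 0. \<exists>\<theta>\<in>{\<theta>. \<theta> ^ N = 1}. eval_fps ?a t = eval_fps ?b (\<theta> * t)"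
    by (rule eventually_frequently[rotated]) simp
  have "finite {\<theta>::complex. \<theta> ^ N = 1}" using finite_roots_unity[of N] N by simp
  from frequently_bex_finite[OF this fr0]
  obtain \<theta> where \<theta>: "\<theta> ^ N = 1" and fr: "\<exists>\<^sub>F t in at 0. eval_fps ?a t = eval_fps ?b (\<theta> * t)"
    by auto
  have "?a = rotate_fps \<theta> ?b"
  proof (rule ccontr)
    assume ne: "?a \<noteq> rotate_fps \<theta> ?b"
    let ?g = "?a - rotate_fps \<theta> ?b"
    have "(\<lambda>t. eval_fps ?a t - eval_fps ?b (\<theta> * t)) has_fps_expansion ?g"
      by (intro has_fps_expansion_diff rotate_fps_has_expansion b) (use a(2) in \<open>simp add: has_fps_expansion_def\<close>)
    then have "((\<lambda>t. (eval_fps ?a t - eval_fps ?b (\<theta> * t)) / t ^ subdegree ?g) \<longlongrightarrow> fps_nth ?g (subdegree ?g)) (at 0)"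
      by (rule fps_expansion_leading) (rule nth_less_subdegree_zero)
    moreover have "fps_nth ?g (subdegree ?g) \<noteq> 0" using ne by (intro nth_subdegree_nonzero) simp
    ultimately have "\<forall>\<^sub>F t in at 0. (eval_fps ?a t - eval_fps ?b (\<theta> * t)) / t ^ subdegree ?g \<noteq> 0"
      by (rule tendsto_imp_eventually_ne)
    then have "\<forall>\<^sub>F t in at 0. eval_fps ?a t \<noteq> eval_fps ?b (\<theta> * t)" by eventually_elim auto
    then show False using fr by (simp add: frequently_def)
  qed
  then show "\<exists>\<theta>. \<theta> ^ N = 1 \<and> ?a = rotate_fps \<theta> ?b" using \<theta> by blast
qed

text \<open>
  A product of linear factors determines its roots with multiplicities, by unique factorization over
  the integral domain of power series.
\<close>

lemma card_linear_factors_cong: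
  fixes a b :: "nat \<Rightarrow> complex fps"
  assumes "(\<Prod>j<n. fps_X - fps_const (a j)) = (\<Prod>j<n. fps_X - fps_const (b j) :: complex fps fps)"
  shows "card {j. j < n \<and> Q (a j)} = card {j. j < n \<and> Q (b j)}"
proof -
  have poly: "fps_of_poly (\<Prod>j<n. [:- c j, 1:]) = (\<Prod>j<n. fps_X - fps_const (c j))" for c :: "nat \<Rightarrow> complex fps"
    unfolding fps_of_poly_prod by (intro prod.cong) (auto simp: fps_of_poly_pCons fps_const_neg[symmetric] simp del: fps_const_neg)
  have "fps_of_poly (\<Prod>j<n. [:- a j, 1:]) = fps_of_poly (\<Prod>j<n. [:- b j, 1:])"
    unfolding poly by (rule assms)
  then have eq: "(\<Prod>j<n. [:- a j, 1:]) = (\<Prod>j<n. [:- b j, 1:])" by (simp only: fps_of_poly_eq_iff)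
  have pr: "proots (\<Prod>j<n. [:- c j, 1:]) = image_mset c (mset_set {..<n})" for c :: "nat \<Rightarrow> complex fps"
  proof -
    have "proots (\<Prod>j<n. [:- c j, 1:]) = (\<Sum>j<n. proots [:- c j, 1:])" by (rule proots_prod) simp
    also have "\<dots> = (\<Sum>j<n. {#c j#})" by simp
    also have "\<dots> = image_mset c (mset_set {..<n})" by (induction n) (auto simp: lessThan_Suc)
    finally show ?thesis .
  qed
  have sz: "size (filter_mset Q (image_mset c (mset_set {..<n}))) = card {j. j < n \<and> Q (c j)}" for c :: "nat \<Rightarrow> complex fps"
  proof -
    have "{j \<in> {..<n}. Q (c j)} = {j. j < n \<and> Q (c j)}" by auto
    then show ?thesis by (simp add: filter_mset_image_mset)
  qed
  show ?thesis using eq pr[of a] pr[of b] sz[of a] sz[of b] by simp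
qed

context polar_family
begin

text \<open>
  The function \<open>f_z\<close> and the unit depend on \<open>t^N\<close> only, hence are invariant under the rotation
  \<open>t \<mapsto> \<theta> t\<close>. So conjugation permutes the polars as a family with multiplicities.
\<close>

lemma rotated_polars:
  assumes N: "level N" and \<theta>: "\<theta> ^ N = 1"
  shows "(\<Prod>j<n. fps_X - fps_const (param N (\<gamma> j))) = (\<Prod>j<n. fps_X - fps_const (rotate_fps \<theta> (param N (\<gamma> j))) :: complex fps fps)"
proof -
  let ?c = "fps_const \<theta> * fps_X :: complex fps"
  have c0: "fps_nth ?c 0 = 0" by simp
  \<comment> \<open>Only multiples of \<open>N\<close> occur as exponents of \<open>t\<close>, and \<open>\<theta> ^ N = 1\<close>.\<close>
  have inv: "inner_compose ?c (subst_w_power N F) = subst_w_power N F" for F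
  proof (rule fps_ext, rule fps_ext)
    fix i j
    have N0: "N > 0" using levelD(1)[OF N] .
    have "fps_nth (fps_nth (inner_compose ?c (subst_w_power N F)) i) j = \<theta> ^ j * fps_nth (fps_nth F i oo fps_X ^ N) j"
      by (simp add: inner_compose_def subst_w_power_def fps_compose_linear)
    also have "\<dots> = fps_nth (fps_nth F i oo fps_X ^ N) j"
      using \<theta> N0 by (auto simp: fps_nth_compose_X_power power_mult elim!: dvdE)
    finally show "fps_nth (fps_nth (inner_compose ?c (subst_w_power N F)) i) j = fps_nth (fps_nth (subst_w_power N F) i) j"
      by (simp add: subst_w_power_def)
  qed
  let ?U = "subst_w_power N u"
  have "?U * (\<Prod>j<n. fps_X - fps_const (param N (\<gamma> j))) = inner_compose ?c (?U * (\<Prod>j<n. fps_X - fps_const (param N (\<gamma> j))))"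
    using inv[of "dz f"] unfolding level_factorization[OF N] by simp
  also have "\<dots> = ?U * (\<Prod>j<n. fps_X - fps_const (param N (\<gamma> j) oo ?c))"
    unfolding inner_compose_prod_linear[OF c0] inv ..
  finally have "?U * (\<Prod>j<n. fps_X - fps_const (param N (\<gamma> j))) = ?U * (\<Prod>j<n. fps_X - fps_const (param N (\<gamma> j) oo ?c))" .
  moreover have "?U \<noteq> 0"
  proof
    assume "?U = 0"
    then have "coeff2 ?U 0 0 = 0" by simp
    then show False using unit levelD(1)[OF N] by (simp add: unit2_def subst_w_power_def fps_nth_compose_X_power)
  qed
  ultimately show ?thesis by (simp add: rotate_fps_def)
qed

text \<open>
  The polars that coincide below \<open>t^D\<close> with the conjugate of \<open>\<gamma> k\<close> given by \<open>\<theta>\<close>.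
\<close>

definition conjugate_class :: "nat \<Rightarrow> nat \<Rightarrow> nat \<Rightarrow> complex \<Rightarrow> nat set" where
  "conjugate_class N D k \<theta> = {j. j < n \<and> (\<forall>i<D. fps_nth (param N (\<gamma> k)) i * \<theta> ^ i = fps_nth (param N (\<gamma> j)) i)}"

text \<open>
  The rotations that fix the truncation of \<open>\<gamma> k\<close> below \<open>t^D\<close>.
\<close>

definition stabilizer :: "nat \<Rightarrow> nat \<Rightarrow> nat \<Rightarrow> complex set" where
  "stabilizer N D k = {\<theta>. \<theta> ^ N = 1 \<and> (\<forall>i<D. fps_nth (param N (\<gamma> k)) i \<noteq> 0 \<longrightarrow> \<theta> ^ i = 1)}"

text \<open>
  Rotating back by \<open>inverse \<theta>\<close> permutes the polars and maps this class to the class of \<open>\<theta> = 1\<close>.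
\<close>

lemma card_conjugate_class:
  assumes N: "level N" and \<theta>: "\<theta> ^ N = 1"
  shows "card (conjugate_class N D k \<theta>) = card {j. j < n \<and> contact D (param N (\<gamma> k)) (param N (\<gamma> j)) = D}"
proof -
  have nz: "\<theta> \<noteq> 0" using \<theta> levelD(1)[OF N] by (auto simp: power_0_left)
  have \<theta>': "inverse \<theta> ^ N = 1" using \<theta> by (simp add: power_inverse)
  let ?Q = "\<lambda>b. \<forall>i<D. fps_nth (param N (\<gamma> k)) i = fps_nth b i"
  have "conjugate_class N D k \<theta> = {j. j < n \<and> ?Q (rotate_fps (inverse \<theta>) (param N (\<gamma> j)))}"
    using nz by (auto simp: conjugate_class_def power_inverse field_simps)
  also have "card \<dots> = card {j. j < n \<and> ?Q (param N (\<gamma> j))}"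
    by (rule card_linear_factors_cong[OF rotated_polars[OF N \<theta>', symmetric]])
  finally show ?thesis by (simp add: contact_eq_iff)
qed

text \<open>
  The rotations that relate \<open>\<gamma> k\<close> to a given polar form a coset of the stabilizer.
\<close>

lemma card_conjugators:
  assumes N: "level N" and j: "j \<in> conjugate_class N D k \<theta>0" and \<theta>0: "\<theta>0 ^ N = 1"
  shows "card {\<theta> \<in> {\<theta>. \<theta> ^ N = 1}. j \<in> conjugate_class N D k \<theta>} = card (stabilizer N D k)"
proof -
  have nz: "\<theta>0 \<noteq> 0" using \<theta>0 levelD(1)[OF N] by (auto simp: power_0_left)
  have "{\<theta> \<in> {\<theta>. \<theta> ^ N = 1}. j \<in> conjugate_class N D k \<theta>} = (\<lambda>\<theta>. \<theta>0 * \<theta>) ` stabilizer N D k"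
  proof (intro set_eqI iffI)
    fix \<theta> assume "\<theta> \<in> {\<theta> \<in> {\<theta>. \<theta> ^ N = 1}. j \<in> conjugate_class N D k \<theta>}"
    then have \<theta>: "\<theta> ^ N = 1" "\<And>i. i < D \<Longrightarrow> fps_nth (param N (\<gamma> k)) i * \<theta> ^ i = fps_nth (param N (\<gamma> k)) i * \<theta>0 ^ i"
      using j by (auto simp: conjugate_class_def)
    have "\<theta> / \<theta>0 \<in> stabilizer N D k"
      unfolding stabilizer_def using \<theta> \<theta>0 nz by (auto simp: power_divide)
    then show "\<theta> \<in> (\<lambda>\<theta>. \<theta>0 * \<theta>) ` stabilizer N D k" using nz by (intro image_eqI[of _ _ "\<theta> / \<theta>0"]) auto
  next
    fix \<theta> assume "\<theta> \<in> (\<lambda>\<theta>. \<theta>0 * \<theta>) ` stabilizer N D k"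
    then obtain \<eta> where \<eta>: "\<eta> \<in> stabilizer N D k" "\<theta> = \<theta>0 * \<eta>" by auto
    have j0: "j < n" "\<And>i. i < D \<Longrightarrow> fps_nth (param N (\<gamma> k)) i * \<theta>0 ^ i = fps_nth (param N (\<gamma> j)) i"
      using j by (auto simp: conjugate_class_def)
    have "fps_nth (param N (\<gamma> k)) i * \<theta> ^ i = fps_nth (param N (\<gamma> j)) i" if "i < D" for i
    proof -
      have "fps_nth (param N (\<gamma> k)) i * \<theta> ^ i = fps_nth (param N (\<gamma> k)) i * \<theta>0 ^ i"
        using \<eta> that by (cases "fps_nth (param N (\<gamma> k)) i = 0") (auto simp: stabilizer_def power_mult_distrib)
      then show ?thesis using j0(2)[OF that] by (rule trans)
    qed
    then have "j \<in> conjugate_class N D k \<theta>" using j0(1) by (simp add: conjugate_class_def)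
    moreover have "\<theta> ^ N = 1" using \<eta> \<theta>0 by (simp add: stabilizer_def power_mult_distrib)
    ultimately show "\<theta> \<in> {\<theta> \<in> {\<theta>. \<theta> ^ N = 1}. j \<in> conjugate_class N D k \<theta>}" by simp
  qed
  moreover have "inj_on (\<lambda>\<theta>. \<theta>0 * \<theta>) X" for X using nz by (auto simp: inj_on_def)
  ultimately show ?thesis by (simp add: card_image)
qed

lemma conjugate_series:
  assumes N: "level N" and j: "j < n" and \<theta>: "\<theta> ^ N = 1"
  obtains \<beta> where "\<beta> \<in> puiseux1" "exponents_over N \<beta>" "arc \<beta> = arc (\<gamma> j)"
    "\<And>i. fps_nth (param N \<beta>) i = fps_nth (param N (\<gamma> j)) i * \<theta> ^ i"
proof -
  have N0: "N > 0" using levelD(1)[OF N] .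
  have e: "exponents_over N (\<gamma> j)" using levelD(2)[OF N j] .
  \<comment> \<open>On the support of \<open>\<gamma> j\<close> the number \<open>q * real N\<close> is natural, so the floor is exact there.\<close>
  define \<beta> where "\<beta> = (\<lambda>q. \<gamma> j q * \<theta> ^ nat \<lfloor>q * real N\<rfloor>)"
  have nth: "fps_nth (param N \<beta>) i = fps_nth (param N (\<gamma> j)) i * \<theta> ^ i" for i
    using N0 by (simp add: param_def \<beta>_def)
  then have eq: "param N \<beta> = rotate_fps \<theta> (param N (\<gamma> j))" by (intro fps_ext) simp
  have e\<beta>: "exponents_over N \<beta>" using e by (auto simp: exponents_over_def \<beta>_def)
  have "fps_conv_radius (param N \<beta>) > 0"
    using rotate_fps_has_expansion[OF level_param(1)[OF N j], of \<theta>] unfolding eq by (simp add: has_fps_expansion_def)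
  then have p\<beta>: "\<beta> \<in> puiseux1" using polar(1)[OF j] e\<beta> by (auto simp: puiseux1_def \<beta>_def)
  have "arc \<beta> = arc (\<gamma> j)" using arc_eq_iff[OF p\<beta> e\<beta> polar(1)[OF j] e] eq \<theta> by blast
  then show ?thesis using that p\<beta> e\<beta> nth by blast
qed

text \<open>
  Membership of an arc in the canyon does not fix a series of the arc. The witness \<open>\<beta>\<close> may have a
  larger denominator, so both are first written over a common one. In the other direction the
  coefficient of \<open>y^d\<close> is arbitrary in the canyon, so it may be corrected by \<open>c\<close>.
\<close>

theorem arc_in_line_iff:
  assumes N: "level N" and j: "j < n" and k: "k < n" and d: "real D = d * real N"
  shows "arc (\<gamma> j) \<in> inf_line (ereal d) (\<gamma> k) \<longleftrightarrow> (\<exists>\<theta>. \<theta> ^ N = 1 \<and> j \<in> conjugate_class N D k \<theta>)"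
proof
  have N0: "N > 0" using levelD(1)[OF N] .
  assume "arc (\<gamma> j) \<in> inf_line (ereal d) (\<gamma> k)"
  then obtain \<beta> c where \<beta>: "\<beta> \<in> puiseux1" "arc (\<gamma> j) = arc \<beta>" "jet d \<beta> = add_term (jet d (\<gamma> k)) c d"
    by (auto simp: inf_line_def inf_disc_def)
  obtain M where M: "exponents_over M \<beta>" using \<beta>(1) by (auto simp: puiseux1_def)
  then have M0: "M > 0" by (simp add: exponents_over_def)
  let ?L = "N * M"
  have L: "exponents_over ?L \<beta>" "exponents_over ?L (\<gamma> j)"
    using exponents_over_mult[OF M N0] exponents_over_mult[OF levelD(2)[OF N j] M0] by (auto simp: mult.commute)
  obtain \<theta> where \<theta>: "\<theta> ^ ?L = 1" "param ?L (\<gamma> j) = rotate_fps \<theta> (param ?L \<beta>)"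
    using arc_eq_iff[OF polar(1)[OF j] L(2) \<beta>(1) L(1)] \<beta>(2) by blast
  have "(\<theta> ^ M) ^ N = 1" using \<theta>(1) by (simp add: mult.commute flip: power_mult)
  moreover have "j \<in> conjugate_class N D k (\<theta> ^ M)"
    unfolding conjugate_class_def
  proof (intro CollectI conjI allI impI j)
    fix i assume i: "i < D"
    have iN: "real i / real N < d" using i d N0 by (simp add: field_simps flip: d)
    have "jet d \<beta> (real i / real N) = add_term (jet d (\<gamma> k)) c d (real i / real N)" using \<beta>(3) by simp
    then have "\<beta> (real i / real N) = \<gamma> k (real i / real N)" using iN by (simp add: jet_def add_term_def)
    moreover have "fps_nth (param ?L (\<gamma> j)) (i * M) = fps_nth (param ?L \<beta>) (i * M) * \<theta> ^ (i * M)"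
      unfolding \<theta>(2) by simp
    moreover have "real (i * M) / real ?L = real i / real N" using M0 by simp
    ultimately show "fps_nth (param N (\<gamma> k)) i * (\<theta> ^ M) ^ i = fps_nth (param N (\<gamma> j)) i"
      by (simp add: param_def mult.commute[of i M] flip: power_mult)
  qed
  ultimately show "\<exists>\<theta>. \<theta> ^ N = 1 \<and> j \<in> conjugate_class N D k \<theta>" by blast
next
  have N0: "N > 0" using levelD(1)[OF N] .
  assume "\<exists>\<theta>. \<theta> ^ N = 1 \<and> j \<in> conjugate_class N D k \<theta>"
  then obtain \<theta> where \<theta>: "\<theta> ^ N = 1" "j \<in> conjugate_class N D k \<theta>" by blast
  have nz: "\<theta> \<noteq> 0" using \<theta>(1) N0 by (auto simp: power_0_left)
  have "inverse \<theta> ^ N = 1" using \<theta>(1) by (simp add: power_inverse)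
  then obtain \<beta> where \<beta>: "\<beta> \<in> puiseux1" "exponents_over N \<beta>" "arc \<beta> = arc (\<gamma> j)"
    "\<And>i. fps_nth (param N \<beta>) i = fps_nth (param N (\<gamma> j)) i * inverse \<theta> ^ i"
    using conjugate_series[OF N j] by blast
  \<comment> \<open>Below \<open>d\<close> the conjugate \<open>\<beta>\<close> agrees with \<open>\<gamma> k\<close>.\<close>
  define c where "c = \<beta> d - \<gamma> k d"
  have "jet d \<beta> q = add_term (jet d (\<gamma> k)) c d q" for q
  proof -
    consider "q > d" | "q = d" | "q < d" by linarith
    then show ?thesis
    proof cases
      case 3
      have "\<beta> q = \<gamma> k q"
      proof (cases "q * real N \<in> \<int> \<and> q \<ge> 0")
        case True
        then obtain i where i: "q * real N = real i"
          by (metis Ints_cases mult_nonneg_nonneg of_nat_0_le_iff of_int_0_le_iff zero_le_imp_eq_int of_int_of_nat_eq)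
        then have q: "q = real i / real N" using N0 by (simp add: field_simps)
        have "real i < real D" using 3 d i N0 by (simp add: flip: i)
        then have "i < D" by simp
        then have "fps_nth (param N (\<gamma> k)) i * \<theta> ^ i = fps_nth (param N (\<gamma> j)) i" using \<theta>(2) by (simp add: conjugate_class_def)
        then have "fps_nth (param N \<beta>) i = fps_nth (param N (\<gamma> k)) i"
          unfolding \<beta>(4) using nz by (simp add: power_inverse field_simps)
        then show ?thesis by (simp add: param_def q)
      next
        case False
        have z: "\<delta> q = 0" if "\<delta> \<in> puiseux1" "exponents_over N \<delta>" for \<delta>
          using that False unfolding puiseux1_def exponents_over_def by (auto intro: ccontr)
        show ?thesis using z[OF \<beta>(1,2)] z[OF polar(1)[OF k] levelD(2)[OF N k]] by simp
      qed
      then show ?thesis using 3 by (simp add: jet_def add_term_def)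
    qed (auto simp: jet_def add_term_def c_def)
  qed
  then have "jet d \<beta> = add_term (jet d (\<gamma> k)) c d" by (rule ext)
  then have "arc (\<gamma> j) \<in> inf_disc d (\<gamma> k) (norm c + 1)"
    unfolding inf_disc_def using \<beta>(1,3) by (intro CollectI exI[of _ \<beta>] conjI exI[of _ c]) auto
  moreover have "norm c + 1 > 0" by (simp add: add_nonneg_pos)
  ultimately show "arc (\<gamma> j) \<in> inf_line (ereal d) (\<gamma> k)" unfolding inf_line_def by auto
qed

text \<open>
  Double counting of the pairs \<open>(\<theta>, j)\<close> with \<open>j\<close> in the class of \<open>\<theta>\<close>: all classes have the same
  size, and every polar in the canyon belongs to as many of them as the stabilizer has elements.
\<close>

theorem card_polars_in_line:
  assumes N: "level N" and k: "k < n" and d: "real D = d * real N"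
  shows "card (stabilizer N D k) * card {j. j < n \<and> arc (\<gamma> j) \<in> inf_line (ereal d) (\<gamma> k)}
    = N * card {j. j < n \<and> contact D (param N (\<gamma> k)) (param N (\<gamma> j)) = D}"
proof -
  let ?\<mu> = "{\<theta>::complex. \<theta> ^ N = 1}" and ?X = "{j. j < n \<and> arc (\<gamma> j) \<in> inf_line (ereal d) (\<gamma> k)}"
  have N0: "N > 0" using levelD(1)[OF N] .
  have fin: "finite ?\<mu>" using finite_roots_unity[of N] N0 by simp
  have cX: "conjugate_class N D k \<theta> = {j \<in> ?X. j \<in> conjugate_class N D k \<theta>}" if "\<theta> \<in> ?\<mu>" for \<theta>
    using that arc_in_line_iff[OF N _ k d] by (auto simp: conjugate_class_def)
  have "(\<Sum>\<theta>\<in>?\<mu>. card {j \<in> ?X. j \<in> conjugate_class N D k \<theta>}) = (\<Sum>j\<in>?X. card (stabilizer N D k))"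
  proof (rule sum_multicount_gen[OF fin])
    show "finite ?X" by simp
    show "\<forall>j\<in>?X. card {\<theta> \<in> ?\<mu>. j \<in> conjugate_class N D k \<theta>} = card (stabilizer N D k)"
    proof
      fix j assume "j \<in> ?X"
      then obtain \<theta>0 where "\<theta>0 ^ N = 1" "j \<in> conjugate_class N D k \<theta>0" using arc_in_line_iff[OF N _ k d] by auto
      then show "card {\<theta> \<in> ?\<mu>. j \<in> conjugate_class N D k \<theta>} = card (stabilizer N D k)" using card_conjugators[OF N] by blast
    qed
  qed
  moreover have "(\<Sum>\<theta>\<in>?\<mu>. card {j \<in> ?X. j \<in> conjugate_class N D k \<theta>})
     = (\<Sum>\<theta>\<in>?\<mu>. card {j. j < n \<and> contact D (param N (\<gamma> k)) (param N (\<gamma> j)) = D})"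
    using cX card_conjugate_class[OF N] by (intro sum.cong) auto
  moreover have "card ?\<mu> = N" using card_roots_unity_eq[OF N0] by simp
  ultimately show ?thesis by (simp add: mult.commute)
qed

end

section \<open>Asymptotics of the gradient inside a canyon\<close>

lemma uniform_limit_divide_const:
  fixes h :: "'a \<Rightarrow> 'b \<Rightarrow> complex"
  assumes "uniform_limit S h l F" shows "uniform_limit S (\<lambda>t v. h t v / c) (\<lambda>v. l v / c) F"
  by (rule bounded_linear.uniform_limit[OF bounded_linear_divide assms])

text \<open>
  A level \<open>N\<close> at which the canyon degree is the integer multiple \<open>D / N\<close>. The equation \<open>E + N = H\<close>
  expresses that \<open>D / N\<close> is the canyon degree.
\<close>

locale canyon_frame = polar_at +
  fixes N D :: nat
  assumes N: "level N" and ND: "N < D" and EH: "order_E N D (param N (\<gamma> k)) + N = ord_H N"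
begin

definition H :: nat where "H = ord_H N"
definition E :: nat where "E = order_E N D (param N (\<gamma> k))"
definition trunc :: "complex fps" where "trunc = fps_cutoff D (param N (\<gamma> k))"
abbreviation pt :: "complex \<Rightarrow> complex \<Rightarrow> complex \<times> complex" where "pt \<equiv> fan N D trunc"

lemma N0: "N > 0" and D0: "D > 0"
  using levelD(1)[OF N] ND by auto

lemma HE: "H = E + N" and HD: "H < D + E" and Hpos: "H > 0"
  using EH ND N0 by (auto simp: H_def E_def)

lemma trunc_nth: "fps_nth trunc i = (if i < D then fps_nth (param N (\<gamma> k)) i else 0)"
  by (simp add: trunc_def)

lemma trunc_low: "i < N \<Longrightarrow> fps_nth trunc i = 0"
  using level_param(2)[OF N k] by (simp add: trunc_nth)

lemma trunc_0: "fps_nth trunc 0 = 0"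
  using trunc_low[OF N0] .

lemma eval_trunc: "eval_fps trunc t = (\<Sum>i<D. fps_nth (param N (\<gamma> k)) i * t ^ i)" and conv_trunc: "fps_conv_radius trunc = \<infinity>"
proof -
  have s: "(\<lambda>i. fps_nth trunc i * t ^ i) sums (\<Sum>i<D. fps_nth trunc i * t ^ i)" for t :: complex
    by (rule sums_finite) (auto simp: trunc_nth)
  then have "eval_fps trunc t = (\<Sum>i<D. fps_nth trunc i * t ^ i)" by (simp add: eval_fps_def sums_iff)
  then show "eval_fps trunc t = (\<Sum>i<D. fps_nth (param N (\<gamma> k)) i * t ^ i)" by (simp add: trunc_nth)
  have "\<infinity> \<le> fps_conv_radius trunc"
    unfolding fps_conv_radius_def by (rule conv_radius_geI_ex') (rule sums_summable[OF s])
  then show "fps_conv_radius trunc = \<infinity>" by simp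
qed

lemma order_E_trunc: "order_E N D trunc = E"
  unfolding order_E_def E_def by (intro sum.cong refl contact_cong) (simp add: trunc_nth)

definition P :: "complex \<Rightarrow> complex" where "P = lead_P N D trunc"

lemma dz_limit: "uniform_limit (ball 0 R) (\<lambda>t v. eval2 (dz f) (pt t v) / t ^ E) P (at 0)" "bounded (P ` ball 0 R)"
  using dz_fan_limit[OF N D0 trunc_0, of R] conv_trunc unfolding order_E_trunc P_def by auto

text \<open>
  The polar itself lies in the fan: it is \<open>v = \<sigma> t\<close> with a convergent series \<open>\<sigma>\<close>. On it \<open>f\<close> is known,
  and \<open>fan_variation\<close> bounds the change of \<open>f\<close> along the fan by \<open>O(t^(D + E))\<close> with \<open>D + E > H\<close>.
\<close>

lemma f_limit: "uniform_limit (ball 0 R) (\<lambda>t v. eval2 f (pt t v) / t ^ H) (\<lambda>v. lead_a) (at 0)"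
proof -
  let ?a = "param N (\<gamma> k)"
  define \<sigma> where "\<sigma> = eval_fps (fps_shift D ?a)"
  define R' where "R' = max R (norm (\<sigma> 0) + 1)"
  obtain K where K: "\<forall>\<^sub>F t in at 0. \<forall>v\<in>ball 0 R'. \<forall>w\<in>ball 0 R'.
    norm (eval2 f (pt t v) - eval2 f (pt t w)) \<le> K * norm t ^ (D + E)"
    using fan_variation[OF N D0 trunc_0, of R'] conv_trunc unfolding order_E_trunc by auto
  have cr: "fps_conv_radius ?a > 0" by (rule level_param(1)[OF N k])
  have "isCont \<sigma> 0"
    unfolding \<sigma>_def using has_field_derivative_eval_fps[of 0 "fps_shift D ?a" UNIV] cr
    by (auto simp: zero_ereal_def intro: DERIV_isCont)
  then have "((\<lambda>t. norm (\<sigma> t)) \<longlongrightarrow> norm (\<sigma> 0)) (at 0)" by (intro tendsto_norm) (simp add: isCont_def)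
  then have sb: "\<forall>\<^sub>F t in at 0. norm (\<sigma> t) < norm (\<sigma> 0) + 1" by (rule order_tendstoD) simp
  have "(\<lambda>t. eval_fps ?a t - eval_fps trunc t) has_fps_expansion (?a - trunc)"
    using cr conv_trunc by (intro has_fps_expansion_diff) (auto simp: has_fps_expansion_def)
  then have "\<forall>\<^sub>F t in nhds 0. eval_fps ?a t - eval_fps trunc t = t ^ D * eval_fps (fps_shift D (?a - trunc)) t"
    by (rule fps_expansion_factor) (simp add: trunc_nth)
  moreover have "fps_shift D (?a - trunc) = fps_shift D ?a" by (rule fps_ext) (simp add: trunc_nth)
  ultimately have "\<forall>\<^sub>F t in nhds 0. pt t (\<sigma> t) = level_arc N ?a t"
    by (auto simp: fan_def level_arc_def \<sigma>_def algebra_simps elim: eventually_mono)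
  then have sg: "\<forall>\<^sub>F t in at 0. pt t (\<sigma> t) = level_arc N ?a t" by (auto simp: eventually_at_filter elim: eventually_mono)
  have l0: "((\<lambda>t. eval2 f (level_arc N ?a t) / t ^ H) \<longlongrightarrow> lead_a) (at 0)" using level_limit[OF N] by (simp add: H_def)
  have l1: "((\<lambda>t::complex. \<bar>K\<bar> * norm t ^ (D + E - H)) \<longlongrightarrow> \<bar>K\<bar> * norm (0::complex) ^ (D + E - H)) (at 0)" by (intro tendsto_intros)
  have l1z: "\<bar>K\<bar> * norm (0::complex) ^ (D + E - H) = 0" using HD by simp
  show ?thesis
  proof (rule uniform_limitI)
    fix e :: real assume e: "e > 0"
    have e1: "\<forall>\<^sub>F t in at 0. dist (eval2 f (level_arc N ?a t) / t ^ H) lead_a < e / 2"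
      using tendstoD[OF l0, of "e/2"] e by simp
    have e2: "\<forall>\<^sub>F t::complex in at 0. \<bar>K\<bar> * norm t ^ (D + E - H) < e / 2"
      using order_tendstoD(2)[OF l1, of "e/2"] e unfolding l1z by simp
    show "\<forall>\<^sub>F t in at 0. \<forall>v\<in>ball 0 R. dist (eval2 f (pt t v) / t ^ H) lead_a < e"
      using K sb sg e1 e2 eventually_neq_at_within[of 0 0 UNIV]
    proof eventually_elim
      case (elim t)
      show ?case
      proof
        fix v :: complex assume v: "v \<in> ball 0 R"
        have "norm (eval2 f (pt t v) - eval2 f (pt t (\<sigma> t))) \<le> K * norm t ^ (D + E)"
          by (rule elim(1)[rule_format]) (use v elim(2) in \<open>auto simp: R'_def\<close>)
        also have "\<dots> \<le> \<bar>K\<bar> * norm t ^ (D + E)" by (intro mult_right_mono) auto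
        also have "\<dots> = \<bar>K\<bar> * norm t ^ (D + E - H) * norm t ^ H" using HD by (simp flip: power_add)
        finally have "norm (eval2 f (pt t v) - eval2 f (level_arc N ?a t)) / norm t ^ H \<le> \<bar>K\<bar> * norm t ^ (D + E - H)"
          using elim(3,6) by (simp add: divide_le_eq)
        moreover have "dist (eval2 f (pt t v) / t ^ H) (eval2 f (level_arc N ?a t) / t ^ H)
            = norm (eval2 f (pt t v) - eval2 f (level_arc N ?a t)) / norm t ^ H"
          by (simp add: dist_norm norm_divide norm_power flip: diff_divide_distrib)
        ultimately have "dist (eval2 f (pt t v) / t ^ H) (eval2 f (level_arc N ?a t) / t ^ H) < e / 2"
          using elim(5) by linarith
        then show "dist (eval2 f (pt t v) / t ^ H) lead_a < e"
          using elim(4) dist_triangle[of "eval2 f (pt t v) / t ^ H" lead_a "eval2 f (level_arc N ?a t) / t ^ H"] by linarith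
      qed
    qed
  qed
qed

text \<open>
  Together with \<open>slope\<close>, the coefficients of the affine function of \<open>P v\<close> that is the limit of the
  rescaled \<open>f_w\<close>.
\<close>

definition kappa :: complex where "kappa = of_nat H * lead_a / of_nat N"

definition slope :: complex where "slope = fps_nth trunc N"

lemma kappa_nz: "kappa \<noteq> 0"
  using Hpos N0 lead_a_nz by (simp add: kappa_def)

definition second_jet :: "complex fps fps set" where
  "second_jet = {f, dz f, dw f, dz (dz f), dw (dz f), dz (dw f), dw (dw f)}"

lemma ex_radius: obtains Rf where "\<And>g. g \<in> second_jet \<Longrightarrow> diff_radius g Rf"
proof -
  have "convergent2 g" if "g \<in> second_jet" for g
    using that conv convergent2_dz convergent2_dw by (auto simp: second_jet_def)
  then have "\<exists>R. diff_radius g R" if "g \<in> second_jet" for g using that ex_diff_radius by metis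
  then obtain r where r: "\<And>g. g \<in> second_jet \<Longrightarrow> diff_radius g (r g)" by metis
  have fin: "finite (r ` second_jet)" "r ` second_jet \<noteq> {}" by (auto simp: second_jet_def)
  let ?R = "Min (r ` second_jet)"
  have pos: "?R > 0" using r Min_in[OF fin] by (auto simp: diff_radius_def)
  have "diff_radius g ?R" if "g \<in> second_jet" for g
    by (rule diff_radius_mono[OF r[OF that] pos]) (use fin that in \<open>auto intro: Min_le\<close>)
  then show ?thesis by (rule that)
qed

lemma ex_radius_f: obtains Rf where "diff_radius f Rf"
  using ex_radius by (auto simp: second_jet_def)

lemma pt_near_0:
  assumes "e > 0"
  obtains d where "d > 0" "\<And>t v. norm t < d \<Longrightarrow> v \<in> ball 0 R \<Longrightarrow> pt t v \<in> polydisc e"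
proof -
  have "0 < fps_conv_radius trunc" by (simp add: conv_trunc)
  from fan_near_0[OF trunc_0 this N0 D0 assms] show ?thesis using that by metis
qed

lemma trunc_derivative: "(eval_fps trunc has_field_derivative eval_fps (fps_deriv trunc) t) (at t)"
  by (rule has_field_derivative_eval_fps) (simp add: conv_trunc)

lemma pt_t_derivative:
  assumes Rf: "diff_radius g Rf" and p: "pt t v \<in> polydisc Rf"
  shows "((\<lambda>t. eval2 g (pt t v)) has_field_derivative
    (eval2 (dz g) (pt t v) * (eval_fps (fps_deriv trunc) t + of_nat D * v * t ^ (D - 1)) + eval2 (dw g) (pt t v) * (of_nat N * t ^ (N - 1)))) (at t)"
proof -
  have 1: "((\<lambda>t. eval_fps trunc t + v * t ^ D) has_field_derivative (eval_fps (fps_deriv trunc) t + of_nat D * v * t ^ (D - 1))) (at t)"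
    by (rule DERIV_cong[OF DERIV_add[OF trunc_derivative DERIV_cmult[OF DERIV_power[OF DERIV_ident]]]]) simp
  have 2: "((\<lambda>t. t ^ N) has_field_derivative of_nat N * t ^ (N - 1)) (at t)"
    by (rule DERIV_cong[OF DERIV_power[OF DERIV_ident]]) simp
  show ?thesis unfolding fan_def by (rule eval2_curve_derivative[OF Rf 1 2]) (use p in \<open>simp add: fan_def\<close>)
qed

text \<open>
  The uniform asymptotic of \<open>f\<close> is differentiated with respect to \<open>t\<close> by Cauchy's inequality on a
  circle of radius \<open>norm t / 2\<close> about \<open>t\<close>, which stays away from the origin.
\<close>

lemma dt_limit:
  "uniform_limit (ball 0 R) (\<lambda>t v. deriv (\<lambda>t. eval2 f (pt t v)) t / t ^ (H - 1)) (\<lambda>v. of_nat H * lead_a) (at 0)"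
proof (rule uniform_limitI)
  fix e :: real assume e: "e > 0"
  \<comment> \<open>On the circle of radius \<open>norm t / 2\<close> about \<open>t\<close> one has \<open>norm s \<le> 3/2 * norm t\<close>.\<close>
  define \<epsilon> where "\<epsilon> = e / (4 * (3/2) ^ H)"
  have \<epsilon>: "\<epsilon> > 0" using e by (simp add: \<epsilon>_def)
  obtain Rf where Rf: "diff_radius f Rf" using ex_radius_f by metis
  then have Rf0: "Rf > 0" by (simp add: diff_radius_def)
  obtain d1 where d1: "d1 > 0" "\<And>t v. norm t < d1 \<Longrightarrow> v \<in> ball 0 R \<Longrightarrow> pt t v \<in> polydisc Rf" using pt_near_0[OF Rf0] by metis
  obtain d2 where d2: "d2 > 0" "\<And>t v. t \<noteq> 0 \<Longrightarrow> norm t < d2 \<Longrightarrow> v \<in> ball 0 R \<Longrightarrow> dist (eval2 f (pt t v) / t ^ H) lead_a < \<epsilon>"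
    using uniform_limitD[OF f_limit[of R] \<epsilon>] unfolding eventually_at by (auto simp: dist_norm)
  define d where "d = min d1 d2 / 2"
  have d: "d > 0" using d1 d2 by (simp add: d_def)
  show "\<forall>\<^sub>F t in at 0. \<forall>v\<in>ball 0 R. dist (deriv (\<lambda>t. eval2 f (pt t v)) t / t ^ (H - 1)) (of_nat H * lead_a) < e"
    unfolding eventually_at
  proof (intro exI[of _ d] conjI d ballI impI)
    fix t v :: complex assume t: "t \<noteq> 0 \<and> dist t 0 < d" and v: "v \<in> ball 0 R"
    define r where "r = norm t / 2"
    have r: "r > 0" using t by (simp add: r_def)
    have s: "norm s < d1" "norm s < d2" "s \<noteq> 0" "norm s \<le> 3/2 * norm t" if "norm (t - s) \<le> r" for s
    proof -
      have "norm s \<le> norm t + norm (t - s)" using norm_triangle_sub[of s t] by (simp add: norm_minus_commute)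
      then show le: "norm s \<le> 3/2 * norm t" using that by (simp add: r_def)
      moreover have "2 * norm t < d1" "2 * norm t < d2" using t by (auto simp: d_def)
      ultimately show "norm s < d1" "norm s < d2" using norm_ge_zero[of t] by linarith+
      show "s \<noteq> 0" using that r by (auto simp: r_def)
    qed
    let ?\<Phi> = "\<lambda>t. eval2 f (pt t v)"
    let ?\<psi> = "\<lambda>s. ?\<Phi> s - lead_a * s ^ H"
    have der: "(?\<Phi> has_field_derivative deriv ?\<Phi> s) (at s)" if "norm (t - s) \<le> r" for s
    proof -
      have "pt s v \<in> polydisc Rf" by (rule d1(2)[OF s(1)[OF that] v])
      then show ?thesis by (intro DERIV_deriv_iff_field_differentiable[THEN iffD2]) (auto simp: field_differentiable_def intro: pt_t_derivative[OF Rf])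
    qed
    have d\<psi>: "(?\<psi> has_field_derivative deriv ?\<Phi> s - lead_a * (of_nat H * s ^ (H - 1))) (at s)" if "norm (t - s) \<le> r" for s
      using der[OF that] by (auto intro!: derivative_eq_intros)
    have "norm ((deriv ^^ 1) ?\<psi> t) \<le> fact 1 * (\<epsilon> * (3/2 * norm t) ^ H) / r ^ 1"
    proof (rule Cauchy_inequality)
      show "?\<psi> holomorphic_on ball t r"
        unfolding holomorphic_on_open[OF open_ball]
      proof
        fix x assume "x \<in> ball t r"
        then have "norm (t - x) \<le> r" by (simp add: dist_norm)
        then show "\<exists>f'. (?\<psi> has_field_derivative f') (at x)" using d\<psi> by blast
      qed
      show "continuous_on (cball t r) ?\<psi>"
      proof (rule continuous_at_imp_continuous_on, rule ballI)
        fix x assume "x \<in> cball t r"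
        then have "norm (t - x) \<le> r" by (simp add: dist_norm)
        then show "isCont ?\<psi> x" by (rule DERIV_isCont[OF d\<psi>])
      qed
      fix s assume sr: "norm (t - s) = r"
      note ss = s[of s, OF eq_refl[OF sr]]
      have "dist (?\<Phi> s / s ^ H) lead_a < \<epsilon>" by (rule d2(2)[OF ss(3,2) v])
      moreover have "?\<psi> s = (?\<Phi> s / s ^ H - lead_a) * s ^ H" using ss(3) by (simp add: field_simps)
      ultimately have "norm (?\<psi> s) \<le> \<epsilon> * norm s ^ H" by (simp add: dist_norm norm_mult norm_power mult_right_mono)
      also have "\<dots> \<le> \<epsilon> * (3/2 * norm t) ^ H" using ss(4) \<epsilon> by (intro mult_left_mono power_mono) auto
      finally show "norm (?\<psi> s) \<le> \<epsilon> * (3/2 * norm t) ^ H" .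
    qed (rule r)
    also have "fact 1 * (\<epsilon> * (3/2 * norm t) ^ H) / r ^ 1 = (e / 2) * norm t ^ (H - 1)"
    proof -
      have e1: "(3/2 * norm t) ^ H = (3/2) ^ H * norm t ^ H" by (rule power_mult_distrib)
      have e2: "norm t ^ H = norm t * norm t ^ (H - 1)" using Hpos by (simp flip: power_Suc)
      define q :: real where "q = (3/2) ^ H"
      have q: "q > 0" by (simp add: q_def)
      show ?thesis unfolding \<epsilon>_def r_def e1 unfolding e2 q_def[symmetric] using t q by (simp add: field_simps)
    qed
    finally have b: "norm (deriv ?\<Phi> t - lead_a * (of_nat H * t ^ (H - 1))) \<le> (e / 2) * norm t ^ (H - 1)"
      using DERIV_imp_deriv[OF d\<psi>[of t]] r by simp
    have "dist (deriv ?\<Phi> t / t ^ (H - 1)) (of_nat H * lead_a) = norm (deriv ?\<Phi> t - lead_a * (of_nat H * t ^ (H - 1))) / norm t ^ (H - 1)"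
      using t by (simp add: dist_norm field_simps flip: norm_divide norm_power)
    also have "\<dots> \<le> e / 2" using b t by (simp add: divide_le_eq)
    finally show "dist (deriv ?\<Phi> t / t ^ (H - 1)) (of_nat H * lead_a) < e" using e by simp
  qed
qed

text \<open>
  The chain rule for \<open>t \<mapsto> f(pt t v)\<close> is solved for \<open>f_w\<close>. All terms have order \<open>H - 1 = E + N - 1\<close>: this
  is where the choice of the canyon degree enters. The derivative of \<open>v t^D\<close> is of higher order
  because \<open>D > N\<close>.
\<close>

lemma dw_limit: "uniform_limit (ball 0 R) (\<lambda>t v. eval2 (dw f) (pt t v) / t ^ E) (\<lambda>v. kappa - slope * P v) (at 0)"
proof -
  obtain Rf where Rf: "diff_radius f Rf" using ex_radius_f by metis
  then have Rf0: "Rf > 0" by (simp add: diff_radius_def)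
  obtain d where d: "d > 0" "\<And>t v. norm t < d \<Longrightarrow> v \<in> ball 0 R \<Longrightarrow> pt t v \<in> polydisc Rf" using pt_near_0[OF Rf0] by metis
  have "eval_fps (fps_deriv trunc) has_fps_expansion fps_deriv trunc"
    using fps_conv_radius_deriv[of trunc] conv_trunc by (simp add: has_fps_expansion_def)
  then have "((\<lambda>t. eval_fps (fps_deriv trunc) t / t ^ (N - 1)) \<longlongrightarrow> fps_nth (fps_deriv trunc) (N - 1)) (at 0)"
    by (rule fps_expansion_leading) (simp add: trunc_low)
  moreover have "fps_nth (fps_deriv trunc) (N - 1) = of_nat N * slope" using N0 by (simp add: slope_def)
  ultimately have l1: "((\<lambda>t. eval_fps (fps_deriv trunc) t / t ^ (N - 1)) \<longlongrightarrow> of_nat N * slope) (at 0)" by simp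
  have "((\<lambda>t::complex. of_nat D * t ^ (D - N)) \<longlongrightarrow> of_nat D * 0 ^ (D - N)) (at 0)" by (intro tendsto_intros)
  moreover have "of_nat D * (0::complex) ^ (D - N) = 0" using ND by simp
  ultimately have l2: "((\<lambda>t::complex. of_nat D * t ^ (D - N)) \<longlongrightarrow> 0) (at 0)" by (simp only: )
  have u: "uniform_limit (ball 0 R) (\<lambda>t v. eval_fps (fps_deriv trunc) t / t ^ (N - 1) + v * (of_nat D * t ^ (D - N))) (\<lambda>v. of_nat N * slope + v * 0) (at 0)"
    by (intro uniform_limit_add uniform_limit_of_tendsto[OF l1] uniform_limit_scaled[OF l2])
  have b: "bounded ((\<lambda>v::complex. of_nat N * slope + v * 0) ` ball 0 R)" by (auto simp: bounded_iff)
  have ul: "uniform_limit (ball 0 R) (\<lambda>t v. (deriv (\<lambda>t. eval2 f (pt t v)) t / t ^ (H - 1)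
      - (eval2 (dz f) (pt t v) / t ^ E) * (eval_fps (fps_deriv trunc) t / t ^ (N - 1) + v * (of_nat D * t ^ (D - N)))) / of_nat N)
      (\<lambda>v. (of_nat H * lead_a - P v * (of_nat N * slope + v * 0)) / of_nat N) (at 0)"
    by (intro uniform_limit_divide_const uniform_limit_minus dt_limit
        bounded_bilinear.bounded_uniform_limit[OF bounded_bilinear_mult dz_limit(1) u b dz_limit(2)])
  have eq: "(\<lambda>v. (of_nat H * lead_a - P v * (of_nat N * slope + v * 0)) / of_nat N) = (\<lambda>v. kappa - slope * P v)"
    using N0 by (auto simp: fun_eq_iff kappa_def field_simps)
  have ev: "\<forall>\<^sub>F t in at 0. \<forall>v\<in>ball 0 R. (deriv (\<lambda>t. eval2 f (pt t v)) t / t ^ (H - 1)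
      - (eval2 (dz f) (pt t v) / t ^ E) * (eval_fps (fps_deriv trunc) t / t ^ (N - 1) + v * (of_nat D * t ^ (D - N)))) / of_nat N
      = eval2 (dw f) (pt t v) / t ^ E"
    unfolding eventually_at
  proof (intro exI[of _ d] conjI ballI impI)
    fix t v :: complex assume t: "t \<noteq> 0 \<and> dist t 0 < d" and v: "v \<in> ball 0 R"
    have p: "pt t v \<in> polydisc Rf" using d(2) t v by simp
    let ?X = "eval_fps (fps_deriv trunc) t" and ?Z = "eval2 (dz f) (pt t v)" and ?W = "eval2 (dw f) (pt t v)"
    have der: "deriv (\<lambda>t. eval2 f (pt t v)) t = ?Z * (?X + of_nat D * v * t ^ (D - 1)) + ?W * (of_nat N * t ^ (N - 1))"
      by (rule DERIV_imp_deriv[OF pt_t_derivative[OF Rf p]])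
    have h1: "t ^ (H - 1) = t ^ E * t ^ (N - 1)" using HE N0 by (simp flip: power_add)
    have h2: "t ^ (D - 1) = t ^ (D - N) * t ^ (N - 1)" using ND N0 by (simp flip: power_add)
    show "(deriv (\<lambda>t. eval2 f (pt t v)) t / t ^ (H - 1) - (?Z / t ^ E) * (?X / t ^ (N - 1) + v * (of_nat D * t ^ (D - N)))) / of_nat N = ?W / t ^ E"
      unfolding der h1 h2 using t N0 by (simp add: field_simps)
  qed (rule d(1))
  show ?thesis using ul unfolding eq by (subst (asm) uniform_limit_cong[OF ev refl])
qed

text \<open>
  A rotation in the stabilizer maps the curve \<open>v = 0\<close> to itself, so it preserves the leading term
  \<open>a t^H\<close> of \<open>f\<close>.
\<close>

lemma stabilizer_pow_H:
  assumes "\<theta> \<in> stabilizer N D k" shows "\<theta> ^ H = 1"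
proof -
  have \<theta>: "\<theta> ^ N = 1" "\<And>i. i < D \<Longrightarrow> fps_nth (param N (\<gamma> k)) i \<noteq> 0 \<Longrightarrow> \<theta> ^ i = 1"
    using assms by (auto simp: stabilizer_def)
  have nz: "\<theta> \<noteq> 0" using \<theta>(1) N0 by (auto simp: power_0_left)
  have "rotate_fps \<theta> trunc = trunc" by (rule fps_ext) (use \<theta>(2) in \<open>auto simp: trunc_nth\<close>)
  then have l: "eval_fps trunc (\<theta> * t) = eval_fps trunc t" for t by (metis eval_rotate_fps)
  have pt0: "pt (\<theta> * t) 0 = pt t 0" for t using l \<theta>(1) by (simp add: fan_def power_mult_distrib)
  have lim: "((\<lambda>t. eval2 f (pt t 0) / t ^ H) \<longlongrightarrow> lead_a) (at 0)"
    using tendsto_uniform_limitI[OF f_limit[of 1], of 0] by simp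
  have "filterlim (\<lambda>t. \<theta> * t) (at 0) (at 0)"
    unfolding filterlim_at using nz eventually_neq_at_within[of 0 0 UNIV]
    by (auto intro!: tendsto_eq_intros elim: eventually_mono)
  from filterlim_compose[OF lim this]
  have "((\<lambda>t. eval2 f (pt t 0) / t ^ H / \<theta> ^ H) \<longlongrightarrow> lead_a) (at 0)"
    unfolding pt0 power_mult_distrib by (simp add: divide_divide_eq_left mult.commute)
  moreover have "((\<lambda>t. eval2 f (pt t 0) / t ^ H / \<theta> ^ H) \<longlongrightarrow> lead_a / \<theta> ^ H) (at 0)"
    by (intro tendsto_divide lim tendsto_const) (use nz in simp)
  ultimately have "lead_a = lead_a / \<theta> ^ H" by (intro tendsto_unique[of "at (0::complex)"]) auto
  then show ?thesis using lead_a_nz nz by (simp add: field_simps)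
qed

lemma pt_stabilizer:
  assumes "\<theta> \<in> stabilizer N D k"
  shows "pt (\<theta> * t) v = pt t (\<theta> ^ D * v)"
proof -
  have \<theta>: "\<theta> ^ N = 1" "\<And>i. i < D \<Longrightarrow> fps_nth (param N (\<gamma> k)) i \<noteq> 0 \<Longrightarrow> \<theta> ^ i = 1"
    using assms by (auto simp: stabilizer_def)
  have "rotate_fps \<theta> trunc = trunc" by (rule fps_ext) (use \<theta>(2) in \<open>auto simp: trunc_nth\<close>)
  then have "eval_fps trunc (\<theta> * t) = eval_fps trunc t" for t by (metis eval_rotate_fps)
  then show ?thesis using \<theta>(1) by (simp add: fan_def power_mult_distrib)
qed

text \<open>
  A rotation outside the stabilizer changes the truncation by a term of order less than \<open>D\<close>, which
  bounded multiples of \<open>t^D\<close> cannot compensate for small \<open>t\<close>.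
\<close>

lemma ex_conjugate_separation:
  "\<exists>d>0. \<forall>\<theta> t v w. \<theta> ^ N = 1 \<longrightarrow> \<theta> \<notin> stabilizer N D k \<longrightarrow> t \<noteq> 0 \<longrightarrow> norm t < d \<longrightarrow> v \<in> ball 0 R \<longrightarrow> w \<in> ball 0 R \<longrightarrow>
     pt (\<theta> * t) w \<noteq> pt t v"
proof -
  have one: "\<forall>\<^sub>F t in at 0. \<forall>v w. v \<in> ball 0 R \<longrightarrow> w \<in> ball 0 R \<longrightarrow> pt (\<theta> * t) w \<noteq> pt t v"
    if \<theta>: "\<theta> ^ N = 1" "\<theta> \<notin> stabilizer N D k" for \<theta>
  proof -
    let ?g = "rotate_fps \<theta> trunc - trunc"
    have n\<theta>: "norm \<theta> = 1" using \<theta>(1) N0 by (metis power_eq_1_iff norm_power norm_one norm_ge_zero less_irrefl)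
    obtain i where i: "i < D" "fps_nth (param N (\<gamma> k)) i \<noteq> 0" "\<theta> ^ i \<noteq> 1" using \<theta> by (auto simp: stabilizer_def)
    then have "fps_nth trunc i \<noteq> 0" by (simp add: trunc_nth)
    moreover have "fps_nth ?g i = fps_nth trunc i * (\<theta> ^ i - 1)" by (simp add: algebra_simps)
    ultimately have gi: "fps_nth ?g i \<noteq> 0" using i(3) by simp
    define s where "s = subdegree ?g"
    have g0: "?g \<noteq> 0" using gi by (metis fps_zero_nth)
    have s: "s < D" using gi i(1) subdegree_leI[of ?g i] by (simp add: s_def)
    have "(\<lambda>t. eval_fps trunc (\<theta> * t) - eval_fps trunc t) has_fps_expansion ?g"
      by (intro has_fps_expansion_diff rotate_fps_has_expansion) (use conv_trunc in \<open>auto simp: has_fps_expansion_def\<close>)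
    then have l: "((\<lambda>t. (eval_fps trunc (\<theta> * t) - eval_fps trunc t) / t ^ s) \<longlongrightarrow> fps_nth ?g s) (at 0)"
      unfolding s_def by (rule fps_expansion_leading) (rule nth_less_subdegree_zero)
    have gs: "fps_nth ?g s \<noteq> 0" unfolding s_def using g0 by (rule nth_subdegree_nonzero)
    have l2: "((\<lambda>t::complex. 2 * \<bar>R\<bar> * norm t ^ (D - s)) \<longlongrightarrow> 2 * \<bar>R\<bar> * norm (0::complex) ^ (D - s)) (at 0)" by (intro tendsto_intros)
    have l2z: "2 * \<bar>R\<bar> * norm (0::complex) ^ (D - s) = 0" using s by simp
    define c where "c = norm (fps_nth ?g s) / 2"
    have c: "c > 0" "c < norm (fps_nth ?g s)" using gs by (auto simp: c_def simp del: fps_sub_nth)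
    have "\<forall>\<^sub>F t in at 0. c < norm ((eval_fps trunc (\<theta> * t) - eval_fps trunc t) / t ^ s)"
      using tendsto_norm[OF l] c(2) by (rule order_tendstoD)
    moreover have "\<forall>\<^sub>F t::complex in at 0. 2 * \<bar>R\<bar> * norm t ^ (D - s) < c"
      using order_tendstoD(2)[OF l2, of c] c(1) unfolding l2z by simp
    ultimately show ?thesis using eventually_neq_at_within[of 0 0 UNIV]
    proof eventually_elim
      case (elim t)
      show ?case
      proof (intro allI impI notI)
        fix v w :: complex assume v: "v \<in> ball 0 R" and w: "w \<in> ball 0 R" and eq: "pt (\<theta> * t) w = pt t v"
        then have "eval_fps trunc (\<theta> * t) - eval_fps trunc t = (v - w * \<theta> ^ D) * t ^ D"
          by (simp add: fan_def power_mult_distrib algebra_simps)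
        also have "\<dots> = (v - w * \<theta> ^ D) * t ^ (D - s) * t ^ s" using s by (simp add: mult.assoc flip: power_add)
        finally have "norm ((eval_fps trunc (\<theta> * t) - eval_fps trunc t) / t ^ s) = norm (v - w * \<theta> ^ D) * norm t ^ (D - s)"
          using elim(3) by (simp add: norm_mult norm_power)
        also have "\<dots> \<le> (2 * \<bar>R\<bar>) * norm t ^ (D - s)"
        proof (rule mult_right_mono)
          have "norm (v - w * \<theta> ^ D) \<le> norm v + norm (w * \<theta> ^ D)" by (rule norm_triangle_ineq4)
          also have "norm (w * \<theta> ^ D) = norm w" using n\<theta> by (simp add: norm_mult norm_power)
          finally show "norm (v - w * \<theta> ^ D) \<le> 2 * \<bar>R\<bar>" using v w by simp
        qed simp
        finally show False using elim(1,2) by simp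
      qed
    qed
  qed
  have "finite {\<theta>::complex. \<theta> ^ N = 1}" using finite_roots_unity[of N] N0 by simp
  then have fin: "finite {\<theta>. \<theta> ^ N = 1 \<and> \<theta> \<notin> stabilizer N D k}" by (rule finite_subset[rotated]) auto
  have "\<forall>\<^sub>F t in at 0. \<forall>\<theta>\<in>{\<theta>. \<theta> ^ N = 1 \<and> \<theta> \<notin> stabilizer N D k}. \<forall>v w. v \<in> ball 0 R \<longrightarrow> w \<in> ball 0 R \<longrightarrow> pt (\<theta> * t) w \<noteq> pt t v"
    by (rule eventually_ball_finite[OF fin]) (use one in blast)
  then show ?thesis unfolding eventually_at by (auto simp: dist_norm)
qed

text \<open>
  The function \<open>P\<close> as a polynomial, which gives access to its degree.
\<close>

definition lead_poly :: "complex poly" where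
  "lead_poly = smult (coeff2 u 0 0) (\<Prod>j<n. let m = contact D trunc (param N (\<gamma> j)) in
     [: fps_nth (trunc - param N (\<gamma> j)) m, (if m = D then 1 else 0) :])"

lemma poly_lead_poly: "poly lead_poly v = P v"
  by (simp add: lead_poly_def P_def lead_P_def poly_prod Let_def)

lemma degree_lead_poly: "degree lead_poly = card {j. j < n \<and> contact D (param N (\<gamma> k)) (param N (\<gamma> j)) = D}"
proof -
  let ?q = "\<lambda>j. let m = contact D trunc (param N (\<gamma> j)) in [: fps_nth (trunc - param N (\<gamma> j)) m, (if m = D then 1 else 0) :]"
  have c: "contact D trunc g = contact D (param N (\<gamma> k)) g" for g by (rule contact_cong) (simp add: trunc_nth)
  have "degree lead_poly = degree (\<Prod>j<n. ?q j)" unfolding lead_poly_def using unit by (simp add: unit2_def)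
  also have "\<dots> = (\<Sum>j<n. degree (?q j))"
  proof (rule degree_prod_sum_eq)
    fix j assume "j \<in> {..<n}"
    show "?q j \<noteq> 0"
      using contact_less[of D trunc "param N (\<gamma> j)"] contact_le[of D trunc "param N (\<gamma> j)"]
      by (auto simp: Let_def simp del: fps_sub_nth)
  qed
  also have "\<dots> = (\<Sum>j<n. if contact D (param N (\<gamma> k)) (param N (\<gamma> j)) = D then 1 else 0)"
    by (intro sum.cong) (auto simp: Let_def c)
  also have "\<dots> = card {j. j < n \<and> contact D (param N (\<gamma> k)) (param N (\<gamma> j)) = D}"
    by (simp add: sum.If_cases Int_def conj_commute)
  finally show ?thesis .
qed

lemma degree_lead_poly_pos: "degree lead_poly > 0"
proof -
  have "k \<in> {j. j < n \<and> contact D (param N (\<gamma> k)) (param N (\<gamma> j)) = D}" using k by (simp add: contact_def)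
  moreover have "finite {j. j < n \<and> contact D (param N (\<gamma> k)) (param N (\<gamma> j)) = D}" by simp
  ultimately show ?thesis unfolding degree_lead_poly card_gt_0_iff by blast
qed

end

section \<open>Solving for the level curves\<close>

text \<open>
  The implicit function is known to be continuous, so \<open>left_factor_has_derivative\<close> applies to the
  map \<open>(G, snd)\<close>, whose derivative is invertible.
\<close>

lemma implicit_function_derivative:
  fixes G :: "complex \<times> complex \<Rightarrow> complex"
  assumes G: "(G has_derivative (\<lambda>h. a * fst h + b * snd h)) (at (T v0, v0))" and a: "a \<noteq> 0"
    and cont: "isCont T v0" and eq: "\<forall>\<^sub>F v in nhds v0. G (T v, v) = c"
  shows "(T has_field_derivative (- b / a)) (at v0)"
proof -
  let ?L = "\<lambda>h :: complex \<times> complex. ((fst h - b * snd h) / a, snd h)"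
  have A: "((\<lambda>v. (c, v)) has_derivative (\<lambda>h. (0, h))) (at v0)"
    by (intro has_derivative_Pair has_derivative_const has_derivative_ident)
  have B: "((\<lambda>p. (G p, snd p)) has_derivative (\<lambda>h. (a * fst h + b * snd h, snd h))) (at (T v0, v0))"
    by (intro has_derivative_Pair G has_derivative_snd has_derivative_ident)
  have L: "linear ?L" by (auto simp: linear_iff algebra_simps add_divide_distrib diff_divide_distrib scaleR_conv_of_real)
  have "((\<lambda>v. (T v, v)) has_derivative (?L \<circ> (\<lambda>h. (0, h)))) (at v0)"
    by (rule left_factor_has_derivative[where \<tau>="\<lambda>v. (T v, v)", OF A B L]) (use a cont eq in \<open>auto simp: fun_eq_iff elim: eventually_mono\<close>)
  then have "((\<lambda>v. fst (T v, v)) has_derivative (\<lambda>h. fst ((?L \<circ> (\<lambda>h. (0, h))) h))) (at v0)"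
    by (rule has_derivative_fst)
  then have "(T has_derivative (\<lambda>h. - (b * h / a))) (at v0)" by (simp add: o_def)
  moreover have "(\<lambda>h. - (b * h / a)) = (*) (- b / a)" by (simp add: fun_eq_iff)
  ultimately show ?thesis unfolding has_field_derivative_def by (simp only: )
qed

lemma principal_root:
  assumes x: "norm (x - 1) < 1/2" and H: "H > 0"
  shows "exp (Ln x / of_nat H) ^ H = x" "x \<notin> \<real>\<^sub>\<le>\<^sub>0"
proof -
  have "Re x > 0" using x abs_Re_le_cmod[of "x - 1"] by simp
  then show "x \<notin> \<real>\<^sub>\<le>\<^sub>0" by (auto elim!: nonpos_Reals_cases)
  have "x \<noteq> 0" using \<open>Re x > 0\<close> by auto
  then show "exp (Ln x / of_nat H) ^ H = x" using H by (simp flip: exp_of_nat_mult)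
qed

context canyon_frame
begin

text \<open>
  It tends to \<open>1\<close>, so its principal root is holomorphic.
\<close>

definition ratio :: "complex \<Rightarrow> complex \<Rightarrow> complex" where
  "ratio t v = eval2 f (pt t v) / (lead_a * t ^ H)"

text \<open>
  The branch of \<open>(f(pt t v) / a)^(1/H)\<close> that is asymptotic to \<open>t\<close>. In terms of it the level curve
  \<open>f = c\<close> is given by \<open>f_root t v = \<tau>\<close> for the roots \<open>\<tau>\<close> of \<open>a \<tau>^H = c\<close>.
\<close>

definition f_root :: "complex \<Rightarrow> complex \<Rightarrow> complex" where
  "f_root t v = t * exp (Ln (ratio t v) / of_nat H)"

lemma ratio_limit: "uniform_limit (ball 0 R) ratio (\<lambda>v. 1) (at 0)"
proof -
  have "uniform_limit (ball 0 R) (\<lambda>t v. eval2 f (pt t v) / t ^ H / lead_a) (\<lambda>v. lead_a / lead_a) (at 0)"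
    by (rule uniform_limit_divide_const[OF f_limit])
  then show ?thesis using lead_a_nz by (simp add: ratio_def[abs_def] divide_divide_eq_left mult.commute)
qed

end

text \<open>
  A disc of transversal coordinates \<open>v\<close> together with a range of \<open>t\<close> in which all asymptotic statements
  hold with explicit margins: \<open>f_root\<close> is close to the identity (\<open>near\<close>), and points determine their
  parameters up to the stabilizer (\<open>sep\<close>).
\<close>

locale sheet_frame = canyon_frame +
  fixes R \<delta> Rf :: real
  assumes R: "R > 0" and \<delta>: "\<delta> > 0"
    and Rf_jet: "\<And>g. g \<in> second_jet \<Longrightarrow> diff_radius g Rf"
    and dom: "\<And>t v. norm t < \<delta> \<Longrightarrow> v \<in> ball 0 R \<Longrightarrow> pt t v \<in> polydisc Rf"
    and near: "\<And>t v. t \<noteq> 0 \<Longrightarrow> norm t < \<delta> \<Longrightarrow> v \<in> ball 0 R \<Longrightarrow>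
      norm (ratio t v - 1) < 1/2 \<and> norm (exp (Ln (ratio t v) / of_nat H) - 1) \<le> 1/8"
    and sep: "\<And>\<theta> t v w. \<theta> ^ N = 1 \<Longrightarrow> \<theta> \<notin> stabilizer N D k \<Longrightarrow> t \<noteq> 0 \<Longrightarrow> norm t < \<delta> \<Longrightarrow>
      v \<in> ball 0 R \<Longrightarrow> w \<in> ball 0 R \<Longrightarrow> pt (\<theta> * t) w \<noteq> pt t v"

lemma (in canyon_frame) ex_sheet_frame:
  assumes "R > 0"
  obtains \<delta> Rf where "sheet_frame f \<gamma> n N0 u k N D R \<delta> Rf"
proof -
  obtain Rf where Rf: "\<And>g. g \<in> second_jet \<Longrightarrow> diff_radius g Rf" using ex_radius by blast
  then have Rf0: "Rf > 0" by (auto simp: diff_radius_def second_jet_def)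
  obtain d1 where d1: "d1 > 0" "\<And>t v. norm t < d1 \<Longrightarrow> v \<in> ball 0 R \<Longrightarrow> pt t v \<in> polydisc Rf" using pt_near_0[OF Rf0] by metis
  have "isCont (\<lambda>x. exp (Ln x / of_nat H)) (1::complex)"
    by (intro continuous_intros continuous_at_Ln isCont_exp) (use Hpos in auto)
  then obtain \<epsilon> where \<epsilon>: "\<epsilon> > 0" "\<And>x::complex. dist x 1 < \<epsilon> \<Longrightarrow> dist (exp (Ln x / of_nat H)) (exp (Ln 1 / of_nat H)) < 1/8"
    unfolding continuous_at_eps_delta by (meson zero_less_divide_1_iff zero_less_numeral)
  obtain d2 where d2: "d2 > 0" "\<And>t v. t \<noteq> 0 \<Longrightarrow> norm t < d2 \<Longrightarrow> v \<in> ball 0 R \<Longrightarrow> dist (ratio t v) 1 < min \<epsilon> (1/2)"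
    using uniform_limitD[OF ratio_limit[of R], of "min \<epsilon> (1/2)"] \<epsilon>(1) unfolding eventually_at by (auto simp: dist_norm)
  obtain d3 where d3: "d3 > 0" "\<And>\<theta> t v w. \<theta> ^ N = 1 \<Longrightarrow> \<theta> \<notin> stabilizer N D k \<Longrightarrow> t \<noteq> 0 \<Longrightarrow> norm t < d3 \<Longrightarrow> v \<in> ball 0 R \<Longrightarrow> w \<in> ball 0 R \<Longrightarrow>
     pt (\<theta> * t) w \<noteq> pt t v" using ex_conjugate_separation[of R] by blast
  have "sheet_frame f \<gamma> n N0 u k N D R (min d1 (min d2 d3)) Rf"
  proof unfold_locales
    show "0 < R" by (rule assms)
    show "0 < min d1 (min d2 d3)" using d1 d2 d3 by simp
    show "\<And>g. g \<in> second_jet \<Longrightarrow> diff_radius g Rf" by (rule Rf)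
    show "pt t v \<in> polydisc Rf" if "norm t < min d1 (min d2 d3)" "v \<in> ball 0 R" for t v using d1 that by simp
    show "norm (ratio t v - 1) < 1/2 \<and> norm (exp (Ln (ratio t v) / of_nat H) - 1) \<le> 1/8"
      if "t \<noteq> 0" "norm t < min d1 (min d2 d3)" "v \<in> ball 0 R" for t v
      using d2(2)[OF that(1) _ that(3)] \<epsilon>(2)[of "ratio t v"] that(2) by (auto simp: dist_norm intro: less_imp_le)
    show "pt (\<theta> * t) w \<noteq> pt t v" if "\<theta> ^ N = 1" "\<theta> \<notin> stabilizer N D k" "t \<noteq> 0" "norm t < min d1 (min d2 d3)" "v \<in> ball 0 R" "w \<in> ball 0 R" for \<theta> t v w
      using d3(2)[OF that(1-3) _ that(5,6)] that(4) by simp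
  qed
  then show ?thesis by (rule that)
qed

context sheet_frame
begin

lemma Rf: "diff_radius f Rf" "diff_radius (dz f) Rf" "diff_radius (dw f) Rf"
  using Rf_jet by (auto simp: second_jet_def)

lemma ratio_nonpos: "t \<noteq> 0 \<Longrightarrow> norm t < \<delta> \<Longrightarrow> v \<in> ball 0 R \<Longrightarrow> ratio t v \<notin> \<real>\<^sub>\<le>\<^sub>0"
  using principal_root(2)[OF _ Hpos] near by blast

lemma f_root_pow:
  assumes "t \<noteq> 0" "norm t < \<delta>" "v \<in> ball 0 R"
  shows "lead_a * f_root t v ^ H = eval2 f (pt t v)"
proof -
  have "exp (Ln (ratio t v) / of_nat H) ^ H = ratio t v" by (rule principal_root(1)) (use near[OF assms] Hpos in auto)
  then show ?thesis using assms(1) lead_a_nz by (simp add: f_root_def power_mult_distrib ratio_def)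
qed

lemma f_root_0 [simp]: "f_root 0 v = 0"
  by (simp add: f_root_def)

lemma f_root_close: assumes "norm t < \<delta>" "v \<in> ball 0 R" shows "norm (f_root t v - t) \<le> norm t / 8"
proof (cases "t = 0")
  case False
  have "f_root t v - t = t * (exp (Ln (ratio t v) / of_nat H) - 1)" by (simp add: f_root_def algebra_simps)
  moreover have "norm t * norm (exp (Ln (ratio t v) / of_nat H) - 1) \<le> norm t * (1/8)"
    using near[OF False assms] by (intro mult_left_mono) auto
  ultimately show ?thesis by (simp add: norm_mult)
qed simp

lemma f_root_nz: assumes "t \<noteq> 0" shows "f_root t v \<noteq> 0"
  using assms by (simp add: f_root_def)

lemma f_pt_has_derivative:
  assumes "norm t < \<delta>" "v \<in> ball 0 R"
  shows "((\<lambda>p. eval2 f (pt (fst p) (snd p))) has_derivative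
    (\<lambda>h. (eval2 (dz f) (pt t v) * (eval_fps (fps_deriv trunc) t + of_nat D * v * t ^ (D - 1)) + eval2 (dw f) (pt t v) * (of_nat N * t ^ (N - 1))) * fst h
       + (eval2 (dz f) (pt t v) * t ^ D) * snd h)) (at (t, v))"
proof -
  have l: "((\<lambda>p. eval_fps trunc (fst p)) has_derivative (\<lambda>h. eval_fps (fps_deriv trunc) t * fst h)) (at (t, v))"
    using has_derivative_compose[where f=fst and f'=fst and g="eval_fps trunc" and x="(t, v)" and s=UNIV,
        OF _ has_field_derivative_imp_has_derivative[OF trunc_derivative]]
    by (simp add: bounded_linear_fst bounded_linear_imp_has_derivative)
  have 1: "((\<lambda>p. (eval_fps trunc (fst p) + snd p * fst p ^ D, fst p ^ N)) has_derivative
     (\<lambda>h. (eval_fps (fps_deriv trunc) t * fst h + (snd h * t ^ D + v * (of_nat D * t ^ (D - 1) * fst h)), of_nat N * t ^ (N - 1) * fst h))) (at (t, v))"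
    by (rule has_derivative_Pair) (auto intro!: derivative_eq_intros l simp: fun_eq_iff algebra_simps)
  let ?p = "\<lambda>p. (eval_fps trunc (fst p) + snd p * fst p ^ D, fst p ^ N)"
  have 2: "(eval2 f has_derivative (\<lambda>h. eval2 (dz f) (pt t v) * fst h + eval2 (dw f) (pt t v) * snd h)) (at (?p (t, v)))"
    using Rf(1) dom[OF assms] by (simp add: diff_radius_def fan_def)
  show ?thesis
    using has_derivative_compose[OF 1 2] unfolding fan_def
    by (rule has_derivative_eq_rhs) (simp add: fun_eq_iff algebra_simps)
qed

lemma isCont_f_pt:
  assumes "norm t < \<delta>" "v \<in> ball 0 R" shows "isCont (\<lambda>p. eval2 f (pt (fst p) (snd p))) (t, v)"
  using f_pt_has_derivative[OF assms] by (rule has_derivative_continuous)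

lemma f_root_isCont:
  assumes "t \<noteq> 0" "norm t < \<delta>" "v \<in> ball 0 R" shows "isCont (\<lambda>p. f_root (fst p) (snd p)) (t, v)"
proof -
  have r: "isCont (\<lambda>p. ratio (fst p) (snd p)) (t, v)"
    unfolding ratio_def using lead_a_nz assms by (intro continuous_intros isCont_f_pt) auto
  have 2: "isCont (\<lambda>p. Ln (ratio (fst p) (snd p))) (t, v)"
    by (rule isCont_o2[OF r continuous_at_Ln]) (use ratio_nonpos[OF assms] in simp)
  have 3: "isCont (\<lambda>p. Ln (ratio (fst p) (snd p)) / of_nat H) (t, v)"
    by (rule isCont_divide[OF 2 continuous_const]) (use Hpos in simp)
  show ?thesis unfolding f_root_def
    by (rule isCont_mult[OF continuous_fst[OF continuous_ident] isCont_o2[OF 3 isCont_exp]])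
qed

text \<open>
  The singularity at \<open>t = 0\<close> is removable, since \<open>f_root\<close> is continuous there.
\<close>

lemma f_root_holomorphic:
  assumes v: "v \<in> ball 0 R" shows "(\<lambda>t. f_root t v) holomorphic_on ball 0 \<delta>"
proof (rule no_isolated_singularity[where K="{0}"])
  have F: "(\<lambda>t. eval2 f (pt t v)) holomorphic_on ball 0 \<delta> - {0}"
  proof (rule holomorphic_on_subset)
    show "(\<lambda>t. eval2 f (pt t v)) holomorphic_on ball 0 \<delta>"
      unfolding holomorphic_on_open[OF open_ball]
      using pt_t_derivative[OF Rf(1) dom[OF _ v]] by (auto intro!: exI)
  qed auto
  show "(\<lambda>t. f_root t v) holomorphic_on ball 0 \<delta> - {0}"
    unfolding f_root_def ratio_def
    by (intro holomorphic_intros F) (use lead_a_nz ratio_nonpos[OF _ _ v] Hpos in \<open>auto simp: ratio_def\<close>)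
  then have "continuous_on (ball 0 \<delta> - {0}) (\<lambda>t. f_root t v)" by (rule holomorphic_on_imp_continuous_on)
  then have c1: "isCont (\<lambda>t. f_root t v) t" if "t \<in> ball 0 \<delta> - {0}" for t
    using that by (subst (asm) continuous_on_eq_continuous_at) (auto intro: open_Diff)
  have "isCont (\<lambda>t. f_root t v) 0"
    unfolding isCont_def f_root_0
  proof (rule Lim_null_comparison)
    show "\<forall>\<^sub>F t in at 0. norm (f_root t v) \<le> 2 * norm t"
      unfolding eventually_at
    proof (intro exI[of _ \<delta>] conjI \<delta> ballI impI)
      fix t :: complex assume "t \<noteq> 0 \<and> dist t 0 < \<delta>"
      then have "norm (f_root t v - t) \<le> norm t / 8" by (intro f_root_close v) simp
      then show "norm (f_root t v) \<le> 2 * norm t" using norm_triangle_sub[of "f_root t v" t] norm_ge_zero[of t] by linarith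
    qed
    show "((\<lambda>t::complex. 2 * norm t) \<longlongrightarrow> 0) (at 0)" by (auto intro!: tendsto_eq_intros)
  qed
  then have "isCont (\<lambda>t. f_root t v) t" if "t \<in> ball 0 \<delta>" for t
    using c1[of t] that by (cases "t = 0") auto
  then show "continuous_on (ball 0 \<delta>) (\<lambda>t. f_root t v)"
    by (intro continuous_at_imp_continuous_on) auto
qed auto

text \<open>
  Cauchy's inequality on a disc of radius \<open>\<delta> / 2\<close> turns the bound \<open>\<delta> / 8\<close> for \<open>f_root t v - t\<close> into the
  bound \<open>1/4\<close> for its derivative.
\<close>

lemma f_root_deriv_close:
  assumes v: "v \<in> ball 0 R" and t: "norm t < \<delta> / 2"
  shows "norm (deriv (\<lambda>t. f_root t v) t - 1) \<le> 1/4" "((\<lambda>t. f_root t v) has_field_derivative deriv (\<lambda>t. f_root t v) t) (at t)"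
proof -
  show d: "((\<lambda>t. f_root t v) has_field_derivative deriv (\<lambda>t. f_root t v) t) (at t)"
    by (rule holomorphic_derivI[OF f_root_holomorphic[OF v] open_ball]) (use t \<delta> in auto)
  let ?e = "\<lambda>t. f_root t v - t"
  have he: "?e holomorphic_on ball 0 \<delta>" by (intro holomorphic_intros f_root_holomorphic v)
  have sub: "cball t (\<delta> / 2) \<subseteq> ball 0 \<delta>"
  proof
    fix x assume "x \<in> cball t (\<delta> / 2)"
    then show "x \<in> ball 0 \<delta>" using t norm_triangle_sub[of x t] by (simp add: dist_norm norm_minus_commute)
  qed
  have "norm ((deriv ^^ 1) ?e t) \<le> fact 1 * (\<delta> / 8) / (\<delta> / 2) ^ 1"
  proof (rule Cauchy_inequality)
    show "?e holomorphic_on ball t (\<delta> / 2)" using he sub by (meson holomorphic_on_subset ball_subset_cball order_trans)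
    show "continuous_on (cball t (\<delta> / 2)) ?e" using he sub by (meson holomorphic_on_imp_continuous_on continuous_on_subset)
    show "0 < \<delta> / 2" using \<delta> by simp
    fix x assume "norm (t - x) = \<delta> / 2"
    then have "x \<in> ball 0 \<delta>" using sub by (auto simp: dist_norm)
    then have x: "norm x < \<delta>" by simp
    show "norm (f_root x v - x) \<le> \<delta> / 8" using f_root_close[OF x v] x by simp
  qed
  moreover have "deriv ?e t = deriv (\<lambda>t. f_root t v) t - 1"
    by (rule DERIV_imp_deriv) (auto intro!: derivative_eq_intros d)
  ultimately show "norm (deriv (\<lambda>t. f_root t v) t - 1) \<le> 1/4" using \<delta> by simp
qed

lemma f_root_lipschitz:
  assumes v: "v \<in> ball 0 R" and x: "norm x < \<delta> / 2" and y: "norm y < \<delta> / 2"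
  shows "norm ((f_root x v - x) - (f_root y v - y)) \<le> 1/4 * norm (x - y)"
proof (rule field_differentiable_bound[where S="ball 0 (\<delta>/2)" and f'="\<lambda>t. deriv (\<lambda>t. f_root t v) t - 1"])
  fix z :: complex assume "z \<in> ball 0 (\<delta> / 2)"
  then have z: "norm z < \<delta> / 2" by simp
  show "((\<lambda>t. f_root t v - t) has_field_derivative deriv (\<lambda>t. f_root t v) z - 1) (at z within ball 0 (\<delta> / 2))"
    by (rule has_field_derivative_at_within) (auto intro!: derivative_eq_intros f_root_deriv_close(2)[OF v z])
  show "norm (deriv (\<lambda>t. f_root t v) z - 1) \<le> 1/4" by (rule f_root_deriv_close(1)[OF v z])
qed (use x y in auto)

lemma f_root_expanding:
  assumes v: "v \<in> ball 0 R" and x: "norm x < \<delta> / 2" and y: "norm y < \<delta> / 2"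
  shows "norm (x - y) \<le> 2 * norm (f_root x v - f_root y v)"
proof -
  have "norm (x - y) \<le> norm (f_root x v - f_root y v) + norm ((f_root x v - x) - (f_root y v - y))"
  proof -
    have "(x - y) - (f_root x v - f_root y v) = - ((f_root x v - x) - (f_root y v - y))" by simp
    then show ?thesis using norm_triangle_sub[of "x - y" "f_root x v - f_root y v"] by (metis norm_minus_cancel)
  qed
  then show ?thesis using f_root_lipschitz[OF assms] norm_ge_zero[of "f_root x v - f_root y v"] by linarith
qed

text \<open>
  \<open>t \<mapsto> t - f_root t v + \<tau>\<close> is a contraction of a disc into itself.
\<close>

lemma ex1_sheet:
  assumes v: "v \<in> ball 0 R" and \<tau>: "norm \<tau> < \<delta> / 4"
  shows "\<exists>!x. x \<in> cball 0 (\<delta> / 3) \<and> f_root x v = \<tau>"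
proof -
  let ?f = "\<lambda>x. x - f_root x v + \<tau>"
  have "\<exists>!x\<in>cball 0 (\<delta> / 3). ?f x = x"
  proof (rule Banach_fix)
    show "?f ` cball 0 (\<delta> / 3) \<subseteq> cball 0 (\<delta> / 3)"
    proof (intro image_subsetI)
      fix x :: complex assume "x \<in> cball 0 (\<delta> / 3)"
      then have x: "norm x \<le> \<delta> / 3" "norm x < \<delta>" using \<delta> by auto
      have "norm (x - f_root x v) \<le> norm x / 8" using f_root_close[OF x(2) v] by (simp add: norm_minus_commute)
      then have "norm (?f x) \<le> \<delta> / 24 + \<delta> / 4" using norm_triangle_ineq[of "x - f_root x v" \<tau>] x(1) \<tau> by linarith
      then show "?f x \<in> cball 0 (\<delta> / 3)" using \<delta> by simp
    qed
    fix x y :: complex assume "x \<in> cball 0 (\<delta> / 3)" "y \<in> cball 0 (\<delta> / 3)"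
    then have xy: "norm x < \<delta> / 2" "norm y < \<delta> / 2" using \<delta> by auto
    show "dist (?f x) (?f y) \<le> 1/4 * dist x y"
      using f_root_lipschitz[OF v xy] by (simp add: dist_norm norm_minus_commute algebra_simps)
  qed (use \<delta> in \<open>auto intro: compact_imp_complete\<close>)
  moreover have "?f x = x \<longleftrightarrow> f_root x v = \<tau>" for x by (auto simp: algebra_simps)
  ultimately show ?thesis by (simp add: Ex1_def Bex_def)
qed

text \<open>
  The inverse of \<open>t \<mapsto> f_root t v\<close>, that is, the point of the curve \<open>v = const\<close> on the sheet with
  label \<open>\<tau>\<close>.
\<close>

definition T :: "complex \<Rightarrow> complex \<Rightarrow> complex" where
  "T \<tau> v = (THE x. x \<in> cball 0 (\<delta> / 3) \<and> f_root x v = \<tau>)"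

lemma T:
  assumes v: "v \<in> ball 0 R" and \<tau>: "norm \<tau> < \<delta> / 4"
  shows "f_root (T \<tau> v) v = \<tau>" "norm (T \<tau> v) < \<delta> / 2" "norm (T \<tau> v) < \<delta>" "norm (T \<tau> v) \<le> 2 * norm \<tau>"
proof -
  have t: "T \<tau> v \<in> cball 0 (\<delta> / 3) \<and> f_root (T \<tau> v) v = \<tau>" unfolding T_def by (rule theI'[OF ex1_sheet[OF assms]])
  then show 1: "f_root (T \<tau> v) v = \<tau>" "norm (T \<tau> v) < \<delta> / 2" "norm (T \<tau> v) < \<delta>" using \<delta> by auto
  have "norm (\<tau> - T \<tau> v) \<le> norm (T \<tau> v) / 8" using f_root_close[OF 1(3) v] 1(1) by simp
  then show "norm (T \<tau> v) \<le> 2 * norm \<tau>" 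
    using norm_triangle_sub[of "T \<tau> v" \<tau>] norm_ge_zero[of \<tau>] norm_minus_commute[of \<tau> "T \<tau> v"] by linarith
qed

lemma T_unique:
  assumes v: "v \<in> ball 0 R" and t: "norm t < \<delta> / 2" and \<tau>: "norm (f_root t v) < \<delta> / 4"
  shows "T (f_root t v) v = t"
  using f_root_expanding[OF v T(2)[OF v \<tau>] t] T(1)[OF v \<tau>] by simp

lemma T_nz: assumes "v \<in> ball 0 R" "norm \<tau> < \<delta> / 4" "\<tau> \<noteq> 0" shows "T \<tau> v \<noteq> 0"
  using T(1)[OF assms(1,2)] assms(3) by auto

lemma T_isCont:
  assumes v: "v \<in> ball 0 R" and \<tau>: "norm \<tau> < \<delta> / 4" "\<tau> \<noteq> 0"
  shows "isCont (T \<tau>) v"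
  unfolding isCont_def
proof (rule tendsto_norm_zero_cancel[THEN LIM_zero_cancel, of "T \<tau>" "T \<tau> v"])
  have "isCont (\<lambda>p. f_root (fst p) (snd p)) (T \<tau> v, v)"
    by (rule f_root_isCont[OF T_nz[OF v \<tau>] T(3)[OF v \<tau>(1)] v])
  moreover have "isCont (\<lambda>w. (T \<tau> v, w)) v" by (intro continuous_intros)
  ultimately have "isCont (\<lambda>w. f_root (T \<tau> v) w) v" using continuous_at_compose[of v "\<lambda>w. (T \<tau> v, w)" "\<lambda>p. f_root (fst p) (snd p)"] by (simp add: o_def)
  then have "((\<lambda>w. f_root (T \<tau> v) w) \<longlongrightarrow> \<tau>) (at v)" using T(1)[OF v \<tau>(1)] by (simp add: isCont_def)
  then have "((\<lambda>w. 2 * norm (\<tau> - f_root (T \<tau> v) w)) \<longlongrightarrow> 2 * norm (\<tau> - \<tau>)) (at v)" by (intro tendsto_intros)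
  then have l: "((\<lambda>w. 2 * norm (\<tau> - f_root (T \<tau> v) w)) \<longlongrightarrow> 0) (at v)" by simp
  have "\<forall>\<^sub>F w in at v. w \<in> ball 0 R" using v by (intro eventually_at_in_open') auto
  then have ev: "\<forall>\<^sub>F w in at v. norm (norm (T \<tau> w - T \<tau> v)) \<le> 2 * norm (\<tau> - f_root (T \<tau> v) w)"
  proof eventually_elim
    case (elim w)
    then show ?case using f_root_expanding[OF elim T(2)[OF elim \<tau>(1)] T(2)[OF v \<tau>(1)]] T(1)[OF elim \<tau>(1)] by simp
  qed
  show "((\<lambda>w. norm (T \<tau> w - T \<tau> v)) \<longlongrightarrow> 0) (at v)" by (rule Lim_null_comparison[OF ev l])
qed

text \<open>
  The derivative of \<open>f = a f_root^H\<close> with respect to \<open>t\<close> does not vanish, as the derivative of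
  \<open>f_root\<close> is close to \<open>1\<close>.
\<close>

lemma f_pt_derivative_nz:
  assumes v: "v \<in> ball 0 R" and t: "t \<noteq> 0" "norm t < \<delta> / 2"
  shows "eval2 (dz f) (pt t v) * (eval_fps (fps_deriv trunc) t + of_nat D * v * t ^ (D - 1)) + eval2 (dw f) (pt t v) * (of_nat N * t ^ (N - 1)) \<noteq> 0"
    (is "?a \<noteq> 0")
proof -
  have t\<delta>: "norm t < \<delta>" using t \<delta> by simp
  have 1: "((\<lambda>t. eval2 f (pt t v)) has_field_derivative ?a) (at t)" by (rule pt_t_derivative[OF Rf(1) dom[OF t\<delta> v]])
  let ?d = "deriv (\<lambda>t. f_root t v) t"
  have 2: "((\<lambda>t. lead_a * f_root t v ^ H) has_field_derivative lead_a * (of_nat H * (?d * f_root t v ^ (H - 1)))) (at t)"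
    using DERIV_cmult[OF DERIV_power[OF f_root_deriv_close(2)[OF v t(2)], of H], of lead_a] by simp
  have "\<forall>\<^sub>F s in nhds t. s \<in> ball 0 \<delta> - {0}" by (rule eventually_nhds_in_open) (use t t\<delta> in \<open>auto intro: open_Diff\<close>)
  then have ev: "\<forall>\<^sub>F s in nhds t. lead_a * f_root s v ^ H = eval2 f (pt s v)"
    by eventually_elim (use f_root_pow v in auto)
  have "((\<lambda>t. eval2 f (pt t v)) has_field_derivative lead_a * (of_nat H * (?d * f_root t v ^ (H - 1)))) (at t)"
    using DERIV_cong_ev[OF refl ev refl] 2 by blast
  then have eq: "?a = lead_a * (of_nat H * (?d * f_root t v ^ (H - 1)))" by (rule DERIV_unique[OF 1])
  have "?d \<noteq> 0"
  proof
    assume "?d = 0"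
    then show False using f_root_deriv_close(1)[OF v t(2)] by simp
  qed
  then show ?thesis unfolding eq using lead_a_nz Hpos f_root_nz[OF t(1)] by simp
qed

lemma T_differentiable:
  assumes v: "v \<in> ball 0 R" and \<tau>: "norm \<tau> < \<delta> / 4" "\<tau> \<noteq> 0"
  shows "\<exists>d. (T \<tau> has_field_derivative d) (at v)"
proof -
  have ev: "\<forall>\<^sub>F w in nhds v. eval2 f (pt (fst (T \<tau> w, w)) (snd (T \<tau> w, w))) = lead_a * \<tau> ^ H"
  proof -
    have "\<forall>\<^sub>F w in nhds v. w \<in> ball 0 R" using v by (intro eventually_nhds_in_open) auto
    then show ?thesis
    proof eventually_elim
      case (elim w)
      show ?case using f_root_pow[OF T_nz[OF elim \<tau>] T(3)[OF elim \<tau>(1)] elim] T(1)[OF elim \<tau>(1)] by simp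
    qed
  qed
  show ?thesis
    using implicit_function_derivative[OF f_pt_has_derivative[OF T(3)[OF v \<tau>(1)] v] f_pt_derivative_nz[OF v T_nz[OF v \<tau>] T(2)[OF v \<tau>(1)]] T_isCont[OF v \<tau>] ev]
    by blast
qed

lemma T_holomorphic:
  assumes "norm \<tau> < \<delta> / 4" "\<tau> \<noteq> 0" shows "T \<tau> holomorphic_on ball 0 R"
  unfolding holomorphic_on_open[OF open_ball] using T_differentiable[OF _ assms] by blast

text \<open>
  Stabilizer rotations permute the sheets: \<open>\<theta>\<close> maps the sheet with label \<open>\<tau>\<close> to the one with label
  \<open>\<theta> \<tau>\<close>.
\<close>

lemma f_root_rotate:
  assumes "\<theta> \<in> stabilizer N D k" shows "f_root (\<theta> * t) v = \<theta> * f_root t (\<theta> ^ D * v)"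
  using stabilizer_pow_H[OF assms] by (simp add: f_root_def ratio_def pt_stabilizer[OF assms] power_mult_distrib)

text \<open>
  The second coordinate determines \<open>t\<close> up to an \<open>N\<close>-th root of unity, and \<open>sep\<close> restricts it to the
  stabilizer.
\<close>

lemma pt_fibre:
  assumes eq: "pt t v = pt s w" and t: "t \<noteq> 0" "norm t < \<delta>" and v: "v \<in> ball 0 R" and w: "w \<in> ball 0 R"
  obtains \<theta> where "\<theta> \<in> stabilizer N D k" "s = \<theta> * t" "v = \<theta> ^ D * w"
proof -
  define \<theta> where "\<theta> = s / t"
  have s: "s = \<theta> * t" using t by (simp add: \<theta>_def)
  have "t ^ N = s ^ N" using eq by (simp add: fan_def)
  then have \<theta>N: "\<theta> ^ N = 1" unfolding \<theta>_def power_divide using t by (simp flip: \<open>t ^ N = s ^ N\<close>)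
  have st: "\<theta> \<in> stabilizer N D k"
  proof (rule ccontr)
    assume "\<theta> \<notin> stabilizer N D k"
    then have "pt (\<theta> * t) w \<noteq> pt t v" by (rule sep[OF \<theta>N _ t v w])
    then show False using eq s by simp
  qed
  have "pt t v = pt t (\<theta> ^ D * w)" using eq pt_stabilizer[OF st] s by simp
  then have "v = \<theta> ^ D * w" using t by (simp add: fan_def)
  then show ?thesis by (rule that[OF st s])
qed

end

section \<open>Sheets of a level curve\<close>

lemma curve_has_derivative:
  assumes Z: "(Z has_field_derivative z') (at (cplx x))" and W: "(W has_field_derivative w') (at (cplx x))"
  shows "((\<lambda>x. (Z (cplx x), W (cplx x))) has_derivative (\<lambda>h. (z' * cplx h, w' * cplx h))) (at x)"
  using has_derivative_Pair[OF
      has_derivative_compose[OF bounded_linear_imp_has_derivative[OF bounded_linear_cplx] has_field_derivative_imp_has_derivative[OF Z]]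
      has_derivative_compose[OF bounded_linear_imp_has_derivative[OF bounded_linear_cplx] has_field_derivative_imp_has_derivative[OF W]]]
  by simp

text \<open>
  A holomorphic curve is conformally parametrized.
\<close>

lemma area_element_curve:
  assumes Z: "(Z has_field_derivative z') (at (cplx x))" and W: "(W has_field_derivative w') (at (cplx x))"
  shows "area_element (\<lambda>x. (Z (cplx x), W (cplx x))) x = (norm z')\<^sup>2 + (norm w')\<^sup>2"
    "frechet_derivative (\<lambda>x. (Z (cplx x), W (cplx x))) (at x) = (\<lambda>h. (z' * cplx h, w' * cplx h))"
proof -
  show fd: "frechet_derivative (\<lambda>x. (Z (cplx x), W (cplx x))) (at x) = (\<lambda>h. (z' * cplx h, w' * cplx h))"
    using frechet_derivative_at[OF curve_has_derivative[OF assms]] by simp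
  let ?m = "(norm z')\<^sup>2 + (norm w')\<^sup>2"
  have i1: "(z', w') \<bullet> (z', w') = ?m" unfolding dot_square_norm by (simp add: norm_Pair)
  have i2: "(z' * \<i>, w' * \<i>) \<bullet> (z' * \<i>, w' * \<i>) = ?m" unfolding dot_square_norm by (simp add: norm_Pair norm_mult)
  have i3: "(z', w') \<bullet> (z' * \<i>, w' * \<i>) = 0" by (simp add: inner_Pair inner_complex_def)
  show "area_element (\<lambda>x. (Z (cplx x), W (cplx x))) x = ?m"
    unfolding area_element_def fd Let_def cplx_axis mult_1_right i1 i2 i3 by simp
qed

lemma Delta_eq: "Delta f p = 
   eval2 (dz f) p * eval2 (dw f) p * (eval2 (dw (dz f)) p + eval2 (dz (dw f)) p)
   - eval2 (dz (dz f)) p * eval2 (dw f) p ^ 2 - eval2 (dw (dw f)) p * eval2 (dz f) p ^ 2"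
  unfolding Delta_def det_3 by (simp add: vector_3 power2_eq_square algebra_simps)

text \<open>
  The tangent vector \<open>(z', w')\<close> is a multiple \<open>\<mu> (c, -a)\<close> of the rotated gradient, and the derivative
  of the gradient along it is the Hessian applied to this vector. The Wronskian \<open>a c' - c a'\<close> is then
  \<open>\<mu>\<close> times the bordered Hessian determinant \<open>Delta\<close>.
\<close>

lemma curvature_times_area:
  fixes f :: "complex fps fps" and p :: "complex \<times> complex" and z' w' :: complex
  defines "a \<equiv> eval2 (dz f) p" and "c \<equiv> eval2 (dw f) p"
  defines "a' \<equiv> eval2 (dz (dz f)) p * z' + eval2 (dw (dz f)) p * w'"
    and "c' \<equiv> eval2 (dz (dw f)) p * z' + eval2 (dw (dw f)) p * w'"
  assumes tangent: "a * z' + c * w' = 0"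
  shows "curvature f p * ((norm z')\<^sup>2 + (norm w')\<^sup>2) = 2 * (norm (a * c' - c * a'))\<^sup>2 / ((norm a)\<^sup>2 + (norm c)\<^sup>2)\<^sup>2"
proof (cases "a = 0 \<and> c = 0")
  case True
  then show ?thesis by (simp add: curvature_def a_def c_def)
next
  case False
  obtain \<mu> where \<mu>: "z' = \<mu> * c" "w' = - \<mu> * a"
  proof (cases "c = 0")
    case True
    then have "z' = 0" using tangent False by simp
    then show ?thesis using that[of "- w' / a"] True False by simp
  next
    case False
    have "w' = - (z' / c) * a" using tangent False by (simp add: field_simps) (metis add.commute add_eq_0_iff mult.commute)
    then show ?thesis using that[of "z' / c"] False by simp
  qed
  have "a * c' - c * a' = \<mu> * Delta f p"
    unfolding Delta_eq a'_def c'_def \<mu> a_def c_def by (simp add: power2_eq_square algebra_simps)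
  then have 1: "(norm (a * c' - c * a'))\<^sup>2 = (norm \<mu>)\<^sup>2 * (norm (Delta f p))\<^sup>2" by (simp add: norm_mult power_mult_distrib)
  define m where "m = (norm a)\<^sup>2 + (norm c)\<^sup>2"
  have m: "m > 0" using False by (auto simp: m_def intro: add_pos_nonneg add_nonneg_pos)
  have 2: "(norm z')\<^sup>2 + (norm w')\<^sup>2 = (norm \<mu>)\<^sup>2 * m"
    by (simp add: \<mu> m_def norm_mult power_mult_distrib algebra_simps)
  have cur: "curvature f p = 2 * (norm (Delta f p))\<^sup>2 / m ^ 3" by (simp add: curvature_def m_def a_def c_def)
  show ?thesis unfolding 1 2 cur m_def[symmetric] using m by (simp add: field_simps power2_eq_square power3_eq_cube)
qed

context sheet_frame
begin

definition sheet :: "complex \<Rightarrow> complex \<Rightarrow> complex \<times> complex" where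
  "sheet \<tau> v = pt (T \<tau> v) v"

lemma sheet_in_level:
  assumes "v \<in> ball 0 R" "norm \<tau> < \<delta> / 4" "\<tau> \<noteq> 0"
  shows "eval2 f (sheet \<tau> v) = lead_a * \<tau> ^ H" "sheet \<tau> v \<in> polydisc Rf"
  using f_root_pow[OF T_nz[OF assms] T(3)[OF assms(1,2)] assms(1)] T(1)[OF assms(1,2)] dom[OF T(3)[OF assms(1,2)] assms(1)]
  by (auto simp: sheet_def)

text \<open>
  Two parameters of one point differ by a rotation \<open>\<theta>\<close>, which multiplies the label by \<open>\<theta>\<close>. As the
  labels agree, \<open>\<theta> = 1\<close>.
\<close>

lemma inj_sheet:
  assumes \<tau>: "norm \<tau> < \<delta> / 4" "\<tau> \<noteq> 0" shows "inj_on (sheet \<tau>) (ball 0 R)"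
proof (rule inj_onI)
  fix v w assume v: "v \<in> ball 0 R" and w: "w \<in> ball 0 R" and eq: "sheet \<tau> v = sheet \<tau> w"
  then have "pt (T \<tau> v) v = pt (T \<tau> w) w" by (simp add: sheet_def)
  then obtain \<theta> where \<theta>: "\<theta> \<in> stabilizer N D k" "T \<tau> w = \<theta> * T \<tau> v" "v = \<theta> ^ D * w"
    using pt_fibre[OF _ T_nz[OF v \<tau>] T(3)[OF v \<tau>(1)] v w] by metis
  have "\<tau> = f_root (\<theta> * T \<tau> v) w" using T(1)[OF w \<tau>(1)] \<theta>(2) by simp
  also have "\<dots> = \<theta> * f_root (T \<tau> v) v" unfolding f_root_rotate[OF \<theta>(1)] \<theta>(3) ..
  also have "\<dots> = \<theta> * \<tau>" using T(1)[OF v \<tau>(1)] by simp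
  finally have "\<theta> = 1" using \<tau>(2) by simp
  then show "v = w" using \<theta>(3) by simp
qed

text \<open>
  Near a point of a sheet the coordinates \<open>(t, v)\<close> are recovered by choosing the branch of the \<open>N\<close>-th
  root of the second coordinate near \<open>T \<tau> v0\<close>. Points of the level curve close to this point have a
  label close to \<open>\<tau>\<close>; since there are finitely many labels, it is \<open>\<tau>\<close>. This shows both that sheets are
  open in the level curve and that their inverse is continuous.
\<close>

lemma sheet_local_inverse:
  assumes v0: "v0 \<in> ball 0 R" and \<tau>: "norm \<tau> < \<delta> / 4" "\<tau> \<noteq> 0"
  obtains O' \<nu> where "open O'" "sheet \<tau> v0 \<in> O'" "continuous_on O' \<nu>" "\<nu> (sheet \<tau> v0) = v0"
    "\<And>p. p \<in> O' \<Longrightarrow> eval2 f p = lead_a * \<tau> ^ H \<Longrightarrow> \<nu> p \<in> ball 0 R \<and> p = sheet \<tau> (\<nu> p)"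
proof -
  define t0 where "t0 = T \<tau> v0"
  define p0 where "p0 = sheet \<tau> v0"
  have t0: "t0 \<noteq> 0" "norm t0 < \<delta> / 2" using T_nz[OF v0 \<tau>] T(2)[OF v0 \<tau>(1)] by (auto simp: t0_def)
  \<comment> \<open>The branch of the \<open>N\<close>-th root of the second coordinate near \<open>t0\<close>; the function \<open>\<nu>\<close> is the corresponding coordinate \<open>v\<close>.\<close>
  define r where "r = (\<lambda>p :: complex \<times> complex. t0 * exp (Ln (snd p / t0 ^ N) / of_nat N))"
  define \<nu> where "\<nu> = (\<lambda>p. (fst p - eval_fps trunc (r p)) / r p ^ D)"
  define O1 where "O1 = {p :: complex \<times> complex. dist (snd p / t0 ^ N) 1 < 1/2}"
  have O1: "open O1" unfolding O1_def by (intro open_Collect_less continuous_intros) (use t0 in auto)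
  have pr: "r p ^ N = snd p" "snd p / t0 ^ N \<notin> \<real>\<^sub>\<le>\<^sub>0" if "p \<in> O1" for p
    using principal_root[of "snd p / t0 ^ N" N] that t0 N0 by (auto simp: O1_def r_def dist_norm power_mult_distrib)
  have rnz: "r p \<noteq> 0" for p using t0 by (simp add: r_def)
  have cr: "continuous_on O1 r" unfolding r_def by (intro continuous_intros) (use t0 pr(2) N0 in auto)
  have cl: "continuous_on UNIV (eval_fps trunc)" using trunc_derivative by (meson DERIV_isCont continuous_at_imp_continuous_on)
  have c\<nu>: "continuous_on O1 \<nu>" unfolding \<nu>_def
    by (intro continuous_intros cr continuous_on_compose2[OF cl cr]) (use rnz in auto)
  have pt_inv: "pt (r p) (\<nu> p) = p" if "p \<in> O1" for p
    using pr(1)[OF that] rnz[of p] by (simp add: fan_def \<nu>_def prod_eq_iff)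
  have p0: "snd p0 / t0 ^ N = 1" using t0 by (simp add: p0_def sheet_def fan_def t0_def)
  then have r0: "r p0 = t0" by (simp add: r_def)
  have \<nu>0: "\<nu> p0 = v0" unfolding \<nu>_def r0 using t0 by (simp add: p0_def sheet_def fan_def t0_def)
  define O2 where "O2 = O1 \<inter> (\<lambda>p. (r p, \<nu> p)) -` (ball 0 (\<delta> / 2) \<times> ball 0 R)"
  have O2: "open O2" unfolding O2_def
    by (rule continuous_open_preimage) (intro continuous_intros cr c\<nu> O1 open_Times open_ball)+
  have O2D: "p \<in> O1" "norm (r p) < \<delta> / 2" "norm (r p) < \<delta>" "\<nu> p \<in> ball 0 R" if "p \<in> O2" for p
    using that \<delta> by (auto simp: O2_def)
  define m where "m = (\<lambda>p. f_root (r p) (\<nu> p))"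
  have cm: "continuous_on O2 m"
  proof (rule continuous_at_imp_continuous_on, rule ballI)
    fix p assume p: "p \<in> O2"
    have 1: "isCont (\<lambda>p. (r p, \<nu> p)) p"
      using O2D(1)[OF p] cr c\<nu> O1 by (auto simp: continuous_on_eq_continuous_at intro: continuous_intros)
    show "isCont m p" unfolding m_def
      using isCont_o2[OF 1 f_root_isCont[OF rnz O2D(3,4)[OF p]]] by simp
  qed
  \<comment> \<open>The possible labels of a point of the level curve are isolated.\<close>
  have "finite {x::complex. x ^ H = \<tau> ^ H}" using finite_nth_roots[OF Hpos, of "\<tau> ^ H"] by simp
  then obtain e where e: "e > 0" "\<And>x. x ^ H = \<tau> ^ H \<Longrightarrow> x \<noteq> \<tau> \<Longrightarrow> e \<le> dist \<tau> x"
    using finite_set_avoid[where S="{x. x ^ H = \<tau> ^ H}" and a=\<tau>] by auto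
  define O3 where "O3 = O2 \<inter> m -` ball \<tau> e"
  have O3: "open O3" unfolding O3_def by (rule continuous_open_preimage[OF cm O2 open_ball])
  have p0O1: "p0 \<in> O1" using p0 by (simp add: O1_def)
  have p0O2: "p0 \<in> O2" using p0O1 r0 \<nu>0 t0 v0 by (simp add: O2_def)
  have "m p0 = \<tau>" unfolding m_def r0 \<nu>0 t0_def by (rule T(1)[OF v0 \<tau>(1)])
  then have p0O3: "p0 \<in> O3" using p0O2 e(1) by (simp add: O3_def)
  show ?thesis
  proof (rule that[of O3 \<nu>])
    show "continuous_on O3 \<nu>" by (rule continuous_on_subset[OF c\<nu>]) (auto simp: O3_def O2_def)
    fix p assume p: "p \<in> O3" and F: "eval2 f p = lead_a * \<tau> ^ H"
    have p2: "p \<in> O2" using p by (simp add: O3_def)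
    have "lead_a * m p ^ H = lead_a * \<tau> ^ H"
      unfolding m_def f_root_pow[OF rnz O2D(3,4)[OF p2]] pt_inv[OF O2D(1)[OF p2]] F ..
    then have "m p ^ H = \<tau> ^ H" using lead_a_nz by simp
    moreover have "dist \<tau> (m p) < e" using p by (simp add: O3_def)
    ultimately have "m p = \<tau>" using e(2)[of "m p"] by force
    then have "T \<tau> (\<nu> p) = r p" using T_unique[OF O2D(4,2)[OF p2]] \<tau>(1) by (simp add: m_def)
    then show "\<nu> p \<in> ball 0 R \<and> p = sheet \<tau> (\<nu> p)" using O2D(4)[OF p2] pt_inv[OF O2D(1)[OF p2]] by (simp add: sheet_def)
  qed (use O3 p0O3 \<nu>0 in \<open>auto simp: p0_def\<close>)
qed

definition sheet_z :: "complex \<Rightarrow> complex \<Rightarrow> complex" where "sheet_z \<tau> v = fst (sheet \<tau> v)"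
definition sheet_w :: "complex \<Rightarrow> complex \<Rightarrow> complex" where "sheet_w \<tau> v = snd (sheet \<tau> v)"

lemma sheet_derivatives:
  assumes v: "v \<in> ball 0 R" and \<tau>: "norm \<tau> < \<delta> / 4" "\<tau> \<noteq> 0"
  shows "(sheet_z \<tau> has_field_derivative deriv (sheet_z \<tau>) v) (at v)" "(sheet_w \<tau> has_field_derivative deriv (sheet_w \<tau>) v) (at v)"
    "\<not> (deriv (sheet_z \<tau>) v = 0 \<and> deriv (sheet_w \<tau>) v = 0)"
proof -
  obtain d where d: "(T \<tau> has_field_derivative d) (at v)" using T_differentiable[OF assms] by blast
  have l: "((\<lambda>v. eval_fps trunc (T \<tau> v)) has_field_derivative eval_fps (fps_deriv trunc) (T \<tau> v) * d) (at v)"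
    by (rule DERIV_chain2[OF trunc_derivative d])
  have Z: "(sheet_z \<tau> has_field_derivative (eval_fps (fps_deriv trunc) (T \<tau> v) * d + (T \<tau> v ^ D + v * (of_nat D * T \<tau> v ^ (D - 1) * d)))) (at v)"
    unfolding sheet_z_def[abs_def] sheet_def fan_def fst_conv
    by (rule DERIV_cong[OF DERIV_add[OF l DERIV_mult[OF DERIV_ident DERIV_power[OF d]]]]) (simp add: algebra_simps)
  have W: "(sheet_w \<tau> has_field_derivative (of_nat N * T \<tau> v ^ (N - 1) * d)) (at v)"
    unfolding sheet_w_def[abs_def] sheet_def fan_def snd_conv by (rule DERIV_cong[OF DERIV_power[OF d]]) simp
  show "(sheet_z \<tau> has_field_derivative deriv (sheet_z \<tau>) v) (at v)" "(sheet_w \<tau> has_field_derivative deriv (sheet_w \<tau>) v) (at v)"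
    using Z W DERIV_imp_deriv by metis+
  show "\<not> (deriv (sheet_z \<tau>) v = 0 \<and> deriv (sheet_w \<tau>) v = 0)"
    using DERIV_imp_deriv[OF Z] DERIV_imp_deriv[OF W] T_nz[OF assms] N0 by auto
qed

lemma sheet_holomorphic:
  assumes \<tau>: "norm \<tau> < \<delta> / 4" "\<tau> \<noteq> 0"
  shows "sheet_z \<tau> holomorphic_on ball 0 R" "sheet_w \<tau> holomorphic_on ball 0 R"
  unfolding holomorphic_on_open[OF open_ball] using sheet_derivatives[OF _ \<tau>] by blast+

lemma sheet_eq: "sheet \<tau> v = (sheet_z \<tau> v, sheet_w \<tau> v)"
  by (simp add: sheet_z_def sheet_w_def)

theorem sheet_chart:
  assumes \<tau>: "norm \<tau> < \<delta> / 4" "\<tau> \<noteq> 0"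
  shows "surface_chart (level_surface f (lead_a * \<tau> ^ H)) (ball 0 R) (\<lambda>x. sheet \<tau> (cplx x))"
proof -
  let ?S = "level_surface f (lead_a * \<tau> ^ H)" and ?\<phi> = "\<lambda>x. sheet \<tau> (cplx x)" and ?U = "ball 0 R :: (real^2) set"
  have U: "cplx x \<in> ball 0 R \<longleftrightarrow> x \<in> ?U" for x by simp
  have der: "(sheet_z \<tau> has_field_derivative deriv (sheet_z \<tau>) (cplx x)) (at (cplx x))" "(sheet_w \<tau> has_field_derivative deriv (sheet_w \<tau>) (cplx x)) (at (cplx x))"
    if "x \<in> ?U" for x using sheet_derivatives(1,2)[OF _ \<tau>, of "cplx x"] that U by auto
  have \<phi>: "?\<phi> = (\<lambda>x. (sheet_z \<tau> (cplx x), sheet_w \<tau> (cplx x)))" by (simp add: sheet_eq)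
  have hd: "(?\<phi> has_derivative (\<lambda>h. (deriv (sheet_z \<tau>) (cplx x) * cplx h, deriv (sheet_w \<tau>) (cplx x) * cplx h))) (at x)" if "x \<in> ?U" for x
    unfolding \<phi> by (rule curve_has_derivative[OF der[OF that]])
  have fd: "frechet_derivative ?\<phi> (at x) = (\<lambda>h. (deriv (sheet_z \<tau>) (cplx x) * cplx h, deriv (sheet_w \<tau>) (cplx x) * cplx h))" if "x \<in> ?U" for x
    unfolding \<phi> by (rule area_element_curve(2)[OF der[OF that]])
  have cphi: "continuous_on ?U ?\<phi>" using hd by (meson continuous_at_imp_continuous_on has_derivative_continuous)
  have inj: "inj_on ?\<phi> ?U"
  proof (rule inj_onI)
    fix x y assume "x \<in> ?U" "y \<in> ?U" "?\<phi> x = ?\<phi> y"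
    then have "cplx x = cplx y" using inj_sheet[OF \<tau>] U by (metis inj_onD)
    then show "x = y" by (metis cplx_uncplx(2))
  qed
  have img: "sheet \<tau> v \<in> ?\<phi> ` ?U" if "v \<in> ball 0 R" for v
    using that by (intro image_eqI[of _ _ "uncplx v"]) auto
  have sub: "?\<phi> ` ?U \<subseteq> ?S" using sheet_in_level(1)[OF _ \<tau>] U by (auto simp: level_surface_def)
  have op: "openin (top_of_set ?S) (?\<phi> ` ?U)"
  proof (subst openin_subopen, rule ballI)
    fix p assume "p \<in> ?\<phi> ` ?U"
    then obtain v0 where v0: "v0 \<in> ball 0 R" "p = sheet \<tau> v0" using U by blast
    obtain O' \<nu> where O': "open O'" "sheet \<tau> v0 \<in> O'"
      "\<And>p. p \<in> O' \<Longrightarrow> eval2 f p = lead_a * \<tau> ^ H \<Longrightarrow> \<nu> p \<in> ball 0 R \<and> p = sheet \<tau> (\<nu> p)"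
      using sheet_local_inverse[OF v0(1) \<tau>] by metis
    have "?S \<inter> O' \<subseteq> ?\<phi> ` ?U"
    proof
      fix p assume "p \<in> ?S \<inter> O'"
      then have "\<nu> p \<in> ball 0 R" "p = sheet \<tau> (\<nu> p)" using O'(3)[of p] by (auto simp: level_surface_def)
      then show "p \<in> ?\<phi> ` ?U" using img by metis
    qed
    moreover have "p \<in> ?S \<inter> O'" using O'(2) v0 sheet_in_level(1)[OF v0(1) \<tau>] by (auto simp: level_surface_def)
    ultimately show "\<exists>T. openin (top_of_set ?S) T \<and> p \<in> T \<and> T \<subseteq> ?\<phi> ` ?U"
      using openin_open_Int[OF O'(1), of ?S] by blast
  qed
  let ?g = "the_inv_into ?U ?\<phi>"
  have cg: "continuous_on (?\<phi> ` ?U) ?g"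
    unfolding continuous_on_eq_continuous_within
  proof
    fix p assume p: "p \<in> ?\<phi> ` ?U"
    then obtain v0 where v0: "v0 \<in> ball 0 R" "p = sheet \<tau> v0" using U by blast
    obtain O' \<nu> where O': "open O'" "sheet \<tau> v0 \<in> O'" "continuous_on O' \<nu>" "\<nu> (sheet \<tau> v0) = v0"
      "\<And>p. p \<in> O' \<Longrightarrow> eval2 f p = lead_a * \<tau> ^ H \<Longrightarrow> \<nu> p \<in> ball 0 R \<and> p = sheet \<tau> (\<nu> p)"
      using sheet_local_inverse[OF v0(1) \<tau>] by metis
    have ginv: "?g s = uncplx (\<nu> s)" if s: "s \<in> O'" "s \<in> ?\<phi> ` ?U" for s
    proof -
      have "eval2 f s = lead_a * \<tau> ^ H" using sub s(2) by (auto simp: level_surface_def)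
      then have "\<nu> s \<in> ball 0 R" "s = sheet \<tau> (\<nu> s)" using O'(5)[OF s(1)] by auto
      then show ?thesis by (intro the_inv_into_f_eq[OF inj]) auto
    qed
    have "isCont \<nu> p" using O'(1-3) v0(2) by (simp add: continuous_on_eq_continuous_at)
    then have "isCont (\<lambda>s. uncplx (\<nu> s)) p"
      by (rule isCont_o2[OF _ linear_continuous_at[OF bounded_linear_uncplx]])
    then have "((\<lambda>s. uncplx (\<nu> s)) \<longlongrightarrow> uncplx (\<nu> p)) (at p within ?\<phi> ` ?U)"
      unfolding isCont_def by (rule tendsto_within_subset) simp
    moreover have "\<forall>\<^sub>F s in at p within ?\<phi> ` ?U. uncplx (\<nu> s) = ?g s"
    proof -
      have "\<forall>\<^sub>F s in nhds p. s \<in> O'" using O'(1,2) v0(2) by (auto intro: eventually_nhds_in_open)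
      then show ?thesis unfolding eventually_at_filter by eventually_elim (use ginv in auto)
    qed
    ultimately have "(?g \<longlongrightarrow> uncplx (\<nu> p)) (at p within ?\<phi> ` ?U)" by (rule Lim_transform_eventually)
    then show "continuous (at p within ?\<phi> ` ?U) ?g"
      using ginv[of p] O'(2) v0(2) p by (simp add: continuous_within)
  qed
  have gi: "?g (?\<phi> x) = x" if "x \<in> ?U" for x by (rule the_inv_into_f_f[OF inj that])
  have hom: "homeomorphism ?U (?\<phi> ` ?U) ?\<phi> ?g"
  proof (rule homeomorphismI[OF cphi cg])
    show "?g ` ?\<phi> ` ?U \<subseteq> ?U"
    proof
      fix y assume "y \<in> ?g ` ?\<phi> ` ?U"
      then obtain x where "x \<in> ?U" "y = ?g (?\<phi> x)" by (elim imageE) simp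
      then show "y \<in> ?U" using gi[of x] by simp
    qed
    show "?\<phi> (?g y) = y" if "y \<in> ?\<phi> ` ?U" for y
      by (rule f_the_inv_into_f[OF inj that])
  qed (use gi in auto)
  show ?thesis
    unfolding surface_chart_def
  proof (intro conjI ballI allI)
    show "open ?U" by simp
    show "openin (top_of_set ?S) (?\<phi> ` ?U)" by (rule op)
    show "\<exists>\<psi>. homeomorphism ?U (?\<phi> ` ?U) ?\<phi> \<psi>" using hom by blast
    fix x assume x: "x \<in> ?U"
    show "?\<phi> differentiable at x" using hd[OF x] by (rule differentiableI)
    have nz: "\<not> (deriv (sheet_z \<tau>) (cplx x) = 0 \<and> deriv (sheet_w \<tau>) (cplx x) = 0)" using sheet_derivatives(3)[OF _ \<tau>] x U by blast
    have "area_element ?\<phi> x = (norm (deriv (sheet_z \<tau>) (cplx x)))\<^sup>2 + (norm (deriv (sheet_w \<tau>) (cplx x)))\<^sup>2"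
      unfolding \<phi> by (rule area_element_curve(1)[OF der[OF x]])
    then show "0 < area_element ?\<phi> x" using nz by (auto intro: add_pos_nonneg add_nonneg_pos)
  next
    fix h
    have cZ: "continuous_on (ball 0 R) (deriv (sheet_z \<tau>))" and cW: "continuous_on (ball 0 R) (deriv (sheet_w \<tau>))"
      using holomorphic_on_imp_continuous_on[OF holomorphic_deriv[OF sheet_holomorphic(1)[OF \<tau>] open_ball]]
        holomorphic_on_imp_continuous_on[OF holomorphic_deriv[OF sheet_holomorphic(2)[OF \<tau>] open_ball]] by simp_all
    have cc: "continuous_on ?U cplx" by (rule linear_continuous_on[OF bounded_linear_cplx])
    have ci: "cplx ` ?U \<subseteq> ball 0 R" by auto
    have "continuous_on ?U (\<lambda>x. (deriv (sheet_z \<tau>) (cplx x) * cplx h, deriv (sheet_w \<tau>) (cplx x) * cplx h))"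
      by (intro continuous_on_Pair continuous_on_mult continuous_on_const continuous_on_compose2[OF cZ cc ci] continuous_on_compose2[OF cW cc ci])
    then show "continuous_on ?U (\<lambda>x. frechet_derivative ?\<phi> (at x) h)"
      by (rule continuous_on_eq) (simp add: fd)
  qed
qed

end

section \<open>The curvature form\<close>

text \<open>
  The area form of the projective line, normalized to total area \<open>2 pi\<close>, at the point \<open>(a : c)\<close> for
  a curve with velocity \<open>(a', c')\<close>.
\<close>

definition wronskian_density :: "complex \<Rightarrow> complex \<Rightarrow> complex \<Rightarrow> complex \<Rightarrow> real" where
  "wronskian_density a a' c c' = 2 * (norm (a * c' - c * a'))\<^sup>2 / ((norm a)\<^sup>2 + (norm c)\<^sup>2)\<^sup>2"

text \<open>
  Multiplying \<open>(a, c)\<close> by a function \<open>s\<close> does not change the point of the projective line.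
\<close>

lemma wronskian_density_scale:
  assumes "s \<noteq> 0"
  shows "wronskian_density (s * a) (s' * a + s * a') (s * c) (s' * c + s * c') = wronskian_density a a' c c'"
proof -
  have 1: "s * a * (s' * c + s * c') - s * c * (s' * a + s * a') = s\<^sup>2 * (a * c' - c * a')" by (simp add: power2_eq_square algebra_simps)
  have 2: "(norm (s * a))\<^sup>2 + (norm (s * c))\<^sup>2 = (norm s)\<^sup>2 * ((norm a)\<^sup>2 + (norm c)\<^sup>2)"
    by (simp add: norm_mult power_mult_distrib algebra_simps)
  show ?thesis unfolding wronskian_density_def 1 2 using assms by (simp add: norm_mult norm_power power_mult_distrib)
qed

lemma wronskian_density_bound:
  assumes "norm a \<le> M" "norm a' \<le> M" "norm c \<le> M" "norm c' \<le> M" and m: "m > 0" "m \<le> norm a \<or> m \<le> norm c"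
  shows "wronskian_density a a' c c' \<le> 2 * (2 * M * M)\<^sup>2 / (m\<^sup>2)\<^sup>2"
  unfolding wronskian_density_def
proof (rule frac_le)
  have M: "M \<ge> 0" using assms(1) norm_ge_zero[of a] by linarith
  have "norm (a * c' - c * a') \<le> norm a * norm c' + norm c * norm a'" by (rule order_trans[OF norm_triangle_ineq4]) (simp add: norm_mult)
  also have "\<dots> \<le> M * M + M * M" using assms M by (intro add_mono mult_mono) auto
  finally show "2 * (norm (a * c' - c * a'))\<^sup>2 \<le> 2 * (2 * M * M)\<^sup>2" by (simp add: power_mono)
  have "m\<^sup>2 \<le> (norm a)\<^sup>2 + (norm c)\<^sup>2"
    using m(2)
  proof
    assume "m \<le> norm a" then have "m\<^sup>2 \<le> (norm a)\<^sup>2" using m(1) by (simp add: power_mono)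
    then show ?thesis using zero_le_power2[of "norm c"] by linarith
  next
    assume "m \<le> norm c" then have "m\<^sup>2 \<le> (norm c)\<^sup>2" using m(1) by (simp add: power_mono)
    then show ?thesis using zero_le_power2[of "norm a"] by linarith
  qed
  then show "(m\<^sup>2)\<^sup>2 \<le> ((norm a)\<^sup>2 + (norm c)\<^sup>2)\<^sup>2" by (rule power_mono) simp
qed (use m in auto)

text \<open>
  Cauchy's inequality on discs of radius \<open>(R - r) / 2\<close>.
\<close>

lemma uniform_limit_deriv:
  fixes A :: "'a \<Rightarrow> complex \<Rightarrow> complex"
  assumes u: "uniform_limit (ball 0 R) A A0 F" and h: "\<forall>\<^sub>F t in F. A t holomorphic_on ball 0 R"
    and h0: "A0 holomorphic_on ball 0 R" and r: "r < R"
  shows "uniform_limit (cball 0 r) (\<lambda>t. deriv (A t)) (deriv A0) F"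
proof (rule uniform_limitI)
  fix e :: real assume e: "e > 0"
  define s where "s = (R - r) / 2"
  have s: "s > 0" using r by (simp add: s_def)
  have "\<forall>\<^sub>F t in F. \<forall>v\<in>ball 0 R. dist (A t v) (A0 v) < e * s / 2"
    by (rule uniform_limitD[OF u]) (use e s in simp)
  then show "\<forall>\<^sub>F t in F. \<forall>v\<in>cball 0 r. dist (deriv (A t) v) (deriv A0 v) < e"
    using h
  proof eventually_elim
    case (elim t)
    show ?case
    proof
      fix v :: complex assume v: "v \<in> cball 0 r"
      have sub: "cball v s \<subseteq> ball 0 R"
      proof
        fix x assume "x \<in> cball v s"
        then have "norm (x - v) \<le> s" "norm v \<le> r" using v by (auto simp: dist_norm norm_minus_commute)
        then show "x \<in> ball 0 R" using norm_triangle_sub[of x v] r by (simp add: s_def)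
      qed
      have hd: "(\<lambda>z. A t z - A0 z) holomorphic_on ball 0 R" by (intro holomorphic_intros elim h0)
      have "norm ((deriv ^^ 1) (\<lambda>z. A t z - A0 z) v) \<le> fact 1 * (e * s / 2) / s ^ 1"
      proof (rule Cauchy_inequality)
        show "(\<lambda>z. A t z - A0 z) holomorphic_on ball v s"
          by (rule holomorphic_on_subset[OF hd order_trans[OF ball_subset_cball sub]])
        show "continuous_on (cball v s) (\<lambda>z. A t z - A0 z)"
          by (rule holomorphic_on_imp_continuous_on[OF holomorphic_on_subset[OF hd sub]])
        fix x assume "norm (v - x) = s"
        then have "x \<in> ball 0 R" using sub by (auto simp: dist_norm)
        then show "norm (A t x - A0 x) \<le> e * s / 2" using elim(1) by (force simp: dist_norm)
      qed (rule s)
      moreover have "v \<in> ball 0 R" using v r by simp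
      then have "deriv (\<lambda>z. A t z - A0 z) v = deriv (A t) v - deriv A0 v"
        using holomorphic_on_imp_differentiable_at[OF elim(2) open_ball] holomorphic_on_imp_differentiable_at[OF h0 open_ball]
        by (intro deriv_diff)
      ultimately show "dist (deriv (A t) v) (deriv A0 v) < e" using s e by (simp add: dist_norm)
    qed
  qed
qed

lemma wronskian_density_measurable:
  assumes A: "A holomorphic_on ball 0 R" and C: "C holomorphic_on ball 0 R" and K: "compact K" "K \<subseteq> ball 0 R"
  shows "(\<lambda>x. ennreal (wronskian_density (A (cplx x)) (deriv A (cplx x)) (C (cplx x)) (deriv C (cplx x))) * indicator (cplx -` K) x)
    \<in> borel_measurable borel"
proof -
  have m: "(\<lambda>x. indicator K x *\<^sub>R g x) \<in> borel_measurable borel" if "g holomorphic_on ball 0 R" for g :: "complex \<Rightarrow> complex"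
    by (rule borel_measurable_continuous_on_indicator[OF borel_closed[OF compact_imp_closed[OF K(1)]]
          holomorphic_on_imp_continuous_on[OF holomorphic_on_subset[OF that K(2)]]])
  define c where "c = (\<lambda>g :: complex \<Rightarrow> complex. \<lambda>x. indicator K (cplx x) *\<^sub>R g (cplx x))"
  have c: "c g \<in> borel_measurable borel" if "g holomorphic_on ball 0 R" for g
    unfolding c_def by (rule measurable_compose[OF cplx_measurable m[OF that]])
  have [measurable]: "c A \<in> borel_measurable borel" "c C \<in> borel_measurable borel"
      "c (deriv A) \<in> borel_measurable borel" "c (deriv C) \<in> borel_measurable borel"
    using c A C holomorphic_deriv[OF A open_ball] holomorphic_deriv[OF C open_ball] by auto
  have "(\<lambda>x. ennreal (wronskian_density (c A x) (c (deriv A) x) (c C x) (c (deriv C) x))) \<in> borel_measurable borel"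
    unfolding wronskian_density_def by measurable
  moreover have "(\<lambda>x. ennreal (wronskian_density (c A x) (c (deriv A) x) (c C x) (c (deriv C) x)))
    = (\<lambda>x. ennreal (wronskian_density (A (cplx x)) (deriv A (cplx x)) (C (cplx x)) (deriv C (cplx x))) * indicator (cplx -` K) x)"
  proof
    fix x
    show "ennreal (wronskian_density (c A x) (c (deriv A) x) (c C x) (c (deriv C) x))
       = ennreal (wronskian_density (A (cplx x)) (deriv A (cplx x)) (C (cplx x)) (deriv C (cplx x))) * indicator (cplx -` K) x"
      by (cases "cplx x \<in> K") (simp_all add: c_def wronskian_density_def)
  qed
  ultimately show ?thesis by simp
qed

text \<open>
  Dominated convergence. The derivatives converge on the smaller disc by \<open>uniform_limit_deriv\<close>, and
  the denominators stay bounded away from \<open>0\<close> by the lower bound \<open>m\<close>.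
\<close>

lemma nn_integral_wronskian_limit:
  fixes A C :: "nat \<Rightarrow> complex \<Rightarrow> complex"
  assumes uA: "uniform_limit (ball 0 R) A A0 sequentially" and uC: "uniform_limit (ball 0 R) C C0 sequentially"
    and hA: "\<forall>\<^sub>F i in sequentially. A i holomorphic_on ball 0 R" and hC: "\<forall>\<^sub>F i in sequentially. C i holomorphic_on ball 0 R"
    and hA0: "A0 holomorphic_on ball 0 R" and hC0: "C0 holomorphic_on ball 0 R"
    and m: "m > 0" "\<And>v. v \<in> ball 0 R \<Longrightarrow> m \<le> norm (A0 v) \<or> m \<le> norm (C0 v)"
    and K: "compact K" "K \<subseteq> cball 0 r" and r: "r < R"
  shows "(\<lambda>i. \<integral>\<^sup>+x\<in>cplx -` K. ennreal (wronskian_density (A i (cplx x)) (deriv (A i) (cplx x)) (C i (cplx x)) (deriv (C i) (cplx x))) \<partial>lborel)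
    \<longlonglongrightarrow> (\<integral>\<^sup>+x\<in>cplx -` K. ennreal (wronskian_density (A0 (cplx x)) (deriv A0 (cplx x)) (C0 (cplx x)) (deriv C0 (cplx x))) \<partial>lborel)"
proof -
  have sub: "cball 0 r \<subseteq> ball (0::complex) R" using r by auto
  have KR: "K \<subseteq> ball 0 R" using K(2) sub by blast
  note uA' = uniform_limit_deriv[OF uA hA hA0 r] and uC' = uniform_limit_deriv[OF uC hC hC0 r]
  have bd: "\<exists>M. \<forall>v\<in>cball 0 r. norm (g v) \<le> M" if "g holomorphic_on ball 0 R" for g :: "complex \<Rightarrow> complex"
  proof -
    have "compact (g ` cball 0 r)"
      by (intro compact_continuous_image holomorphic_on_imp_continuous_on[OF holomorphic_on_subset[OF that sub]] compact_cball)
    then have "bounded (g ` cball 0 r)" by (rule compact_imp_bounded)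
    then show ?thesis by (simp add: bounded_iff)
  qed
  obtain M1 M2 M3 M4 where M: "\<forall>v\<in>cball 0 r. norm (A0 v) \<le> M1" "\<forall>v\<in>cball 0 r. norm (C0 v) \<le> M2"
    "\<forall>v\<in>cball 0 r. norm (deriv A0 v) \<le> M3" "\<forall>v\<in>cball 0 r. norm (deriv C0 v) \<le> M4"
    using bd[OF hA0] bd[OF hC0] bd[OF holomorphic_deriv[OF hA0 open_ball]] bd[OF holomorphic_deriv[OF hC0 open_ball]] by auto
  define M where "M = max (max M1 M2) (max M3 M4) + 1"
  \<comment> \<open>From some index on, all four functions are within \<open>1\<close> of their limits, and the lower bound \<open>m\<close> degrades to \<open>m / 2\<close> at most.\<close>
  define e where "e = min 1 (m / 2)"
  have e: "e > 0" using m by (simp add: e_def)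
  define B where "B = 2 * (2 * M * M)\<^sup>2 / ((m/2)\<^sup>2)\<^sup>2"
  define G where "G = (\<lambda>A C v :: complex. wronskian_density (A v) (deriv A v) (C v) (deriv C v))"
  have "\<forall>\<^sub>F i in sequentially. A i holomorphic_on ball 0 R \<and> C i holomorphic_on ball 0 R \<and> (\<forall>v\<in>cball 0 r. G (A i) (C i) v \<le> B)"
    using hA hC uniform_limitD[OF uA e] uniform_limitD[OF uC e] uniform_limitD[OF uA' e] uniform_limitD[OF uC' e]
  proof eventually_elim
    case (elim i)
    show ?case
    proof (intro conjI elim ballI)
      fix v :: complex assume v: "v \<in> cball 0 r"
      then have vR: "v \<in> ball 0 R" using sub by blast
      have d: "norm (A i v - A0 v) < e" "norm (C i v - C0 v) < e" "norm (deriv (A i) v - deriv A0 v) < e" "norm (deriv (C i) v - deriv C0 v) < e"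
        using elim(3-6) v vR by (auto simp: dist_norm)
      have up: "norm a \<le> M" if "norm (a - b) < e" "norm b \<le> max (max M1 M2) (max M3 M4)" for a b :: complex
        using that norm_triangle_sub[of a b] by (simp add: M_def e_def)
      have lo: "m / 2 \<le> norm a" if "norm (a - b) < e" "m \<le> norm b" for a b :: complex
        using that norm_triangle_sub[of b a] by (simp add: norm_minus_commute e_def)
      have bs: "norm (A0 v) \<le> max (max M1 M2) (max M3 M4)" "norm (C0 v) \<le> max (max M1 M2) (max M3 M4)"
         "norm (deriv A0 v) \<le> max (max M1 M2) (max M3 M4)" "norm (deriv C0 v) \<le> max (max M1 M2) (max M3 M4)"
        using M v by (auto simp: le_max_iff_disj)
      show "G (A i) (C i) v \<le> B"
        unfolding G_def B_def
      proof (rule wronskian_density_bound)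
        show "m / 2 \<le> norm (A i v) \<or> m / 2 \<le> norm (C i v)" using m(2)[OF vR] lo d by blast
      qed (use up[OF d(1) bs(1)] up[OF d(2) bs(2)] up[OF d(3) bs(3)] up[OF d(4) bs(4)] m in auto)
    qed
  qed
  then obtain n0 where n0: "\<And>i. i \<ge> n0 \<Longrightarrow> A i holomorphic_on ball 0 R" "\<And>i. i \<ge> n0 \<Longrightarrow> C i holomorphic_on ball 0 R"
      "\<And>i v. i \<ge> n0 \<Longrightarrow> v \<in> cball 0 r \<Longrightarrow> G (A i) (C i) v \<le> B"
    unfolding eventually_sequentially by blast
  have mK: "cplx -` K \<in> sets borel"
    using measurable_sets_borel[OF cplx_measurable borel_closed[OF compact_imp_closed[OF K(1)]]] by simp
  have "(\<lambda>i. \<integral>\<^sup>+x. ennreal (G (A (i + n0)) (C (i + n0)) (cplx x)) * indicator (cplx -` K) x \<partial>lborel)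
     \<longlonglongrightarrow> (\<integral>\<^sup>+x. ennreal (G A0 C0 (cplx x)) * indicator (cplx -` K) x \<partial>lborel)"
  proof (rule nn_integral_dominated_convergence[where w="\<lambda>x. ennreal B * indicator (cplx -` K) x"])
    show "(\<lambda>x. ennreal (G (A (i + n0)) (C (i + n0)) (cplx x)) * indicator (cplx -` K) x) \<in> borel_measurable lborel" for i
      using wronskian_density_measurable[OF n0(1)[of "i + n0"] n0(2)[of "i + n0"] K(1) KR] by (simp add: G_def)
    show "(\<lambda>x. ennreal (G A0 C0 (cplx x)) * indicator (cplx -` K) x) \<in> borel_measurable lborel"
      using wronskian_density_measurable[OF hA0 hC0 K(1) KR] by (simp add: G_def)
    show "(\<lambda>x. ennreal B * indicator (cplx -` K) x) \<in> borel_measurable lborel" using mK by simp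
    show "AE x in lborel. ennreal (G (A (i + n0)) (C (i + n0)) (cplx x)) * indicator (cplx -` K) x \<le> ennreal B * indicator (cplx -` K) x" for i
    proof (rule AE_I2)
      fix x
      show "ennreal (G (A (i + n0)) (C (i + n0)) (cplx x)) * indicator (cplx -` K) x \<le> ennreal B * indicator (cplx -` K) x"
        using n0(3)[of "i + n0" "cplx x"] K(2) by (cases "cplx x \<in> K") (auto intro!: ennreal_leI)
    qed
    have "bounded (cplx -` K)"
      using compact_imp_bounded[OF K(1)] unfolding bounded_iff by (metis norm_cplx vimageE)
    then have "emeasure lborel (cplx -` K) < \<infinity>" by (rule emeasure_bounded_finite)
    then show "(\<integral>\<^sup>+x. ennreal B * indicator (cplx -` K) x \<partial>lborel) < \<infinity>"
      using mK by (simp add: nn_integral_cmult_indicator ennreal_mult_less_top)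
    show "AE x in lborel. (\<lambda>i. ennreal (G (A (i + n0)) (C (i + n0)) (cplx x)) * indicator (cplx -` K) x)
        \<longlonglongrightarrow> ennreal (G A0 C0 (cplx x)) * indicator (cplx -` K) x"
    proof (rule AE_I2)
      fix x
      show "(\<lambda>i. ennreal (G (A (i + n0)) (C (i + n0)) (cplx x)) * indicator (cplx -` K) x)
        \<longlonglongrightarrow> ennreal (G A0 C0 (cplx x)) * indicator (cplx -` K) x"
      proof (cases "cplx x \<in> K")
        case True
        then have v: "cplx x \<in> cball 0 r" "cplx x \<in> ball 0 R" using K(2) KR by blast+
        have nz: "((norm (A0 (cplx x)))\<^sup>2 + (norm (C0 (cplx x)))\<^sup>2)\<^sup>2 \<noteq> 0" using m(2)[OF v(2)] m(1) by (auto simp: add_nonneg_eq_0_iff)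
        have "(\<lambda>i. G (A i) (C i) (cplx x)) \<longlonglongrightarrow> G A0 C0 (cplx x)"
          unfolding G_def wronskian_density_def
          by (intro tendsto_intros nz tendsto_uniform_limitI[OF uA v(2)] tendsto_uniform_limitI[OF uC v(2)]
              tendsto_uniform_limitI[OF uA' v(1)] tendsto_uniform_limitI[OF uC' v(1)])
        then have "(\<lambda>i. ennreal (G (A (i + n0)) (C (i + n0)) (cplx x))) \<longlonglongrightarrow> ennreal (G A0 C0 (cplx x))"
          by (rule tendsto_ennrealI[OF LIMSEQ_ignore_initial_segment])
        then show ?thesis using True by simp
      qed simp
    qed
  qed
  then show ?thesis unfolding G_def by (rule LIMSEQ_offset)
qed

context sheet_frame
begin

text \<open>
  The gradient on a sheet, divided by the power \<open>t^E\<close> by which it tends to \<open>0\<close>.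
\<close>

definition scaled_fz :: "complex \<Rightarrow> complex \<Rightarrow> complex" where "scaled_fz \<tau> v = eval2 (dz f) (sheet \<tau> v) / T \<tau> v ^ E"
definition scaled_fw :: "complex \<Rightarrow> complex \<Rightarrow> complex" where "scaled_fw \<tau> v = eval2 (dw f) (sheet \<tau> v) / T \<tau> v ^ E"
definition sheet_density :: "complex \<Rightarrow> complex \<Rightarrow> real" where
  "sheet_density \<tau> v = wronskian_density (scaled_fz \<tau> v) (deriv (scaled_fz \<tau>) v) (scaled_fw \<tau> v) (deriv (scaled_fw \<tau>) v)"

lemma along_sheet_derivative:
  assumes g: "g \<in> second_jet" and v: "v \<in> ball 0 R" and \<tau>: "norm \<tau> < \<delta> / 4" "\<tau> \<noteq> 0"
  shows "((\<lambda>v. eval2 g (sheet \<tau> v)) has_field_derivative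
     (eval2 (dz g) (sheet \<tau> v) * deriv (sheet_z \<tau>) v + eval2 (dw g) (sheet \<tau> v) * deriv (sheet_w \<tau>) v)) (at v)"
  using eval2_curve_derivative[OF Rf_jet[OF g] sheet_derivatives(1,2)[OF v \<tau>]] sheet_in_level(2)[OF v \<tau>]
  by (simp add: sheet_eq)

lemma scaled_gradient_holomorphic:
  assumes \<tau>: "norm \<tau> < \<delta> / 4" "\<tau> \<noteq> 0"
  shows "scaled_fz \<tau> holomorphic_on ball 0 R" "scaled_fw \<tau> holomorphic_on ball 0 R"
proof -
  have h: "(\<lambda>v. eval2 g (sheet \<tau> v)) holomorphic_on ball 0 R" if "g \<in> second_jet" for g
    unfolding holomorphic_on_open[OF open_ball] using along_sheet_derivative[OF that _ \<tau>] by blast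
  have T': "T \<tau> v ^ E \<noteq> 0" if "v \<in> ball 0 R" for v using T_nz[OF that \<tau>] by simp
  show "scaled_fz \<tau> holomorphic_on ball 0 R"
    unfolding scaled_fz_def[abs_def] by (intro holomorphic_intros h T_holomorphic[OF \<tau>] T') (auto simp: second_jet_def)
  show "scaled_fw \<tau> holomorphic_on ball 0 R"
    unfolding scaled_fw_def[abs_def] by (intro holomorphic_intros h T_holomorphic[OF \<tau>] T') (auto simp: second_jet_def)
qed

text \<open>
  As \<open>f\<close> is constant on the sheet, \<open>curvature_times_area\<close> applies; the factor \<open>t^E\<close> drops out by
  \<open>wronskian_density_scale\<close>.
\<close>

lemma curvature_on_sheet:
  assumes v: "v \<in> ball 0 R" and \<tau>: "norm \<tau> < \<delta> / 4" "\<tau> \<noteq> 0"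
  shows "curvature f (sheet \<tau> v) * ((norm (deriv (sheet_z \<tau>) v))\<^sup>2 + (norm (deriv (sheet_w \<tau>) v))\<^sup>2) = sheet_density \<tau> v"
proof -
  let ?p = "sheet \<tau> v" and ?z = "deriv (sheet_z \<tau>) v" and ?w = "deriv (sheet_w \<tau>) v"
  have jet: "f \<in> second_jet" "dz f \<in> second_jet" "dw f \<in> second_jet" by (auto simp: second_jet_def)
  have ball: "\<forall>\<^sub>F w in nhds v. w \<in> ball 0 R" using v by (intro eventually_nhds_in_open) auto
  have ev: "\<forall>\<^sub>F w in nhds v. eval2 f (sheet \<tau> w) = lead_a * \<tau> ^ H"
    using ball by eventually_elim (use sheet_in_level(1)[OF _ \<tau>] in blast)
  have "((\<lambda>w. eval2 f (sheet \<tau> w)) has_field_derivative 0) (at v)"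
    using DERIV_cong_ev[OF refl ev refl, of 0] by simp
  then have tangent: "eval2 (dz f) ?p * ?z + eval2 (dw f) ?p * ?w = 0"
    by (rule DERIV_unique[OF along_sheet_derivative[OF jet(1) v \<tau>]])
  define s where "s = (\<lambda>v. T \<tau> v ^ E)"
  have s: "s v \<noteq> 0" using T_nz[OF v \<tau>] by (simp add: s_def)
  have sd: "(s has_field_derivative deriv s v) (at v)"
    using holomorphic_derivI[OF holomorphic_on_power[OF T_holomorphic[OF \<tau>]] open_ball v, of E] by (simp add: s_def[abs_def])
  have eqs: "eval2 (dz f) (sheet \<tau> w) = s w * scaled_fz \<tau> w" "eval2 (dw f) (sheet \<tau> w) = s w * scaled_fw \<tau> w" if "w \<in> ball 0 R" for w
    using T_nz[OF that \<tau>] by (auto simp: s_def scaled_fz_def scaled_fw_def)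
  have prod: "((\<lambda>w. s w * g w) has_field_derivative deriv s v * g v + s v * deriv g v) (at v)"
    if "g holomorphic_on ball 0 R" for g
    using DERIV_mult[OF sd holomorphic_derivI[OF that open_ball v]] by (simp add: mult.commute)
  have evA: "\<forall>\<^sub>F w in nhds v. eval2 (dz f) (sheet \<tau> w) = s w * scaled_fz \<tau> w"
    using ball by eventually_elim (rule eqs(1))
  have evC: "\<forall>\<^sub>F w in nhds v. eval2 (dw f) (sheet \<tau> w) = s w * scaled_fw \<tau> w"
    using ball by eventually_elim (rule eqs(2))
  have a': "eval2 (dz (dz f)) ?p * ?z + eval2 (dw (dz f)) ?p * ?w = deriv s v * scaled_fz \<tau> v + s v * deriv (scaled_fz \<tau>) v"
    using along_sheet_derivative[OF jet(2) v \<tau>] prod[OF scaled_gradient_holomorphic(1)[OF \<tau>]]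
    unfolding DERIV_cong_ev[OF refl evA refl] by (rule DERIV_unique)
  have c': "eval2 (dz (dw f)) ?p * ?z + eval2 (dw (dw f)) ?p * ?w = deriv s v * scaled_fw \<tau> v + s v * deriv (scaled_fw \<tau>) v"
    using along_sheet_derivative[OF jet(3) v \<tau>] prod[OF scaled_gradient_holomorphic(2)[OF \<tau>]]
    unfolding DERIV_cong_ev[OF refl evC refl] by (rule DERIV_unique)
  show ?thesis
    unfolding curvature_times_area[OF tangent] a' c' eqs[OF v]
    using wronskian_density_scale[OF s] by (simp add: sheet_density_def wronskian_density_def)
qed

lemma curvature_measurable:
  assumes X: "closed X" "X \<subseteq> polydisc Rf"
  shows "(\<lambda>p. ennreal (curvature f p) * indicator X p) \<in> borel_measurable borel"
proof -
  \<comment> \<open>Outside \<open>X\<close> all data vanish, and the quotient becomes \<open>0 / 0 = 0\<close>.\<close>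
  define c where "c = (\<lambda>g p. indicator X p *\<^sub>R eval2 g p)"
  have "c g \<in> borel_measurable borel" if "g \<in> second_jet" for g
    unfolding c_def
    by (intro borel_measurable_continuous_on_indicator borel_closed X(1) continuous_on_subset[OF continuous_on_eval2[OF Rf_jet[OF that]] X(2)])
  then have [measurable]: "c (dz f) \<in> borel_measurable borel" "c (dw f) \<in> borel_measurable borel"
     "c (dz (dz f)) \<in> borel_measurable borel" "c (dw (dz f)) \<in> borel_measurable borel"
     "c (dz (dw f)) \<in> borel_measurable borel" "c (dw (dw f)) \<in> borel_measurable borel" by (auto simp: second_jet_def)
  have "(\<lambda>p. ennreal (2 * (norm (c (dz f) p * c (dw f) p * (c (dw (dz f)) p + c (dz (dw f)) p)
   - c (dz (dz f)) p * c (dw f) p ^ 2 - c (dw (dw f)) p * c (dz f) p ^ 2))\<^sup>2 / ((norm (c (dz f) p))\<^sup>2 + (norm (c (dw f) p))\<^sup>2) ^ 3)) \<in> borel_measurable borel"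
    (is "(\<lambda>p. ennreal (?k p)) \<in> _") by measurable
  moreover have "ennreal (?k p) = ennreal (curvature f p) * indicator X p" for p
    by (cases "p \<in> X") (simp_all add: c_def curvature_def Delta_eq)
  ultimately show ?thesis by simp
qed

lemma continuous_on_sheet:
  assumes \<tau>: "norm \<tau> < \<delta> / 4" "\<tau> \<noteq> 0" shows "continuous_on (ball 0 R) (sheet \<tau>)"
  unfolding sheet_eq[abs_def]
  by (intro continuous_on_Pair holomorphic_on_imp_continuous_on sheet_holomorphic[OF \<tau>])

lemma sheet_image:
  assumes K: "compact K" "K \<subseteq> ball 0 R" and \<tau>: "norm \<tau> < \<delta> / 4" "\<tau> \<noteq> 0"
  shows "closed (sheet \<tau> ` K)" "sheet \<tau> ` K \<subseteq> polydisc Rf"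
proof -
  show "closed (sheet \<tau> ` K)"
    by (rule compact_imp_closed[OF compact_continuous_image[OF continuous_on_subset[OF continuous_on_sheet[OF \<tau>] K(2)] K(1)]])
  show "sheet \<tau> ` K \<subseteq> polydisc Rf" using sheet_in_level(2)[OF _ \<tau>] K(2) by blast
qed

theorem nn_integral_curvature_sheet:
  assumes K: "compact K" "K \<subseteq> ball 0 R" and \<tau>: "norm \<tau> < \<delta> / 4" "\<tau> \<noteq> 0"
  shows "(\<integral>\<^sup>+p\<in>sheet \<tau> ` K. ennreal (curvature f p) \<partial>area_measure (level_surface f (lead_a * \<tau> ^ H)))
    = (\<integral>\<^sup>+x\<in>cplx -` K. ennreal (sheet_density \<tau> (cplx x)) \<partial>lborel)"
proof -
  let ?\<phi> = "\<lambda>x. sheet \<tau> (cplx x)" and ?U = "ball 0 R :: (real^2) set"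
  have U: "cplx x \<in> ball 0 R \<longleftrightarrow> x \<in> ?U" for x by simp
  have sub: "sheet \<tau> ` K \<subseteq> ?\<phi> ` ?U"
  proof
    fix p assume "p \<in> sheet \<tau> ` K"
    then obtain v where v: "v \<in> K" "p = sheet \<tau> v" by blast
    then have "uncplx v \<in> ?U" using K(2) by (force simp: dist_norm)
    then show "p \<in> ?\<phi> ` ?U" using v by (intro image_eqI[of _ _ "uncplx v"]) auto
  qed
  have pre: "{x \<in> ?U. ?\<phi> x \<in> sheet \<tau> ` K} = cplx -` K"
  proof (intro set_eqI iffI)
    fix x assume "x \<in> {x \<in> ?U. ?\<phi> x \<in> sheet \<tau> ` K}"
    then obtain v where v: "x \<in> ?U" "v \<in> K" "?\<phi> x = sheet \<tau> v" by blast
    then have "cplx x = v" using inj_onD[OF inj_sheet[OF \<tau>] v(3)] K(2) U by blast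
    then show "x \<in> cplx -` K" using v by simp
  qed (use K(2) U in blast)
  have "(\<integral>\<^sup>+p\<in>sheet \<tau> ` K. ennreal (curvature f p) \<partial>area_measure (level_surface f (lead_a * \<tau> ^ H)))
     = (\<integral>\<^sup>+x\<in>cplx -` K. ennreal (curvature f (?\<phi> x)) * ennreal (area_element ?\<phi> x) \<partial>lborel)"
    unfolding pre[symmetric]
    by (rule nn_integral_area_measure_chart[OF sheet_chart[OF \<tau>] borel_closed[OF sheet_image(1)[OF K \<tau>]] sub curvature_measurable[OF sheet_image[OF K \<tau>]]])
  also have "\<dots> = (\<integral>\<^sup>+x\<in>cplx -` K. ennreal (sheet_density \<tau> (cplx x)) \<partial>lborel)"
  proof (rule nn_integral_cong)
    fix x
    show "ennreal (curvature f (?\<phi> x)) * ennreal (area_element ?\<phi> x) * indicator (cplx -` K) x = ennreal (sheet_density \<tau> (cplx x)) * indicator (cplx -` K) x"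
    proof (cases "cplx x \<in> K")
      case True
      then have v: "cplx x \<in> ball 0 R" using K(2) by blast
      have c0: "curvature f (?\<phi> x) \<ge> 0" by (simp add: curvature_def)
      have "area_element ?\<phi> x = (norm (deriv (sheet_z \<tau>) (cplx x)))\<^sup>2 + (norm (deriv (sheet_w \<tau>) (cplx x)))\<^sup>2"
        unfolding sheet_eq by (rule area_element_curve(1)[OF sheet_derivatives(1,2)[OF v \<tau>]])
      then have "curvature f (?\<phi> x) * area_element ?\<phi> x = sheet_density \<tau> (cplx x)" using curvature_on_sheet[OF v \<tau>] by simp
      then show ?thesis using c0 by (simp flip: ennreal_mult')
    qed simp
  qed
  finally show ?thesis .
qed

end

section \<open>Covering the horn by sheets\<close>

lemma (in polar_family) stabilizer_group:
  assumes N: "N > 0"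
  shows "finite (stabilizer N D k)" "1 \<in> stabilizer N D k"
    "\<theta> \<in> stabilizer N D k \<Longrightarrow> \<eta> \<in> stabilizer N D k \<Longrightarrow> \<theta> * \<eta> \<in> stabilizer N D k"
    "\<theta> \<in> stabilizer N D k \<Longrightarrow> inverse \<theta> \<in> stabilizer N D k" "\<theta> \<in> stabilizer N D k \<Longrightarrow> \<theta> \<noteq> 0"
proof -
  have "finite {\<theta>::complex. \<theta> ^ N = 1}" using finite_nth_roots[OF N, of 1] by simp
  then show "finite (stabilizer N D k)" by (rule rev_finite_subset) (auto simp: stabilizer_def)
  show "\<theta> \<in> stabilizer N D k \<Longrightarrow> \<eta> \<in> stabilizer N D k \<Longrightarrow> \<theta> * \<eta> \<in> stabilizer N D k"
    "\<theta> \<in> stabilizer N D k \<Longrightarrow> inverse \<theta> \<in> stabilizer N D k"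
    by (auto simp: stabilizer_def power_mult_distrib power_inverse)
  show "\<theta> \<in> stabilizer N D k \<Longrightarrow> \<theta> \<noteq> 0" using N by (auto simp: stabilizer_def power_0_left)
qed (simp add: stabilizer_def)

context canyon_frame
begin

text \<open>
  The disc of the canyon of radius \<open>\<rho>\<close> consists of the \<open>v\<close> with distance at most \<open>\<rho>\<close> from this point,
  because the horn is described relative to \<open>\<gamma> k\<close> and not to its truncation.
\<close>

definition center :: complex where "center = fps_nth (param N (\<gamma> k)) D"

text \<open>
  The horn does not determine \<open>v\<close> but only its orbit under the stabilizer. On the union of the
  rotated discs every point of the horn has the same number of parameters.
\<close>

definition orbit :: "real \<Rightarrow> complex set" where
  "orbit \<rho> = (\<Union>\<theta>\<in>stabilizer N D k. (\<lambda>v. \<theta> ^ D * v) ` cball center \<rho>)"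

lemma norm_stabilizer: assumes "\<theta> \<in> stabilizer N D k" shows "norm \<theta> = 1"
proof -
  have "\<theta> ^ N = 1" using assms by (simp add: stabilizer_def)
  then show ?thesis using N0 by (metis power_eq_1_iff norm_power norm_one norm_ge_zero less_irrefl)
qed

lemma orbit:
  shows "compact (orbit \<rho>)" "orbit \<rho> \<subseteq> cball 0 (norm center + \<rho>)" "cball center \<rho> \<subseteq> orbit \<rho>"
    "\<theta> \<in> stabilizer N D k \<Longrightarrow> v \<in> orbit \<rho> \<Longrightarrow> \<theta> ^ D * v \<in> orbit \<rho>"
proof -
  note grp = stabilizer_group[OF N0, where D=D and k=k]
  show "compact (orbit \<rho>)" unfolding orbit_def
    by (intro compact_UN grp(1) compact_continuous_image continuous_intros compact_cball)
  show "orbit \<rho> \<subseteq> cball 0 (norm center + \<rho>)"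
  proof
    fix v assume "v \<in> orbit \<rho>"
    then obtain \<theta> w where w: "\<theta> \<in> stabilizer N D k" "dist center w \<le> \<rho>" "v = \<theta> ^ D * w" by (auto simp: orbit_def)
    have "norm v = norm w" using norm_stabilizer[OF w(1)] w(3) by (simp add: norm_mult norm_power)
    then show "v \<in> cball 0 (norm center + \<rho>)" using w(2) norm_triangle_sub[of w center] by (simp add: dist_norm norm_minus_commute)
  qed
  show "cball center \<rho> \<subseteq> orbit \<rho>" unfolding orbit_def using grp(2) by force
  assume \<theta>: "\<theta> \<in> stabilizer N D k" and "v \<in> orbit \<rho>"
  then obtain \<eta> w where w: "\<eta> \<in> stabilizer N D k" "w \<in> cball center \<rho>" "v = \<eta> ^ D * w" unfolding orbit_def by blast
  have "\<theta> ^ D * v = (\<theta> * \<eta>) ^ D * w" using w(3) by (simp add: power_mult_distrib)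
  then show "\<theta> ^ D * v \<in> orbit \<rho>" unfolding orbit_def by (elim ssubst) (rule UN_I[OF grp(3)[OF \<theta> w(1)] imageI[OF w(2)]])
qed

lemma eval_trunc_add_term: "eval_fps (trunc + fps_const v * fps_X ^ D) t = eval_fps trunc t + v * t ^ D"
proof -
  have "(\<lambda>i. fps_nth (trunc + fps_const v * fps_X ^ D) i * t ^ i) sums
      (\<Sum>i<Suc D. fps_nth (trunc + fps_const v * fps_X ^ D) i * t ^ i)"
    by (rule sums_finite) (auto simp: trunc_nth)
  then have "eval_fps (trunc + fps_const v * fps_X ^ D) t = (\<Sum>i<Suc D. fps_nth (trunc + fps_const v * fps_X ^ D) i * t ^ i)"
    by (simp add: eval_fps_def sums_iff)
  also have "\<dots> = (\<Sum>i<D. fps_nth (param N (\<gamma> k)) i * t ^ i) + v * t ^ D"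
    by (simp add: trunc_nth)
  finally show ?thesis by (simp only: eval_trunc)
qed

text \<open>
  The finite series in the definition of the horn are the polynomials \<open>trunc + v t^D\<close> over the
  denominator \<open>N\<close>.
\<close>

lemma horn_eq:
  assumes d: "real D = d * real N"
  shows "horn d (\<gamma> k) \<rho> \<eta> = {p \<in> cball 0 \<eta>. \<exists>t. \<exists>v\<in>cball center \<rho>. p = pt t v}"
proof -
  have e: "exponents_over N (\<gamma> k)" using levelD(2)[OF N] k by blast
  have ej: "exponents_over N (jet d (\<gamma> k))" using e by (auto simp: exponents_over_def jet_def)
  have dN: "d = real D / real N" using d N0 by simp
  have le: "real i / real N \<le> d \<longleftrightarrow> i \<le> D" for i unfolding dN using N0 by (simp add: divide_le_cancel)
  have pj: "param N (jet d (\<gamma> k)) = trunc + fps_const center * fps_X ^ D"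
    by (rule fps_ext) (auto simp: param_def jet_def le trunc_nth center_def)
  have rng: "range (arc_map (add_term (jet d (\<gamma> k)) c d)) = range (\<lambda>t. pt t (center + c))" for c
  proof -
    have "exponents_over N (add_term (jet d (\<gamma> k)) c d)" unfolding dN using add_term_level(2)[OF ej] unfolding dN .
    moreover have "param N (add_term (jet d (\<gamma> k)) c d) = trunc + fps_const (center + c) * fps_X ^ D"
      using add_term_level(1)[OF ej, of c D] unfolding dN[symmetric] pj by (simp add: algebra_simps flip: fps_const_add)
    ultimately show ?thesis
      using range_arc_map by (simp add: level_arc_def[abs_def] eval_trunc_add_term fan_def)
  qed
  have "(\<exists>c. norm c \<le> \<rho> \<and> p \<in> range (\<lambda>t. pt t (center + c))) \<longleftrightarrow> (\<exists>t. \<exists>v\<in>cball center \<rho>. p = pt t v)" for p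
  proof
    assume "\<exists>c. norm c \<le> \<rho> \<and> p \<in> range (\<lambda>t. pt t (center + c))"
    then obtain c t where "norm c \<le> \<rho>" "p = pt t (center + c)" by blast
    then show "\<exists>t. \<exists>v\<in>cball center \<rho>. p = pt t v" by (intro exI[of _ t] bexI[of _ "center + c"]) (auto simp: dist_norm)
  next
    assume "\<exists>t. \<exists>v\<in>cball center \<rho>. p = pt t v"
    then obtain v t where "dist center v \<le> \<rho>" "p = pt t v" by auto
    then show "\<exists>c. norm c \<le> \<rho> \<and> p \<in> range (\<lambda>t. pt t (center + c))"
      by (intro exI[of _ "v - center"]) (auto simp: dist_norm norm_minus_commute)
  qed
  then show ?thesis unfolding horn_def rng by blast
qed

text \<open>
  The curvature form for the limit \<open>(P, kappa - slope P)\<close> of the rescaled gradient.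
\<close>

definition limit_density :: "complex \<Rightarrow> real" where
  "limit_density v = wronskian_density (P v) (deriv P v) (kappa - slope * P v) (deriv (\<lambda>v. kappa - slope * P v) v)"

lemma P_holomorphic: "P holomorphic_on S"
  
proof -
  have "P = poly lead_poly" by (simp add: fun_eq_iff poly_lead_poly)
  then show ?thesis
    unfolding holomorphic_on_def field_differentiable_def using has_field_derivative_at_within[OF poly_DERIV[of lead_poly]] by auto
qed

text \<open>
  Both components cannot be small because \<open>kappa \<noteq> 0\<close>.
\<close>

lemma gradient_bounded_below: obtains m where "m > 0" "\<And>v. m \<le> norm (P v) \<or> m \<le> norm (kappa - slope * P v)"
proof -
  \<comment> \<open>If \<open>norm (P v) < m\<close>, then \<open>norm (slope * P v) < norm kappa / 2\<close>.\<close>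
  define m where "m = norm kappa / (2 * (1 + norm slope))"
  have pos: "1 + norm slope > 0" using norm_ge_zero[of slope] by linarith
  have m: "m > 0" using kappa_nz pos by (simp add: m_def)
  have "m \<le> norm (kappa - slope * P v)" if "\<not> m \<le> norm (P v)" for v
  proof -
    have "norm slope * norm (P v) \<le> norm slope * m" using that by (intro mult_left_mono) auto
    moreover have "m * (2 * (1 + norm slope)) = norm kappa" using pos by (simp add: m_def)
    then have "norm kappa = 2 * m + 2 * (norm slope * m)" by (simp add: algebra_simps)
    ultimately show ?thesis using norm_triangle_ineq2[of kappa "slope * P v"] m by (simp add: norm_mult) (smt (verit) mult_nonneg_nonneg norm_ge_zero)
  qed
  then show ?thesis using that[of m] m by blast
qed

lemma pt_norm_near_0:
  assumes "e > 0"
  obtains d where "d > 0" "\<And>t v. norm t < d \<Longrightarrow> v \<in> ball 0 R \<Longrightarrow> pt t v \<in> cball 0 e"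
proof -
  obtain d where d: "d > 0" "\<And>t v. norm t < d \<Longrightarrow> v \<in> ball 0 R \<Longrightarrow> pt t v \<in> polydisc (e / 2)" using pt_near_0[of "e / 2" R] assms by auto
  have "pt t v \<in> cball 0 e" if "norm t < d" "v \<in> ball 0 R" for t v
    using d(2)[OF that] norm_Pair_le[of "fst (pt t v)" "snd (pt t v)"] by (simp add: polydisc_def)
  then show ?thesis using that d(1) by blast
qed

end

context sheet_frame
begin

lemma sheet_limit:
  assumes u: "uniform_limit (ball 0 R) (\<lambda>t v. g (pt t v) / t ^ E) l (at 0)"
  shows "uniform_limit (ball 0 R) (\<lambda>\<tau> v. g (sheet \<tau> v) / T \<tau> v ^ E) l (at 0)"
proof (rule uniform_limitI)
  fix e :: real assume "e > 0"
  from uniform_limitD[OF u this] obtain d where d: "d > 0" "\<And>t v. t \<noteq> 0 \<Longrightarrow> norm t < d \<Longrightarrow> v \<in> ball 0 R \<Longrightarrow> dist (g (pt t v) / t ^ E) (l v) < e"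
    unfolding eventually_at by (auto simp: dist_norm)
  show "\<forall>\<^sub>F \<tau> in at 0. \<forall>v\<in>ball 0 R. dist (g (sheet \<tau> v) / T \<tau> v ^ E) (l v) < e"
    unfolding eventually_at
  proof (intro exI[of _ "min (d / 2) (\<delta> / 4)"] conjI ballI impI)
    show "0 < min (d / 2) (\<delta> / 4)" using d \<delta> by simp
    fix \<tau> v :: complex assume \<tau>: "\<tau> \<noteq> 0 \<and> dist \<tau> 0 < min (d / 2) (\<delta> / 4)" and v: "v \<in> ball 0 R"
    then have \<tau>': "norm \<tau> < \<delta> / 4" "\<tau> \<noteq> 0" "2 * norm \<tau> < d" by auto
    have "norm (T \<tau> v) < d" using T(4)[OF v \<tau>'(1)] \<tau>'(3) by linarith
    then show "dist (g (sheet \<tau> v) / T \<tau> v ^ E) (l v) < e" unfolding sheet_def by (rule d(2)[OF T_nz[OF v \<tau>'(1,2)] _ v])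
  qed
qed

lemma sheet_integral_limit:
  assumes K: "compact K" "K \<subseteq> cball 0 r" and r: "r < R"
  shows "((\<lambda>\<tau>. \<integral>\<^sup>+x\<in>cplx -` K. ennreal (sheet_density \<tau> (cplx x)) \<partial>lborel)
    \<longlongrightarrow> (\<integral>\<^sup>+x\<in>cplx -` K. ennreal (limit_density (cplx x)) \<partial>lborel)) (at 0)"
  unfolding tendsto_at_iff_sequentially comp_def
proof (intro allI impI)
  fix X :: "nat \<Rightarrow> complex" assume X: "\<forall>i. X i \<in> UNIV - {0}" "X \<longlonglongrightarrow> 0"
  have XF: "filterlim X (at 0) sequentially" unfolding filterlim_at using X by auto
  obtain m where m: "m > 0" "\<And>v. m \<le> norm (P v) \<or> m \<le> norm (kappa - slope * P v)" using gradient_bounded_below by metis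
  have "\<forall>\<^sub>F i in sequentially. dist (X i) 0 < \<delta> / 4" by (rule tendstoD[OF X(2)]) (use \<delta> in simp)
  then have ev: "\<forall>\<^sub>F i in sequentially. norm (X i) < \<delta> / 4 \<and> X i \<noteq> 0" using X(1) by simp
  have hA: "\<forall>\<^sub>F i in sequentially. scaled_fz (X i) holomorphic_on ball 0 R" and hC: "\<forall>\<^sub>F i in sequentially. scaled_fw (X i) holomorphic_on ball 0 R"
    using ev by (eventually_elim, use scaled_gradient_holomorphic in blast)+
  have uA: "uniform_limit (ball 0 R) (\<lambda>i. scaled_fz (X i)) P sequentially"
    using filterlim_compose[OF sheet_limit[OF dz_limit(1)] XF] by (simp add: scaled_fz_def[abs_def])
  have uC: "uniform_limit (ball 0 R) (\<lambda>i. scaled_fw (X i)) (\<lambda>v. kappa - slope * P v) sequentially"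
    using filterlim_compose[OF sheet_limit[OF dw_limit] XF] by (simp add: scaled_fw_def[abs_def])
  show "(\<lambda>i. \<integral>\<^sup>+x\<in>cplx -` K. ennreal (sheet_density (X i) (cplx x)) \<partial>lborel)
    \<longlonglongrightarrow> (\<integral>\<^sup>+x\<in>cplx -` K. ennreal (limit_density (cplx x)) \<partial>lborel)"
    unfolding sheet_density_def limit_density_def
    by (rule nn_integral_wronskian_limit[OF uA uC hA hC P_holomorphic _ m(1) _ K r])
      (use m(2) in \<open>auto intro!: holomorphic_intros P_holomorphic\<close>)
qed

definition level_roots :: "complex \<Rightarrow> complex set" where "level_roots c = {\<tau>. lead_a * \<tau> ^ H = c}"

lemma finite_level_roots: "finite (level_roots c)"
proof -
  have "level_roots c = {\<tau>. \<tau> ^ H = c / lead_a}" using lead_a_nz by (auto simp: level_roots_def field_simps)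
  then show ?thesis using finite_nth_roots[OF Hpos] by simp
qed

text \<open>
  The sheets through one point are those whose labels differ by a stabilizer rotation.
\<close>

lemma sheet_fibre:
  assumes \<tau>: "norm \<tau> < \<delta> / 4" "\<tau> \<noteq> 0" and v: "v \<in> orbit \<rho>" and R: "norm center + \<rho> < R"
  shows "{\<sigma> \<in> level_roots (lead_a * \<tau> ^ H). sheet \<tau> v \<in> sheet \<sigma> ` orbit \<rho>} = (\<lambda>\<theta>. \<theta> * \<tau>) ` stabilizer N D k"
proof (intro set_eqI iffI)
  have sub: "w \<in> ball 0 R" if "w \<in> orbit \<rho>" for w using orbit(2)[of \<rho>] that R by (auto dest!: subsetD)
  note vR = sub[OF v]
  note grp = stabilizer_group[OF N0, where D=D and k=k]
  fix \<sigma>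
  {
    assume "\<sigma> \<in> {\<sigma> \<in> level_roots (lead_a * \<tau> ^ H). sheet \<tau> v \<in> sheet \<sigma> ` orbit \<rho>}"
    then obtain w where w: "lead_a * \<sigma> ^ H = lead_a * \<tau> ^ H" "w \<in> orbit \<rho>" "sheet \<tau> v = sheet \<sigma> w" by (auto simp: level_roots_def)
    have "\<sigma> ^ H = \<tau> ^ H" using w(1) lead_a_nz by simp
    then have \<sigma>: "norm \<sigma> = norm \<tau>" using Hpos by (metis norm_ge_zero norm_power power_eq_imp_eq_base)
    have \<sigma>4: "norm \<sigma> < \<delta> / 4" using \<sigma> \<tau> by simp
    obtain \<theta> where \<theta>: "\<theta> \<in> stabilizer N D k" "T \<sigma> w = \<theta> * T \<tau> v" "v = \<theta> ^ D * w"
      by (rule pt_fibre[OF w(3)[unfolded sheet_def] T_nz[OF vR \<tau>] T(3)[OF vR \<tau>(1)] vR sub[OF w(2)]])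
    have "\<sigma> = f_root (\<theta> * T \<tau> v) w" using T(1)[OF sub[OF w(2)] \<sigma>4] \<theta>(2) by simp
    also have "\<dots> = \<theta> * f_root (T \<tau> v) v" unfolding f_root_rotate[OF \<theta>(1)] \<theta>(3)[symmetric] ..
    also have "\<dots> = \<theta> * \<tau>" using T(1)[OF vR \<tau>(1)] by simp
    finally show "\<sigma> \<in> (\<lambda>\<theta>. \<theta> * \<tau>) ` stabilizer N D k" using \<theta>(1) by blast
  }
  {
    assume "\<sigma> \<in> (\<lambda>\<theta>. \<theta> * \<tau>) ` stabilizer N D k"
    then obtain \<theta> where \<theta>: "\<theta> \<in> stabilizer N D k" "\<sigma> = \<theta> * \<tau>" by blast
    define w where "w = inverse \<theta> ^ D * v"
    have w: "w \<in> orbit \<rho>" unfolding w_def by (rule orbit(4)[OF grp(4)[OF \<theta>(1)] v])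
    have vw: "v = \<theta> ^ D * w" using grp(5)[OF \<theta>(1)] by (simp add: w_def power_inverse)
    have n: "norm (\<theta> * x) = norm x" for x using norm_stabilizer[OF \<theta>(1)] by (simp add: norm_mult)
    have f_root: "f_root (\<theta> * T \<tau> v) w = \<sigma>" unfolding f_root_rotate[OF \<theta>(1)] vw[symmetric] using T(1)[OF vR \<tau>(1)] \<theta>(2) by simp
    have "T (f_root (\<theta> * T \<tau> v) w) w = \<theta> * T \<tau> v"
      by (rule T_unique[OF sub[OF w]]) (use n T(2)[OF vR \<tau>(1)] f_root \<theta>(2) \<tau> in auto)
    then have "sheet \<sigma> w = sheet \<tau> v" unfolding f_root by (simp add: sheet_def pt_stabilizer[OF \<theta>(1)] vw[symmetric])
    moreover have "\<sigma> ^ H = \<tau> ^ H" using stabilizer_pow_H[OF \<theta>(1)] \<theta>(2) by (simp add: power_mult_distrib)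
    ultimately show "\<sigma> \<in> {\<sigma> \<in> level_roots (lead_a * \<tau> ^ H). sheet \<tau> v \<in> sheet \<sigma> ` orbit \<rho>}"
      using w by (auto simp: level_roots_def intro!: image_eqI[of _ _ w])
  }
qed

text \<open>
  The bound on \<open>\<eta>\<close> ensures that points of the horn have a parameter \<open>t\<close> in the range where \<open>f_root\<close> is
  invertible. The bound \<open>e\<close> ensures, conversely, that the sheets for small \<open>c\<close> lie in the ball of
  radius \<open>\<eta>\<close> and are not cut off by it.
\<close>

lemma horn_level:
  assumes d: "real D = d * real N" and R: "norm center + \<rho> < R" and \<eta>: "\<eta> < (\<delta> / 8) ^ N"
    and e: "\<And>t v. norm t < e \<Longrightarrow> v \<in> ball 0 R \<Longrightarrow> pt t v \<in> cball 0 \<eta>"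
    and c: "c \<noteq> 0" "\<And>\<tau>. \<tau> \<in> level_roots c \<Longrightarrow> norm \<tau> < \<delta> / 4 \<and> 2 * norm \<tau> < e"
  shows "level_surface f c \<inter> horn d (\<gamma> k) \<rho> \<eta> = (\<Union>\<tau>\<in>level_roots c. sheet \<tau> ` orbit \<rho>)"
proof (intro set_eqI iffI)
  have sub: "w \<in> ball 0 R" if "w \<in> orbit \<rho>" for w using orbit(2)[of \<rho>] that R by (auto dest!: subsetD)
  fix p
  {
    assume "p \<in> level_surface f c \<inter> horn d (\<gamma> k) \<rho> \<eta>"
    then obtain t v where tv: "v \<in> cball center \<rho>" "p = pt t v" and p: "norm p \<le> \<eta>" "eval2 f p = c"
      unfolding horn_eq[OF d] level_surface_def by auto
    have v: "v \<in> orbit \<rho>" using orbit(3) tv(1) by blast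
    have "t \<noteq> 0"
    proof
      assume "t = 0"
      then have "p = 0" using tv(2) N0 D0 trunc_0 by (simp add: fan_def eval_fps_at_0 zero_prod_def)
      then show False using p(2) c(1) eval2_0[OF conv] f00 by simp
    qed
    have "norm (snd p) \<le> norm p" by (metis norm_snd_le prod.collapse)
    then have "norm t ^ N < (\<delta> / 8) ^ N" using p(1) \<eta> tv(2) by (simp add: fan_def norm_power)
    then have t8: "norm t < \<delta> / 8" by (rule power_less_imp_less_base) (use \<delta> in simp)
    then have t: "norm t < \<delta> / 2" "norm t < \<delta>" using \<delta> by auto
    have "norm (f_root t v) \<le> 2 * norm t" using f_root_close[OF t(2) sub[OF v]] norm_triangle_sub[of "f_root t v" t] norm_ge_zero[of t] by linarith
    then have k4: "norm (f_root t v) < \<delta> / 4" using t8 by simp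
    have "f_root t v \<in> level_roots c" unfolding level_roots_def using f_root_pow[OF \<open>t \<noteq> 0\<close> t(2) sub[OF v]] p(2) tv(2) by simp
    moreover have "p = sheet (f_root t v) v" using T_unique[OF sub[OF v] t(1) k4] tv(2) by (simp add: sheet_def)
    ultimately show "p \<in> (\<Union>\<tau>\<in>level_roots c. sheet \<tau> ` orbit \<rho>)" using v by blast
  }
  {
    assume "p \<in> (\<Union>\<tau>\<in>level_roots c. sheet \<tau> ` orbit \<rho>)"
    then obtain \<tau> v where \<tau>: "\<tau> \<in> level_roots c" and v: "v \<in> orbit \<rho>" and p: "p = sheet \<tau> v" by blast
    have \<tau>4: "norm \<tau> < \<delta> / 4" "2 * norm \<tau> < e" using c(2)[OF \<tau>] by auto
    have \<tau>0: "\<tau> \<noteq> 0" using \<tau> c(1) Hpos by (auto simp: level_roots_def)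
    have F: "eval2 f p = c" using sheet_in_level(1)[OF sub[OF v] \<tau>4(1) \<tau>0] \<tau> p by (simp add: level_roots_def)
    have "norm (T \<tau> v) < e" using T(4)[OF sub[OF v] \<tau>4(1)] \<tau>4(2) by linarith
    then have "p \<in> cball 0 \<eta>" unfolding p sheet_def by (rule e[OF _ sub[OF v]])
    moreover obtain \<theta> w where w: "\<theta> \<in> stabilizer N D k" "w \<in> cball center \<rho>" "v = \<theta> ^ D * w" using v unfolding orbit_def by blast
    have "p = pt (\<theta> * T \<tau> v) w" unfolding p sheet_def pt_stabilizer[OF w(1)] w(3)[symmetric] ..
    ultimately show "p \<in> level_surface f c \<inter> horn d (\<gamma> k) \<rho> \<eta>"
      unfolding horn_eq[OF d] level_surface_def using F w(2) by blast
  }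
qed

text \<open>
  Summing the curvature over all sheets counts every point as often as the stabilizer has elements.
\<close>

lemma horn_curvature_sheets:
  assumes d: "real D = d * real N" and R: "norm center + \<rho> < R" and \<eta>: "\<eta> < (\<delta> / 8) ^ N"
    and e: "\<And>t v. norm t < e \<Longrightarrow> v \<in> ball 0 R \<Longrightarrow> pt t v \<in> cball 0 \<eta>"
    and c: "c \<noteq> 0" "\<And>\<tau>. \<tau> \<in> level_roots c \<Longrightarrow> norm \<tau> < \<delta> / 4 \<and> 2 * norm \<tau> < e"
  shows "of_nat (card (stabilizer N D k)) *
      (\<integral>\<^sup>+p\<in>level_surface f c \<inter> horn d (\<gamma> k) \<rho> \<eta>. ennreal (curvature f p) \<partial>area_measure (level_surface f c))
    = (\<Sum>\<tau>\<in>level_roots c. \<integral>\<^sup>+x\<in>cplx -` orbit \<rho>. ennreal (sheet_density \<tau> (cplx x)) \<partial>lborel)"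
proof -
  let ?M = "area_measure (level_surface f c)" and ?X = "\<Union>\<tau>\<in>level_roots c. sheet \<tau> ` orbit \<rho>"
  let ?q = "card (stabilizer N D k)"
  have K: "compact (orbit \<rho>)" "orbit \<rho> \<subseteq> ball 0 R" using orbit(1,2)[of \<rho>] R by (auto dest!: subsetD)
  have sM: "sets ?M = sets borel" using is_area_measure_area_measure[of "level_surface f c"] by (simp add: is_area_measure_def)
  have mM: "measurable ?M borel = borel_measurable borel" by (rule measurable_cong_sets[OF sM refl])
  have nz: "\<tau> \<noteq> 0" if "\<tau> \<in> level_roots c" for \<tau> using that c(1) Hpos by (auto simp: level_roots_def)
  have cl: "closed (sheet \<tau> ` orbit \<rho>)" "sheet \<tau> ` orbit \<rho> \<subseteq> polydisc Rf" if "\<tau> \<in> level_roots c" for \<tau>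
    using sheet_image[OF K] c(2)[OF that] nz[OF that] by auto
  have X: "closed ?X" "?X \<subseteq> polydisc Rf"
  proof -
    show "closed ?X" by (rule closed_UN[OF finite_level_roots]) (use cl in blast)
    show "?X \<subseteq> polydisc Rf" using cl(2) by blast
  qed
  have fib: "card {\<sigma> \<in> level_roots c. p \<in> sheet \<sigma> ` orbit \<rho>} = (if p \<in> ?X then ?q else 0)" for p
  proof (cases "p \<in> ?X")
    case True
    then obtain \<tau> v where \<tau>: "\<tau> \<in> level_roots c" and v: "v \<in> orbit \<rho>" and p: "p = sheet \<tau> v" by blast
    have ca: "lead_a * \<tau> ^ H = c" using \<tau> by (simp add: level_roots_def)
    have "{\<sigma> \<in> level_roots c. p \<in> sheet \<sigma> ` orbit \<rho>} = (\<lambda>\<theta>. \<theta> * \<tau>) ` stabilizer N D k"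
      unfolding p using sheet_fibre[of \<tau> v \<rho>] c(2)[OF \<tau>] nz[OF \<tau>] v R unfolding ca by blast
    moreover have "inj_on (\<lambda>\<theta>. \<theta> * \<tau>) (stabilizer N D k)" using nz[OF \<tau>] by (auto simp: inj_on_def)
    ultimately show ?thesis using True by (simp add: card_image)
  next
    case False
    then have "{\<sigma> \<in> level_roots c. p \<in> sheet \<sigma> ` orbit \<rho>} = {}" by blast
    then show ?thesis using False by (simp only: card.empty if_False)
  qed
  have "(\<Sum>\<tau>\<in>level_roots c. \<integral>\<^sup>+x\<in>cplx -` orbit \<rho>. ennreal (sheet_density \<tau> (cplx x)) \<partial>lborel)
    = (\<Sum>\<tau>\<in>level_roots c. \<integral>\<^sup>+p\<in>sheet \<tau> ` orbit \<rho>. ennreal (curvature f p) \<partial>?M)"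
  proof (rule sum.cong[OF refl])
    fix \<tau> assume \<tau>: "\<tau> \<in> level_roots c"
    then have ca: "lead_a * \<tau> ^ H = c" by (simp add: level_roots_def)
    show "(\<integral>\<^sup>+x\<in>cplx -` orbit \<rho>. ennreal (sheet_density \<tau> (cplx x)) \<partial>lborel) = (\<integral>\<^sup>+p\<in>sheet \<tau> ` orbit \<rho>. ennreal (curvature f p) \<partial>?M)"
      using nn_integral_curvature_sheet[OF K, of \<tau>] c(2)[OF \<tau>] nz[OF \<tau>] unfolding ca by simp
  qed
  also have "\<dots> = (\<integral>\<^sup>+p. (\<Sum>\<tau>\<in>level_roots c. ennreal (curvature f p) * indicator (sheet \<tau> ` orbit \<rho>) p) \<partial>?M)"
    by (rule nn_integral_sum[symmetric]) (simp add: mM curvature_measurable[OF cl])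
  also have "\<dots> = (\<integral>\<^sup>+p. of_nat ?q * (ennreal (curvature f p) * indicator ?X p) \<partial>?M)"
  proof (rule nn_integral_cong)
    fix p
    have "(\<Sum>\<tau>\<in>level_roots c. ennreal (curvature f p) * indicator (sheet \<tau> ` orbit \<rho>) p)
      = (\<Sum>\<tau>\<in>level_roots c. if p \<in> sheet \<tau> ` orbit \<rho> then ennreal (curvature f p) else 0)"
      by (intro sum.cong refl) (simp add: indicator_def)
    also have "\<dots> = of_nat (card {\<sigma> \<in> level_roots c. p \<in> sheet \<sigma> ` orbit \<rho>}) * ennreal (curvature f p)"
      by (simp add: sum.If_cases[OF finite_level_roots] Int_def)
    also have "\<dots> = of_nat ?q * (ennreal (curvature f p) * indicator ?X p)"
      unfolding fib by (simp add: indicator_def)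
    finally show "(\<Sum>\<tau>\<in>level_roots c. ennreal (curvature f p) * indicator (sheet \<tau> ` orbit \<rho>) p)
      = of_nat ?q * (ennreal (curvature f p) * indicator ?X p)" .
  qed
  also have "\<dots> = of_nat ?q * (\<integral>\<^sup>+p\<in>?X. ennreal (curvature f p) \<partial>?M)"
    by (rule nn_integral_cmult) (simp add: mM curvature_measurable[OF X])
  finally have fin: "of_nat ?q * (\<integral>\<^sup>+p\<in>?X. ennreal (curvature f p) \<partial>?M)
      = (\<Sum>\<tau>\<in>level_roots c. \<integral>\<^sup>+x\<in>cplx -` orbit \<rho>. ennreal (sheet_density \<tau> (cplx x)) \<partial>lborel)" by (rule sym)
  have "level_surface f c \<inter> horn d (\<gamma> k) \<rho> \<eta> = ?X" by (rule horn_level[OF assms])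
  then show ?thesis using fin by (simp only: )
qed

end

section \<open>Total curvature of a canyon\<close>

context canyon_frame
begin

lemma P_derivative: "(P has_field_derivative poly (pderiv lead_poly) v) (at v)"
proof -
  have "P = poly lead_poly" by (simp add: fun_eq_iff poly_lead_poly)
  then show ?thesis using poly_DERIV[of lead_poly v] by simp
qed

text \<open>
  The second component is an affine function of the first, so the Wronskian is \<open>- kappa P'\<close>.
\<close>

lemma limit_density_eq:
  "limit_density v = (norm (poly (pderiv lead_poly) v))\<^sup>2 *
    (2 * (norm kappa)\<^sup>2 / ((norm (P v))\<^sup>2 + (norm (kappa - slope * P v))\<^sup>2)\<^sup>2)"
proof -
  have 1: "deriv P v = poly (pderiv lead_poly) v" by (rule DERIV_imp_deriv[OF P_derivative])
  have 2: "deriv (\<lambda>v. kappa - slope * P v) v = - slope * poly (pderiv lead_poly) v"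
    by (rule DERIV_imp_deriv) (auto intro!: derivative_eq_intros P_derivative)
  have 3: "P v * (- slope * poly (pderiv lead_poly) v) - (kappa - slope * P v) * poly (pderiv lead_poly) v = - (kappa * poly (pderiv lead_poly) v)"
    by (simp add: algebra_simps)
  show ?thesis unfolding limit_density_def wronskian_density_def 1 2 3 by (simp add: norm_mult power_mult_distrib)
qed

text \<open>
  The limit form is the pullback by \<open>P\<close> of a form with total mass \<open>2 pi\<close>.
\<close>

lemma nn_integral_limit_density:
  "(\<integral>\<^sup>+x. ennreal (limit_density (cplx x)) \<partial>lborel) = ennreal (2 * pi * real (degree lead_poly))"
proof -
  define h where "h = (\<lambda>y. 2 * (norm kappa)\<^sup>2 / ((norm (cplx y))\<^sup>2 + (norm (kappa - slope * cplx y))\<^sup>2)\<^sup>2)"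
  have m: "h \<in> borel_measurable borel" unfolding h_def by measurable
  have "(\<integral>\<^sup>+x. ennreal (limit_density (cplx x)) \<partial>lborel)
    = (\<integral>\<^sup>+x. ennreal ((norm (poly (pderiv lead_poly) (cplx x)))\<^sup>2 * h (uncplx (poly lead_poly (cplx x)))) \<partial>lborel)"
    by (simp add: limit_density_eq h_def poly_lead_poly)
  also have "\<dots> = of_nat (degree lead_poly) * (\<integral>\<^sup>+y. ennreal (h y) \<partial>lborel)"
    by (rule nn_integral_poly_pullback[OF degree_lead_poly_pos m]) (simp add: h_def)
  also have "(\<integral>\<^sup>+y. ennreal (h y) \<partial>lborel) = ennreal (2 * pi)"
    unfolding h_def by (rule nn_integral_plane_fubini_study[OF kappa_nz])
  also have "of_nat (degree lead_poly) * ennreal (2 * pi) = ennreal (2 * pi * real (degree lead_poly))"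
    by (simp add: ennreal_of_nat_eq_real_of_nat mult.commute flip: ennreal_mult')
  finally show ?thesis .
qed

definition orbit_curvature :: "real \<Rightarrow> ennreal" where
  "orbit_curvature \<rho> = (\<integral>\<^sup>+x\<in>cplx -` orbit \<rho>. ennreal (limit_density (cplx x)) \<partial>lborel)"

lemma orbit_curvature_limit: "(orbit_curvature \<longlongrightarrow> ennreal (2 * pi * real (degree lead_poly))) at_top"
proof (rule tendsto_at_topI_sequentially)
  fix X :: "nat \<Rightarrow> real" assume X: "filterlim X at_top sequentially"
  have [measurable]: "(\<lambda>x. ennreal (limit_density (cplx x))) \<in> borel_measurable borel"
    unfolding limit_density_eq poly_lead_poly[symmetric]
    by (intro measurable_compose[OF _ measurable_ennreal] borel_measurable_times borel_measurable_divide borel_measurable_power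
        borel_measurable_add borel_measurable_const borel_measurable_norm borel_measurable_continuous_onI continuous_intros
        measurable_compose[OF cplx_measurable])
  have mK [measurable]: "cplx -` orbit \<rho> \<in> sets borel" for \<rho>
    using measurable_sets_borel[OF cplx_measurable borel_closed[OF compact_imp_closed[OF orbit(1)]]] by simp
  have "(\<lambda>i. \<integral>\<^sup>+x. ennreal (limit_density (cplx x)) * indicator (cplx -` orbit (X i)) x \<partial>lborel)
      \<longlonglongrightarrow> (\<integral>\<^sup>+x. ennreal (limit_density (cplx x)) \<partial>lborel)"
  proof (rule nn_integral_dominated_convergence[where w="\<lambda>x. ennreal (limit_density (cplx x))"])
    show "(\<integral>\<^sup>+x. ennreal (limit_density (cplx x)) \<partial>lborel) < \<infinity>" unfolding nn_integral_limit_density by simp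
    show "AE x in lborel. ennreal (limit_density (cplx x)) * indicator (cplx -` orbit (X i)) x \<le> ennreal (limit_density (cplx x))" for i
      by (intro AE_I2) (simp add: indicator_def)
    show "AE x in lborel. (\<lambda>i. ennreal (limit_density (cplx x)) * indicator (cplx -` orbit (X i)) x) \<longlonglongrightarrow> ennreal (limit_density (cplx x))"
    proof (rule AE_I2)
      fix x
      have "\<forall>\<^sub>F i in sequentially. X i \<ge> dist center (cplx x)" using X by (simp add: filterlim_at_top)
      then have "\<forall>\<^sub>F i in sequentially. ennreal (limit_density (cplx x)) = ennreal (limit_density (cplx x)) * indicator (cplx -` orbit (X i)) x"
      proof eventually_elim
        case (elim i)
        then have "cplx x \<in> orbit (X i)" using orbit(3)[of "X i"] by auto
        then show ?case by simp
      qed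
      then show "(\<lambda>i. ennreal (limit_density (cplx x)) * indicator (cplx -` orbit (X i)) x) \<longlonglongrightarrow> ennreal (limit_density (cplx x))"
        by (rule Lim_transform_eventually[OF tendsto_const])
    qed
  qed measurable
  then show "(\<lambda>i. orbit_curvature (X i)) \<longlonglongrightarrow> ennreal (2 * pi * real (degree lead_poly))"
    unfolding orbit_curvature_def nn_integral_limit_density .
qed

definition disc_curvature :: "real \<Rightarrow> ereal" where
  "disc_curvature \<rho> = enn2ereal (ennreal (1 / real (card (stabilizer N D k))) * (of_nat H * orbit_curvature \<rho>))"

lemma card_stabilizer_pos: "card (stabilizer N D k) > 0"
  using stabilizer_group(1,2)[OF N0, where D=D and k=k] by (metis card_gt_0_iff empty_iff)

lemma disc_curvature_limit: "(disc_curvature \<longlongrightarrow> ereal (2 * pi * real H * real (degree lead_poly) / real (card (stabilizer N D k)))) at_top"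
proof -
  let ?q = "real (card (stabilizer N D k))"
  have "((\<lambda>\<rho>. ennreal (1 / ?q) * (of_nat H * orbit_curvature \<rho>)) \<longlongrightarrow> ennreal (1 / ?q) * (of_nat H * ennreal (2 * pi * real (degree lead_poly)))) at_top"
    by (intro ennreal_tendsto_cmult orbit_curvature_limit) (simp_all add: of_nat_less_top)
  moreover have "ennreal (1 / ?q) * (of_nat H * ennreal (2 * pi * real (degree lead_poly))) = ennreal (2 * pi * real H * real (degree lead_poly) / ?q)"
    by (simp add: ennreal_of_nat_eq_real_of_nat mult_ac flip: ennreal_mult')
  ultimately have "((\<lambda>\<rho>. enn2ereal (ennreal (1 / ?q) * (of_nat H * orbit_curvature \<rho>))) \<longlongrightarrow> enn2ereal (ennreal (2 * pi * real H * real (degree lead_poly) / ?q))) at_top"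
    by (intro tendsto_enn2erealI) simp
  moreover have "enn2ereal (ennreal (2 * pi * real H * real (degree lead_poly) / ?q)) = ereal (2 * pi * real H * real (degree lead_poly) / ?q)"
    by (rule enn2ereal_ennreal) simp
  ultimately show ?thesis unfolding disc_curvature_def[abs_def] by (simp only: )
qed

end

text \<open>
  The roots of \<open>a \<tau>^H = c\<close> are the multiples \<open>\<zeta> rt(c)\<close> of one chosen root by the \<open>H\<close>-th roots of unity.
  The choice need not be continuous away from \<open>0\<close>; it only has to tend to \<open>0\<close>.
\<close>

lemma (in sheet_frame) sum_level_roots_limit:
  fixes g :: "complex \<Rightarrow> ennreal"
  assumes g: "(g \<longlongrightarrow> l) (at 0)"
  shows "((\<lambda>c. \<Sum>\<tau>\<in>level_roots c. g \<tau>) \<longlongrightarrow> of_nat H * l) (at 0)"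
proof -
  define rt where "rt = (\<lambda>c. SOME t. t ^ H = c / lead_a)"
  have rt: "rt c ^ H = c / lead_a" for c unfolding rt_def by (rule someI_ex[OF ex_complex_root[OF Hpos]])
  have nrt: "norm (rt c) = root H (norm (c / lead_a))" for c
    using rt[of c] Hpos by (metis norm_ge_zero norm_power real_root_power_cancel)
  have "((\<lambda>c. root H (norm (c / lead_a))) \<longlongrightarrow> root H (norm (0 / lead_a))) (at 0)"
    by (intro tendsto_real_root tendsto_norm tendsto_divide tendsto_const tendsto_ident_at lead_a_nz)
  then have "((\<lambda>c. norm (rt c)) \<longlongrightarrow> 0) (at 0)" unfolding nrt using Hpos by simp
  then have rt0: "(rt \<longlongrightarrow> 0) (at 0)" by (rule tendsto_norm_zero_cancel)
  have rtnz: "rt c \<noteq> 0" if "c \<noteq> 0" for c using rt[of c] that lead_a_nz Hpos by (auto simp: power_0_left)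
  let ?Z = "{\<zeta>::complex. \<zeta> ^ H = 1}"
  have fl: "filterlim (\<lambda>c. \<zeta> * rt c) (at 0) (at 0)" if "\<zeta> \<in> ?Z" for \<zeta>
  proof -
    have z: "\<zeta> \<noteq> 0" using that Hpos by (auto simp: power_0_left)
    have "((\<lambda>c. \<zeta> * rt c) \<longlongrightarrow> \<zeta> * 0) (at 0)" by (intro tendsto_intros rt0)
    moreover have "\<forall>\<^sub>F c in at 0. \<zeta> * rt c \<noteq> 0"
      using eventually_neq_at_within[of 0 0 UNIV] by eventually_elim (use z rtnz in simp)
    ultimately show ?thesis by (intro filterlim_atI) simp_all
  qed
  have L: "((\<lambda>c. \<Sum>\<zeta>\<in>?Z. g (\<zeta> * rt c)) \<longlongrightarrow> (\<Sum>\<zeta>\<in>?Z. l)) (at 0)"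
    by (intro tendsto_sum filterlim_compose[OF g fl])
  have card_Z: "(\<Sum>\<zeta>\<in>?Z. l) = of_nat H * l" using card_nth_roots[OF _ Hpos, of 1] by simp
  have "\<forall>\<^sub>F c in at 0. (\<Sum>\<zeta>\<in>?Z. g (\<zeta> * rt c)) = (\<Sum>\<tau>\<in>level_roots c. g \<tau>)"
    using eventually_neq_at_within[of 0 0 UNIV]
  proof eventually_elim
    case (elim c)
    have "level_roots c = (\<lambda>\<zeta>. \<zeta> * rt c) ` ?Z"
    proof (intro set_eqI iffI)
      fix \<tau> assume "\<tau> \<in> level_roots c"
      then have "\<tau> ^ H = rt c ^ H" using rt[of c] lead_a_nz by (auto simp: level_roots_def)
      then show "\<tau> \<in> (\<lambda>\<zeta>. \<zeta> * rt c) ` ?Z" using rtnz[OF elim] by (intro image_eqI[of _ _ "\<tau> / rt c"]) (auto simp: power_divide)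
    qed (use rt[of c] lead_a_nz in \<open>auto simp: level_roots_def power_mult_distrib\<close>)
    moreover have "inj_on (\<lambda>\<zeta>. \<zeta> * rt c) ?Z" using rtnz[OF elim] by (auto simp: inj_on_def)
    ultimately show ?case by (simp add: sum.reindex)
  qed
  then show ?thesis by (rule Lim_transform_eventually[OF L[unfolded card_Z]])
qed

context canyon_frame
begin

text \<open>
  The limit for \<open>c \<rightarrow> 0\<close> does not depend on \<open>\<eta>\<close>, since for small \<open>c\<close> the sheets are not cut off by the
  ball.
\<close>

lemma has_disc_curvature:
  assumes d: "real D = d * real N" and \<rho>: "\<rho> > 0"
  shows "has_disc_curvature f d (\<gamma> k) \<rho> (disc_curvature \<rho>)"
  unfolding has_disc_curvature_def
proof (intro exI[of _ "\<lambda>_. disc_curvature \<rho>"] conjI tendsto_const)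
  let ?r = "norm center + \<rho>"
  \<comment> \<open>The disc of \<open>v\<close> is larger than the orbit, as required for the convergence of derivatives.\<close>
  have R0: "?r + 1 > 0" using \<rho> norm_ge_zero[of center] by linarith
  obtain \<delta> Rf where "sheet_frame f \<gamma> n N0 u k N D (?r + 1) \<delta> Rf" using ex_sheet_frame[OF R0] by metis
  then interpret sheet_frame f \<gamma> n N0 u k N D "?r + 1" \<delta> Rf .
  let ?J = "\<lambda>\<tau>. \<integral>\<^sup>+x\<in>cplx -` orbit \<rho>. ennreal (sheet_density \<tau> (cplx x)) \<partial>lborel"
  let ?q = "card (stabilizer N D k)"
  have J: "(?J \<longlongrightarrow> orbit_curvature \<rho>) (at 0)"
    unfolding orbit_curvature_def by (rule sheet_integral_limit[OF orbit(1,2)]) simp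
  have S: "((\<lambda>c. enn2ereal (ennreal (1 / real ?q) * (\<Sum>\<tau>\<in>level_roots c. ?J \<tau>))) \<longlongrightarrow> disc_curvature \<rho>) (at 0)"
    unfolding disc_curvature_def by (intro tendsto_enn2erealI ennreal_tendsto_cmult sum_level_roots_limit[OF J]) simp
  have "\<forall>\<^sub>F \<eta> in at_right 0. \<eta> < (\<delta> / 8) ^ N" 
    by (rule order_tendstoD(2)[OF tendsto_ident_at]) (use \<delta> in simp)
  then show "\<forall>\<^sub>F \<eta> in at_right 0. (horn_curvature f d (\<gamma> k) \<rho> \<eta> \<longlongrightarrow> disc_curvature \<rho>) (at 0)"
    using eventually_at_right_less[of "0::real"]
  proof eventually_elim
    case (elim \<eta>)
    obtain e where e: "e > 0" "\<And>t v. norm t < e \<Longrightarrow> v \<in> ball 0 (?r + 1) \<Longrightarrow> pt t v \<in> cball 0 \<eta>"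
      using pt_norm_near_0[OF elim(2), of "?r + 1"] by metis
    define s where "s = min (\<delta> / 4) (e / 2)"
    have s: "s > 0" using e(1) \<delta> by (simp add: s_def)
    have "\<forall>\<^sub>F c in at 0. norm (c::complex) < norm lead_a * s ^ H"
      by (rule order_tendstoD(2)[OF tendsto_norm[OF tendsto_ident_at]]) (use s lead_a_nz in simp)
    then have "\<forall>\<^sub>F c in at 0. enn2ereal (ennreal (1 / real ?q) * (\<Sum>\<tau>\<in>level_roots c. ?J \<tau>)) = horn_curvature f d (\<gamma> k) \<rho> \<eta> c"
      using eventually_neq_at_within[of 0 0 UNIV]
    proof eventually_elim
      case (elim c)
      have small: "norm \<tau> < \<delta> / 4 \<and> 2 * norm \<tau> < e" if "\<tau> \<in> level_roots c" for \<tau>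
      proof -
        have "norm lead_a * norm \<tau> ^ H < norm lead_a * s ^ H" using that elim(1) by (auto simp: level_roots_def norm_mult norm_power)
        then have "norm \<tau> ^ H < s ^ H" using lead_a_nz by simp
        then have "norm \<tau> < s" by (rule power_less_imp_less_base) (use s in simp)
        then show ?thesis by (auto simp: s_def)
      qed
      let ?I = "\<integral>\<^sup>+p\<in>level_surface f c \<inter> horn d (\<gamma> k) \<rho> \<eta>. ennreal (curvature f p) \<partial>area_measure (level_surface f c)"
      have "of_nat ?q * ?I = (\<Sum>\<tau>\<in>level_roots c. ?J \<tau>)"
        by (rule horn_curvature_sheets[OF d _ \<open>\<eta> < (\<delta> / 8) ^ N\<close> e(2) elim(2) small]) simp
      moreover have "ennreal (1 / real ?q) * (of_nat ?q * ?I) = ?I"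
      proof -
        have "ennreal (1 / real ?q) * of_nat ?q = 1"
          using card_stabilizer_pos by (simp add: ennreal_of_nat_eq_real_of_nat flip: ennreal_mult')
        then show ?thesis by (simp flip: mult.assoc)
      qed
      ultimately show ?case unfolding horn_curvature_def by simp
    qed
    then show ?case by (rule Lim_transform_eventually[OF S])
  qed
qed

theorem has_line_curvature:
  assumes d: "real D = d * real N"
  shows "has_line_curvature f (ereal d) (\<gamma> k) (ereal (2 * pi * real H * real (degree lead_poly) / real (card (stabilizer N D k))))"
  unfolding has_line_curvature_def
proof (simp, intro exI[of _ disc_curvature] conjI)
  show "\<forall>\<^sub>F \<rho> in at_top. has_disc_curvature f d (\<gamma> k) \<rho> (disc_curvature \<rho>)"
    using eventually_gt_at_top[of "0::real"] by eventually_elim (rule has_disc_curvature[OF d])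
qed (rule disc_curvature_limit)

text \<open>
  Such a polar is the curve \<open>v = \<sigma> t\<close> in the fan with parameter \<open>\<theta> t\<close>, where \<open>\<sigma>\<close> is a convergent
  series, so \<open>f_limit\<close> determines the order of \<open>f\<close> on it.
\<close>

lemma order_along_conjugate:
  assumes \<theta>: "\<theta> ^ N = 1" and j: "j \<in> conjugate_class N D k \<theta>"
  shows "order_along f (\<gamma> j) = ereal (real H / real N)"
proof -
  have jn: "j < n" and bi: "\<And>i. i < D \<Longrightarrow> fps_nth (param N (\<gamma> k)) i * \<theta> ^ i = fps_nth (param N (\<gamma> j)) i"
    using j by (auto simp: conjugate_class_def)
  let ?b = "param N (\<gamma> j)"
  have nz: "\<theta> \<noteq> 0" using \<theta> N0 by (auto simp: power_0_left)
  define G where "G = ?b - rotate_fps \<theta> trunc"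
  have "(\<lambda>t. eval_fps ?b t - eval_fps trunc (\<theta> * t)) has_fps_expansion G"
    unfolding G_def using level_param(1)[OF N jn] rotate_fps_has_expansion[of trunc \<theta>] conv_trunc
    by (intro has_fps_expansion_diff) (auto simp: has_fps_expansion_def)
  then have fac': "\<forall>\<^sub>F t in nhds 0. eval_fps ?b t - eval_fps trunc (\<theta> * t) = t ^ D * eval_fps (fps_shift D G) t"
    by (rule fps_expansion_factor) (simp add: G_def trunc_nth bi)
  have crG: "fps_conv_radius G > 0"
    using \<open>(\<lambda>t. eval_fps ?b t - eval_fps trunc (\<theta> * t)) has_fps_expansion G\<close> by (simp add: has_fps_expansion_def)
  define \<sigma> where "\<sigma> = (\<lambda>t. eval_fps (fps_shift D G) t / \<theta> ^ D)"
  have "isCont (eval_fps (fps_shift D G)) 0"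
    using has_field_derivative_eval_fps[of 0 "fps_shift D G" UNIV] crG by (auto simp: zero_ereal_def intro: DERIV_isCont)
  then have "isCont \<sigma> 0" unfolding \<sigma>_def by (rule isCont_divide[OF _ continuous_const]) (use nz in simp_all)
  then have "((\<lambda>t. norm (\<sigma> t)) \<longlongrightarrow> norm (\<sigma> 0)) (at 0)" by (intro tendsto_norm) (simp add: isCont_def)
  then have sb: "\<forall>\<^sub>F t in at 0. norm (\<sigma> t) < norm (\<sigma> 0) + 1" by (rule order_tendstoD) simp
  have sg: "\<forall>\<^sub>F t in at 0. pt (\<theta> * t) (\<sigma> t) = level_arc N ?b t"
    using fac' nz \<theta> unfolding eventually_at_filter
    by (auto simp: fan_def level_arc_def \<sigma>_def power_mult_distrib algebra_simps elim!: eventually_mono)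
  have fl: "filterlim (\<lambda>t. \<theta> * t) (at 0) (at 0)"
    unfolding filterlim_at using nz eventually_neq_at_within[of 0 0 UNIV]
    by (auto intro!: tendsto_eq_intros elim: eventually_mono)
  have "((\<lambda>t. eval2 f (level_arc N ?b t) / (\<theta> * t) ^ H) \<longlongrightarrow> lead_a) (at 0)"
  proof (rule tendstoI)
    fix e :: real assume "e > 0"
    from uniform_limitD[OF filterlim_compose[OF f_limit fl] this, of "norm (\<sigma> 0) + 1"]
    show "\<forall>\<^sub>F t in at 0. dist (eval2 f (level_arc N ?b t) / (\<theta> * t) ^ H) lead_a < e"
      using sb sg
    proof eventually_elim
      case (elim t)
      then show ?case using elim(1)[rule_format, of "\<sigma> t"] by simp
    qed
  qed
  then have "((\<lambda>t. \<theta> ^ H * (eval2 f (level_arc N ?b t) / (\<theta> * t) ^ H)) \<longlongrightarrow> \<theta> ^ H * lead_a) (at 0)"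
    by (intro tendsto_intros)
  then have "((\<lambda>t. eval2 f (level_arc N ?b t) / t ^ H) \<longlongrightarrow> \<theta> ^ H * lead_a) (at 0)"
    using nz by (simp add: power_mult_distrib)
  then show ?thesis
    by (rule order_along_eq(2)[OF conv polar(1)[OF jn] levelD(2)[OF N jn]]) (use nz lead_a_nz in simp)
qed

lemma order_along_canyon:
  assumes d: "real D = d * real N" and j: "j < n" "arc (\<gamma> j) \<in> inf_line (ereal d) (\<gamma> k)"
  shows "order_along f (\<gamma> j) = ereal (real H / real N)"
  using order_along_conjugate arc_in_line_iff[OF N j(1) k d] j(2) by blast

end

theorem theoremC:
  fixes f :: "complex fps fps" and \<gamma> :: "nat \<Rightarrow> real \<Rightarrow> complex" and k :: nat
  assumes "convergent2 f"
    and "coeff2 f 0 0 = 0"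
    and "mini_regular f"
    and "\<not> is_smooth_power f"
    and "polar_factorization f \<gamma>"
    and "k < order2 f - 1"
    and "1 < d_gr f (\<gamma> k)"
  shows "has_line_curvature f (d_gr f (\<gamma> k)) (\<gamma> k)
    (if d_gr f (\<gamma> k) < \<infinity>
     then ereal (2 * pi) *
       (canyon_mu f \<gamma> (canyon f (\<gamma> k)) + ereal (real (canyon_mult f \<gamma> (canyon f (\<gamma> k)))))
     else 0)"
proof (cases "along f (\<gamma> k) = 0")
  case True
  then have "d_gr f (\<gamma> k) = \<infinity>" by (simp add: d_gr_def)
  then show ?thesis by (simp add: has_line_curvature_def)
next
  case False
  define n where "n = order2 f - 1"
  obtain u N0 where u: "unit2 u" "0 < N0" "\<forall>j<n. exponents_over N0 (\<gamma> j)"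
      "subst_w_power N0 (dz f) = subst_w_power N0 u * (\<Prod>j<n. fps_X - fps_const (param N0 (\<gamma> j)))"
      "\<forall>j<n. \<gamma> j \<in> puiseux1"
    using assms(5) unfolding polar_factorization_def n_def by blast
  interpret polar_at f \<gamma> n N0 u k
    by unfold_locales (use u assms False in \<open>auto simp: n_def\<close>)
  obtain d where d: "d_gr f (\<gamma> k) = ereal d" "d \<in> \<rat>" "d > 1" "fz_order d + 1 = f_order"
    using canyon_degree[OF assms(7)] by metis
  obtain N D where lev: "level N" "N \<le> D" "real D = d * real N"
    using ex_level_of_rational[OF d(2)] d(3) by (metis less_imp_le)
  have N0': "N > 0" by (rule levelD(1)[OF lev(1)])
  have "real N < real D" unfolding lev(3) using d(3) N0' by simp
  then have lt: "N < D" by simp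
  \<comment> \<open>The equation for the canyon degree, multiplied by the denominator.\<close>
  have "real (order_E N D (param N (\<gamma> k)) + N) = real (ord_H N)"
    unfolding of_nat_add order_E_fz_order[OF lev(1,3)] ord_H_f_order[OF lev(1)] d(4)[symmetric] by (simp add: algebra_simps)
  then have EH: "order_E N D (param N (\<gamma> k)) + N = ord_H N" by (simp only: of_nat_eq_iff)
  interpret canyon_frame f \<gamma> n N0 u k N D by unfold_locales (use lev lt EH in auto)
  let ?A = "{j. j < n \<and> arc (\<gamma> j) \<in> inf_line (ereal d) (\<gamma> k)}" and ?q = "card (stabilizer N D k)"
  have A: "polars_in f \<gamma> (canyon f (\<gamma> k)) = ?A" by (simp add: polars_in_def canyon_def d(1) n_def)
  have "canyon_mu f \<gamma> (canyon f (\<gamma> k)) = (\<Sum>j\<in>?A. ereal (real H / real N - 1))"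
    unfolding canyon_mu_def A by (rule sum.cong) (use order_along_canyon[OF lev(3)] in \<open>auto simp: one_ereal_def\<close>)
  then have "canyon_mu f \<gamma> (canyon f (\<gamma> k)) + ereal (real (canyon_mult f \<gamma> (canyon f (\<gamma> k)))) = ereal (real (card ?A) * (real H / real N))"
    unfolding canyon_mult_def A by (simp add: algebra_simps)
  moreover have "?q * card ?A = N * degree lead_poly"
    using card_polars_in_line[OF lev(1) k lev(3)] degree_lead_poly by simp
  then have "real ?q * real (card ?A) = real N * real (degree lead_poly)" by (metis of_nat_mult)
  then have "2 * pi * (real (card ?A) * (real H / real N)) = 2 * pi * real H * real (degree lead_poly) / real ?q"
    using card_stabilizer_pos N0' by (simp add: field_simps)
  ultimately show ?thesis using has_line_curvature[OF lev(3)] by (simp add: d(1))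
qed

end
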